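(* Let $d\ge 2$, $\mu>0$, $s\in\mathbb{R}$ and $1\le p\le\infty$ satisfy: $s\ge 0$ if $p=1$; $s>-\min\{\frac{d}{p'},\,1+\frac{d}{p}\}$ if $1<p<\infty$; $s\ge -1$ if $p=\infty$. Let $u_0\in\widehat{\dot B}{}^{-1}_{\infty,2}(\mathbb{R}^d)\cap\widehat{\dot B}{}^{0}_{1,\infty}(\mathbb{R}^d)$ be an $\mathbb{R}^d$-valued initial velocity with $\operatorname{div}u_0=0$ in $\mathcal{S}'$ and with $\|u_0\|_{\widehat{\dot B}{}^{-1}_{\infty,2}}$ sufficiently small. Suppose moreover that there exist a non-zero vector $M_0\in\mathbb{R}^d$ and $\alpha>0$ such that $$\left|\widehat{u}_0(\xi)-P(\xi)M_0\right|=O(|\xi|^\alpha)\quad\text{as }|\xi|\to0 .$$ Then there is a constant $C>0$ independent of $t$ such that the global mild solution $u$ of the incompressible Navier--Stokes equations with initial velocity $u_0$ satisfies, for all $t\ge1$, $$\left\||\nabla|^s\left(u(t)-S_\mu(t)M_0\right)\right\|_{\widehat{L}^p}\le C\begin{cases}t^{-\frac d2\left(1-\frac1p\right)-\frac s2-\frac{\min\{\alpha,1\}}2}, & d\ge3,\\[2pt] t^{-\frac d2\left(1-\frac1p\right)-\frac s2}\left\{t^{-\frac\alpha2}+t^{-\frac12}\log(1+t)\right\}, & d=2.\end{cases}$$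
   Context: Fourier transform: $\widehat f(\xi)=\mathcal{F}[f](\xi)=(2\pi)^{-d/2}\int_{\mathbb{R}^d}e^{-ix\cdot\xi}f(x)\,dx$, $\mathcal{F}^{-1}[g](x)=(2\pi)^{-d/2}\int_{\mathbb{R}^d}e^{ix\cdot\xi}g(\xi)\,d\xi$. $p'$ is the Hölder conjugate of $p$. $|\nabla|^sf=\mathcal{F}^{-1}[|\xi|^s\widehat f]$, $e^{\mu t\Delta}f=\mathcal{F}^{-1}[e^{-\mu t|\xi|^2}\widehat f]$. Fourier--Lebesgue norm: $\|f\|_{\widehat L^p}=\|\widehat f\|_{L^{p'}}$ (for $f\in\mathcal{S}'$ with $\widehat f\in L^1_{loc}$). Thus $\||\nabla|^sf\|_{\widehat L^p}=\||\xi|^s\widehat f\|_{L^{p'}_\xi}$. Homogeneous Fourier--Herz space $\widehat{\dot B}{}^{s}_{p,\sigma}(\mathbb{R}^d)$: the $f\in\mathcal{S}'$ with $\widehat f\in L^1_{loc}$ and $\|f\|_{\widehat{\dot B}{}^{s}_{p,\sigma}}=\big\|\{2^{sj}\|\dot\Delta_jf\|_{\widehat L^p}\}_{j\in\mathbb{Z}}\big\|_{\ell^\sigma}<\infty$, where $\dot\Delta_jf=\mathcal{F}^{-1}[\widehat\phi(2^{-j}\xi)\widehat f]$ and $\widehat\phi\ge0$ is smooth, radial, supported in $\{1/2\le|\xi|\le2\}$ with $\sum_{j\in\mathbb{Z}}\widehat\phi(2^{-j}\xi)=1$ for $\xi\ne0$. One has $\widehat{\dot B}{}^0_{1,\infty}\simeq\widehat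 L^1$ (i.e. $\widehat u_0\in L^\infty$); pointwise statements on $\widehat u_0$ are understood up to null sets. $P(\xi)=\left(\delta_{lm}-\xi_l\xi_m/|\xi|^2\right)_{1\le l,m\le d}$ for $\xi\neq0$; the (matrix-valued) Oseen kernel is $S_\mu(x,t)=\mathcal{F}^{-1}[e^{-\mu t|\xi|^2}P(\xi)](x)$. Navier--Stokes: $\partial_tu-\mu\Delta u+\operatorname{div}(u\otimes u)+\nabla p=0$, $\operatorname{div}u=0$, $u|_{t=0}=u_0$ on $\mathbb{R}^d\times(0,\infty)$. A global mild solution is $u\in L^2(\mathbb{R}_+;\widehat L^\infty)$ with $$u(t)=e^{\mu t\Delta}u_0-\int_0^te^{\mu(t-\tau)\Delta}\mathcal{P}_\sigma\operatorname{div}(u\otimes u)(\tau)\,d\tau,$$ where $\mathcal{P}_\sigma$ is the Fourier multiplier with symbol $P(\xi)$. It is known that if $u_0\in\widehat{\dot B}{}^{-1}_{\infty,2}$, $\operatorname{div}u_0=0$, and $\|u_0\|_{\widehat{\dot B}{}^{-1}_{\infty,2}}$ is sufficiently small, there is a unique global mild solution; "the global mild solution" refers to it, and "sufficiently small" means below this kind of threshold (a positive constant not depending on $u_0$). *)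

theory Defs
  imports "HOL-Analysis.Analysis" "HOL-Probability.Essential_Supremum"
begin

section \<open>Schwartz functions and tempered distributions\<close>

definition partial_deriv ::
    "'n::finite \<Rightarrow> (real^'n \<Rightarrow> 'b::real_normed_vector) \<Rightarrow> real^'n \<Rightarrow> 'b" where
  "partial_deriv j f x = frechet_derivative f (at x) (axis j 1)"

text \<open>A multi-index is written as the list of the directions of differentiation.\<close>

fun iter_partial ::
    "'n::finite list \<Rightarrow> (real^'n \<Rightarrow> 'b::real_normed_vector) \<Rightarrow> real^'n \<Rightarrow> 'b" where
  "iter_partial [] f = f"
| "iter_partial (j # js) f = partial_deriv j (iter_partial js f)"

definition smooth :: "(real^'n::finite \<Rightarrow> 'b::real_normed_vector) \<Rightarrow> bool" where
  "smooth f \<longleftrightarrow> (\<forall>js x. iter_partial js f differentiable (at x))"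

definition schwartz :: "(real^'n::finite \<Rightarrow> complex) set" where
  "schwartz = {\<phi>. smooth \<phi> \<and>
     (\<forall>k js. bounded (range (\<lambda>x. (1 + norm x) ^ k *\<^sub>R iter_partial js \<phi> x)))}"

definition test_functions :: "(real^'n::finite \<Rightarrow> complex) set" where
  "test_functions = {\<phi>. smooth \<phi> \<and> (\<exists>R. \<forall>x. norm x > R \<longrightarrow> \<phi> x = 0)}"

definition schwartz_seminorm :: "nat \<Rightarrow> (real^'n::finite \<Rightarrow> complex) \<Rightarrow> real" where
  "schwartz_seminorm N \<phi> =
     (SUP (js, x) \<in> {js. length js \<le> N} \<times> UNIV. (1 + norm x) ^ N * norm (iter_partial js \<phi> x))"

text \<open>Only the values of a functional on \<open>schwartz\<close> are meaningful; accordingly, identities between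
  distributions are always stated by testing against \<open>schwartz\<close>.\<close>

type_synonym 'n dist = "(real^'n \<Rightarrow> complex) \<Rightarrow> complex"
type_synonym 'n vdist = "('n dist)^'n"

definition tempered :: "'n::finite dist set" where
  "tempered = {T.
     (\<forall>\<phi>\<in>schwartz. \<forall>\<psi>\<in>schwartz. T (\<lambda>x. \<phi> x + \<psi> x) = T \<phi> + T \<psi>) \<and>
     (\<forall>\<phi>\<in>schwartz. \<forall>c. T (\<lambda>x. c * \<phi> x) = c * T \<phi>) \<and>
     (\<exists>C N. \<forall>\<phi>\<in>schwartz. norm (T \<phi>) \<le> C * schwartz_seminorm N \<phi>)}"

definition real_dist :: "'n::finite dist \<Rightarrow> bool" where
  "real_dist T \<longleftrightarrow> (\<forall>\<phi>\<in>schwartz. (\<forall>x. \<phi> x \<in> \<real>) \<longrightarrow> T \<phi> \<in> \<real>)"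

definition locally_integrable :: "(real^'n::finite \<Rightarrow> complex) \<Rightarrow> bool" where
  "locally_integrable g \<longleftrightarrow> (\<forall>K. compact K \<longrightarrow> set_integrable lborel K g)"

definition regular_dist :: "(real^'n::finite \<Rightarrow> complex) \<Rightarrow> 'n dist" where
  "regular_dist g = (\<lambda>\<phi>. LINT x|lborel. g x * \<phi> x)"

text \<open>\<open>represents g T\<close>: the tempered distribution \<open>T\<close> is the function \<open>g\<close> in \<open>L\<^sup>1\<^sub>l\<^sub>o\<^sub>c\<close>. The test
  functions have compact support because \<open>g * \<phi>\<close> need not be integrable for every Schwartz \<open>\<phi>\<close>;
  by density of the test functions, \<open>g\<close> still determines \<open>T\<close> on \<open>schwartz\<close>.\<close>

definition represents :: "(real^'n::finite \<Rightarrow> complex) \<Rightarrow> 'n dist \<Rightarrow> bool" where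
  "represents g T \<longleftrightarrow> T \<in> tempered \<and> locally_integrable g \<and>
     (\<forall>\<phi>\<in>test_functions. T \<phi> = regular_dist g \<phi>)"

text \<open>The function (unique up to null sets) that represents \<open>T\<close>, if there is one.\<close>

definition fun_of :: "'n::finite dist \<Rightarrow> real^'n \<Rightarrow> complex" where
  "fun_of T = (SOME g. represents g T)"

definition dist_partial :: "'n::finite \<Rightarrow> 'n dist \<Rightarrow> 'n dist" where
  "dist_partial j T = (\<lambda>\<phi>. - T (partial_deriv j \<phi>))"

definition div_free :: "'n::finite vdist \<Rightarrow> bool" where
  "div_free F \<longleftrightarrow> (\<forall>\<phi>\<in>schwartz. (\<Sum>j\<in>UNIV. dist_partial j (F $ j) \<phi>) = 0)"

section \<open>Fourier transform and Fourier multipliers\<close>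

definition fourier :: "(real^'n::finite \<Rightarrow> complex) \<Rightarrow> real^'n \<Rightarrow> complex" where
  "fourier f \<xi> = complex_of_real ((2 * pi) powr (- real CARD('n) / 2)) *
     (LINT x|lborel. exp (- \<i> * complex_of_real (x \<bullet> \<xi>)) * f x)"

definition inv_fourier :: "(real^'n::finite \<Rightarrow> complex) \<Rightarrow> real^'n \<Rightarrow> complex" where
  "inv_fourier g x = complex_of_real ((2 * pi) powr (- real CARD('n) / 2)) *
     (LINT \<xi>|lborel. exp (\<i> * complex_of_real (x \<bullet> \<xi>)) * g \<xi>)"

definition fourier_dist :: "'n::finite dist \<Rightarrow> 'n dist" where
  "fourier_dist T = (\<lambda>\<phi>. T (fourier \<phi>))"

text \<open>\<open>f \<in> S'\<close> with Fourier transform in \<open>L\<^sup>1\<^sub>l\<^sub>o\<^sub>c\<close>, and that Fourier transform as a function.\<close>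

definition has_ft :: "'n::finite dist \<Rightarrow> bool" where
  "has_ft f \<longleftrightarrow> f \<in> tempered \<and> (\<exists>g. represents g (fourier_dist f))"

definition ft :: "'n::finite dist \<Rightarrow> real^'n \<Rightarrow> complex" where
  "ft f = fun_of (fourier_dist f)"

definition vft :: "'n::finite vdist \<Rightarrow> real^'n \<Rightarrow> complex^'n" where
  "vft F \<xi> = (\<chi> l. ft (F $ l) \<xi>)"

text \<open>The tempered distribution (unique on \<open>schwartz\<close>) with Fourier transform \<open>g\<close>.\<close>

definition ift :: "(real^'n::finite \<Rightarrow> complex) \<Rightarrow> 'n dist" where
  "ift g = (SOME f. f \<in> tempered \<and> represents g (fourier_dist f))"

text \<open>Multiplier with a matrix-valued symbol, and with a scalar symbol acting on each component.\<close>

definition matrix_multiplier ::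
    "(real^'n::finite \<Rightarrow> complex^'n^'n) \<Rightarrow> 'n vdist \<Rightarrow> 'n vdist" where
  "matrix_multiplier A F = (\<chi> l. ift (\<lambda>\<xi>. (A \<xi> *v vft F \<xi>) $ l))"

definition multiplier :: "(real^'n::finite \<Rightarrow> real) \<Rightarrow> 'n vdist \<Rightarrow> 'n vdist" where
  "multiplier m F = (\<chi> l. ift (\<lambda>\<xi>. complex_of_real (m \<xi>) * ft (F $ l) \<xi>))"

definition riesz :: "real \<Rightarrow> 'n::finite vdist \<Rightarrow> 'n vdist" where
  "riesz s = multiplier (\<lambda>\<xi>. norm \<xi> powr s)"

definition heat :: "real \<Rightarrow> real \<Rightarrow> 'n::finite vdist \<Rightarrow> 'n vdist" where
  "heat \<mu> t = multiplier (\<lambda>\<xi>. exp (- \<mu> * t * (norm \<xi>)\<^sup>2))"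

definition leray_symbol :: "real^'n::finite \<Rightarrow> complex^'n^'n" where
  "leray_symbol \<xi> =
     (\<chi> l m. complex_of_real ((if l = m then 1 else 0) - \<xi> $ l * \<xi> $ m / (norm \<xi>)\<^sup>2))"

definition leray :: "'n::finite vdist \<Rightarrow> 'n vdist" where
  "leray = matrix_multiplier leray_symbol"

definition cvec :: "real^'n::finite \<Rightarrow> complex^'n" where
  "cvec v = (\<chi> i. complex_of_real (v $ i))"

definition oseen :: "real \<Rightarrow> real \<Rightarrow> real^'n::finite \<Rightarrow> complex^'n^'n" where
  "oseen \<mu> t x = (\<chi> l m.
     inv_fourier (\<lambda>\<xi>. complex_of_real (exp (- \<mu> * t * (norm \<xi>)\<^sup>2)) * leray_symbol \<xi> $ l $ m) x)"

text \<open>The vector field \<open>x \<mapsto> S\<^sub>\<mu>(x,t) M\<close> as a distribution.\<close>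

definition oseen_dist :: "real \<Rightarrow> real \<Rightarrow> real^'n::finite \<Rightarrow> 'n vdist" where
  "oseen_dist \<mu> t M = (\<chi> l. regular_dist (\<lambda>x. (oseen \<mu> t x *v cvec M) $ l))"

section \<open>Lebesgue, Fourier--Lebesgue and Fourier--Herz norms\<close>

text \<open>Exponents range over \<open>[1,\<infinity>]\<close>, as elements of \<open>ennreal\<close>; \<open>recip p\<close> is the real number \<open>1/p\<close>
  with \<open>1/\<infinity> = 0\<close>, and \<open>conj_exp p\<close> solves \<open>1/p + 1/p' = 1\<close>, including \<open>1' = \<infinity>\<close> and \<open>\<infinity>' = 1\<close>.\<close>

definition recip :: "ennreal \<Rightarrow> real" where
  "recip p = enn2real (inverse p)"

definition conj_exp :: "ennreal \<Rightarrow> ennreal" where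
  "conj_exp p = inverse (1 - inverse p)"

definition epowr :: "ennreal \<Rightarrow> real \<Rightarrow> ennreal" where
  "epowr a r = (if a = \<infinity> then \<infinity> else ennreal (enn2real a powr r))"

text \<open>The \<open>L\<^sup>p(M)\<close> norm of a \<open>[0,\<infinity>]\<close>-valued function; the \<open>\<ell>\<^sup>p\<close> norm is the case of a counting
  measure.\<close>

definition Lp_norm :: "'a measure \<Rightarrow> ennreal \<Rightarrow> ('a \<Rightarrow> ennreal) \<Rightarrow> ennreal" where
  "Lp_norm M p f =
     (if p = \<infinity> then esssup M f
      else epowr (\<integral>\<^sup>+x. epowr (f x) (enn2real p) \<partial>M) (1 / enn2real p))"

definition Lhat_norm :: "ennreal \<Rightarrow> 'n::finite vdist \<Rightarrow> ennreal" where
  "Lhat_norm p F =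
     (if \<forall>l. has_ft (F $ l) then Lp_norm lborel (conj_exp p) (\<lambda>\<xi>. ennreal (norm (vft F \<xi>))) else \<infinity>)"

text \<open>The function \<open>\<psi>\<close> below is the Fourier transform of the Littlewood--Paley function.\<close>

definition dyadic_cutoff :: "(real^'n::finite \<Rightarrow> real) \<Rightarrow> bool" where
  "dyadic_cutoff \<psi> \<longleftrightarrow> smooth \<psi> \<and> (\<forall>\<xi>. 0 \<le> \<psi> \<xi>) \<and>
     (\<forall>\<xi> \<eta>. norm \<xi> = norm \<eta> \<longrightarrow> \<psi> \<xi> = \<psi> \<eta>) \<and>
     (\<forall>\<xi>. \<psi> \<xi> \<noteq> 0 \<longrightarrow> 1 / 2 \<le> norm \<xi> \<and> norm \<xi> \<le> 2) \<and>
     (\<forall>\<xi>. \<xi> \<noteq> 0 \<longrightarrow> ((\<lambda>j::int. \<psi> ((2 powr - real_of_int j) *\<^sub>R \<xi>)) has_sum 1) UNIV)"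

definition dyadic_block :: "(real^'n::finite \<Rightarrow> real) \<Rightarrow> int \<Rightarrow> 'n vdist \<Rightarrow> 'n vdist" where
  "dyadic_block \<psi> j = multiplier (\<lambda>\<xi>. \<psi> ((2 powr - real_of_int j) *\<^sub>R \<xi>))"

definition herz_norm ::
    "(real^'n::finite \<Rightarrow> real) \<Rightarrow> real \<Rightarrow> ennreal \<Rightarrow> ennreal \<Rightarrow> 'n vdist \<Rightarrow> ennreal" where
  "herz_norm \<psi> s p \<sigma> F = Lp_norm (count_space UNIV) \<sigma>
     (\<lambda>j::int. ennreal (2 powr (s * real_of_int j)) * Lhat_norm p (dyadic_block \<psi> j F))"

definition herz_space ::
    "(real^'n::finite \<Rightarrow> real) \<Rightarrow> real \<Rightarrow> ennreal \<Rightarrow> ennreal \<Rightarrow> 'n vdist set" where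
  "herz_space \<psi> s p \<sigma> = {F. (\<forall>l. has_ft (F $ l)) \<and> herz_norm \<psi> s p \<sigma> F < \<infinity>}"

section \<open>Global mild solutions of the Navier--Stokes equations\<close>

text \<open>\<open>div (v \<otimes> v)\<close> for \<open>v\<close> given by functions, the products \<open>v\<^sub>j v\<^sub>l\<close> being pointwise.\<close>

definition div_tensor :: "'n::finite vdist \<Rightarrow> 'n vdist" where
  "div_tensor v = (\<chi> l. (\<lambda>\<phi>. \<Sum>j\<in>UNIV.
     dist_partial j (regular_dist (\<lambda>x. fun_of (v $ j) x * fun_of (v $ l) x)) \<phi>))"

definition duhamel_integrand ::
    "real \<Rightarrow> (real \<Rightarrow> 'n::finite vdist) \<Rightarrow> real \<Rightarrow> real \<Rightarrow> 'n vdist" where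
  "duhamel_integrand \<mu> u t \<tau> = heat \<mu> (t - \<tau>) (leray (div_tensor (u \<tau>)))"

text \<open>\<open>L\<^sup>2\<close> in time on \<open>(0,\<infinity>)\<close>, with values in the Fourier--Lebesgue space of exponent \<open>\<infinity>\<close>. Since that
  space is isometric to the separable space \<open>L\<^sup>1\<close>, strong measurability in time is the same as
  measurability of the pairings with Schwartz functions.\<close>

definition L2_time_Lhat_inf :: "(real \<Rightarrow> 'n::finite vdist) \<Rightarrow> bool" where
  "L2_time_Lhat_inf u \<longleftrightarrow>
     (\<forall>t>0. \<forall>l. u t $ l \<in> tempered) \<and>
     (\<forall>l. \<forall>\<phi>\<in>schwartz. (\<lambda>t. (u t $ l) \<phi>) \<in> borel_measurable (restrict_space lborel {0<..})) \<and>
     Lp_norm (restrict_space lborel {0<..}) 2 (\<lambda>t. Lhat_norm \<infinity> (u t)) < \<infinity>"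

text \<open>The Duhamel integral is taken in the sense of tempered distributions, and the equation holds at
  every \<open>t > 0\<close>, so that \<open>u t\<close> is determined for every such \<open>t\<close>.\<close>

definition global_mild_solution ::
    "real \<Rightarrow> 'n::finite vdist \<Rightarrow> (real \<Rightarrow> 'n vdist) \<Rightarrow> bool" where
  "global_mild_solution \<mu> u\<^sub>0 u \<longleftrightarrow> L2_time_Lhat_inf u \<and>
     (\<forall>t>0. \<forall>l. \<forall>\<phi>\<in>schwartz.
        set_integrable lborel {0<..<t} (\<lambda>\<tau>. (duhamel_integrand \<mu> u t \<tau> $ l) \<phi>) \<and>
        (u t $ l) \<phi> = (heat \<mu> t u\<^sub>0 $ l) \<phi> -
          (LINT \<tau>:{0<..<t}|lborel. (duhamel_integrand \<mu> u t \<tau> $ l) \<phi>))"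

end

theory Submission
  imports Defs "HOL-Probability.Probability"
begin

text \<open>The estimate is proved on the Fourier side, for the modulus \<open>a t \<xi>\<close> of the Fourier transform of
  the solution, called its amplitude; the Fourier transform of the initial velocity is written
  \<open>v\<^sub>0\<close>. The operators of the Duhamel formula are Fourier multipliers and products become
  convolutions, so that the mild equation turns into a scalar integral inequality: \<open>a t\<close> is at most
  \<open>exp (- \<mu> t |\<xi>|\<^sup>2) |v\<^sub>0|\<close> plus a constant times the time integral of
  \<open>|\<xi>| exp (- \<mu> (t - \<tau>) |\<xi>|\<^sup>2)\<close> times the convolution of
  \<open>a \<tau>\<close> with itself. This is \<open>mild_amplitude_inequality\<close>; the next steps concern
  only nonnegative functions.

  The key point is the bound \<open>a t \<xi> \<le> C exp (- sqrt (\<mu> t) |\<xi>|)\<close>, proved in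
  \<open>exponential_bound\<close>. The weight \<open>exp (sqrt (\<mu> t) |\<xi>|)\<close> is submultiplicative in
  \<open>\<xi>\<close>, so it passes through the convolution, and it grows so slowly in \<open>t\<close> that half
  of the heat kernel pays for its growth. Hence, up to a constant factor, the weighted amplitude satisfies the
  same inequality with \<open>\<mu> / 2\<close> in place of \<open>\<mu>\<close>. Smallness of the initial
  velocity in the Fourier--Herz space of index \<open>(-1, \<infinity>, 2)\<close> means that its heat flow is
  small in \<open>L\<^sup>2\<close> in time with values in \<open>L\<^sup>1\<close>
  (\<open>herz_heat_flow\<close>); a continuity argument makes the weighted amplitude small in the same norm. Then
  the part of the weighted amplitude that exceeds a multiple of the supremum of \<open>|v\<^sub>0|\<close>
  satisfies a linear inequality that is strictly contractive, and vanishes.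

  With this bound the convolution at time \<open>\<tau>\<close> is of size
  \<open>\<tau>\<^bsup>-d/2\<^esup> exp (- sqrt (\<mu> \<tau>) |\<xi>| / 2)\<close>. The integral of the power
  over \<open>1/2 < \<tau> < t\<close> is bounded in dimension \<open>d \<ge> 3\<close> and logarithmic if
  \<open>d = 2\<close>, and the factor \<open>|\<xi>|\<close> of the divergence remains, which is worth
  \<open>t\<^bsup>-1/2\<^esup>\<close> (\<open>duhamel_decay\<close>). The linear part of the solution differs
  from the Oseen flow of \<open>M\<^sub>0\<close> by the heat factor times \<open>v\<^sub>0 - P M\<^sub>0\<close>,
  which is \<open>O(|\<xi>|\<^sup>\<alpha>)\<close> at the origin and bounded, and is worth
  \<open>t\<^bsup>-\<alpha>/2\<^esup>\<close>. Both contributions are reduced to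
  \<open>|\<xi>|\<^sup>m exp (- \<kappa> sqrt t |\<xi>|)\<close> with \<open>m = min \<alpha> 1\<close>, whose
  Lebesgue norms are computed by scaling in \<open>Lp_norm_powr_exp\<close>.

  What remains is to justify the passage to the Fourier side for a solution that is only a family of tempered
  distributions. Distributions are handled through their spectra (\<open>has_spectrum\<close>), functions that
  become integrable after division by \<open>1 + |\<xi>|\<close>; one derivative of a product of two fields with
  integrable spectrum is of this kind. Since the Schwartz space is separable, the spectra at different times can
  be chosen jointly measurable (\<open>jointly_measurable_spectrum\<close>), and Fubini's theorem identifies the
  spectrum of the Duhamel integral (\<open>mild_spectrum\<close>).\<close>

section \<open>Smooth functions\<close>

lemma partial_deriv_eqI:
  assumes "(f has_derivative f') (at x)"
  shows "partial_deriv j f x = f' (axis j 1)"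
  using frechet_derivative_at[OF assms] by (simp add: partial_deriv_def)

lemma has_derivative_partials:
  fixes f :: "real^'n::finite \<Rightarrow> 'b::real_normed_vector"
  assumes "f differentiable (at x)"
  shows "(f has_derivative (\<lambda>h. \<Sum>j\<in>UNIV. (h $ j) *\<^sub>R partial_deriv j f x)) (at x)"
proof -
  let ?D = "frechet_derivative f (at x)"
  have D: "(f has_derivative ?D) (at x)"
    using assms by (simp add: frechet_derivative_works)
  then have lin: "linear ?D" by (rule has_derivative_linear)
  have "?D h = (\<Sum>j\<in>UNIV. (h $ j) *\<^sub>R partial_deriv j f x)" for h
  proof -
    have "?D h = ?D (\<Sum>j\<in>UNIV. (h $ j) *\<^sub>R axis j 1)"
      using basis_expansion[of h] by (simp add: scalar_mult_eq_scaleR)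
    also have "\<dots> = (\<Sum>j\<in>UNIV. (h $ j) *\<^sub>R partial_deriv j f x)"
      by (simp add: linear_sum[OF lin] linear_cmul[OF lin] partial_deriv_def)
    finally show ?thesis .
  qed
  then have "?D = (\<lambda>h. \<Sum>j\<in>UNIV. (h $ j) *\<^sub>R partial_deriv j f x)" by (rule ext)
  then show ?thesis using D by simp
qed

lemma iter_partial_append: "iter_partial (as @ bs) f = iter_partial as (iter_partial bs f)"
  by (induction as) auto

lemma smooth_differentiable: "smooth f \<Longrightarrow> f differentiable (at x)"
  unfolding smooth_def by (metis iter_partial.simps(1))

lemma smooth_iter_partial: "smooth f \<Longrightarrow> smooth (iter_partial js f)"
  unfolding smooth_def by (metis iter_partial_append)

lemma smooth_partial: "smooth f \<Longrightarrow> smooth (partial_deriv j f)"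
  using smooth_iter_partial[of f "[j]"] by simp

lemma iter_partial_in:
  assumes "\<And>f j. f \<in> S \<Longrightarrow> partial_deriv j f \<in> S" "f \<in> S"
  shows "iter_partial js f \<in> S"
  using assms by (induction js) auto

text \<open>Smoothness is proved coinductively: a family of differentiable functions that is closed under
  partial derivatives consists of smooth functions.\<close>

lemma smooth_coinduct:
  assumes "f \<in> S" "\<And>f x. f \<in> S \<Longrightarrow> f differentiable (at x)"
    and "\<And>f j. f \<in> S \<Longrightarrow> partial_deriv j f \<in> S"
  shows "smooth f"
  unfolding smooth_def using iter_partial_in[OF assms(3,1)] assms(2) by blast

lemma smooth_continuous: "smooth f \<Longrightarrow> continuous_on S f"
  by (meson continuous_at_imp_continuous_on differentiable_imp_continuous_within smooth_differentiable)

lemma smooth_measurable [measurable_dest]: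
  fixes f :: "real^'n::finite \<Rightarrow> 'b::real_normed_vector"
  shows "smooth f \<Longrightarrow> f \<in> borel_measurable borel"
  by (simp add: borel_measurable_continuous_onI smooth_continuous)

lemma partial_const [simp]: "partial_deriv j (\<lambda>_. c) = (\<lambda>_. 0)"
  by (rule ext) (simp add: partial_deriv_eqI[OF has_derivative_const])

lemma smooth_const [simp]: "smooth (\<lambda>_::real^'n::finite. c :: 'b::real_normed_vector)"
  by (rule smooth_coinduct[of _ "range (\<lambda>c _. c)"]) auto

lemma partial_add:
  assumes "f differentiable (at x)" "g differentiable (at x)"
  shows "partial_deriv j (\<lambda>x. f x + g x) x = partial_deriv j f x + partial_deriv j g x"
  using partial_deriv_eqI[OF has_derivative_add[OF has_derivative_partials[OF assms(1)] has_derivative_partials[OF assms(2)]], of j]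
  by (simp add: axis_def if_distrib if_distribR cong: if_cong)

lemma partial_bounded_linear:
  assumes "f differentiable (at x)" "bounded_linear L"
  shows "partial_deriv j (\<lambda>x. L (f x)) x = L (partial_deriv j f x)"
  using partial_deriv_eqI[OF bounded_linear.has_derivative[OF assms(2) has_derivative_partials[OF assms(1)]], of j]
  by (simp add: axis_def if_distrib if_distribR cong: if_cong)

lemma partial_mult:
  fixes f g :: "real^'n::finite \<Rightarrow> 'b::real_normed_algebra"
  assumes "f differentiable (at x)" "g differentiable (at x)"
  shows "partial_deriv j (\<lambda>x. f x * g x) x = f x * partial_deriv j g x + partial_deriv j f x * g x"
  using partial_deriv_eqI[OF has_derivative_mult[OF has_derivative_partials[OF assms(1)] has_derivative_partials[OF assms(2)]], of j]
  by (simp add: axis_def if_distrib if_distribR cong: if_cong)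

lemma smooth_add:
  assumes "smooth f" "smooth g"
  shows "smooth (\<lambda>x. f x + g x)"
proof (rule smooth_coinduct[of _ "{\<lambda>x. f x + g x | f g. smooth f \<and> smooth g}"])
  show "partial_deriv j h \<in> {\<lambda>x. f x + g x | f g. smooth f \<and> smooth g}"
    if h: "h \<in> {\<lambda>x. f x + g x | f g. smooth f \<and> smooth g}" for h j
  proof -
    obtain f g where fg: "h = (\<lambda>x. f x + g x)" "smooth f" "smooth g" using h by auto
    have "partial_deriv j h = (\<lambda>x. partial_deriv j f x + partial_deriv j g x)"
      by (rule ext) (simp add: fg partial_add smooth_differentiable)
    then show ?thesis using fg smooth_partial by blast
  qed
qed (use assms in \<open>auto intro: smooth_differentiable differentiable_add\<close>)

lemma smooth_bounded_linear_comp: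
  assumes "smooth f" "bounded_linear L"
  shows "smooth (\<lambda>x. L (f x))"
proof (rule smooth_coinduct[of _ "{\<lambda>x. L (f x) | f. smooth f}"])
  show "partial_deriv j h \<in> {\<lambda>x. L (f x) | f. smooth f}"
    if h: "h \<in> {\<lambda>x. L (f x) | f. smooth f}" for h j
  proof -
    obtain f where fg: "h = (\<lambda>x. L (f x))" "smooth f" using h by auto
    have "partial_deriv j h = (\<lambda>x. L (partial_deriv j f x))"
      by (rule ext) (simp add: fg partial_bounded_linear smooth_differentiable assms)
    then show ?thesis using fg smooth_partial by blast
  qed
  show "h differentiable (at x)" if "h \<in> {\<lambda>x. L (f x) | f. smooth f}" for h x
    using that smooth_differentiable bounded_linear.has_derivative[OF assms(2)]
    unfolding differentiable_def by blast
qed (use assms in auto)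

text \<open>By the product rule, the sums of products of smooth functions form a family to which \<open>smooth_coinduct\<close>
  applies.\<close>

inductive_set prod_span :: "(real^'n::finite \<Rightarrow> 'b::real_normed_algebra) set" where
  prod: "smooth f \<Longrightarrow> smooth g \<Longrightarrow> (\<lambda>x. f x * g x) \<in> prod_span"
| add: "f \<in> prod_span \<Longrightarrow> g \<in> prod_span \<Longrightarrow> (\<lambda>x. f x + g x) \<in> prod_span"

lemma smooth_mult:
  fixes f g :: "real^'n::finite \<Rightarrow> 'b::real_normed_algebra"
  assumes "smooth f" "smooth g"
  shows "smooth (\<lambda>x. f x * g x)"
proof (rule smooth_coinduct[of _ prod_span])
  have *: "(\<forall>x. h differentiable (at x)) \<and> partial_deriv j h \<in> prod_span"
    if "h \<in> prod_span" for h :: "real^'n \<Rightarrow> 'b" and j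
    using that
  proof induction
    case (prod f g)
    have "partial_deriv j (\<lambda>x. f x * g x) = (\<lambda>x. f x * partial_deriv j g x + partial_deriv j f x * g x)"
      by (rule ext) (simp add: prod partial_mult smooth_differentiable)
    moreover have "(\<lambda>x. f x * partial_deriv j g x + partial_deriv j f x * g x) \<in> prod_span"
      by (intro prod_span.add prod_span.prod prod smooth_partial)
    ultimately show ?case using prod by (auto intro!: differentiable_mult intro: smooth_differentiable)
  next
    case (add f g)
    have "partial_deriv j (\<lambda>x. f x + g x) = (\<lambda>x. partial_deriv j f x + partial_deriv j g x)"
      by (rule ext) (simp add: add partial_add smooth_differentiable)
    then show ?case using add by (auto intro!: prod_span.add differentiable_add)
  qed
  show "h differentiable (at x)" "partial_deriv j h \<in> prod_span" if "h \<in> prod_span" for h :: "real^'n \<Rightarrow> 'b" and j x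
    using *[OF that] by auto
qed (use assms prod_span.prod in auto)

lemma smooth_linear:
  assumes "bounded_linear L"
  shows "smooth (L :: real^'n::finite \<Rightarrow> 'b::real_normed_vector)"
proof (rule smooth_coinduct[of _ "insert L (range (\<lambda>c _. c))"])
  have "partial_deriv j L = (\<lambda>_. L (axis j 1))" for j
    by (rule ext, rule partial_deriv_eqI) (simp add: bounded_linear_imp_has_derivative assms)
  then show "partial_deriv j h \<in> insert L (range (\<lambda>c _. c))" if "h \<in> insert L (range (\<lambda>c _. c))" for j h
    using that by auto
  show "h differentiable (at x)" if "h \<in> insert L (range (\<lambda>c _. c))" for h x
    using that assms by (auto simp: bounded_linear_imp_differentiable)
qed auto

lemma partial_affine:
  fixes f :: "real^'n::finite \<Rightarrow> 'b::real_normed_vector"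
  assumes "f differentiable (at (c *\<^sub>R x + a))"
  shows "partial_deriv j (\<lambda>x. f (c *\<^sub>R x + a)) x = c *\<^sub>R partial_deriv j f (c *\<^sub>R x + a)"
proof -
  have "((\<lambda>x. c *\<^sub>R x + a) has_derivative (\<lambda>h. c *\<^sub>R h)) (at x)"
    by (auto intro!: derivative_eq_intros)
  from diff_chain_at[OF this has_derivative_partials[OF assms]]
  have "((\<lambda>x. f (c *\<^sub>R x + a)) has_derivative (\<lambda>h. \<Sum>j\<in>UNIV. ((c *\<^sub>R h) $ j) *\<^sub>R partial_deriv j f (c *\<^sub>R x + a))) (at x)"
    by (simp add: o_def)
  from partial_deriv_eqI[OF this, of j] show ?thesis
    by (simp add: axis_def if_distrib if_distribR cong: if_cong)
qed

lemma differentiable_affine: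
  assumes "\<And>y. f differentiable (at y)"
  shows "(\<lambda>x. f (c *\<^sub>R x + a)) differentiable (at (x::'a::real_normed_vector))"
proof -
  have "(\<lambda>x. c *\<^sub>R x + a) differentiable (at x)" by (auto intro!: derivative_intros)
  from differentiable_chain_at[OF this assms] show ?thesis by (simp add: o_def)
qed

lemma iter_partial_affine:
  fixes f :: "real^'n::finite \<Rightarrow> 'b::real_normed_vector"
  assumes "smooth f"
  shows "iter_partial js (\<lambda>x. f (c *\<^sub>R x + a)) = (\<lambda>x. c ^ length js *\<^sub>R iter_partial js f (c *\<^sub>R x + a))"
proof (induction js)
  case (Cons j js)
  let ?g = "iter_partial js f"
  have d: "?g differentiable (at y)" for y using assms by (simp add: smooth_def)
  have "partial_deriv j (\<lambda>x. c ^ length js *\<^sub>R ?g (c *\<^sub>R x + a)) x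
        = c ^ length js *\<^sub>R partial_deriv j (\<lambda>x. ?g (c *\<^sub>R x + a)) x" for x
    by (rule partial_bounded_linear[OF differentiable_affine[OF d] bounded_linear_scaleR_right])
  then show ?case
    by (auto simp: Cons fun_eq_iff partial_affine[OF d])
qed simp

lemma smooth_affine:
  fixes f :: "real^'n::finite \<Rightarrow> 'b::real_normed_vector"
  assumes "smooth f" shows "smooth (\<lambda>x. f (c *\<^sub>R x + a))"
  unfolding smooth_def iter_partial_affine[OF assms]
proof (intro allI)
  fix js x
  show "(\<lambda>x. c ^ length js *\<^sub>R iter_partial js f (c *\<^sub>R x + a)) differentiable at x"
    by (intro differentiable_scaleR differentiable_const differentiable_affine) (use assms in \<open>simp add: smooth_def\<close>)
qed

lemma partial_local:
  fixes f g :: "real^'n::finite \<Rightarrow> 'b::real_normed_vector"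
  assumes "open U" "x \<in> U" "\<And>y. y \<in> U \<Longrightarrow> f y = g y" "g differentiable (at x)"
  shows "partial_deriv j f x = partial_deriv j g x" "f differentiable (at x)"
proof -
  have "(f has_derivative (\<lambda>h. \<Sum>j\<in>UNIV. (h $ j) *\<^sub>R partial_deriv j g x)) (at x)"
    by (rule has_derivative_transform_within_open[OF has_derivative_partials[OF assms(4)] assms(1,2)]) (simp add: assms(3))
  from partial_deriv_eqI[OF this, of j] this show "partial_deriv j f x = partial_deriv j g x" "f differentiable (at x)"
    by (auto simp: axis_def if_distrib if_distribR differentiable_def cong: if_cong)
qed

lemma iter_partial_local:
  fixes f g :: "real^'n::finite \<Rightarrow> 'b::real_normed_vector"
  assumes "open U" "\<And>y. y \<in> U \<Longrightarrow> f y = g y" "smooth g"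
  shows "x \<in> U \<Longrightarrow> iter_partial js f x = iter_partial js g x \<and> iter_partial js f differentiable (at x)"
proof (induction js arbitrary: x)
  case Nil
  then show ?case using partial_local(2)[OF assms(1) Nil, of f g] assms by (auto simp: smooth_differentiable)
next
  case (Cons j js)
  have d: "iter_partial js g differentiable (at y)" for y using assms by (simp add: smooth_def)
  have e: "partial_deriv j (iter_partial js f) y = partial_deriv j (iter_partial js g) y" if "y \<in> U" for y
    using partial_local(1)[OF assms(1) that, of "iter_partial js f" "iter_partial js g"] Cons.IH d by auto
  have d2: "iter_partial (j#js) g differentiable (at x)" using assms by (simp only: smooth_def)
  show ?case
    using e[OF Cons.prems] partial_local(2)[OF assms(1) Cons.prems, of "iter_partial (j#js) f" "iter_partial (j#js) g"] e d2
    by auto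
qed

lemma smooth_local:
  fixes f :: "real^'n::finite \<Rightarrow> 'b::real_normed_vector"
  assumes "\<And>x. \<exists>U g. open U \<and> x \<in> U \<and> smooth g \<and> (\<forall>y\<in>U. f y = g y)"
  shows "smooth f"
  unfolding smooth_def
proof (intro allI)
  fix js x
  obtain U g where "open U" "x \<in> U" "smooth g" "\<forall>y\<in>U. f y = g y" using assms by blast
  then show "iter_partial js f differentiable at x" using iter_partial_local[of U f g x js] by auto
qed

lemma smooth_real_polynomial:
  fixes p :: "real^'n::finite \<Rightarrow> real"
  assumes "real_polynomial_function p" shows "smooth p"
  using assms by induction (auto intro: smooth_linear smooth_add smooth_mult)

lemma smooth_of_real: "smooth f \<Longrightarrow> smooth (\<lambda>x. complex_of_real (f x))"
  by (rule smooth_bounded_linear_comp[OF _ bounded_linear_of_real])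

lemma smooth_polynomial:
  fixes p :: "real^'n::finite \<Rightarrow> complex"
  assumes "polynomial_function p" shows "smooth p"
proof -
  have "smooth (\<lambda>x. Re (p x))" "smooth (\<lambda>x. Im (p x))"
    using assms bounded_linear_Re bounded_linear_Im
    unfolding polynomial_function_def o_def by (auto intro!: smooth_real_polynomial)
  then have "smooth (\<lambda>x. complex_of_real (Re (p x)) + \<i> * complex_of_real (Im (p x)))"
    by (intro smooth_add smooth_mult smooth_of_real smooth_const)
  moreover have "(\<lambda>x. complex_of_real (Re (p x)) + \<i> * complex_of_real (Im (p x))) = p"
    by (auto simp: fun_eq_iff complex_eq_iff)
  ultimately show ?thesis by simp
qed

section \<open>Schwartz functions\<close>

lemma schwartz_smooth: "\<phi> \<in> schwartz \<Longrightarrow> smooth \<phi>"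
  by (simp add: schwartz_def)

lemma schwartz_differentiable: "\<phi> \<in> schwartz \<Longrightarrow> \<phi> differentiable (at x)"
  by (simp add: schwartz_smooth smooth_differentiable)

lemma schwartz_measurable [measurable_dest]: "\<phi> \<in> schwartz \<Longrightarrow> \<phi> \<in> borel_measurable borel"
  by (intro smooth_measurable schwartz_smooth)

lemma schwartz_continuous: "\<phi> \<in> schwartz \<Longrightarrow> continuous_on S \<phi>"
  by (intro smooth_continuous schwartz_smooth)

lemma schwartz_partial: "\<phi> \<in> schwartz \<Longrightarrow> partial_deriv j \<phi> \<in> schwartz"
proof -
  have *: "iter_partial js (partial_deriv j \<phi>) = iter_partial (js @ [j]) \<phi>" for js
    by (simp add: iter_partial_append)
  assume "\<phi> \<in> schwartz" then show ?thesis
    unfolding schwartz_def mem_Collect_eq * using smooth_partial by blast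
qed

lemma schwartz_iter_partial: "\<phi> \<in> schwartz \<Longrightarrow> iter_partial js \<phi> \<in> schwartz"
  by (rule iter_partial_in) (auto intro: schwartz_partial)

lemma schwartz_decay:
  assumes "\<phi> \<in> schwartz"
  obtains C where "\<And>x. (1 + norm x) ^ k * norm (\<phi> x) \<le> C" "C > 0"
proof -
  have "bounded (range (\<lambda>x. (1 + norm x) ^ k *\<^sub>R iter_partial [] \<phi> x))"
    using assms unfolding schwartz_def by blast
  then obtain C where "\<And>x. norm ((1 + norm x) ^ k *\<^sub>R \<phi> x) \<le> C" "C > 0"
    by (auto simp: bounded_pos)
  then show ?thesis using that[of C] by auto
qed

text \<open>The weights need to be controlled for the members of the family only, because the derivatives are
  again members.\<close>

lemma schwartz_coinduct:
  assumes "f \<in> S" "\<And>f x. f \<in> S \<Longrightarrow> f differentiable (at x)"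
    and "\<And>f j. f \<in> S \<Longrightarrow> partial_deriv j f \<in> S"
    and "\<And>f k. f \<in> S \<Longrightarrow> \<exists>C. \<forall>x. (1 + norm x) ^ k * norm (f x) \<le> C"
  shows "f \<in> schwartz"
proof -
  have "bounded (range (\<lambda>x. (1 + norm x) ^ k *\<^sub>R iter_partial js f x))" for k js
  proof -
    have "iter_partial js f \<in> S" using iter_partial_in[OF assms(3,1)] .
    from assms(4)[OF this, of k] show ?thesis by (auto simp: bounded_iff)
  qed
  moreover have "smooth f" by (rule smooth_coinduct[OF assms(1-3)])
  ultimately show ?thesis by (simp add: schwartz_def)
qed

lemma schwartz_add:
  assumes "\<phi> \<in> schwartz" "\<psi> \<in> schwartz"
  shows "(\<lambda>x. \<phi> x + \<psi> x) \<in> schwartz"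
proof (rule schwartz_coinduct[of _ "{\<lambda>x. f x + g x | f g. f \<in> schwartz \<and> g \<in> schwartz}"])
  let ?S = "{\<lambda>x. f x + g x | f g. f \<in> schwartz \<and> g \<in> schwartz}"
  fix h assume "h \<in> ?S"
  then obtain f g where fg: "h = (\<lambda>x. f x + g x)" "f \<in> schwartz" "g \<in> schwartz" by auto
  show "h differentiable (at x)" for x using fg by (auto intro: differentiable_add schwartz_differentiable)
  have "partial_deriv j h = (\<lambda>x. partial_deriv j f x + partial_deriv j g x)" for j
    by (rule ext) (simp add: fg partial_add schwartz_differentiable)
  then show "partial_deriv j h \<in> ?S" for j using fg schwartz_partial by blast
  show "\<exists>C. \<forall>x. (1 + norm x) ^ k * norm (h x) \<le> C" for k
  proof -
    obtain C1 where C1: "\<And>x. (1 + norm x) ^ k * norm (f x) \<le> C1" using schwartz_decay[OF fg(2)] by metis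
    obtain C2 where C2: "\<And>x. (1 + norm x) ^ k * norm (g x) \<le> C2" using schwartz_decay[OF fg(3)] by metis
    have "(1 + norm x) ^ k * norm (h x) \<le> C1 + C2" for x
    proof -
      have "(1 + norm x) ^ k * norm (h x) \<le> (1 + norm x) ^ k * (norm (f x) + norm (g x))"
        by (intro mult_left_mono) (auto simp: fg norm_triangle_ineq)
      also have "\<dots> \<le> C1 + C2" using C1[of x] C2[of x] by (simp add: algebra_simps)
      finally show ?thesis .
    qed
    then show ?thesis by blast
  qed
qed (use assms in auto)

lemma schwartz_bounded_linear:
  assumes "\<phi> \<in> schwartz" "bounded_linear L"
  shows "(\<lambda>x. L (\<phi> x)) \<in> schwartz"
proof (rule schwartz_coinduct[of _ "{\<lambda>x. L (f x) | f. f \<in> schwartz}"])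
  let ?S = "{\<lambda>x. L (f x) | f. f \<in> schwartz}"
  fix h assume "h \<in> ?S"
  then obtain f where fg: "h = (\<lambda>x. L (f x))" "f \<in> schwartz" by auto
  show "h differentiable (at x)" for x 
    using smooth_bounded_linear_comp[OF schwartz_smooth[OF fg(2)] assms(2)] fg(1) by (simp add: smooth_differentiable)
  have "partial_deriv j h = (\<lambda>x. L (partial_deriv j f x))" for j
    by (rule ext) (simp add: fg partial_bounded_linear schwartz_differentiable assms)
  then show "partial_deriv j h \<in> ?S" for j using fg schwartz_partial by blast
  show "\<exists>C. \<forall>x. (1 + norm x) ^ k * norm (h x) \<le> C" for k
  proof -
    obtain C1 where C1: "\<And>x. (1 + norm x) ^ k * norm (f x) \<le> C1" using schwartz_decay[OF fg(2)] by metis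
    obtain K where K: "K > 0" "\<And>x. norm (L x) \<le> norm x * K" using bounded_linear.pos_bounded[OF assms(2)] by blast
    have "(1 + norm x) ^ k * norm (h x) \<le> C1 * K" for x
    proof -
      have "(1 + norm x) ^ k * norm (h x) \<le> (1 + norm x) ^ k * (norm (f x) * K)"
        by (intro mult_left_mono) (auto simp: fg K)
      also have "\<dots> \<le> C1 * K" using mult_right_mono[OF C1[of x], of K] K(1) by (simp add: algebra_simps)
      finally show ?thesis .
    qed
    then show ?thesis by blast
  qed
qed (use assms in auto)

lemma schwartz_cmult: "\<phi> \<in> schwartz \<Longrightarrow> (\<lambda>x. c * \<phi> x) \<in> schwartz"
  by (rule schwartz_bounded_linear[OF _ bounded_linear_mult_right])

lemma schwartz_zero: "(\<lambda>x. 0) \<in> schwartz"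
  by (rule schwartz_coinduct[of _ "{\<lambda>x. 0}"]) auto

lemma schwartz_uminus: "\<phi> \<in> schwartz \<Longrightarrow> (\<lambda>x. - \<phi> x) \<in> schwartz"
  by (rule schwartz_bounded_linear[OF _ bounded_linear_minus[OF bounded_linear_ident]])

lemma schwartz_diff: "\<phi> \<in> schwartz \<Longrightarrow> \<psi> \<in> schwartz \<Longrightarrow> (\<lambda>x. \<phi> x - \<psi> x) \<in> schwartz"
  using schwartz_add[OF _ schwartz_uminus, of \<phi> \<psi>] by simp

lemma schwartz_sum: "(\<And>i. i \<in> I \<Longrightarrow> \<phi> i \<in> schwartz) \<Longrightarrow> (\<lambda>x. \<Sum>i\<in>I. \<phi> i x) \<in> schwartz"
  by (induction I rule: infinite_finite_induct) (auto intro: schwartz_add schwartz_zero)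

lemma partial_coord: "partial_deriv j (\<lambda>x. complex_of_real (x $ i)) x = (if i = j then 1 else 0)"
proof -
  have "bounded_linear (\<lambda>x::real^'a. complex_of_real (x $ i))"
    by (intro bounded_linear_compose[OF bounded_linear_of_real] bounded_linear_vec_nth)
  from partial_deriv_eqI[OF bounded_linear_imp_has_derivative[OF this], of j x] show ?thesis
    by (simp add: axis_def)
qed

lemma smooth_coord: "smooth (\<lambda>x::real^'n::finite. complex_of_real (x $ i))"
  by (intro smooth_linear bounded_linear_compose[OF bounded_linear_of_real] bounded_linear_vec_nth)

lemma schwartz_coord_mult:
  assumes "\<phi> \<in> schwartz"
  shows "(\<lambda>x. complex_of_real (x $ i) * \<phi> x) \<in> schwartz"
proof (rule schwartz_coinduct[of _ "{\<lambda>x. complex_of_real (x $ i) * f x + g x | f g. f \<in> schwartz \<and> g \<in> schwartz}"])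
  let ?S = "{\<lambda>x. complex_of_real (x $ i) * f x + g x | f g. f \<in> schwartz \<and> g \<in> schwartz}"
  show "(\<lambda>x. complex_of_real (x $ i) * \<phi> x) \<in> ?S" using assms schwartz_zero by force
  fix h assume "h \<in> ?S"
  then obtain f g where fg: "h = (\<lambda>x. complex_of_real (x $ i) * f x + g x)" "f \<in> schwartz" "g \<in> schwartz" by auto
  note d = smooth_differentiable[OF smooth_coord] schwartz_differentiable[OF fg(2)] schwartz_differentiable[OF fg(3)]
  show "h differentiable (at x)" for x using fg d by (auto intro!: differentiable_add differentiable_mult)
  show "partial_deriv j h \<in> ?S" for j
  proof -
    have "partial_deriv j h = (\<lambda>x. complex_of_real (x $ i) * partial_deriv j f x 
          + ((if i = j then 1 else 0) * f x + partial_deriv j g x))"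
      by (rule ext) (auto simp: fg partial_add partial_mult d differentiable_mult partial_coord)
    moreover have "(\<lambda>x. (if i = j then 1 else 0) * f x + partial_deriv j g x) \<in> schwartz"
      by (intro schwartz_add schwartz_cmult schwartz_partial fg)
    ultimately show ?thesis using schwartz_partial[OF fg(2), of j] by (intro CollectI exI conjI)
  qed
  show "\<exists>C. \<forall>x. (1 + norm x) ^ k * norm (h x) \<le> C" for k
  proof -
    obtain C1 where C1: "\<And>x. (1 + norm x) ^ Suc k * norm (f x) \<le> C1" using schwartz_decay[OF fg(2)] by metis
    obtain C2 where C2: "\<And>x. (1 + norm x) ^ k * norm (g x) \<le> C2" using schwartz_decay[OF fg(3)] by metis
    have "(1 + norm x) ^ k * norm (h x) \<le> C1 + C2" for x
    proof -
      have "norm (h x) \<le> \<bar>x $ i\<bar> * norm (f x) + norm (g x)"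
        unfolding fg by (rule order_trans[OF norm_triangle_ineq]) (simp add: norm_mult)
      also have "\<dots> \<le> (1 + norm x) * norm (f x) + norm (g x)"
        using component_le_norm_cart[of x i] by (intro add_right_mono mult_right_mono) auto
      finally have "(1 + norm x) ^ k * norm (h x) \<le> (1 + norm x) ^ k * ((1 + norm x) * norm (f x) + norm (g x))"
        by (intro mult_left_mono) auto
      also have "\<dots> \<le> C1 + C2" using C1[of x] C2[of x] by (simp add: algebra_simps)
      finally show ?thesis .
    qed
    then show ?thesis by blast
  qed
qed

lemma schwartz_affine:
  assumes "\<phi> \<in> schwartz" "c \<noteq> 0"
  shows "(\<lambda>x. \<phi> (c *\<^sub>R x + a)) \<in> schwartz"
proof (rule schwartz_coinduct[of _ "{\<lambda>x. f (c *\<^sub>R x + a) | f. f \<in> schwartz}"])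
  let ?S = "{\<lambda>x. f (c *\<^sub>R x + a) | f. f \<in> schwartz}"
  fix h assume "h \<in> ?S"
  then obtain f where fg: "h = (\<lambda>x. f (c *\<^sub>R x + a))" "f \<in> schwartz" by auto
  show "h differentiable (at x)" for x unfolding fg
    by (intro differentiable_affine schwartz_differentiable fg)
  have "partial_deriv j h = (\<lambda>x. c *\<^sub>R partial_deriv j f (c *\<^sub>R x + a))" for j
    by (rule ext) (simp add: fg partial_affine schwartz_differentiable assms)
  moreover have "(\<lambda>x. c *\<^sub>R partial_deriv j f x) \<in> schwartz" for j
    by (rule schwartz_bounded_linear[OF _ bounded_linear_scaleR_right]) (simp add: schwartz_partial fg)
  ultimately show "partial_deriv j h \<in> ?S" for j by auto
  show "\<exists>C. \<forall>x. (1 + norm x) ^ k * norm (h x) \<le> C" for k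
  proof -
    obtain C where C: "\<And>x. (1 + norm x) ^ k * norm (f x) \<le> C" using schwartz_decay[OF fg(2)] by metis
    define B where "B = 1 + 1 / \<bar>c\<bar> + norm a / \<bar>c\<bar>"
    have B: "1 + norm x \<le> B * (1 + norm (c *\<^sub>R x + a))" for x
    proof -
      have "\<bar>c\<bar> * norm x \<le> norm (c *\<^sub>R x + a) + norm a"
        using norm_triangle_ineq4[of "c *\<^sub>R x + a" a] by simp
      then have "norm x \<le> (norm (c *\<^sub>R x + a) + norm a) / \<bar>c\<bar>"
        using assms(2) by (simp add: pos_le_divide_eq mult.commute)
      then have "norm x \<le> norm (c *\<^sub>R x + a) / \<bar>c\<bar> + norm a / \<bar>c\<bar>" by (simp add: add_divide_distrib)
      moreover have "0 \<le> norm a / \<bar>c\<bar> * norm (c *\<^sub>R x + a)" "0 \<le> 1 / \<bar>c\<bar>" "0 \<le> norm (c *\<^sub>R x + a)" by auto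
      moreover have "B * (1 + norm (c *\<^sub>R x + a)) = 1 + 1 / \<bar>c\<bar> + norm a / \<bar>c\<bar> + norm (c *\<^sub>R x + a)
          + norm (c *\<^sub>R x + a) / \<bar>c\<bar> + norm a / \<bar>c\<bar> * norm (c *\<^sub>R x + a)"
        unfolding B_def by (simp only: distrib_left distrib_right mult_1_left mult_1_right times_divide_eq_left add.assoc add.left_commute)
      ultimately show ?thesis by linarith
    qed
    have "(1 + norm x) ^ k * norm (h x) \<le> B ^ k * C" for x
    proof -
      have "(1 + norm x) ^ k * norm (h x) \<le> (B * (1 + norm (c *\<^sub>R x + a))) ^ k * norm (h x)"
        by (intro mult_right_mono power_mono B) auto
      also have "\<dots> = B ^ k * ((1 + norm (c *\<^sub>R x + a)) ^ k * norm (f (c *\<^sub>R x + a)))"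
        by (simp add: fg power_mult_distrib)
      also have "\<dots> \<le> B ^ k * C" by (intro mult_left_mono C) (auto simp: B_def)
      finally show ?thesis .
    qed
    then show ?thesis by blast
  qed
qed (use assms in auto)

lemma iter_partial_support:
  fixes \<phi> :: "real^'n::finite \<Rightarrow> 'b::real_normed_vector"
  assumes "\<forall>x. norm x > R \<longrightarrow> \<phi> x = 0" "norm x > R"
  shows "iter_partial js \<phi> x = 0"
proof -
  have "open {x::real^'n. norm x > R}" by (intro open_Collect_less continuous_intros)
  from iter_partial_local[OF this, of \<phi> "\<lambda>_. 0" x js] have "iter_partial js \<phi> x = iter_partial js (\<lambda>_. 0) x"
    using assms by auto
  also have "iter_partial js (\<lambda>_. 0) = (\<lambda>_::real^'n. 0::'b)" by (induction js) auto
  finally show ?thesis by simp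
qed

lemma test_schwartz: "\<phi> \<in> test_functions \<Longrightarrow> \<phi> \<in> schwartz"
proof -
  assume "\<phi> \<in> test_functions"
  then obtain R where \<phi>: "smooth \<phi>" and R: "\<forall>x. norm x > R \<longrightarrow> \<phi> x = 0" by (auto simp: test_functions_def)
  have "bounded (range (\<lambda>x. (1 + norm x) ^ k *\<^sub>R iter_partial js \<phi> x))" for k js
  proof -
    let ?g = "\<lambda>x. (1 + norm x) ^ k *\<^sub>R iter_partial js \<phi> x"
    have "continuous_on (cball 0 R) ?g"
      by (intro continuous_intros smooth_continuous smooth_iter_partial \<phi>)
    then have "compact (?g ` cball 0 R)" by (rule compact_continuous_image) auto
    then have "bounded (insert 0 (?g ` cball 0 R))" by (simp add: compact_imp_bounded)
    moreover have "range ?g \<subseteq> insert 0 (?g ` cball 0 R)"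
    proof
      fix y assume "y \<in> range ?g"
      then obtain x where x: "y = ?g x" by auto
      show "y \<in> insert 0 (?g ` cball 0 R)"
        using iter_partial_support[OF R, of x js] by (cases "norm x > R") (auto simp: x)
    qed
    ultimately show ?thesis by (rule bounded_subset)
  qed
  then show ?thesis using \<phi> by (simp add: schwartz_def)
qed

lemma test_smooth_mult:
  "\<phi> \<in> test_functions \<Longrightarrow> smooth g \<Longrightarrow> (\<lambda>x. g x * \<phi> x) \<in> test_functions"
  by (auto simp: test_functions_def intro!: smooth_mult)

lemma seminorm_bdd:
  assumes "\<phi> \<in> schwartz"
  shows "bdd_above ((\<lambda>(js, x). (1 + norm x) ^ N * norm (iter_partial js \<phi> x)) ` ({js. length js \<le> N} \<times> UNIV))"
proof -
  have fin: "finite {js::'a list. length js \<le> N}"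
    using finite_lists_length_le[of "UNIV::'a set" N] by simp
  have "\<exists>C. \<forall>x. (1 + norm x) ^ N * norm (iter_partial js \<phi> x) \<le> C" for js
    using schwartz_decay[OF schwartz_iter_partial[OF assms]] by metis
  then obtain C where C: "\<And>js x. (1 + norm x) ^ N * norm (iter_partial js \<phi> x) \<le> C js" by metis
  show ?thesis
  proof (rule bdd_aboveI2[where M="\<Sum>js | length js \<le> N. \<bar>C js\<bar>"], clarify)
    fix js :: "'a list" and x assume "length js \<le> N"
    then have "\<bar>C js\<bar> \<le> (\<Sum>js | length js \<le> N. \<bar>C js\<bar>)"
      by (intro member_le_sum) (auto simp: fin)
    then show "(1 + norm x) ^ N * norm (iter_partial js \<phi> x) \<le> (\<Sum>js | length js \<le> N. \<bar>C js\<bar>)"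
      using C[of x js] by linarith
  qed
qed

lemma le_seminorm:
  assumes "\<phi> \<in> schwartz" "length js \<le> N"
  shows "(1 + norm x) ^ N * norm (iter_partial js \<phi> x) \<le> schwartz_seminorm N \<phi>"
  unfolding schwartz_seminorm_def
  using cSUP_upper[OF _ seminorm_bdd[OF assms(1), of N], of "(js, x)"] assms(2) by auto

lemma seminorm_nonneg: "\<phi> \<in> schwartz \<Longrightarrow> 0 \<le> schwartz_seminorm N \<phi>"
  using le_seminorm[of \<phi> "[]" N 0] by (auto intro: order_trans[rotated])

lemma seminorm_le:
  assumes "\<And>js x. length js \<le> N \<Longrightarrow> (1 + norm x) ^ N * norm (iter_partial js \<phi> x) \<le> C"
  shows "schwartz_seminorm N \<phi> \<le> C"
  unfolding schwartz_seminorm_def by (rule cSUP_least) (use assms in \<open>auto intro: exI[of _ "[]"]\<close>)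

lemma seminorm_decay:
  assumes "\<phi> \<in> schwartz" shows "(1 + norm x) ^ N * norm (\<phi> x) \<le> schwartz_seminorm N \<phi>"
  using le_seminorm[OF assms, of "[]" N x] by simp

lemma iter_partial_add:
  assumes "smooth f" "smooth g"
  shows "iter_partial js (\<lambda>x. f x + g x) = (\<lambda>x. iter_partial js f x + iter_partial js g x)"
  using assms
  by (induction js) (auto simp: partial_add smooth_differentiable smooth_iter_partial intro!: ext)

lemma iter_partial_bounded_linear:
  assumes "smooth \<phi>" "bounded_linear L"
  shows "iter_partial js (\<lambda>x. L (\<phi> x)) = (\<lambda>x. L (iter_partial js \<phi> x))"
  using assms 
  by (induction js) (auto simp: partial_bounded_linear smooth_differentiable smooth_iter_partial intro!: ext)

lemma iter_partial_diff:
  assumes "\<phi> \<in> schwartz" "\<psi> \<in> schwartz"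
  shows "iter_partial js (\<lambda>x. \<phi> x - \<psi> x) = (\<lambda>x. iter_partial js \<phi> x - iter_partial js \<psi> x)"
  using iter_partial_add[OF schwartz_smooth[OF assms(1)] schwartz_smooth[OF schwartz_uminus[OF assms(2)]], of js]
    iter_partial_bounded_linear[OF schwartz_smooth[OF assms(2)] bounded_linear_minus[OF bounded_linear_ident], of js]
  by simp

section \<open>Smooth cutoffs\<close>

locale bump =
  fixes \<theta> :: "real^'n::finite \<Rightarrow> real"
  assumes bump_smooth: "smooth \<theta>"
    and bump_one: "norm x < 1 \<Longrightarrow> \<theta> x = 1"
    and bump_zero: "norm x > 2 \<Longrightarrow> \<theta> x = 0"
    and bump_nonneg: "0 \<le> \<theta> x" and bump_le_one: "\<theta> x \<le> 1"

text \<open>A dyadic cutoff provides a smooth function that is \<open>1\<close> near the origin and has compact support: at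
  \<open>2 < |x| < 4\<close> only the pieces \<open>j = 1\<close> and \<open>j = 2\<close> are present, so they sum to \<open>1\<close>, and
  \<open>1 - \<psi> (x/2) - \<psi> (x/4)\<close> vanishes there and extends by zero.\<close>

lemma dyadic_cutoff_bump:
  fixes \<psi> :: "real^'n::finite \<Rightarrow> real"
  assumes "dyadic_cutoff \<psi>"
  shows "bump (\<lambda>x. if norm x < 3 then 1 - \<psi> ((1/2) *\<^sub>R x) - \<psi> ((1/4) *\<^sub>R x) else 0)" (is "bump ?\<theta>")
proof -
  have sm: "smooth \<psi>" and nn: "\<And>x. 0 \<le> \<psi> x"
    and supp: "\<And>x. \<psi> x \<noteq> 0 \<Longrightarrow> 1/2 \<le> norm x \<and> norm x \<le> 2"
    and tot: "\<And>x. x \<noteq> 0 \<Longrightarrow> ((\<lambda>j::int. \<psi> ((2 powr - real_of_int j) *\<^sub>R x)) has_sum 1) UNIV"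
    using assms unfolding dyadic_cutoff_def by blast+
  let ?g = "\<lambda>x. 1 - \<psi> ((1/2) *\<^sub>R x) - \<psi> ((1/4) *\<^sub>R x)"
  have \<psi>0: "\<psi> 0 = 0" using supp[of 0] by auto
  have "smooth (\<lambda>x. \<psi> ((1/2) *\<^sub>R x + 0))" "smooth (\<lambda>x. \<psi> ((1/4) *\<^sub>R x + 0))" by (rule smooth_affine[OF sm])+
  note sm2 = this[THEN smooth_bounded_linear_comp[OF _ bounded_linear_minus[OF bounded_linear_ident]]]
  have "smooth (\<lambda>x. 1 + (- \<psi> ((1/2) *\<^sub>R x) + - \<psi> ((1/4) *\<^sub>R x)))"
    using smooth_add[OF smooth_const[of 1] smooth_add[OF sm2]] by simp
  then have smg: "smooth ?g" by (simp add: algebra_simps)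
  have vanish: "?g x = 0" if "2 < norm x" "norm x < 4" for x
  proof -
    have "((\<lambda>j::int. \<psi> ((2 powr - real_of_int j) *\<^sub>R x)) has_sum 1) {1,2}"
    proof (rule has_sum_cong_neutral[THEN iffD1, OF _ _ _ tot])
      fix j :: int assume j: "j \<in> UNIV - {1,2}"
      show "\<psi> ((2 powr - real_of_int j) *\<^sub>R x) = 0"
      proof (rule ccontr)
        assume "\<psi> ((2 powr - real_of_int j) *\<^sub>R x) \<noteq> 0"
        from supp[OF this] have *: "1/2 \<le> 2 powr - real_of_int j * norm x" "2 powr - real_of_int j * norm x \<le> 2" by auto
        consider "j \<le> 0" | "j \<ge> 3" using j by force
        then show False
        proof cases
          case 1
          then have "(2::real) powr 0 \<le> 2 powr - real_of_int j" by (intro powr_mono) auto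
          then have "1 * norm x \<le> 2 powr - real_of_int j * norm x" by (intro mult_right_mono) auto
          then show False using * that by auto
        next
          case 2
          then have "(2::real) powr - real_of_int j \<le> 2 powr - 3" by (intro powr_mono) auto
          then have "2 powr - real_of_int j * norm x \<le> 2 powr - 3 * norm x" by (intro mult_right_mono) auto
          also have "(2::real) powr - 3 = 1/8" by (simp add: powr_minus)
          finally show False using * that by auto
        qed
      qed
    qed (use that in auto)
    from has_sum_unique[OF has_sum_finite this]
    have "(\<Sum>j\<in>{1,2::int}. \<psi> ((2 powr - real_of_int j) *\<^sub>R x)) = 1" by blast
    moreover have "(2::real) powr - 2 = 1/4" "(2::real) powr - 1 = 1/2" by (simp_all add: powr_minus)
    ultimately show ?thesis by simp
  qed
  have ge: "0 \<le> ?g x" for x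
  proof (cases "x = 0")
    case False
    have "(\<Sum>j\<in>{1,2::int}. \<psi> ((2 powr - real_of_int j) *\<^sub>R x)) \<le> 1"
      by (rule has_sum_mono2[OF has_sum_finite tot]) (use False nn in auto)
    moreover have "(2::real) powr - 2 = 1/4" "(2::real) powr - 1 = 1/2" by (simp_all add: powr_minus)
    ultimately show ?thesis by simp
  qed (simp add: \<psi>0)
  show ?thesis
  proof
    show "smooth ?\<theta>"
    proof (rule smooth_local)
      fix x :: "real^'n"
      show "\<exists>U g. open U \<and> x \<in> U \<and> smooth g \<and> (\<forall>y\<in>U. ?\<theta> y = g y)"
      proof (cases "norm x < 3")
        case True
        have "open {x::real^'n. norm x < 3}" by (intro open_Collect_less continuous_intros)
        then show ?thesis using True smg by (intro exI[of _ "{x. norm x < 3}"] exI[of _ ?g]) auto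
      next
        case False
        have "open {x::real^'n. norm x > 2}" by (intro open_Collect_less continuous_intros)
        then show ?thesis using False vanish by (intro exI[of _ "{x. norm x > 2}"] exI[of _ "\<lambda>_. 0"]) auto
      qed
    qed
    show "?\<theta> x = 1" if "norm x < 1" for x
    proof -
      have "\<psi> ((1/2) *\<^sub>R x) = 0" using supp[of "(1/2) *\<^sub>R x"] that by force
      moreover have "\<psi> ((1/4) *\<^sub>R x) = 0" using supp[of "(1/4) *\<^sub>R x"] that by force
      ultimately show ?thesis using that by simp
    qed
    show "?\<theta> x = 0" if "norm x > 2" for x using vanish[of x] that by auto
    show "0 \<le> ?\<theta> x" for x using ge by auto
    show "?\<theta> x \<le> 1" for x using nn[of "(1/2) *\<^sub>R x"] nn[of "(1/4) *\<^sub>R x"] by auto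
  qed
qed

section \<open>Radial integrals and affine substitutions\<close>

lemma lborel_affine_density:
  assumes "c \<noteq> 0"
  shows "distr lborel borel (\<lambda>x::'a::euclidean_space. t + c *\<^sub>R x) = density lborel (\<lambda>_. ennreal (1 / \<bar>c\<bar> ^ DIM('a)))"
proof -
  have "density lborel (\<lambda>_. ennreal (1 / \<bar>c\<bar> ^ DIM('a)))
      = density (density (distr lborel borel (\<lambda>x::'a. t + c *\<^sub>R x)) (\<lambda>_. \<bar>c\<bar>^DIM('a))) (\<lambda>_. ennreal (1 / \<bar>c\<bar> ^ DIM('a)))"
    using lborel_affine[OF assms, of t] by simp
  also have "\<dots> = density (distr lborel borel (\<lambda>x::'a. t + c *\<^sub>R x)) (\<lambda>_. 1)"
    using assms by (subst density_density_eq) (auto simp: ennreal_mult[symmetric])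
  finally show ?thesis by (simp add: density_1)
qed

lemma LINT_affine:
  fixes f :: "'a::euclidean_space \<Rightarrow> 'b::{banach, second_countable_topology}"
  assumes [measurable]: "f \<in> borel_measurable borel" and "c \<noteq> 0"
  shows "(LINT x|lborel. f (t + c *\<^sub>R x)) = (1 / \<bar>c\<bar> ^ DIM('a)) *\<^sub>R (LINT x|lborel. f x)"
proof -
  have "(LINT x|lborel. f (t + c *\<^sub>R x)) = (LINT x|distr lborel borel (\<lambda>x::'a. t + c *\<^sub>R x). f x)"
    by (subst integral_distr) auto
  also have "\<dots> = (1 / \<bar>c\<bar> ^ DIM('a)) *\<^sub>R (LINT x|lborel. f x)"
    unfolding lborel_affine_density[OF assms(2)] by (subst integral_density) auto
  finally show ?thesis .
qed

lemma nn_integral_affine: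
  fixes f :: "'a::euclidean_space \<Rightarrow> ennreal"
  assumes [measurable]: "f \<in> borel_measurable borel" and "c \<noteq> 0"
  shows "(\<integral>\<^sup>+x. f (t + c *\<^sub>R x) \<partial>lborel) = ennreal (1 / \<bar>c\<bar> ^ DIM('a)) * (\<integral>\<^sup>+x. f x \<partial>lborel)"
proof -
  have "(\<integral>\<^sup>+x. f (t + c *\<^sub>R x) \<partial>lborel) = (\<integral>\<^sup>+x. f x \<partial>distr lborel borel (\<lambda>x::'a. t + c *\<^sub>R x))"
    by (subst nn_integral_distr) auto
  also have "\<dots> = ennreal (1 / \<bar>c\<bar> ^ DIM('a)) * (\<integral>\<^sup>+x. f x \<partial>lborel)"
    unfolding lborel_affine_density[OF assms(2)] by (subst nn_integral_density) (auto simp: nn_integral_cmult)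
  finally show ?thesis .
qed

lemma integrable_affine:
  fixes f :: "'a::euclidean_space \<Rightarrow> 'b::{banach, second_countable_topology}"
  assumes "integrable lborel f" "c \<noteq> 0"
  shows "integrable lborel (\<lambda>x. f (t + c *\<^sub>R x))"
proof -
  have [measurable]: "f \<in> borel_measurable borel" using assms(1) by auto
  have "integrable (distr lborel borel (\<lambda>x::'a. t + c *\<^sub>R x)) f"
    unfolding lborel_affine_density[OF assms(2)] using assms by (subst integrable_density) auto
  then show ?thesis by (subst (asm) integrable_distr_eq) auto
qed

text \<open>Both measures agree on the intervals \<open>{..r}\<close>, where the left-hand side is the volume of a ball.\<close>

lemma distr_norm_lborel:
  "distr lborel borel (norm :: real^'n::finite \<Rightarrow> real) =
   density lborel (\<lambda>r. ennreal (real CARD('n) * unit_ball_vol CARD('n) * r ^ (CARD('n) - 1)) * indicator {0..} r)"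
  (is "?M = ?N")
proof -
  let ?n = "CARD('n)" let ?V = "unit_ball_vol (real CARD('n))"
  have n: "?n \<ge> 1" by (simp add: Suc_leI)
  have M: "emeasure ?M {..a} = ennreal (?V * (max a 0) ^ ?n)" for a
  proof -
    have "emeasure ?M {..a} = emeasure lborel {x::real^'n. norm x \<le> a}"
      by (subst emeasure_distr) (auto intro!: arg_cong[where f="emeasure lborel"])
    also have "\<dots> = ennreal (?V * (max a 0) ^ ?n)"
    proof (cases "a \<ge> 0")
      case True
      have "{x::real^'n. norm x \<le> a} = cball 0 a" by auto
      then show ?thesis using emeasure_cball[OF True, of "0::real^'n"] True by simp
    next
      case False
      then have "{x::real^'n. norm x \<le> a} = {}" using norm_ge_zero order_trans by blast
      then show ?thesis using False n by (simp add: max_def power_0_left)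
    qed
    finally show ?thesis .
  qed
  have N: "emeasure ?N {..a} = ennreal (?V * (max a 0) ^ ?n)" for a
  proof -
    have "emeasure ?N {..a} = (\<integral>\<^sup>+r. ennreal (real ?n * ?V * r ^ (?n - 1)) * indicator {0..max a 0} r \<partial>lborel)"
    proof (subst emeasure_density)
      show "(\<integral>\<^sup>+ r. ennreal (real ?n * ?V * r ^ (?n - 1)) * indicator {0..} r * indicator {..a} r \<partial>lborel)
          = (\<integral>\<^sup>+r. ennreal (real ?n * ?V * r ^ (?n - 1)) * indicator {0..max a 0} r \<partial>lborel)"
        by (rule nn_integral_cong_AE, rule AE_mp[OF AE_lborel_singleton[of 0]])
          (auto split: split_indicator intro!: AE_I2)
    qed auto
    also have "\<dots> = ennreal (?V * (max a 0) ^ ?n - ?V * 0 ^ ?n)"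
    proof (rule nn_integral_FTC_Icc)
      fix x :: real
      show "((\<lambda>r. ?V * r ^ ?n) has_real_derivative real ?n * ?V * x ^ (?n - 1)) (at x)"
        by (auto intro!: derivative_eq_intros)
    qed auto
    finally show ?thesis using n by (simp add: power_0_left)
  qed
  show ?thesis
  proof (rule measure_eqI_generator_eq[where E="range atMost" and \<Omega>=UNIV and A="\<lambda>i::nat. {..real i}"])
    show "Int_stable (range atMost :: real set set)" by (auto simp: Int_stable_def)
    show "sets ?M = sigma_sets UNIV (range atMost)" "sets ?N = sigma_sets UNIV (range atMost)"
      by (auto simp: borel_eq_atMost)
    show "(\<Union>i. {..real i}) = UNIV" using real_arch_simple by auto
    show "emeasure ?M X = emeasure ?N X" if "X \<in> range atMost" for X using that M N by auto
    show "emeasure ?M {..real i} \<noteq> \<infinity>" for i by (simp add: M)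
  qed auto
qed

lemma nn_integral_radial:
  assumes [measurable]: "g \<in> borel_measurable borel"
  shows "(\<integral>\<^sup>+x. g (norm (x::real^'n::finite)) \<partial>lborel) =
    (\<integral>\<^sup>+r. ennreal (real CARD('n) * unit_ball_vol CARD('n) * r ^ (CARD('n) - 1)) * g r * indicator {0..} r \<partial>lborel)"
proof -
  have "(\<integral>\<^sup>+x. g (norm (x::real^'n)) \<partial>lborel) = (\<integral>\<^sup>+r. g r \<partial>distr lborel borel (norm :: real^'n \<Rightarrow> real))"
    by (subst nn_integral_distr) auto
  also have "\<dots> = (\<integral>\<^sup>+r. ennreal (real CARD('n) * unit_ball_vol CARD('n) * r ^ (CARD('n) - 1)) * indicator {0..} r * g r \<partial>lborel)"
    unfolding distr_norm_lborel by (subst nn_integral_density) auto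
  finally show ?thesis by (simp add: mult_ac)
qed

text \<open>In polar coordinates this is the Gamma integral; the exponent of \<open>\<kappa>\<close> is the source of all
  powers of \<open>t\<close> below, with \<open>\<kappa>\<close> proportional to \<open>sqrt t\<close>.\<close>

lemma nn_integral_powr_exp:
  assumes "\<beta> > - real CARD('n::finite)"
  obtains C where "C \<ge> 0" "\<And>\<kappa>. \<kappa> > 0 \<Longrightarrow>
     (\<integral>\<^sup>+x. ennreal (norm (x::real^'n) powr \<beta> * exp (- \<kappa> * norm x)) \<partial>lborel) = ennreal (C * \<kappa> powr (- \<beta> - real CARD('n)))"
proof -
  let ?n = "CARD('n)" let ?A = "real CARD('n) * unit_ball_vol (real CARD('n))"
  define s where "s = \<beta> + real ?n"
  have s: "s > 0" using assms by (simp add: s_def)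
  have n: "?n \<ge> 1" by (simp add: Suc_leI)
  show ?thesis
  proof (rule that[of "?A * Gamma s"])
    show "0 \<le> ?A * Gamma s" using Gamma_real_pos[OF s] by simp
    fix \<kappa> :: real assume \<kappa>: "\<kappa> > 0"
    let ?G = "\<lambda>t::real. ennreal (indicator {0..} t * t powr (s - 1) / exp t)"
    have "(\<integral>\<^sup>+x. ennreal (norm (x::real^'n) powr \<beta> * exp (- \<kappa> * norm x)) \<partial>lborel)
      = (\<integral>\<^sup>+r. ennreal (?A * r ^ (?n - 1)) * ennreal (r powr \<beta> * exp (- \<kappa> * r)) * indicator {0..} r \<partial>lborel)"
      by (rule nn_integral_radial) auto
    also have "\<dots> = (\<integral>\<^sup>+r. ennreal (?A * \<kappa> powr (1 - s)) * ?G (0 + \<kappa> *\<^sub>R r) \<partial>lborel)"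
    proof (rule nn_integral_cong_AE, rule AE_mp[OF AE_lborel_singleton[of 0]], rule AE_I2, rule impI)
      fix r :: real assume "r \<noteq> 0"
      show "ennreal (?A * r ^ (?n - 1)) * ennreal (r powr \<beta> * exp (- \<kappa> * r)) * indicator {0..} r
           = ennreal (?A * \<kappa> powr (1 - s)) * ?G (0 + \<kappa> *\<^sub>R r)"
      proof (cases "r > 0")
        case True
        have "r ^ (?n - 1) = r powr (real ?n - 1)" using True n by (simp add: powr_realpow[symmetric] of_nat_diff)
        then have "(?A * r ^ (?n - 1)) * (r powr \<beta> * exp (- \<kappa> * r)) = ?A * (r powr (s - 1)) * exp (- \<kappa> * r)"
        proof -
          have "r powr (real ?n - 1) * r powr \<beta> = r powr (s - 1)" by (simp add: s_def powr_add[symmetric] algebra_simps)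
          moreover have "(?A * r ^ (?n - 1)) * (r powr \<beta> * exp (- \<kappa> * r)) = ?A * (r ^ (?n - 1) * r powr \<beta>) * exp (- \<kappa> * r)"
            by (simp only: mult.assoc)
          ultimately show ?thesis using \<open>r ^ (?n - 1) = r powr (real ?n - 1)\<close> by simp
        qed
        also have "\<dots> = (?A * \<kappa> powr (1 - s)) * ((\<kappa> * r) powr (s - 1) / exp (\<kappa> * r))"
        proof -
          have "\<kappa> powr (1 - s) * \<kappa> powr (s - 1) = 1" using \<kappa> by (simp flip: powr_add)
          moreover have "(?A * \<kappa> powr (1 - s)) * ((\<kappa> * r) powr (s - 1) / exp (\<kappa> * r))
              = (\<kappa> powr (1 - s) * \<kappa> powr (s - 1)) * (?A * (r powr (s - 1)) * exp (- \<kappa> * r))"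
            using \<kappa> True by (simp add: powr_mult exp_minus divide_inverse)
          ultimately show ?thesis by simp
        qed
        finally show ?thesis using True \<kappa> by (auto simp: ennreal_mult[symmetric] indicator_def)
      next
        case False
        then have "r < 0" using \<open>r \<noteq> 0\<close> by simp
        then show ?thesis using \<kappa> by (simp add: indicator_def mult_pos_neg not_le)
      qed
    qed
    also have "\<dots> = ennreal (?A * \<kappa> powr (1 - s)) * (\<integral>\<^sup>+r. ?G (0 + \<kappa> *\<^sub>R r) \<partial>lborel)"
      by (rule nn_integral_cmult) auto
    also have "(\<integral>\<^sup>+r. ?G (0 + \<kappa> *\<^sub>R r) \<partial>lborel) = ennreal (1 / \<kappa>) * ennreal (Gamma s)"
      using \<kappa> by (subst nn_integral_affine) (auto simp: Gamma_conv_nn_integral_real[OF s])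
    also have "ennreal (?A * \<kappa> powr (1 - s)) * (ennreal (1 / \<kappa>) * ennreal (Gamma s)) = ennreal (?A * Gamma s * \<kappa> powr (- s))"
      using \<kappa> Gamma_real_pos[OF s] by (simp add: ennreal_mult[symmetric] powr_diff powr_minus field_simps)
    finally show "(\<integral>\<^sup>+x. ennreal (norm (x::real^'n) powr \<beta> * exp (- \<kappa> * norm x)) \<partial>lborel)
        = ennreal (?A * Gamma s * \<kappa> powr (- \<beta> - real ?n))" by (simp add: s_def algebra_simps)
  qed
qed

lemma integrable_inverse_power:
  "integrable lborel (\<lambda>x::real^'n::finite. 1 / (1 + norm x) ^ (CARD('n) + 1))"
proof (rule integrableI_bounded)
  let ?n = "CARD('n)" let ?A = "real CARD('n) * unit_ball_vol (real CARD('n))"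
  have n: "?n \<ge> 1" by (simp add: Suc_leI)
  have "(\<integral>\<^sup>+x. ennreal (norm (1 / (1 + norm (x::real^'n)) ^ (?n + 1))) \<partial>lborel)
      = (\<integral>\<^sup>+r. ennreal (?A * r ^ (?n - 1)) * ennreal (norm (1 / (1 + r) ^ (?n + 1))) * indicator {0..} r \<partial>lborel)"
    by (rule nn_integral_radial) auto
  also have "\<dots> \<le> (\<integral>\<^sup>+r. ennreal (?A * (1 / (1 + r) ^ 2)) * indicator {0..} r \<partial>lborel)"
  proof (rule nn_integral_mono)
    fix r :: real
    show "ennreal (?A * r ^ (?n - 1)) * ennreal (norm (1 / (1 + r) ^ (?n + 1))) * indicator {0..} r
       \<le> ennreal (?A * (1 / (1 + r) ^ 2)) * indicator {0..} r"
    proof (cases "r \<ge> 0")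
      case True
      have "r ^ (?n - 1) * (1 / (1 + r) ^ (?n + 1)) \<le> (1 + r) ^ (?n - 1) * (1 / (1 + r) ^ (?n + 1))"
        using True by (intro mult_right_mono power_mono) auto
      also have "\<dots> = 1 / (1 + r) ^ 2"
      proof -
        have "(1 + r) ^ (?n + 1) = (1 + r) ^ (?n - 1) * (1 + r) ^ 2"
          using n by (simp add: power_add[symmetric])
        then show ?thesis using True by simp
      qed
      finally have "?A * (r ^ (?n - 1) * (1 / (1 + r) ^ (?n + 1))) \<le> ?A * (1 / (1 + r) ^ 2)"
        by (intro mult_left_mono) auto
      then show ?thesis using True by (auto simp: ennreal_mult[symmetric] intro!: ennreal_leI)
    qed simp
  qed
  also have "\<dots> = ennreal (0 - (- ?A / (1 + 0)))"
  proof (rule nn_integral_FTC_atLeast)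
    show "((\<lambda>r. - ?A / (1 + r)) has_real_derivative ?A * (1 / (1 + x)\<^sup>2)) (at x)" if "0 \<le> x" for x
      using that by (auto intro!: derivative_eq_intros simp: power2_eq_square field_simps)
    show "((\<lambda>r. - ?A / (1 + r)) \<longlongrightarrow> 0) at_top" by real_asymp
  qed auto
  finally show "(\<integral>\<^sup>+x. ennreal (norm (1 / (1 + norm (x::real^'n)) ^ (?n + 1))) \<partial>lborel) < \<infinity>"
    by (rule le_less_trans) simp
qed simp

lemma schwartz_integrable:
  fixes \<phi> :: "real^'n::finite \<Rightarrow> complex"
  assumes "\<phi> \<in> schwartz" shows "integrable lborel \<phi>"
proof -
  obtain C where C: "\<And>x. (1 + norm x) ^ (CARD('n) + 1) * norm (\<phi> x) \<le> C" "C > 0" using schwartz_decay[OF assms] by metis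
  show ?thesis
  proof (rule Bochner_Integration.integrable_bound)
    show "integrable lborel (\<lambda>x::real^'n. C * (1 / (1 + norm x) ^ (CARD('n) + 1)))"
      by (intro integrable_mult_right integrable_inverse_power)
    show "\<phi> \<in> borel_measurable lborel" using schwartz_measurable[OF assms] by simp
    have "norm (\<phi> x) \<le> norm (C * (1 / (1 + norm x) ^ (CARD('n) + 1)))" for x
    proof -
      have "(1 + norm x) ^ (CARD('n) + 1) > 0" by (intro zero_less_power) (simp add: add_pos_nonneg)
      then have "norm (\<phi> x) \<le> C * (1 / (1 + norm x) ^ (CARD('n) + 1))"
        using C(1)[of x] by (simp add: field_simps)
      then show ?thesis using C(2) by simp
    qed
    then show "AE x in lborel. norm (\<phi> x) \<le> norm (C * (1 / (1 + norm x) ^ (CARD('n) + 1)))" by simp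
  qed
qed

text \<open>An integral norm that is controlled by the seminorms.\<close>

lemma schwartz_L1_le_seminorm:
  obtains C where "C > 0" "\<And>\<phi> :: real^'n::finite \<Rightarrow> complex. \<phi> \<in> schwartz \<Longrightarrow>
     (LINT x|lborel. norm (\<phi> x)) \<le> C * schwartz_seminorm (CARD('n) + 1) \<phi>"
proof (rule that)
  let ?I = "LINT x|lborel. 1 / (1 + norm (x::real^'n)) ^ (CARD('n) + 1)"
  have I: "?I \<ge> 0" by (rule integral_nonneg_AE) auto
  then show "?I + 1 > 0" by linarith
  fix \<phi> :: "real^'n \<Rightarrow> complex" assume \<phi>: "\<phi> \<in> schwartz"
  have "(LINT x|lborel. norm (\<phi> x)) \<le> (LINT x|lborel. schwartz_seminorm (CARD('n) + 1) \<phi> * (1 / (1 + norm (x::real^'n)) ^ (CARD('n) + 1)))"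
  proof (rule integral_mono)
    fix x :: "real^'n"
    have "(1 + norm x) ^ (CARD('n) + 1) > 0" by (intro zero_less_power) (simp add: add_pos_nonneg)
    then show "norm (\<phi> x) \<le> schwartz_seminorm (CARD('n) + 1) \<phi> * (1 / (1 + norm x) ^ (CARD('n) + 1))"
      using seminorm_decay[OF \<phi>, of x "CARD('n) + 1"] by (simp add: field_simps)
  next
    show "integrable lborel (\<lambda>x::real^'n. schwartz_seminorm (CARD('n) + 1) \<phi> * (1 / (1 + norm x) ^ (CARD('n) + 1)))"
      by (intro integrable_mult_right integrable_inverse_power)
  qed (intro integrable_norm schwartz_integrable \<phi>)
  also have "\<dots> = schwartz_seminorm (CARD('n) + 1) \<phi> * ?I" by (rule integral_mult_right_zero)
  also have "\<dots> \<le> (?I + 1) * schwartz_seminorm (CARD('n) + 1) \<phi>"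
    using seminorm_nonneg[OF \<phi>, of "CARD('n) + 1"] by (simp add: algebra_simps)
  finally show "(LINT x|lborel. norm (\<phi> x)) \<le> (?I + 1) * schwartz_seminorm (CARD('n) + 1) \<phi>" .
qed

section \<open>The Fourier transform\<close>

abbreviation wave :: "real^'n::finite \<Rightarrow> real^'n \<Rightarrow> complex" where
  "wave x \<xi> \<equiv> exp (- \<i> * complex_of_real (x \<bullet> \<xi>))"

text \<open>Differentiation under the integral sign, by dominated convergence of the difference quotients.\<close>

lemma has_derivative_LINT:
  fixes K :: "'a::real_normed_vector \<Rightarrow> 'b \<Rightarrow> complex"
  assumes U: "open U" "convex U" "x \<in> U"
    and int: "\<And>z. z \<in> U \<Longrightarrow> integrable M (K z)"
    and der: "\<And>z y. z \<in> U \<Longrightarrow> ((\<lambda>z. K z y) has_derivative K' z y) (at z)"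
    and bnd: "\<And>z y h. z \<in> U \<Longrightarrow> norm (K' z y h) \<le> B y * norm h"
    and B: "integrable M B" and meas: "\<And>h. (\<lambda>y. K' x y h) \<in> borel_measurable M"
  shows "((\<lambda>z. LINT y|M. K z y) has_derivative (\<lambda>h. LINT y|M. K' x y h)) (at x)"
proof -
  have intK': "integrable M (\<lambda>y. K' x y h)" for h
    by (rule Bochner_Integration.integrable_bound[OF integrable_mult_left[OF B, of "norm h"] meas])
      (use bnd[OF U(3)] in \<open>auto intro!: AE_I2 intro: order_trans[OF _ abs_ge_self]\<close>)
  have lin: "linear (K' x y)" for y using has_derivative_linear[OF der[OF U(3)]] .
  have "bounded_linear (\<lambda>h. LINT y|M. K' x y h)"
  proof (rule bounded_linear_intro)
    show "(LINT y|M. K' x y (a + b)) = (LINT y|M. K' x y a) + (LINT y|M. K' x y b)" for a b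
      by (simp add: linear_add[OF lin] intK')
    show "(LINT y|M. K' x y (r *\<^sub>R a)) = r *\<^sub>R (LINT y|M. K' x y a)" for r a
      by (simp add: linear_cmul[OF lin])
    show "norm (LINT y|M. K' x y h) \<le> norm h * (LINT y|M. B y)" for h
    proof -
      have "norm (LINT y|M. K' x y h) \<le> (LINT y|M. B y * norm h)"
        by (rule order_trans[OF integral_norm_bound integral_mono]) (use intK' B bnd[OF U(3)] in auto)
      then show ?thesis by (simp add: mult.commute)
    qed
  qed
  moreover have "((\<lambda>z. ((LINT y|M. K z y) - (LINT y|M. K x y) - (LINT y|M. K' x y (z - x))) /\<^sub>R norm (z - x)) \<longlongrightarrow> 0) (at x)"
    unfolding tendsto_at_iff_sequentially comp_def
  proof (intro allI impI)
    fix X assume X: "\<forall>i. X i \<in> UNIV - {x}" "X \<longlonglongrightarrow> x"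
    obtain N where N: "\<And>i. i \<ge> N \<Longrightarrow> X i \<in> U"
      using topological_tendstoD[OF X(2) U(1,3)] by (auto simp: eventually_sequentially)
    define Q where "Q = (\<lambda>i y. (K (X (i + N)) y - K x y - K' x y (X (i + N) - x)) /\<^sub>R norm (X (i + N) - x))"
    have "(\<lambda>i. LINT y|M. Q i y) \<longlonglongrightarrow> (LINT y|M. 0)"
    proof (rule integral_dominated_convergence)
      show "integrable M (\<lambda>y. 2 * B y)" using B by simp
      show "Q i \<in> borel_measurable M" for i unfolding Q_def using int[OF U(3)] int[OF N[of "i + N"]] meas by auto
      show "AE y in M. (\<lambda>i. Q i y) \<longlonglongrightarrow> 0"
      proof (rule AE_I2)
        fix y
        have "((\<lambda>z. (K z y - K x y - K' x y (z - x)) /\<^sub>R norm (z - x)) \<longlongrightarrow> 0) (at x)"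
          using der[OF U(3), of y] by (simp add: has_derivative_at_within)
        then show "(\<lambda>i. Q i y) \<longlonglongrightarrow> 0"
          unfolding tendsto_at_iff_sequentially comp_def Q_def 
          using X LIMSEQ_ignore_initial_segment[OF X(2), of N] by auto
      qed
      show "AE y in M. norm (Q i y) \<le> 2 * B y" for i
      proof (rule AE_I2)
        fix y
        let ?z = "X (i + N)"
        have z: "?z \<in> U" using N by simp
        have "norm (K ?z y - K x y) \<le> B y * norm (?z - x)"
        proof (rule differentiable_bound[OF U(2)])
          show "((\<lambda>z. K z y) has_derivative K' w y) (at w within U)" if "w \<in> U" for w
            using der[OF that] by (rule has_derivative_at_withinI)
          have "0 \<le> B y * norm (?z - x)" using bnd[OF U(3)] norm_ge_zero order_trans by blast
          then have "0 \<le> B y" using X(1) by (auto simp: zero_le_mult_iff)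
          then show "onorm (K' w y) \<le> B y" if "w \<in> U" for w using bnd[OF that] by (rule onorm_bound)
        qed (use z U in auto)
        moreover have "norm (K' x y (?z - x)) \<le> B y * norm (?z - x)" by (rule bnd[OF U(3)])
        ultimately have "norm (K ?z y - K x y - K' x y (?z - x)) \<le> 2 * B y * norm (?z - x)"
          using norm_triangle_ineq4[of "K ?z y - K x y" "K' x y (?z - x)"] by linarith
        moreover have "norm (?z - x) > 0" using X(1) by auto
        ultimately show "norm (Q i y) \<le> 2 * B y" by (simp add: Q_def divide_simps mult.commute)
      qed
    qed auto
    moreover have "(LINT y|M. Q i y) = ((LINT y|M. K (X (i+N)) y) - (LINT y|M. K x y) - (LINT y|M. K' x y (X (i+N) - x))) /\<^sub>R norm (X (i+N) - x)" for i
      unfolding Q_def using int[OF U(3)] int[OF N[of "i + N"]] intK' by simp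
    ultimately have "(\<lambda>i. ((LINT y|M. K (X (i+N)) y) - (LINT y|M. K x y) - (LINT y|M. K' x y (X (i+N) - x))) /\<^sub>R norm (X (i+N) - x)) \<longlonglongrightarrow> 0"
      by simp
    then show "(\<lambda>i. ((LINT y|M. K (X i) y) - (LINT y|M. K x y) - (LINT y|M. K' x y (X i - x))) /\<^sub>R norm (X i - x)) \<longlonglongrightarrow> 0"
      by (rule LIMSEQ_offset)
  qed
  ultimately show ?thesis by (simp add: has_derivative_at_within)
qed

lemma norm_exp_char [simp]: "norm (exp (- (\<i> * complex_of_real r))) = 1"
  using norm_exp_i_times[of "-r"] by simp

abbreviation fc :: "'n::finite itself \<Rightarrow> real" where "fc _ \<equiv> (2 * pi) powr (- real CARD('n) / 2)"

lemma integrable_char: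
  assumes "integrable lborel (f :: real^'n::finite \<Rightarrow> complex)"
  shows "integrable lborel (\<lambda>x. wave x \<xi> * f x)"
    "integrable lborel (\<lambda>x. exp (\<i> * complex_of_real (\<xi> \<bullet> x)) * f x)"
  using assms by (auto intro!: Bochner_Integration.integrable_bound[OF assms] AE_I2 simp: norm_mult)

lemma inv_fourier_eq: "inv_fourier g x = fourier g (- x)"
  by (simp add: inv_fourier_def fourier_def inner_commute)

lemma fourier_norm_le:
  assumes "integrable lborel (f :: real^'n::finite \<Rightarrow> complex)"
  shows "norm (fourier f \<xi>) \<le> fc TYPE('n) * (LINT x|lborel. norm (f x))"
  unfolding fourier_def norm_mult
  by (rule mult_mono[OF _ integral_norm_bound[THEN order_trans]]) (auto simp: norm_mult)

lemma fourier_measurable [measurable]: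
  assumes [measurable]: "f \<in> borel_measurable borel"
  shows "fourier f \<in> borel_measurable borel"
  unfolding fourier_def[abs_def] by measurable

lemma fourier_add:
  assumes "integrable lborel f" "integrable lborel g"
  shows "fourier (\<lambda>x. f x + g x) \<xi> = fourier f \<xi> + fourier g \<xi>"
  unfolding fourier_def using integrable_char[OF assms(1)] integrable_char[OF assms(2)]
  by (simp add: distrib_left)

lemma fourier_cmult: "fourier (\<lambda>x. c * f x) \<xi> = c * fourier f \<xi>"
  unfolding fourier_def by (simp add: mult.left_commute[of _ c])

lemma fourier_sum:
  assumes "\<And>i. i \<in> I \<Longrightarrow> integrable lborel (f i)"
  shows "fourier (\<lambda>x. \<Sum>i\<in>I. f i x) \<xi> = (\<Sum>i\<in>I. fourier (f i) \<xi>)"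
  using assms
  by (induction I rule: infinite_finite_induct) (auto simp: fourier_add fourier_cmult[of 0 "\<lambda>_. 0", simplified])

lemma has_derivative_exp_comp:
  fixes g :: "'a::real_normed_vector \<Rightarrow> complex"
  assumes "(g has_derivative g') (at x)"
  shows "((\<lambda>x. exp (g x)) has_derivative (\<lambda>h. exp (g x) * g' h)) (at x)"
  using has_derivative_compose[OF assms DERIV_exp[unfolded has_field_derivative_def, of "g x"]] by simp

lemma fourier_derivative:
  fixes f :: "real^'n::finite \<Rightarrow> complex"
  assumes f: "integrable lborel f" and xf: "integrable lborel (\<lambda>x. norm x * norm (f x))"
  shows "fourier f differentiable (at \<xi>)"
    and "partial_deriv j (fourier f) \<xi> = fourier (\<lambda>x. - \<i> * (complex_of_real (x $ j) * f x)) \<xi>"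
proof -
  let ?K' = "\<lambda>\<xi> x h. - \<i> * complex_of_real (x \<bullet> h) * wave x \<xi> * f x"
  have [measurable]: "f \<in> borel_measurable borel" using f by auto
  have "((\<lambda>\<xi>. LINT x|lborel. wave x \<xi> * f x) has_derivative (\<lambda>h. LINT x|lborel. ?K' \<xi> x h)) (at \<xi>)"
  proof (rule has_derivative_LINT[where U=UNIV and B="\<lambda>x. norm x * norm (f x)"])
    show "((\<lambda>\<xi>. wave x \<xi> * f x) has_derivative ?K' \<xi> x) (at \<xi>)" for x \<xi>
    proof -
      have "((\<lambda>\<xi>. - \<i> * complex_of_real (x \<bullet> \<xi>)) has_derivative (\<lambda>h. - \<i> * complex_of_real (x \<bullet> h))) (at \<xi>)"
        by (auto intro!: derivative_eq_intros)
      from has_derivative_mult_left[OF has_derivative_exp_comp[OF this], of "f x"] show ?thesis by (simp add: mult_ac)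
    qed
    show "norm (?K' \<xi> x h) \<le> norm x * norm (f x) * norm h" for \<xi> x h
      using mult_right_mono[OF Cauchy_Schwarz_ineq2[of x h], of "norm (f x)"] by (simp add: norm_mult mult_ac)
  qed (use integrable_char[OF f] xf in auto)
  then have "((\<lambda>\<xi>. complex_of_real (fc TYPE('n)) * (LINT x|lborel. wave x \<xi> * f x)) has_derivative
      (\<lambda>h. complex_of_real (fc TYPE('n)) * (LINT x|lborel. ?K' \<xi> x h))) (at \<xi>)"
    by (rule has_derivative_mult_right)
  then have D: "(fourier f has_derivative (\<lambda>h. complex_of_real (fc TYPE('n)) * (LINT x|lborel. ?K' \<xi> x h))) (at \<xi>)"
    by (simp add: fourier_def[abs_def])
  then show "fourier f differentiable (at \<xi>)" by (auto simp: differentiable_def)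
  show "partial_deriv j (fourier f) \<xi> = fourier (\<lambda>x. - \<i> * (complex_of_real (x $ j) * f x)) \<xi>"
    unfolding partial_deriv_eqI[OF D] by (simp add: fourier_def inner_axis mult_ac)
qed

lemma schwartz_norm_mult_integrable:
  fixes \<phi> :: "real^'n::finite \<Rightarrow> complex"
  assumes "\<phi> \<in> schwartz" shows "integrable lborel (\<lambda>x. norm x * norm (\<phi> x))"
proof (rule Bochner_Integration.integrable_bound)
  show "integrable lborel (\<lambda>x. \<Sum>j\<in>UNIV. norm (complex_of_real (x $ j) * \<phi> x))"
    by (intro Bochner_Integration.integrable_sum integrable_norm schwartz_integrable schwartz_coord_mult assms)
  show "(\<lambda>x. norm x * norm (\<phi> x)) \<in> borel_measurable lborel" using schwartz_measurable[OF assms] by simp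
  have "norm x * norm (\<phi> x) \<le> (\<Sum>j\<in>UNIV. norm (complex_of_real (x $ j) * \<phi> x))" for x
    using mult_right_mono[OF norm_le_l1_cart[of x], of "norm (\<phi> x)"] by (simp add: norm_mult sum_distrib_right)
  then show "AE x in lborel. norm (norm x * norm (\<phi> x)) \<le> norm (\<Sum>j\<in>UNIV. norm (complex_of_real (x $ j) * \<phi> x))"
    by (auto intro!: AE_I2 intro: order_trans[OF _ abs_ge_self])
qed

lemma partial_fourier:
  assumes "\<phi> \<in> schwartz"
  shows "partial_deriv j (fourier \<phi>) = fourier (\<lambda>x. - \<i> * (complex_of_real (x $ j) * \<phi> x))"
  by (rule ext) (intro fourier_derivative schwartz_integrable schwartz_norm_mult_integrable assms)

text \<open>Integration by parts, in the form: differentiate the translation invariance of the integral.\<close>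

lemma fourier_partial:
  fixes \<phi> :: "real^'n::finite \<Rightarrow> complex"
  assumes \<phi>: "\<phi> \<in> schwartz"
  shows "fourier (partial_deriv j \<phi>) \<xi> = \<i> * complex_of_real (\<xi> $ j) * fourier \<phi> \<xi>"
proof -
  let ?e = "\<lambda>x. wave x \<xi>"
  let ?I = "LINT x|lborel. ?e x * \<phi> x"
  have [measurable]: "\<phi> \<in> borel_measurable borel" "partial_deriv j \<phi> \<in> borel_measurable borel"
    using schwartz_measurable schwartz_partial \<phi> by auto
  have e: "(LINT x|lborel. ?e x * \<phi> (h *\<^sub>R axis j 1 + x)) = exp (\<i> * complex_of_real (h * \<xi> $ j)) * ?I" for h
  proof -
    let ?z = "\<lambda>x::real^'n. h *\<^sub>R axis j 1 + 1 *\<^sub>R x"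
    have "(LINT x|lborel. ?e x * \<phi> (h *\<^sub>R axis j 1 + x)) = 
       (LINT x|lborel. exp (\<i> * complex_of_real (h * \<xi> $ j)) * (?e (?z x) * \<phi> (?z x)))"
    proof (rule Bochner_Integration.integral_cong[OF refl])
      fix x :: "real^'n"
      have "- \<i> * complex_of_real (x \<bullet> \<xi>) = \<i> * complex_of_real (h * \<xi> $ j) + (- \<i> * complex_of_real ((?z x) \<bullet> \<xi>))"
        by (simp add: inner_add_left inner_axis' algebra_simps)
      then have "?e x = exp (\<i> * complex_of_real (h * \<xi> $ j)) * ?e (?z x)"
        by (simp only: exp_add)
      then show "?e x * \<phi> (h *\<^sub>R axis j 1 + x) = exp (\<i> * complex_of_real (h * \<xi> $ j)) * (?e (?z x) * \<phi> (?z x))"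
        by simp
    qed
    also have "\<dots> = exp (\<i> * complex_of_real (h * \<xi> $ j)) * (LINT x|lborel. ?e (?z x) * \<phi> (?z x))"
      by simp
    also have "(LINT x|lborel. ?e (?z x) * \<phi> (?z x)) = ?I"
      by (subst LINT_affine[of "\<lambda>x. ?e x * \<phi> x"]) auto
    finally show ?thesis .
  qed
  obtain C where C: "\<And>x. (1 + norm x) ^ (CARD('n) + 1) * norm (partial_deriv j \<phi> x) \<le> C" "C > 0"
    using schwartz_decay[OF schwartz_partial[OF \<phi>]] by metis
  let ?B = "\<lambda>x::real^'n. 2 ^ (CARD('n) + 1) * C * (1 / (1 + norm x) ^ (CARD('n) + 1))"
  have "((\<lambda>h. LINT x|lborel. ?e x * \<phi> (h *\<^sub>R axis j 1 + x)) has_derivative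
     (\<lambda>k. LINT x|lborel. ?e x * (k *\<^sub>R partial_deriv j \<phi> (0 *\<^sub>R axis j 1 + x)))) (at 0)"
  proof (rule has_derivative_LINT[where U="{-1<..<1}" and B="?B" and K'="\<lambda>h x k. ?e x * (k *\<^sub>R partial_deriv j \<phi> (h *\<^sub>R axis j 1 + x))"])
    fix h :: real assume h: "h \<in> {-1<..<1}"
    show "integrable lborel (\<lambda>x. ?e x * \<phi> (h *\<^sub>R axis j 1 + x))"
      using integrable_char(1)[OF integrable_affine[OF schwartz_integrable[OF \<phi>], of 1 "h *\<^sub>R axis j 1"]] by simp
    fix x :: "real^'n"
    have "((\<lambda>h. h *\<^sub>R axis j 1 + x) has_derivative (\<lambda>k. k *\<^sub>R axis j 1)) (at h)"
      by (auto intro!: derivative_eq_intros)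
    from diff_chain_at[OF this has_derivative_partials[OF schwartz_differentiable[OF \<phi>]]]
    have "((\<lambda>h. \<phi> (h *\<^sub>R axis j 1 + x)) has_derivative (\<lambda>k. k *\<^sub>R partial_deriv j \<phi> (h *\<^sub>R axis j 1 + x))) (at h)"
      by (simp add: o_def axis_def if_distrib if_distribR cong: if_cong)
    then show "((\<lambda>h. ?e x * \<phi> (h *\<^sub>R axis j 1 + x)) has_derivative (\<lambda>k. ?e x * (k *\<^sub>R partial_deriv j \<phi> (h *\<^sub>R axis j 1 + x)))) (at h)"
      by (rule has_derivative_mult_right)
    fix k :: real
    let ?y = "h *\<^sub>R axis j 1 + x"
    have "norm x \<le> norm ?y + norm (h *\<^sub>R axis j (1::real))"
      using norm_triangle_ineq4[of ?y "h *\<^sub>R axis j 1"] by simp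
    moreover have "norm (h *\<^sub>R axis j (1::real)) \<le> 1" using h by auto
    ultimately have "norm x \<le> norm ?y + 1" by (rule order_trans[OF _ add_left_mono])
    then have "1 + norm x \<le> 1 + (norm ?y + 1)" by (rule add_left_mono)
    also have "\<dots> \<le> 2 * (1 + norm ?y)" by simp
    finally have "1 + norm x \<le> 2 * (1 + norm ?y)" .
    then have "(1 + norm x) ^ (CARD('n) + 1) \<le> 2 ^ (CARD('n) + 1) * (1 + norm ?y) ^ (CARD('n) + 1)"
      using power_mono[of "1 + norm x" "2 * (1 + norm ?y)" "CARD('n) + 1"] by (simp only: power_mult_distrib) auto
    then have "(1 + norm x) ^ (CARD('n) + 1) * norm (partial_deriv j \<phi> ?y) \<le> 2 ^ (CARD('n) + 1) * ((1 + norm ?y) ^ (CARD('n) + 1) * norm (partial_deriv j \<phi> ?y))"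
      by (subst mult.assoc[symmetric]) (rule mult_right_mono[OF _ norm_ge_zero])
    also have "\<dots> \<le> 2 ^ (CARD('n) + 1) * C" by (intro mult_left_mono C) simp
    finally have a: "(1 + norm x) ^ (CARD('n) + 1) * norm (partial_deriv j \<phi> ?y) \<le> 2 ^ (CARD('n) + 1) * C" .
    have "norm (partial_deriv j \<phi> ?y) \<le> ?B x"
    proof -
      have "(1 + norm x) ^ (CARD('n) + 1) > 0" by (intro zero_less_power) (simp add: add_pos_nonneg)
      then show ?thesis using a by (simp add: pos_le_divide_eq mult.commute)
    qed
    from mult_right_mono[OF this, of "norm k"]
    have "norm (partial_deriv j \<phi> ?y) * norm k \<le> ?B x * norm k" by simp
    moreover have "norm (?e x * (k *\<^sub>R partial_deriv j \<phi> ?y)) = norm (partial_deriv j \<phi> ?y) * norm k"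
      by (simp add: norm_mult)
    ultimately show "norm (?e x * (k *\<^sub>R partial_deriv j \<phi> ?y)) \<le> ?B x * norm k" by presburger
  next
    show "integrable lborel ?B" by (intro integrable_mult_right integrable_inverse_power)
  qed auto
  moreover have "((\<lambda>h. exp (\<i> * complex_of_real (h * \<xi> $ j)) * ?I) has_derivative (\<lambda>k. (\<i> * complex_of_real (k * \<xi> $ j)) * ?I)) (at 0)"
  proof -
    have "((\<lambda>h. \<i> * complex_of_real (h * \<xi> $ j)) has_derivative (\<lambda>k. \<i> * complex_of_real (k * \<xi> $ j))) (at 0)"
      by (auto intro!: derivative_eq_intros)
    from has_derivative_mult_left[OF has_derivative_exp_comp[OF this], of ?I] show ?thesis by simp
  qed
  ultimately have "(\<lambda>k::real. LINT x|lborel. ?e x * (k *\<^sub>R partial_deriv j \<phi> (0 *\<^sub>R axis j 1 + x))) = (\<lambda>k. (\<i> * complex_of_real (k * \<xi> $ j)) * ?I)"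
    unfolding e by (rule has_derivative_unique)
  from fun_cong[OF this, of 1] have "(LINT x|lborel. ?e x * partial_deriv j \<phi> x) = (\<i> * complex_of_real (\<xi> $ j)) * ?I"
    by simp
  then show ?thesis by (simp add: fourier_def mult_ac)
qed

lemma fourier_decay:
  fixes \<phi> :: "real^'n::finite \<Rightarrow> complex"
  assumes "\<phi> \<in> schwartz"
  shows "\<exists>C. \<forall>\<xi>. (1 + (norm \<xi>)\<^sup>2) ^ k * norm (fourier \<phi> \<xi>) \<le> C"
  using assms
proof (induction k arbitrary: \<phi>)
  case 0
  then show ?case using fourier_norm_le[OF schwartz_integrable] by auto
next
  case (Suc k)
  let ?\<psi> = "\<lambda>x. \<phi> x - (\<Sum>j\<in>UNIV. partial_deriv j (partial_deriv j \<phi>) x)"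
  have \<psi>: "?\<psi> \<in> schwartz" by (intro schwartz_diff schwartz_sum schwartz_partial Suc.prems)
  have "fourier ?\<psi> \<xi> = complex_of_real (1 + (norm \<xi>)\<^sup>2) * fourier \<phi> \<xi>" for \<xi>
  proof -
    have "fourier ?\<psi> \<xi> = fourier (\<lambda>x. \<phi> x + (-1) * (\<Sum>j\<in>UNIV. partial_deriv j (partial_deriv j \<phi>) x)) \<xi>" by simp
    also have "\<dots> = fourier \<phi> \<xi> + (-1) * (\<Sum>j\<in>UNIV. fourier (partial_deriv j (partial_deriv j \<phi>)) \<xi>)"
      by (subst fourier_add, (intro schwartz_integrable schwartz_cmult schwartz_sum schwartz_partial Suc.prems)+)
        (simp only: fourier_cmult, simp add: fourier_sum schwartz_integrable schwartz_partial Suc.prems)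
    also have "\<dots> = fourier \<phi> \<xi> + (\<Sum>j\<in>UNIV. complex_of_real ((\<xi> $ j)\<^sup>2)) * fourier \<phi> \<xi>"
    proof -
      have "(-1) * fourier (partial_deriv j (partial_deriv j \<phi>)) \<xi> = complex_of_real ((\<xi> $ j)\<^sup>2) * fourier \<phi> \<xi>" for j
        by (simp add: fourier_partial schwartz_partial Suc.prems power2_eq_square mult_ac)
      then show ?thesis by (simp only: sum_distrib_left sum_distrib_right)
    qed
    also have "(\<Sum>j\<in>UNIV. complex_of_real ((\<xi> $ j)\<^sup>2)) = complex_of_real ((norm \<xi>)\<^sup>2)"
      by (simp add: norm_vec_def L2_set_def sum_nonneg)
    finally show ?thesis by (simp add: distrib_right)
  qed
  then have *: "norm (fourier ?\<psi> \<xi>) = (1 + (norm \<xi>)\<^sup>2) * norm (fourier \<phi> \<xi>)" for \<xi>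
    by (simp add: norm_mult del: of_real_add of_real_power)
  obtain C where "\<forall>\<xi>. (1 + (norm \<xi>)\<^sup>2) ^ k * norm (fourier ?\<psi> \<xi>) \<le> C" using Suc.IH[OF \<psi>] by blast
  then show ?case unfolding * by (intro exI[of _ C]) (simp add: mult_ac)
qed

text \<open>Differentiation and multiplication by coordinates are exchanged, so the transforms of Schwartz functions
  form a family as required by \<open>schwartz_coinduct\<close>.\<close>

lemma fourier_schwartz:
  fixes \<phi> :: "real^'n::finite \<Rightarrow> complex"
  assumes "\<phi> \<in> schwartz" shows "fourier \<phi> \<in> schwartz"
proof (rule schwartz_coinduct[of _ "fourier ` schwartz"])
  fix h :: "real^'n \<Rightarrow> complex" assume "h \<in> fourier ` schwartz"
  then obtain \<phi> where h: "h = fourier \<phi>" "\<phi> \<in> schwartz" by auto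
  show "h differentiable (at x)" for x
    unfolding h by (intro fourier_derivative schwartz_integrable schwartz_norm_mult_integrable h)
  show "partial_deriv j h \<in> fourier ` schwartz" for j
    unfolding h partial_fourier[OF h(2)] by (intro imageI schwartz_cmult schwartz_coord_mult h)
  show "\<exists>C. \<forall>x. (1 + norm x) ^ k * norm (h x) \<le> C" for k
  proof -
    obtain C where C: "\<And>\<xi>. (1 + (norm \<xi>)\<^sup>2) ^ k * norm (h \<xi>) \<le> C" using fourier_decay[OF h(2)] h(1) by metis
    have "(1 + norm x) ^ k * norm (h x) \<le> 2 ^ k * C" for x
    proof -
      have "1 + norm x \<le> 2 * (1 + (norm x)\<^sup>2)"
        using sum_squares_bound[of "norm x" 1] by (simp add: power2_eq_square) (smt (verit) mult_nonneg_nonneg norm_ge_zero)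
      then have "(1 + norm x) ^ k * norm (h x) \<le> (2 * (1 + (norm x)\<^sup>2)) ^ k * norm (h x)"
        by (intro mult_right_mono power_mono) auto
      also have "\<dots> = 2 ^ k * ((1 + (norm x)\<^sup>2) ^ k * norm (h x))" by (simp only: power_mult_distrib mult.assoc)
      also have "\<dots> \<le> 2 ^ k * C" by (intro mult_left_mono C) simp
      finally show ?thesis .
    qed
    then show ?thesis by blast
  qed
qed (use assms in auto)

lemma schwartz_reflect: "\<phi> \<in> schwartz \<Longrightarrow> (\<lambda>x. \<phi> (- x)) \<in> schwartz"
  using schwartz_affine[of \<phi> "-1" 0] by simp

lemma inv_fourier_schwartz: "\<phi> \<in> schwartz \<Longrightarrow> inv_fourier \<phi> \<in> schwartz"
  unfolding inv_fourier_eq[abs_def] by (intro schwartz_reflect fourier_schwartz)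

text \<open>By Fubini's theorem; both sides are the double integral of \<open>f x * g \<xi>\<close> against the symmetric kernel.\<close>

lemma fourier_swap:
  fixes f g :: "real^'n::finite \<Rightarrow> complex"
  assumes f: "integrable lborel f" and g: "integrable lborel g"
  shows "(LINT x|lborel. fourier f x * g x) = (LINT x|lborel. f x * fourier g x)"
proof -
  let ?F = "\<lambda>x y. wave y x * f y * g x"
  have [measurable]: "f \<in> borel_measurable borel" "g \<in> borel_measurable borel" using f g by auto
  have "integrable (lborel \<Otimes>\<^sub>M lborel) (\<lambda>(x, y). f y * g x)"
  proof (rule lborel_pair.Fubini_integrable)
    show "integrable lborel (\<lambda>x. LINT y|lborel. norm (case (x, y) of (x, y) \<Rightarrow> f y * g x))"
      using f g by (simp add: norm_mult)
    show "AE x in lborel. integrable lborel (\<lambda>y. case (x, y) of (x, y) \<Rightarrow> f y * g x)"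
      using f by simp
  qed (simp add: split_beta)
  then have "integrable (lborel \<Otimes>\<^sub>M lborel) (\<lambda>(x, y). ?F x y)"
    by (rule Bochner_Integration.integrable_bound) (auto simp: norm_mult split_beta)
  from lborel_pair.Fubini_integral[OF this]
  have "(LINT x|lborel. LINT y|lborel. ?F x y) = (LINT y|lborel. LINT x|lborel. ?F x y)" by simp
  moreover have "fourier f x * g x = complex_of_real (fc TYPE('n)) * (LINT y|lborel. ?F x y)" for x
    by (simp add: fourier_def)
  moreover have "f y * fourier g y = complex_of_real (fc TYPE('n)) * (LINT x|lborel. ?F x y)" for y
  proof -
    have "(LINT x|lborel. ?F x y) = (LINT x|lborel. f y * (wave x y * g x))"
      by (rule Bochner_Integration.integral_cong) (auto simp: inner_commute mult_ac)
    also have "\<dots> = f y * (LINT x|lborel. wave x y * g x)"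
      by (rule integral_mult_right_zero)
    finally show ?thesis unfolding fourier_def by (simp only: mult_ac)
  qed
  ultimately show ?thesis by (simp only: integral_mult_right_zero)
qed

definition gauss :: "real^'n::finite \<Rightarrow> complex" where
  "gauss x = complex_of_real (exp (- (norm x)\<^sup>2 / 2))"

lemma gauss_1d:
  fixes t :: real
  shows "integrable lborel (\<lambda>x. exp (- \<i> * complex_of_real (x * t)) * complex_of_real (exp (- x\<^sup>2 / 2)))"
    and "(LINT x|lborel. exp (- \<i> * complex_of_real (x * t)) * complex_of_real (exp (- x\<^sup>2 / 2))) = complex_of_real (sqrt (2 * pi) * exp (- t\<^sup>2 / 2))"
proof -
  let ?h = "\<lambda>x. exp (- \<i> * complex_of_real (x * t)) * complex_of_real (exp (- x\<^sup>2 / 2))"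
  have d: "std_normal_density x = exp (- x\<^sup>2 / 2) / sqrt (2 * pi)" for x by (simp add: std_normal_density_def)
  have "integrable lborel std_normal_density" by (rule integrable_normal_density) simp
  then have i: "integrable lborel (\<lambda>x. sqrt (2 * pi) * std_normal_density x)" by (rule integrable_mult_right)
  show "integrable lborel ?h"
    by (rule Bochner_Integration.integrable_bound[OF i]) (auto simp: norm_mult d)
  have "complex_of_real (exp (- (- t)\<^sup>2 / 2)) = char std_normal_distribution (-t)"
    by (simp only: char_std_normal_distribution)
  also have "\<dots> = (LINT x|lborel. std_normal_density x *\<^sub>R exp (\<i> * complex_of_real (- t * x)))"
    unfolding char_def by (subst integral_density) (auto simp: normal_density_nonneg)
  also have "\<dots> = (LINT x|lborel. complex_of_real (1 / sqrt (2 * pi)) * ?h x)"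
    by (rule Bochner_Integration.integral_cong) (auto simp: d scaleR_conv_of_real mult_ac)
  also have "\<dots> = complex_of_real (1 / sqrt (2 * pi)) * (LINT x|lborel. ?h x)" by simp
  finally show "(LINT x|lborel. ?h x) = complex_of_real (sqrt (2 * pi) * exp (- t\<^sup>2 / 2))"
    by (simp add: field_simps)
qed

text \<open>The Gaussian is a product over the coordinates, and in one dimension its transform is the characteristic
  function of the normal distribution.\<close>

lemma gauss_integral:
  fixes \<xi> :: "real^'n::finite"
  shows "integrable lborel (gauss :: real^'n \<Rightarrow> complex)" and "fourier gauss \<xi> = gauss \<xi>"
proof -
  let ?h = "\<lambda>\<xi> b x. exp (- \<i> * complex_of_real (x * (\<xi> \<bullet> b))) * complex_of_real (exp (- x\<^sup>2 / 2))"
  let ?P = "\<lambda>f::real^'n \<Rightarrow> real. \<Sum>b\<in>Basis. f b *\<^sub>R b"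
  interpret product_sigma_finite "\<lambda>_::real^'n. lborel :: real measure" by standard
  have eq: "wave x \<xi> * gauss x = (\<Prod>b\<in>Basis. ?h \<xi> b (x \<bullet> b))" for x \<xi> :: "real^'n"
  proof -
    have "(norm x)\<^sup>2 = (\<Sum>b\<in>Basis. (x \<bullet> b)\<^sup>2)" 
      unfolding power2_norm_eq_inner by (subst euclidean_inner) (simp add: power2_eq_square)
    then have g: "gauss x = (\<Prod>b\<in>Basis. complex_of_real (exp (- (x \<bullet> b)\<^sup>2 / 2)))"
      by (simp add: gauss_def exp_sum[symmetric] sum_negf sum_divide_distrib flip: of_real_prod)
    have "- \<i> * complex_of_real (x \<bullet> \<xi>) = (\<Sum>b\<in>Basis. - \<i> * complex_of_real ((x \<bullet> b) * (\<xi> \<bullet> b)))"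
      by (subst euclidean_inner) (simp add: sum_distrib_left sum_negf)
    then have "wave x \<xi> = (\<Prod>b\<in>Basis. exp (- \<i> * complex_of_real ((x \<bullet> b) * (\<xi> \<bullet> b))))"
      by (simp only: exp_sum[OF finite_Basis])
    then show ?thesis unfolding g by (simp add: prod.distrib)
  qed
  have meas: "(\<lambda>x. wave x \<xi> * gauss x) \<in> borel_measurable borel" for \<xi> :: "real^'n"
    unfolding gauss_def by measurable
  note lb = lborel_eq[where 'a="real^'n"]
  have P: "?P f \<bullet> b = f b" if "b \<in> Basis" for f b using that by simp
  have [measurable]: "?P \<in> (\<Pi>\<^sub>M b\<in>Basis. lborel) \<rightarrow>\<^sub>M borel" by measurable
  have int: "integrable lborel (\<lambda>x. wave x \<xi> * gauss x)"
    and val: "(LINT x|lborel. wave x \<xi> * gauss x) = (\<Prod>b\<in>Basis. LINT x|lborel. ?h \<xi> b x)" for \<xi> :: "real^'n"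
  proof -
    have e: "(\<lambda>f. wave (?P f) \<xi> * gauss (?P f)) = (\<lambda>f. \<Prod>b\<in>Basis. ?h \<xi> b (f b))"
      unfolding eq by (intro ext prod.cong refl) (simp only: P)
    have "integrable (\<Pi>\<^sub>M b\<in>(Basis::(real^'n) set). lborel) (\<lambda>f. \<Prod>b\<in>Basis. ?h \<xi> b (f b))"
      by (intro product_integrable_prod gauss_1d) auto
    then show "integrable lborel (\<lambda>x. wave x \<xi> * gauss x)"
      unfolding lb using meas by (subst integrable_distr_eq) (auto simp only: e, measurable)
    have "(LINT x|lborel. wave x \<xi> * gauss x) 
        = (LINT f|(\<Pi>\<^sub>M b\<in>Basis. lborel). wave (?P f) \<xi> * gauss (?P f))"
      unfolding lb using meas by (subst integral_distr) (auto, measurable)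
    also have "\<dots> = (\<Prod>b\<in>Basis. LINT x|lborel. ?h \<xi> b x)"
      unfolding e by (intro product_integral_prod gauss_1d) auto
    finally show "(LINT x|lborel. wave x \<xi> * gauss x) = (\<Prod>b\<in>Basis. LINT x|lborel. ?h \<xi> b x)" .
  qed
  show "integrable lborel (gauss :: real^'n \<Rightarrow> complex)" using int[of 0] by simp
  have "fourier gauss \<xi> = complex_of_real (fc TYPE('n)) * (\<Prod>b\<in>Basis. complex_of_real (sqrt (2 * pi)) * complex_of_real (exp (- (\<xi> \<bullet> b)\<^sup>2 / 2)))"
    unfolding fourier_def val gauss_1d(2) by simp
  also have "\<dots> = complex_of_real (fc TYPE('n) * sqrt (2 * pi) ^ CARD('n)) * (\<Prod>b\<in>Basis. complex_of_real (exp (- (\<xi> \<bullet> b)\<^sup>2 / 2)))"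
    by (simp add: prod.distrib)
  also have "fc TYPE('n) * sqrt (2 * pi) ^ CARD('n) = 1"
  proof -
    have "sqrt (2 * pi) ^ CARD('n) = (2 * pi) powr (real CARD('n) / 2)"
      by (simp add: powr_half_sqrt[symmetric] powr_realpow[symmetric] powr_powr)
    then show ?thesis by (simp add: powr_add[symmetric])
  qed
  also have "(\<Prod>b\<in>Basis. complex_of_real (exp (- (\<xi> \<bullet> b)\<^sup>2 / 2))) = gauss \<xi>"
    using eq[of \<xi> 0] by simp
  finally show "fourier gauss \<xi> = gauss \<xi>" by simp
qed

text \<open>Fourier inversion at the origin: test against the dilated Gaussians \<open>gauss (x / k)\<close>, which tend
  to \<open>1\<close>, while their Fourier transforms form an approximate identity.\<close>

lemma fourier_inversion_0:
  fixes f :: "real^'n::finite \<Rightarrow> complex"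
  assumes f: "integrable lborel f" and Ff: "integrable lborel (fourier f)"
    and bd: "\<And>x. norm (f x) \<le> B" and cont: "isCont f 0"
  shows "complex_of_real (fc TYPE('n)) * (LINT \<xi>|lborel. fourier f \<xi>) = f 0"
proof -
  have [measurable]: "f \<in> borel_measurable borel" using f by auto
  have [measurable]: "gauss \<in> borel_measurable (borel :: (real^'n) measure)"
    unfolding gauss_def by measurable
  have g1: "norm (gauss x) \<le> 1" for x :: "real^'n" by (simp add: gauss_def)
  let ?c = "\<lambda>k. 1 / real (Suc k)"
  have c0: "(\<lambda>k. ?c k) \<longlonglongrightarrow> 0" by (rule LIMSEQ_Suc[OF lim_1_over_n])
  have Fint: "fourier (\<lambda>x. f (?c k *\<^sub>R x)) \<xi> = complex_of_real (real (Suc k) ^ CARD('n)) * fourier f (real (Suc k) *\<^sub>R \<xi>)" for k \<xi>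
  proof -
    have "(LINT x|lborel. wave x \<xi> * f (?c k *\<^sub>R x)) =
       (LINT x|lborel. (\<lambda>y. exp (- \<i> * complex_of_real (y \<bullet> (real (Suc k) *\<^sub>R \<xi>))) * f y) (0 + ?c k *\<^sub>R x))"
      by (rule Bochner_Integration.integral_cong) auto
    also have "\<dots> = (1 / \<bar>?c k\<bar> ^ DIM(real^'n)) *\<^sub>R (LINT y|lborel. exp (- \<i> * complex_of_real (y \<bullet> (real (Suc k) *\<^sub>R \<xi>))) * f y)"
      by (rule LINT_affine) auto
    finally show ?thesis by (simp add: fourier_def power_one_over scaleR_conv_of_real)
  qed
  have eq: "(LINT \<xi>|lborel. fourier f \<xi> * gauss (?c k *\<^sub>R \<xi>)) = (LINT x|lborel. f (?c k *\<^sub>R x) * gauss x)" for k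
  proof -
    have "(LINT x|lborel. f (?c k *\<^sub>R x) * gauss x) = (LINT x|lborel. f (?c k *\<^sub>R x) * fourier gauss x)"
      by (simp add: gauss_integral)
    also have "\<dots> = (LINT \<xi>|lborel. fourier (\<lambda>x. f (?c k *\<^sub>R x)) \<xi> * gauss \<xi>)"
      using integrable_affine[OF f, of "?c k" 0] by (intro fourier_swap[symmetric] gauss_integral) auto
    also have "\<dots> = (LINT \<xi>|lborel. complex_of_real (real (Suc k) ^ CARD('n)) * (\<lambda>\<eta>. fourier f \<eta> * gauss (?c k *\<^sub>R \<eta>)) (0 + real (Suc k) *\<^sub>R \<xi>))"
      unfolding Fint by (rule Bochner_Integration.integral_cong) auto
    also have "\<dots> = complex_of_real (real (Suc k) ^ CARD('n)) * (LINT \<xi>|lborel. (\<lambda>\<eta>. fourier f \<eta> * gauss (?c k *\<^sub>R \<eta>)) (0 + real (Suc k) *\<^sub>R \<xi>))"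
      by (rule integral_mult_right_zero)
    also have "\<dots> = (LINT \<xi>|lborel. fourier f \<xi> * gauss (?c k *\<^sub>R \<xi>))"
    proof -
      have m: "(\<lambda>\<eta>. fourier f \<eta> * gauss (?c k *\<^sub>R \<eta>)) \<in> borel_measurable borel" by measurable
      show ?thesis
        by (subst LINT_affine[OF m]) (simp_all add: scaleR_conv_of_real del: of_nat_Suc)
    qed
    finally show ?thesis by simp
  qed
  have gl: "(\<lambda>k. gauss (?c k *\<^sub>R x)) \<longlonglongrightarrow> 1" for x :: "real^'n"
  proof -
    have "(\<lambda>k. complex_of_real (exp (- (norm (?c k *\<^sub>R x))\<^sup>2 / 2))) \<longlonglongrightarrow> complex_of_real (exp (- (norm (0 *\<^sub>R x))\<^sup>2 / 2))"
      by (intro tendsto_intros c0) auto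
    then show ?thesis by (simp add: gauss_def)
  qed
  have L1: "(\<lambda>k. LINT \<xi>|lborel. fourier f \<xi> * gauss (?c k *\<^sub>R \<xi>)) \<longlonglongrightarrow> (LINT \<xi>|lborel. fourier f \<xi> * 1)"
  proof (rule integral_dominated_convergence[where w="\<lambda>x. norm (fourier f x)"])
    show "AE x in lborel. (\<lambda>k. fourier f x * gauss (?c k *\<^sub>R x)) \<longlonglongrightarrow> fourier f x * 1"
      by (intro AE_I2 tendsto_intros gl)
    show "AE x in lborel. norm (fourier f x * gauss (?c k *\<^sub>R x)) \<le> norm (fourier f x)" for k
      by (auto simp: norm_mult intro!: mult_left_le g1)
  qed (use Ff in auto)
  have L2: "(\<lambda>k. LINT x|lborel. f (?c k *\<^sub>R x) * gauss x) \<longlonglongrightarrow> (LINT x|lborel. f 0 * gauss (x::real^'n))"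
  proof (rule integral_dominated_convergence[where w="\<lambda>x::real^'n. B * norm (gauss x)"])
    show "AE x in lborel. (\<lambda>k. f (?c k *\<^sub>R x) * gauss x) \<longlonglongrightarrow> f 0 * gauss x"
    proof (intro AE_I2 tendsto_intros)
      fix x :: "real^'n"
      have "(\<lambda>k. ?c k *\<^sub>R x) \<longlonglongrightarrow> 0 *\<^sub>R x" by (intro tendsto_intros c0)
      then show "(\<lambda>k. f (?c k *\<^sub>R x)) \<longlonglongrightarrow> f 0" using isCont_tendsto_compose[OF cont] by simp
    qed
    show "AE x in lborel. norm (f (?c k *\<^sub>R x) * gauss x) \<le> B * norm (gauss x)" for k
      by (auto simp: norm_mult intro!: mult_right_mono bd)
  qed (use gauss_integral(1) in auto)
  have "(LINT \<xi>|lborel. fourier f \<xi>) = f 0 * (LINT x|lborel. gauss (x::real^'n))"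
    using LIMSEQ_unique[OF L1[unfolded eq] L2] by simp
  moreover have "complex_of_real (fc TYPE('n)) * (LINT x|lborel. gauss (x::real^'n)) = 1"
    using gauss_integral(2)[of "0::real^'n"] by (simp add: fourier_def gauss_def)
  moreover have "complex_of_real (fc TYPE('n)) * (f 0 * (LINT x|lborel. gauss (x::real^'n))) = f 0 * (complex_of_real (fc TYPE('n)) * (LINT x|lborel. gauss (x::real^'n)))"
    by (rule mult.left_commute)
  ultimately show ?thesis by simp
qed

text \<open>A translation of \<open>f\<close> reduces inversion at \<open>x\<close> to inversion at the origin.\<close>

theorem fourier_inversion:
  fixes f :: "real^'n::finite \<Rightarrow> complex"
  assumes f: "integrable lborel f" and Ff: "integrable lborel (fourier f)"
    and bd: "\<And>x. norm (f x) \<le> B" and cont: "\<And>x. isCont f x"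
  shows "inv_fourier (fourier f) x = f x"
proof -
  have [measurable]: "f \<in> borel_measurable borel" using f by auto
  let ?g = "\<lambda>y. f (x + y)"
  have g: "fourier ?g \<xi> = exp (\<i> * complex_of_real (x \<bullet> \<xi>)) * fourier f \<xi>" for \<xi>
  proof -
    have "(LINT y|lborel. wave y \<xi> * f (x + y)) =
      (LINT y|lborel. exp (\<i> * complex_of_real (x \<bullet> \<xi>)) * (\<lambda>z. wave z \<xi> * f z) (x + 1 *\<^sub>R y))"
    proof (rule Bochner_Integration.integral_cong[OF refl])
      fix y
      have "- \<i> * complex_of_real (y \<bullet> \<xi>) = \<i> * complex_of_real (x \<bullet> \<xi>) + (- \<i> * complex_of_real ((x + 1 *\<^sub>R y) \<bullet> \<xi>))"
        by (simp add: inner_add_left algebra_simps)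
      then have "wave y \<xi> = exp (\<i> * complex_of_real (x \<bullet> \<xi>)) * wave (x + 1 *\<^sub>R y) \<xi>"
        by (simp only: exp_add)
      then show "wave y \<xi> * f (x + y) = exp (\<i> * complex_of_real (x \<bullet> \<xi>)) * (\<lambda>z. wave z \<xi> * f z) (x + 1 *\<^sub>R y)"
        by simp
    qed
    also have "\<dots> = exp (\<i> * complex_of_real (x \<bullet> \<xi>)) * (LINT y|lborel. (\<lambda>z. wave z \<xi> * f z) (x + 1 *\<^sub>R y))"
      by (rule integral_mult_right_zero)
    also have "(LINT y|lborel. (\<lambda>z. wave z \<xi> * f z) (x + 1 *\<^sub>R y)) = (LINT z|lborel. wave z \<xi> * f z)"
      by (subst LINT_affine) auto
    finally show ?thesis by (simp add: fourier_def mult_ac)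
  qed
  have "complex_of_real (fc TYPE('n)) * (LINT \<xi>|lborel. fourier ?g \<xi>) = ?g 0"
  proof (rule fourier_inversion_0)
    show "integrable lborel ?g" using integrable_affine[OF f, of 1 x] by simp
    show "integrable lborel (fourier ?g)" using integrable_char(2)[OF Ff, of x] by (simp add: g[abs_def])
    have "((\<lambda>y. f (x + y)) \<longlongrightarrow> f (x + 0)) (at 0)"
      by (rule isCont_tendsto_compose[OF cont]) (intro tendsto_intros)
    then show "isCont ?g 0" by (simp add: isCont_def)
  qed (rule bd)
  then show ?thesis by (simp add: g inv_fourier_def)
qed

lemma schwartz_bounded: "\<phi> \<in> schwartz \<Longrightarrow> norm (\<phi> x) \<le> schwartz_seminorm 0 \<phi>"
  using seminorm_decay[of \<phi> x 0] by simp

lemma inv_fourier_fourier: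
  assumes "\<phi> \<in> schwartz" shows "inv_fourier (fourier \<phi>) = \<phi>"
proof
  fix x show "inv_fourier (fourier \<phi>) x = \<phi> x"
    by (intro fourier_inversion[where B="schwartz_seminorm 0 \<phi>"] schwartz_integrable fourier_schwartz schwartz_bounded assms)
      (use schwartz_continuous[OF assms, of UNIV] in \<open>auto simp: continuous_on_eq_continuous_at\<close>)
qed

lemma fourier_reflect:
  assumes [measurable]: "f \<in> borel_measurable borel"
  shows "fourier (\<lambda>x. f (- x)) = inv_fourier f"
proof
  fix x
  have "(LINT \<xi>|lborel. wave \<xi> x * f (-\<xi>)) = (LINT \<xi>|lborel. (\<lambda>\<xi>. exp (\<i> * complex_of_real (x \<bullet> \<xi>)) * f \<xi>) (0 + (-1) *\<^sub>R \<xi>))"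
    by (simp add: inner_commute)
  also have "\<dots> = (LINT \<xi>|lborel. exp (\<i> * complex_of_real (x \<bullet> \<xi>)) * f \<xi>)" by (subst LINT_affine) auto
  finally show "fourier (\<lambda>x. f (- x)) x = inv_fourier f x" by (simp add: fourier_def inv_fourier_def)
qed

lemma fourier_inv_fourier:
  assumes "\<phi> \<in> schwartz" shows "fourier (inv_fourier \<phi>) = \<phi>"
proof
  fix x
  have "fourier (inv_fourier \<phi>) x = inv_fourier (fourier (\<lambda>y. \<phi> (- y))) (- x)"
    unfolding fourier_reflect[OF schwartz_measurable[OF assms]] by (simp add: inv_fourier_eq)
  then show "fourier (inv_fourier \<phi>) x = \<phi> x" by (simp add: inv_fourier_fourier schwartz_reflect assms)
qed

section \<open>Density of the test functions\<close>

text \<open>Leibniz' rule, as a bound: each of the \<open>2 ^ length js\<close> terms is at most \<open>M * B\<close>.\<close>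

lemma norm_iter_partial_mult_le:
  fixes f g :: "real^'n::finite \<Rightarrow> 'b::real_normed_algebra"
  assumes "smooth f" "smooth g"
    and "\<And>as. length as \<le> length js \<Longrightarrow> norm (iter_partial as f x) \<le> M"
    and "\<And>bs. length bs \<le> length js \<Longrightarrow> norm (iter_partial bs g x) \<le> B"
  shows "norm (iter_partial js (\<lambda>x. f x * g x) x) \<le> 2 ^ length js * M * B"
  using assms
proof (induction js arbitrary: f g rule: rev_induct)
  case Nil
  have "norm (f x) * norm (g x) \<le> M * B"
    using Nil(3,4)[of "[]"] by (intro mult_mono) (auto intro: order_trans[OF norm_ge_zero])
  then show ?case using norm_mult_ineq[of "f x" "g x"] by simp
next
  case (snoc j js)
  have "partial_deriv j (\<lambda>x. f x * g x) = (\<lambda>x. f x * partial_deriv j g x + partial_deriv j f x * g x)"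
    by (rule ext) (simp add: snoc partial_mult smooth_differentiable)
  then have "iter_partial (js @ [j]) (\<lambda>x. f x * g x) x
      = iter_partial js (\<lambda>x. f x * partial_deriv j g x) x + iter_partial js (\<lambda>x. partial_deriv j f x * g x) x"
    by (simp add: iter_partial_append iter_partial_add smooth_mult smooth_partial snoc)
  moreover have "norm (iter_partial js (\<lambda>x. f x * partial_deriv j g x) x) \<le> 2 ^ length js * M * B"
    by (intro snoc.IH smooth_partial snoc.prems(1,2))
      (use snoc.prems(3) snoc.prems(4)[of "_ @ [j]"] in \<open>auto simp: iter_partial_append\<close>)
  moreover have "norm (iter_partial js (\<lambda>x. partial_deriv j f x * g x) x) \<le> 2 ^ length js * M * B"
    by (intro snoc.IH smooth_partial snoc.prems(1,2))
      (use snoc.prems(4) snoc.prems(3)[of "_ @ [j]"] in \<open>auto simp: iter_partial_append\<close>)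
  ultimately show ?case
    using norm_triangle_ineq[of "iter_partial js (\<lambda>x. f x * partial_deriv j g x) x" "iter_partial js (\<lambda>x. partial_deriv j f x * g x) x"]
    by simp
qed

context bump
begin

definition cut :: "real \<Rightarrow> real^'n \<Rightarrow> complex" where
  "cut R x = complex_of_real (\<theta> ((1 / R) *\<^sub>R x))"

lemma cut_smooth: "smooth (cut R)"
  using smooth_of_real[OF smooth_affine[OF bump_smooth, of "1/R" 0]] by (simp add: cut_def[abs_def])

lemma cut_one: "R > 0 \<Longrightarrow> norm x < R \<Longrightarrow> cut R x = 1"
  by (simp add: cut_def bump_one field_simps)

lemma cut_zero: "R > 0 \<Longrightarrow> norm x > 2 * R \<Longrightarrow> cut R x = 0"
  by (simp add: cut_def bump_zero field_simps)

lemma cut_norm: "norm (cut R x) \<le> 1"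
  by (simp add: cut_def bump_nonneg bump_le_one)

lemma cut_test: "R > 0 \<Longrightarrow> cut R \<in> test_functions"
  using cut_smooth cut_zero by (auto simp: test_functions_def)

text \<open>The function is multiplied by \<open>cut R\<close>. The error lives where \<open>|x| > R\<close>, and there the control of one
  more power of \<open>|x|\<close> gains a factor \<open>1/R\<close>.\<close>

lemma test_dense_schwartz:
  fixes \<phi> :: "real^'n \<Rightarrow> complex"
  assumes \<phi>: "\<phi> \<in> schwartz" and e: "e > 0"
  obtains \<phi>' where "\<phi>' \<in> test_functions" "schwartz_seminorm N (\<lambda>x. \<phi>' x - \<phi> x) \<le> e"
proof -
  let ?t = "(\<lambda>x. complex_of_real (\<theta> x))"
  have ct: "?t \<in> schwartz"
    using test_schwartz[OF cut_test[of 1]] by (simp add: cut_def[abs_def])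
  define M0 where "M0 = schwartz_seminorm N ?t"
  have M0: "norm (iter_partial as ?t y) \<le> M0" if "length as \<le> N" for as y
  proof -
    have "1 * norm (iter_partial as ?t y) \<le> (1 + norm y) ^ N * norm (iter_partial as ?t y)"
      by (intro mult_right_mono one_le_power) auto
    then show ?thesis using le_seminorm[OF ct that, of y] by (simp add: M0_def)
  qed
  then have M0p: "M0 \<ge> 0" using M0[of "[]"] norm_ge_zero order_trans by (metis list.size(3) zero_le)
  define S where "S = schwartz_seminorm (N + 1) \<phi>"
  have S: "S \<ge> 0" unfolding S_def by (rule seminorm_nonneg[OF \<phi>])
  define R where "R = 1 + 2 ^ N * (M0 + 1) * S / e"
  have R: "R \<ge> 1" using e S M0p by (simp add: R_def)
  define \<phi>' where "\<phi>' = (\<lambda>x. \<phi> x * cut R x)"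
  have \<phi>': "\<phi>' \<in> test_functions" unfolding \<phi>'_def
    using test_smooth_mult[OF cut_test schwartz_smooth[OF \<phi>]] R by simp
  define c where "c = (\<lambda>x. cut R x + (-1))"
  have c: "smooth c" unfolding c_def by (intro smooth_add cut_smooth smooth_const)
  have cb: "norm (iter_partial as c x) \<le> M0 + 1" if "length as \<le> N" for as x
  proof -
    have "iter_partial as c x = iter_partial as (cut R) x + iter_partial as (\<lambda>_. -1) x"
      unfolding c_def by (subst iter_partial_add) (auto simp: cut_smooth)
    moreover have "norm (iter_partial as (\<lambda>_::real^'n. -1 :: complex) x) \<le> 1"
    proof (cases as)
      case (Cons j js)
      have "iter_partial (j # js) (\<lambda>_::real^'n. -1 :: complex) = (\<lambda>_. 0)" by (induction js arbitrary: j) auto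
      then show ?thesis using Cons by simp
    qed simp
    moreover have "norm (iter_partial as (cut R) x) \<le> M0"
    proof -
      have "iter_partial as (\<lambda>x. ?t ((1/R) *\<^sub>R x + 0)) x = ((1/R) ^ length as) *\<^sub>R iter_partial as ?t ((1/R) *\<^sub>R x + 0)"
        by (rule fun_cong[OF iter_partial_affine]) (intro smooth_of_real bump_smooth)
      then have "norm (iter_partial as (cut R) x) = (1/R) ^ length as * norm (iter_partial as ?t ((1/R) *\<^sub>R x))"
        using R by (simp add: cut_def[abs_def])
      also have "\<dots> \<le> 1 * M0" using R by (intro mult_mono M0 that power_le_one) auto
      finally show ?thesis by simp
    qed
    ultimately show ?thesis by (simp only:) (rule order_trans[OF norm_triangle_ineq add_mono])
  qed
  have "schwartz_seminorm N (\<lambda>x. \<phi>' x - \<phi> x) \<le> e"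
  proof (rule seminorm_le)
    fix js :: "'n list" and x :: "real^'n" assume js: "length js \<le> N"
    have eq: "(\<lambda>x. \<phi>' x - \<phi> x) = (\<lambda>x. c x * \<phi> x)" by (auto simp: \<phi>'_def c_def algebra_simps)
    show "(1 + norm x) ^ N * norm (iter_partial js (\<lambda>x. \<phi>' x - \<phi> x) x) \<le> e"
    proof (cases "norm x < R")
      case True
      have "open {x::real^'n. norm x < R}" by (intro open_Collect_less continuous_intros)
      from iter_partial_local[OF this, of "\<lambda>x. c x * \<phi> x" "\<lambda>_. 0" x js]
      have "iter_partial js (\<lambda>x. c x * \<phi> x) x = iter_partial js (\<lambda>_. 0) x" using R True cut_one by (auto simp: c_def)
      also have "iter_partial js (\<lambda>_::real^'n. 0::complex) = (\<lambda>_. 0)" by (induction js) auto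
      finally show ?thesis using e by (simp add: eq)
    next
      case False
      let ?w = "1 + norm x"
      have w: "?w > 0" by (simp add: add_pos_nonneg)
      have bs: "norm (iter_partial bs \<phi> x) \<le> S / ?w ^ (N + 1)" if "length bs \<le> length js" for bs
      proof -
        have "?w ^ (N + 1) > 0" using w by (rule zero_less_power)
        then show ?thesis using le_seminorm[OF \<phi>, of bs "N + 1" x] that js
          by (simp add: S_def pos_le_divide_eq mult.commute del: power_Suc)
      qed
      have "norm (iter_partial js (\<lambda>x. c x * \<phi> x) x) \<le> 2 ^ length js * (M0 + 1) * (S / ?w ^ (N + 1))"
        by (rule norm_iter_partial_mult_le[OF c schwartz_smooth[OF \<phi>] cb bs]) (use js in auto)
      also have "\<dots> \<le> 2 ^ N * (M0 + 1) * (S / ?w ^ (N + 1))"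
        using js M0p S w by (intro mult_right_mono power_increasing) auto
      finally have "?w ^ N * norm (iter_partial js (\<lambda>x. c x * \<phi> x) x) \<le> ?w ^ N * (2 ^ N * (M0 + 1) * (S / ?w ^ (N + 1)))"
        using w by (intro mult_left_mono) auto
      also have "\<dots> = 2 ^ N * (M0 + 1) * S / ?w"
      proof -
        have "a ^ N * (A * (S / a ^ (N + 1))) = A * S / a" if "a > 0" for a A :: real using that by (simp add: field_simps)
        from this[OF w] show ?thesis .
      qed
      also have "\<dots> \<le> 2 ^ N * (M0 + 1) * S / R" using False R M0p S w by (intro divide_left_mono) auto
      also have "\<dots> \<le> e"
      proof -
        have "2 ^ N * (M0 + 1) * S / e \<le> R" by (simp add: R_def)
        then show ?thesis using e R by (simp add: field_simps)
      qed
      finally show ?thesis by (simp add: eq)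
    qed
  qed
  then show ?thesis using that \<phi>' by blast
qed

text \<open>Bounded approximation almost everywhere: continuous functions are made bounded by radial
  projection, replaced by polynomials (Stone--Weierstrass), and cut off.\<close>

lemma test_approx_bounded:
  fixes s :: "real^'n \<Rightarrow> complex"
  assumes [measurable]: "s \<in> borel_measurable borel" and s1: "\<And>x. norm (s x) \<le> 1"
    and supp: "\<And>x. norm x > R \<Longrightarrow> s x = 0" and R: "R > 0"
  obtains \<phi> where "\<And>k::nat. \<phi> k \<in> test_functions" "\<And>k x. norm (\<phi> k x) \<le> 1"
    "\<And>k x. norm x > 4 * R \<Longrightarrow> \<phi> k x = 0" "AE x in lborel. (\<lambda>k. \<phi> k x) \<longlonglongrightarrow> s x"
proof -
  have "s measurable_on UNIV"
    by (rule lebesgue_measurable_imp_measurable_on) (auto intro!: measurable_completion)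
  then obtain Z g where Z: "negligible Z" and g: "\<And>k. continuous_on UNIV (g k)"
    and lim: "\<And>x. x \<notin> Z \<Longrightarrow> (\<lambda>k. g k x) \<longlonglongrightarrow> s x"
    unfolding measurable_on_def by auto
  define h where "h k x = (1 / max 1 (norm (g k x))) *\<^sub>R g k x" for k x
  have h: "continuous_on UNIV (h k)" for k unfolding h_def
    by (intro continuous_intros g) auto
  have h1: "norm (h k x) \<le> 1" for k x by (auto simp: h_def max_def field_simps)
  have hlim: "(\<lambda>k. h k x) \<longlonglongrightarrow> s x" if "x \<notin> Z" for x
  proof -
    have "(\<lambda>k. h k x) \<longlonglongrightarrow> (1 / max 1 (norm (s x))) *\<^sub>R s x" unfolding h_def
      by (intro tendsto_intros lim that) auto
    moreover have "max 1 (norm (s x)) = 1" using s1[of x] by simp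
    ultimately show ?thesis by simp
  qed
  have "\<exists>p. polynomial_function p \<and> (\<forall>x\<in>cball 0 (4 * R). norm (h k x - p x) < 1 / real (Suc k))" for k
    by (rule Stone_Weierstrass_polynomial_function) (auto intro: continuous_on_subset[OF h])
  then obtain p where p: "\<And>k. polynomial_function (p k)" 
    and pa: "\<And>k x. norm x \<le> 4 * R \<Longrightarrow> norm (h k x - p k x) < 1 / real (Suc k)" by (metis mem_cball_0)
  define q where "q k x = complex_of_real (1 / (1 + 1 / real (Suc k))) * p k x" for k x
  define \<phi> where "\<phi> k x = q k x * cut (2 * R) x" for k x
  have zero: "\<phi> k x = 0" if "norm x > 4 * R" for k x using cut_zero[of "2 * R" x] that R by (simp add: \<phi>_def)
  show ?thesis
  proof (rule that)
    show "\<phi> k \<in> test_functions" for k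
      unfolding \<phi>_def q_def using R
      by (intro test_smooth_mult cut_test smooth_mult smooth_const smooth_polynomial p) simp
    show "\<phi> k x = 0" if "norm x > 4 * R" for k x by (rule zero[OF that])
    show "norm (\<phi> k x) \<le> 1" for k x
    proof (cases "norm x \<le> 4 * R")
      case True
      have "norm (p k x) \<le> norm (h k x) + norm (h k x - p k x)" by (metis norm_minus_commute norm_triangle_sub)
      then have "norm (p k x) \<le> 1 + 1 / real (Suc k)" using h1[of k x] pa[OF True, of k] by linarith
      moreover have "1 + 1 / real (Suc k) > 0" by (simp add: add_pos_pos)
      ultimately have "norm (q k x) \<le> 1" unfolding q_def norm_mult norm_of_real
        by (simp add: divide_simps mult.commute)
      then show ?thesis unfolding \<phi>_def norm_mult using cut_norm[of "2 * R" x]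
        by (intro mult_le_one) auto
    qed (use zero in auto)
    have "(\<lambda>k. \<phi> k x) \<longlonglongrightarrow> s x" if x: "x \<notin> Z" for x
    proof (cases "norm x \<le> 4 * R")
      case True
      have 0: "(\<lambda>k. 1 / real (Suc k)) \<longlonglongrightarrow> 0" by (rule LIMSEQ_Suc[OF lim_1_over_n])
      have "(\<lambda>k. h k x - p k x) \<longlonglongrightarrow> 0"
        by (rule Lim_null_comparison[OF _ 0]) (use pa[OF True] in \<open>auto intro!: always_eventually less_imp_le\<close>)
      from tendsto_diff[OF hlim[OF x] this] have "(\<lambda>k. p k x) \<longlonglongrightarrow> s x" by simp
      then have "(\<lambda>k. \<phi> k x) \<longlonglongrightarrow> complex_of_real (1 / (1 + 0)) * s x * cut (2 * R) x"
        unfolding \<phi>_def q_def by (intro tendsto_intros 0) auto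
      moreover have "s x * cut (2 * R) x = s x"
        using cut_one[of "2 * R" x] supp[of x] R by (cases "norm x > R") auto
      ultimately show ?thesis by simp
    next
      case False
      then show ?thesis using zero[of x] supp[of x] R by auto
    qed
    moreover have "AE x in lborel. x \<notin> Z"
      by (rule AE_completion_iff[THEN iffD1], rule AE_not_in) (use Z negligible_iff_null_sets in blast)
    ultimately show "AE x in lborel. (\<lambda>k. \<phi> k x) \<longlonglongrightarrow> s x" by auto
  qed
qed

text \<open>The norm is the limit of the pairings of \<open>g\<close> with its conjugate sign on large balls, and this sign is
  approximated boundedly by test functions.\<close>

lemma L1_norm_le_by_testing:
  fixes g :: "real^'n \<Rightarrow> complex"
  assumes g: "integrable lborel g"
    and e: "\<And>\<phi>. \<phi> \<in> test_functions \<Longrightarrow> (\<And>x. norm (\<phi> x) \<le> 1) \<Longrightarrow> norm (LINT x|lborel. g x * \<phi> x) \<le> e"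
  shows "(LINT x|lborel. norm (g x)) \<le> e"
proof -
  have [measurable]: "g \<in> borel_measurable borel" using g by auto
  define s where "s m x = (if norm x \<le> real (Suc m) then cnj (sgn (g x)) else 0)" for m x
  have s1: "norm (s m x) \<le> 1" for m x by (simp add: s_def norm_sgn)
  have [measurable]: "cnj \<in> borel_measurable borel" by (intro borel_measurable_continuous_onI continuous_intros)
  have [measurable]: "s m \<in> borel_measurable borel" for m unfolding s_def sgn_div_norm by measurable
  have gs: "g x * s m x = complex_of_real (if norm x \<le> real (Suc m) then norm (g x) else 0)" for m x
    by (simp add: s_def sgn_eq complex_norm_square[symmetric] power2_eq_square)
  have "norm (LINT x|lborel. g x * s m x) \<le> e" for m
  proof -
    obtain \<phi> where \<phi>: "\<And>k. \<phi> k \<in> test_functions" "\<And>k x. norm (\<phi> k x) \<le> 1"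
      and lim: "AE x in lborel. (\<lambda>k. \<phi> k x) \<longlonglongrightarrow> s m x"
      by (rule test_approx_bounded[of "s m" "real (Suc m)"]) (use s1 in \<open>auto simp: s_def\<close>)
    have [measurable]: "\<phi> k \<in> borel_measurable borel" for k using schwartz_measurable[OF test_schwartz[OF \<phi>(1)]] .
    have "(\<lambda>k. LINT x|lborel. g x * \<phi> k x) \<longlonglongrightarrow> (LINT x|lborel. g x * s m x)"
    proof (rule integral_dominated_convergence[where w="\<lambda>x. norm (g x)"])
      show "AE x in lborel. (\<lambda>k. g x * \<phi> k x) \<longlonglongrightarrow> g x * s m x"
        using lim by eventually_elim (intro tendsto_intros)
      show "AE x in lborel. norm (g x * \<phi> k x) \<le> norm (g x)" for k
        by (auto simp: norm_mult intro!: mult_left_le \<phi>)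
    qed (use g in auto)
    then show ?thesis
      by (rule Lim_bounded[OF tendsto_norm, of _ _ 0]) (use e \<phi> in auto)
  qed
  moreover have "(\<lambda>m. LINT x|lborel. g x * s m x) \<longlonglongrightarrow> (LINT x|lborel. complex_of_real (norm (g x)))"
  proof (rule integral_dominated_convergence[where w="\<lambda>x. norm (g x)"])
    show "AE x in lborel. (\<lambda>m. g x * s m x) \<longlonglongrightarrow> complex_of_real (norm (g x))"
    proof (rule AE_I2)
      fix x :: "real^'n"
      obtain m0 :: nat where "norm x \<le> real m0" using real_arch_simple by blast
      then show "(\<lambda>m. g x * s m x) \<longlonglongrightarrow> complex_of_real (norm (g x))"
        unfolding gs by (intro tendsto_eventually eventually_sequentiallyI[of m0]) auto
    qed
    show "AE x in lborel. norm (g x * s m x) \<le> norm (g x)" for m by (auto simp: gs)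
  qed (use g in auto)
  ultimately have "norm (LINT x|lborel. complex_of_real (norm (g x))) \<le> e"
    by (intro Lim_bounded[OF tendsto_norm, of _ _ 0 e]) auto
  then show ?thesis by (simp add: integral_of_real)
qed

lemma locally_integrable_measurable:
  fixes g :: "real^'n \<Rightarrow> complex"
  assumes "locally_integrable g" shows "g \<in> borel_measurable borel"
proof (rule borel_measurable_LIMSEQ_metric)
  show "(\<lambda>x. indicator (cball 0 (real m)) x *\<^sub>R g x) \<in> borel_measurable borel" for m
  proof -
    have "integrable lborel (\<lambda>x. indicator (cball 0 (real m)) x *\<^sub>R g x)"
      using assms compact_cball unfolding locally_integrable_def set_integrable_def by blast
    from borel_measurable_integrable[OF this] show ?thesis by simp
  qed
  fix x :: "real^'n"
  obtain m0 :: nat where "norm x \<le> real m0" using real_arch_simple by blast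
  then show "(\<lambda>m. indicator (cball 0 (real m)) x *\<^sub>R g x) \<longlonglongrightarrow> g x"
    by (intro tendsto_eventually eventually_sequentiallyI[of m0]) (auto simp: indicator_def)
qed

lemma locally_integrable_mult_cut:
  fixes g :: "real^'n \<Rightarrow> complex"
  assumes g: "locally_integrable g" and R: "R > 0"
  shows "integrable lborel (\<lambda>x. g x * cut R x)"
proof -
  have [measurable]: "g \<in> borel_measurable borel" using locally_integrable_measurable[OF g] .
  have [measurable]: "cut R \<in> borel_measurable borel" by (intro smooth_measurable cut_smooth)
  have "set_integrable lborel (cball 0 (2 * R)) g" using g by (simp add: locally_integrable_def)
  then show ?thesis unfolding set_integrable_def
    by (rule Bochner_Integration.integrable_bound)
      (use cut_zero[OF R] cut_norm in \<open>auto simp: norm_mult indicator_def intro!: AE_I2 mult_left_le\<close>)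
qed

lemma integrable_mult_le_one:
  fixes f \<phi> :: "'a \<Rightarrow> complex"
  assumes f: "integrable M f" and [measurable]: "\<phi> \<in> borel_measurable M" and "\<And>x. norm (\<phi> x) \<le> 1"
  shows "integrable M (\<lambda>x. f x * \<phi> x)"
  by (rule Bochner_Integration.integrable_bound[OF f]) (use f assms(3) in \<open>auto intro!: AE_I2 mult_left_le simp: norm_mult\<close>)

text \<open>After multiplication by a cutoff the difference is integrable, and its \<open>L\<^sup>1\<close> norm vanishes because all
  its pairings do.\<close>

lemma locally_integrable_unique:
  fixes g h :: "real^'n \<Rightarrow> complex"
  assumes g: "locally_integrable g" and h: "locally_integrable h"
    and eq: "\<And>\<phi>. \<phi> \<in> test_functions \<Longrightarrow> (LINT x|lborel. g x * \<phi> x) = (LINT x|lborel. h x * \<phi> x)"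
  shows "AE x in lborel. g x = h x"
proof -
  have [measurable]: "g \<in> borel_measurable borel" "h \<in> borel_measurable borel"
    using locally_integrable_measurable g h by auto
  have "AE x in lborel. g x * cut (real (Suc m)) x = h x * cut (real (Suc m)) x" for m
  proof -
    let ?c = "cut (real (Suc m))"
    have i: "integrable lborel (\<lambda>x. g x * ?c x)" "integrable lborel (\<lambda>x. h x * ?c x)"
      using locally_integrable_mult_cut g h by auto
    have [measurable]: "?c \<in> borel_measurable borel" by (intro smooth_measurable cut_smooth)
    have "(LINT x|lborel. norm (g x * ?c x - h x * ?c x)) \<le> 0"
    proof (rule L1_norm_le_by_testing)
      show "integrable lborel (\<lambda>x. g x * ?c x - h x * ?c x)" using i by simp
      fix \<phi> :: "real^'n \<Rightarrow> complex" assume \<phi>: "\<phi> \<in> test_functions" "\<And>x. norm (\<phi> x) \<le> 1"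
      have [measurable]: "\<phi> \<in> borel_measurable borel" using schwartz_measurable[OF test_schwartz[OF \<phi>(1)]] .
      have j: "integrable lborel (\<lambda>x. (g x * ?c x) * \<phi> x)" "integrable lborel (\<lambda>x. (h x * ?c x) * \<phi> x)"
        using integrable_mult_le_one[OF i(1) _ \<phi>(2)] integrable_mult_le_one[OF i(2) _ \<phi>(2)] by auto
      have "(LINT x|lborel. (g x * ?c x - h x * ?c x) * \<phi> x) = (LINT x|lborel. (g x * ?c x) * \<phi> x) - (LINT x|lborel. (h x * ?c x) * \<phi> x)"
        using j by (simp add: left_diff_distrib)
      also have "\<dots> = 0" using eq[OF test_smooth_mult[OF \<phi>(1) cut_smooth[of "real (Suc m)"]]] by (simp add: mult.assoc)
      finally show "norm (LINT x|lborel. (g x * ?c x - h x * ?c x) * \<phi> x) \<le> 0" by simp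
    qed
    moreover have "integrable lborel (\<lambda>x. norm (g x * ?c x - h x * ?c x))" using i by simp
    ultimately have "AE x in lborel. norm (g x * ?c x - h x * ?c x) = 0"
      by (subst integral_nonneg_eq_0_iff_AE[symmetric]) (auto intro!: antisym integral_nonneg_AE)
    then show ?thesis by simp
  qed
  then have "AE x in lborel. \<forall>m::nat. g x * cut (real (Suc m)) x = h x * cut (real (Suc m)) x"
    by (subst AE_all_countable) blast
  then show ?thesis
  proof eventually_elim
    fix x assume *: "\<forall>m::nat. g x * cut (real (Suc m)) x = h x * cut (real (Suc m)) x"
    obtain m :: nat where "norm x < real m" using reals_Archimedean2 by blast
    then have "cut (real (Suc m)) x = 1" by (intro cut_one) auto
    then show "g x = h x" using *[rule_format, of m] by simp
  qed
qed

text \<open>After truncation, \<open>g\<close> is bounded with bounded support, and bounded approximation almost everywhere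
  implies approximation in \<open>L\<^sup>1\<close> by dominated convergence.\<close>

lemma test_dense_L1:
  fixes g :: "real^'n \<Rightarrow> complex"
  assumes g: "integrable lborel g" and e: "e > 0"
  obtains \<phi> where "\<phi> \<in> test_functions" "(LINT x|lborel. norm (g x - \<phi> x)) < e"
proof -
  have [measurable]: "g \<in> borel_measurable borel" using g by auto
  define t where "t m x = (if norm x \<le> real (Suc m) \<and> norm (g x) \<le> real (Suc m) then g x else 0)" for m :: nat and x
  have [measurable]: "t m \<in> borel_measurable borel" for m unfolding t_def by measurable
  have "(\<lambda>m. LINT x|lborel. norm (g x - t m x)) \<longlonglongrightarrow> (LINT x|(lborel :: (real^'n) measure). 0)"
  proof (rule integral_dominated_convergence[where w="\<lambda>x. norm (g x)"])
    show "AE x in lborel. (\<lambda>m. norm (g x - t m x)) \<longlonglongrightarrow> 0"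
    proof (rule AE_I2)
      fix x :: "real^'n"
      obtain m0 :: nat where "max (norm x) (norm (g x)) \<le> real m0" using real_arch_simple by blast
      then show "(\<lambda>m. norm (g x - t m x)) \<longlonglongrightarrow> 0"
        by (intro tendsto_eventually eventually_sequentiallyI[of m0]) (auto simp: t_def)
    qed
  qed (use g in \<open>auto simp: t_def\<close>)
  then obtain m where m: "(LINT x|lborel. norm (g x - t m x)) < e / 2"
    using order_tendstoD(2)[of _ 0 sequentially "e/2"] e by (auto simp: eventually_sequentially)
  let ?m = "real (Suc m)"
  obtain \<phi> where \<phi>: "\<And>k. \<phi> k \<in> test_functions" "\<And>k x. norm (\<phi> k x) \<le> 1" "\<And>k x. norm x > 4 * ?m \<Longrightarrow> \<phi> k x = 0"
      and lim: "AE x in lborel. (\<lambda>k. \<phi> k x) \<longlonglongrightarrow> t m x / complex_of_real ?m"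
    by (rule test_approx_bounded[of "\<lambda>x. t m x / complex_of_real ?m" ?m]) (auto simp: t_def norm_divide divide_simps simp del: of_nat_Suc)
  have [measurable]: "\<phi> k \<in> borel_measurable borel" for k using schwartz_measurable[OF test_schwartz[OF \<phi>(1)]] .
  have "(\<lambda>k. LINT x|lborel. norm (t m x - complex_of_real ?m * \<phi> k x)) \<longlonglongrightarrow> (LINT x|(lborel :: (real^'n) measure). 0)"
  proof (rule integral_dominated_convergence[where w="\<lambda>x. 2 * ?m * indicator (cball 0 (4 * ?m)) x"])
    show "AE x in lborel. (\<lambda>k. norm (t m x - complex_of_real ?m * \<phi> k x)) \<longlonglongrightarrow> 0"
      using lim
    proof eventually_elim
      fix x assume "(\<lambda>k. \<phi> k x) \<longlonglongrightarrow> t m x / complex_of_real ?m"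
      then have "(\<lambda>k. norm (t m x - complex_of_real ?m * \<phi> k x)) \<longlonglongrightarrow> norm (t m x - complex_of_real ?m * (t m x / complex_of_real ?m))"
        by (intro tendsto_intros)
      then show "(\<lambda>k. norm (t m x - complex_of_real ?m * \<phi> k x)) \<longlonglongrightarrow> 0" by (simp del: of_nat_Suc)
    qed
    show "AE x in lborel. norm (norm (t m x - complex_of_real ?m * \<phi> k x)) \<le> 2 * ?m * indicator (cball 0 (4 * ?m)) x" for k
    proof (rule AE_I2)
      fix x
      have a: "norm (t m x) \<le> ?m" by (simp add: t_def)
      have b: "norm (complex_of_real ?m * \<phi> k x) \<le> ?m" unfolding norm_mult using \<phi>(2)[of k x] by (simp add: mult_left_le del: of_nat_Suc)
      show "norm (norm (t m x - complex_of_real ?m * \<phi> k x)) \<le> 2 * ?m * indicator (cball 0 (4 * ?m)) x"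
      proof (cases "norm x > 4 * ?m")
        case True
        then have "t m x = 0" "\<phi> k x = 0" using \<phi>(3)[of x k] by (auto simp: t_def)
        then show ?thesis by simp
      next
        case False
        have "norm (t m x - complex_of_real ?m * \<phi> k x) \<le> ?m + ?m" by (rule order_trans[OF norm_triangle_ineq4 add_mono[OF a b]])
        then show ?thesis using False by (simp add: indicator_def del: of_nat_Suc)
      qed
    qed
    show "integrable lborel (\<lambda>x::real^'n. 2 * ?m * indicator (cball 0 (4 * ?m)) x)"
      by (intro integrable_mult_right integrable_real_indicator) (auto intro: emeasure_bounded_finite simp flip: infinity_ennreal_def simp del: of_nat_Suc)
  qed auto
  then obtain k where k: "(LINT x|lborel. norm (t m x - complex_of_real ?m * \<phi> k x)) < e / 2"
    using order_tendstoD(2)[of _ 0 sequentially "e/2"] e by (auto simp: eventually_sequentially)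
  define f where "f = (\<lambda>x. complex_of_real ?m * \<phi> k x)"
  have f: "f \<in> test_functions" unfolding f_def by (rule test_smooth_mult[OF \<phi>(1) smooth_const])
  have fi: "integrable lborel f" using schwartz_integrable[OF test_schwartz[OF f]] .
  have ti: "integrable lborel (t m)" by (rule Bochner_Integration.integrable_bound[OF g]) (auto simp: t_def)
  have "(LINT x|lborel. norm (g x - f x)) \<le> (LINT x|lborel. norm (g x - t m x) + norm (t m x - f x))"
    using g fi ti by (intro integral_mono) (auto intro: order_trans[OF _ norm_triangle_ineq])
  also have "\<dots> < e" using m k g fi ti by (simp add: f_def)
  finally show ?thesis using that f by blast
qed

end

section \<open>Separability of the Schwartz space\<close>

lemma countable_code:
  assumes "countable (f ` S)"
  shows "\<exists>D. countable D \<and> D \<subseteq> S \<and> (\<forall>x\<in>S. \<exists>d\<in>D. f d = f x)"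
proof (intro exI conjI ballI)
  show "countable (inv_into S f ` (f ` S))" using assms by (rule countable_image)
  show "inv_into S f ` (f ` S) \<subseteq> S" by (auto intro: inv_into_into)
  show "\<exists>d\<in>inv_into S f ` (f ` S). f d = f x" if "x \<in> S" for x
    by (rule bexI[of _ "inv_into S f (f x)"]) (use that in \<open>auto intro: f_inv_into_f\<close>)
qed

lemma norm_partials_lipschitz:
  fixes f :: "real^'n::finite \<Rightarrow> 'b::real_normed_vector"
  assumes "\<And>x. f differentiable (at x)" "\<And>j x. norm (partial_deriv j f x) \<le> M"
  shows "norm (f x - f y) \<le> real CARD('n) * M * norm (x - y)"
proof (rule differentiable_bound[of UNIV])
  show "(f has_derivative (\<lambda>h. \<Sum>j\<in>UNIV. (h $ j) *\<^sub>R partial_deriv j f x)) (at x within UNIV)" for x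
    using has_derivative_partials[OF assms(1)] .
  have M: "M \<ge> 0" using order_trans[OF norm_ge_zero assms(2)] .
  show "onorm (\<lambda>h. \<Sum>j\<in>UNIV. (h $ j) *\<^sub>R partial_deriv j f x) \<le> real CARD('n) * M" for x
  proof (rule onorm_bound)
    fix h :: "real^'n"
    have "norm (\<Sum>j\<in>UNIV. (h $ j) *\<^sub>R partial_deriv j f x) \<le> (\<Sum>j\<in>(UNIV::'n set). norm h * M)"
      using M by (intro sum_norm_le) (auto intro!: mult_mono assms component_le_norm_cart)
    then show "norm (\<Sum>j\<in>UNIV. (h $ j) *\<^sub>R partial_deriv j f x) \<le> real CARD('n) * M * norm h" by (simp add: mult_ac)
  qed (use M in auto)
qed auto

text \<open>Up to an error \<open>e\<close> in a seminorm, a Schwartz function is determined by an integer bound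
  on the next seminorm and by rounded values of its derivatives at finitely many points.\<close>

lemma schwartz_countable_net:
  assumes e: "e > 0"
  shows "\<exists>D. countable D \<and> D \<subseteq> (schwartz :: (real^'n::finite \<Rightarrow> complex) set) \<and>
    (\<forall>\<phi>\<in>schwartz. \<exists>d\<in>D. schwartz_seminorm N (\<lambda>x. d x - \<phi> x) \<le> e)"
proof -
  let ?n = "real CARD('n)"
  define r where "r M = 2 * real M / e" for M :: nat
  define W where "W M = (1 + r M) ^ N" for M
  have r: "r M \<ge> 0" for M using e by (simp add: r_def)
  have W: "W M > 0" for M using r[of M] by (auto simp: W_def intro: zero_less_power)
  define \<delta> where "\<delta> M = e / (4 * ?n * real (Suc M) * W M)" for M
  have \<delta>: "\<delta> M > 0" for M using e W[of M] by (simp add: \<delta>_def zero_less_card_finite del: of_nat_Suc)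
  have "\<exists>G. finite G \<and> cball (0::real^'n) (r M) \<subseteq> (\<Union>g\<in>G. ball g (\<delta> M))" for M
    using compact_eq_totally_bounded[of "cball (0::real^'n) (r M)"] \<delta>[of M] by auto
  then obtain G :: "nat \<Rightarrow> (real^'n) set" where G: "\<And>M. finite (G M)" "\<And>M. cball (0::real^'n) (r M) \<subseteq> (\<Union>g\<in>G M. ball g (\<delta> M))" by metis
  let ?L = "{js::'n list. length js \<le> N}"
  have finL: "finite ?L" using finite_lists_length_le[of "UNIV::'n set" N] by simp
  define \<eta> where "\<eta> M = e / (4 * W M)" for M
  have \<eta>: "\<eta> M > 0" for M using e W[of M] by (simp add: \<eta>_def)
  define M where "M \<phi> = nat \<lceil>schwartz_seminorm (N + 1) \<phi>\<rceil>" for \<phi> :: "real^'n \<Rightarrow> complex"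
  define c where "c \<phi> = (M \<phi>, restrict (\<lambda>(js, g). (\<lfloor>Re (iter_partial js \<phi> g) / \<eta> (M \<phi>)\<rfloor>, \<lfloor>Im (iter_partial js \<phi> g) / \<eta> (M \<phi>)\<rfloor>)) (?L \<times> G (M \<phi>)))"
    for \<phi> :: "real^'n \<Rightarrow> complex"
  have "countable (\<Union>m. {m} \<times> (?L \<times> G m \<rightarrow>\<^sub>E (UNIV :: (int \<times> int) set)))"
    by (intro countable_UN countable_SIGMA countable_PiE finite_cartesian_product finL G) auto
  moreover have "c ` schwartz \<subseteq> (\<Union>m. {m} \<times> (?L \<times> G m \<rightarrow>\<^sub>E (UNIV :: (int \<times> int) set)))"
    by (auto simp: c_def)
  ultimately have "countable (c ` schwartz)" by (rule countable_subset[rotated])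
  then obtain D where D: "countable D" "D \<subseteq> schwartz" "\<And>\<phi>. \<phi> \<in> schwartz \<Longrightarrow> \<exists>d\<in>D. c d = c \<phi>"
    using countable_code by metis
  have "schwartz_seminorm N (\<lambda>x. d x - \<phi> x) \<le> e" if d: "d \<in> schwartz" and \<phi>: "\<phi> \<in> schwartz" and eq: "c d = c \<phi>" for d \<phi>
  proof (rule seminorm_le)
    fix js :: "'n list" and x :: "real^'n" assume js: "length js \<le> N"
    define m where "m = M \<phi>"
    have Md: "M d = m" using eq by (simp add: c_def m_def)
    have S: "schwartz_seminorm (N + 1) \<phi> \<le> real m" "schwartz_seminorm (N + 1) d \<le> real m"
      using real_nat_ceiling_ge[of "schwartz_seminorm (N + 1) \<phi>"] real_nat_ceiling_ge[of "schwartz_seminorm (N + 1) d"]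
        Md by (simp_all only: m_def M_def)
    have b: "(1 + norm y) ^ (N + 1) * norm (iter_partial as f y) \<le> real m"
      if "f = \<phi> \<or> f = d" "length as \<le> N + 1" for f as y
      using le_seminorm[OF \<phi> that(2), of y] le_seminorm[OF d that(2), of y] S that(1) by auto
    have b1: "norm (iter_partial as f y) \<le> real m" if "f = \<phi> \<or> f = d" "length as \<le> N + 1" for f as y
    proof -
      have "1 * norm (iter_partial as f y) \<le> (1 + norm y) ^ (N + 1) * norm (iter_partial as f y)"
        by (intro mult_right_mono one_le_power) auto
      then show ?thesis using b[OF that, of y] by simp
    qed
    have df: "iter_partial js (\<lambda>x. d x - \<phi> x) x = iter_partial js d x - iter_partial js \<phi> x"
      by (simp add: iter_partial_diff d \<phi>)
    show "(1 + norm x) ^ N * norm (iter_partial js (\<lambda>x. d x - \<phi> x) x) \<le> e"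
    proof (cases "norm x \<le> r m")
      case False
      have w: "1 + norm x > 0" by (simp add: add_pos_nonneg)
      have "(1 + norm x) * ((1 + norm x) ^ N * norm (iter_partial js d x - iter_partial js \<phi> x)) \<le>
         (1 + norm x) * ((1 + norm x) ^ N * (norm (iter_partial js d x) + norm (iter_partial js \<phi> x)))"
        using w by (intro mult_left_mono norm_triangle_ineq4) auto
      also have "\<dots> \<le> 2 * real m" using b[of \<phi> js x] b[of d js x] js by (simp add: algebra_simps)
      also have "\<dots> = r m * e" using e by (simp add: r_def)
      also have "\<dots> \<le> (1 + norm x) * e" using False e by (intro mult_right_mono) auto
      finally show ?thesis unfolding df using w by simp
    next
      case True
      then obtain g where g: "g \<in> G m" "norm (x - g) < \<delta> m"
        using G(2)[of m] by (force simp: dist_norm norm_minus_commute)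
      have lip: "norm (iter_partial js f x - iter_partial js f g) \<le> ?n * real m * \<delta> m" if f: "f = \<phi> \<or> f = d" for f
      proof -
        have "norm (iter_partial js f x - iter_partial js f g) \<le> ?n * real m * norm (x - g)"
        proof (rule norm_partials_lipschitz)
          show "iter_partial js f differentiable at x" for x using f d \<phi> by (auto simp: schwartz_differentiable schwartz_iter_partial)
          show "norm (partial_deriv j (iter_partial js f) x) \<le> real m" for j x using b1[OF f, of "j # js"] js by simp
        qed
        also have "\<dots> \<le> ?n * real m * \<delta> m" using g by (intro mult_left_mono) auto
        finally show ?thesis .
      qed
      have "c d = c \<phi>" by (rule eq)
      then have "restrict (\<lambda>(js, g). (\<lfloor>Re (iter_partial js d g) / \<eta> m\<rfloor>, \<lfloor>Im (iter_partial js d g) / \<eta> m\<rfloor>)) (?L \<times> G m) (js, g)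
          = restrict (\<lambda>(js, g). (\<lfloor>Re (iter_partial js \<phi> g) / \<eta> m\<rfloor>, \<lfloor>Im (iter_partial js \<phi> g) / \<eta> m\<rfloor>)) (?L \<times> G m) (js, g)"
        by (simp only: c_def Md m_def[symmetric] prod.inject)
      then have fl: "\<lfloor>Re (iter_partial js d g) / \<eta> m\<rfloor> = \<lfloor>Re (iter_partial js \<phi> g) / \<eta> m\<rfloor>"
        "\<lfloor>Im (iter_partial js d g) / \<eta> m\<rfloor> = \<lfloor>Im (iter_partial js \<phi> g) / \<eta> m\<rfloor>"
        using js g(1) by auto
      have close: "\<bar>a - b\<bar> \<le> \<eta> m" if "\<lfloor>a / \<eta> m\<rfloor> = \<lfloor>b / \<eta> m\<rfloor>" for a b
      proof -
        have "\<bar>a / \<eta> m - b / \<eta> m\<bar> \<le> 1" using that by linarith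
        then have "\<bar>a - b\<bar> / \<eta> m \<le> 1" using \<eta>[of m] by (simp add: diff_divide_distrib[symmetric])
        then show ?thesis using \<eta>[of m] by (simp add: divide_le_eq)
      qed
      have "norm (iter_partial js d g - iter_partial js \<phi> g) \<le> 2 * \<eta> m"
        using cmod_le[of "iter_partial js d g - iter_partial js \<phi> g"] close[OF fl(1)] close[OF fl(2)] by simp
      moreover have "iter_partial js d x - iter_partial js \<phi> x = (iter_partial js d x - iter_partial js d g)
          + (iter_partial js d g - iter_partial js \<phi> g) - (iter_partial js \<phi> x - iter_partial js \<phi> g)" by simp
      ultimately have "norm (iter_partial js d x - iter_partial js \<phi> x) \<le> 2 * \<eta> m + 2 * (?n * real m * \<delta> m)"
        using lip[of d] lip[of \<phi>] norm_triangle_ineq4[of "(iter_partial js d x - iter_partial js d g) + (iter_partial js d g - iter_partial js \<phi> g)" "iter_partial js \<phi> x - iter_partial js \<phi> g"]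
          norm_triangle_ineq[of "iter_partial js d x - iter_partial js d g" "iter_partial js d g - iter_partial js \<phi> g"] by simp
      also have "\<dots> \<le> e / W m"
      proof -
        have "?n * real m * \<delta> m \<le> ?n * real (Suc m) * \<delta> m" using \<delta>[of m] by (intro mult_right_mono) auto
        also have "\<dots> = e / (4 * W m)" using W[of m] by (simp add: \<delta>_def zero_less_card_finite field_simps del: of_nat_Suc)
        finally have "?n * real m * \<delta> m \<le> e / (4 * W m)" .
        moreover have "2 * \<eta> m + 2 * (e / (4 * W m)) = e / W m" using W[of m] by (simp add: \<eta>_def field_simps)
        ultimately show ?thesis by linarith
      qed
      finally have 1: "norm (iter_partial js d x - iter_partial js \<phi> x) \<le> e / W m" .
      have "(1 + norm x) ^ N * norm (iter_partial js d x - iter_partial js \<phi> x) \<le> W m * (e / W m)"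
        unfolding W_def[of m] using True r[of m]
        by (intro mult_mono power_mono 1[unfolded W_def]) auto
      also have "\<dots> = e" using W[of m] by simp
      finally show ?thesis unfolding df .
    qed
  qed
  then show ?thesis using D by (intro exI[of _ D]) blast
qed

lemma schwartz_separable:
  obtains d :: "nat \<Rightarrow> real^'n::finite \<Rightarrow> complex" where "\<And>k. d k \<in> schwartz"
    "\<And>\<phi> N e. \<phi> \<in> schwartz \<Longrightarrow> e > 0 \<Longrightarrow> \<exists>k. schwartz_seminorm N (\<lambda>x. d k x - \<phi> x) \<le> e"
proof -
  let ?P = "\<lambda>N k D. countable D \<and> D \<subseteq> (schwartz :: (real^'n \<Rightarrow> complex) set) \<and>
    (\<forall>\<phi>\<in>schwartz. \<exists>d\<in>D. schwartz_seminorm N (\<lambda>x. d x - \<phi> x) \<le> 1 / real (Suc k))"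
  define D where "D N k = (SOME D. ?P N k D)" for N k
  have P: "?P N k (D N k)" for N k
    unfolding D_def by (rule someI_ex, rule schwartz_countable_net) simp
  have D: "countable (D N k)" "D N k \<subseteq> schwartz" for N k using P[of N k] by auto
  have net: "\<exists>d\<in>D N k. schwartz_seminorm N (\<lambda>x. d x - \<phi> x) \<le> 1 / real (Suc k)" if "\<phi> \<in> schwartz" for N k \<phi>
    using P[of N k] that by blast
  let ?D = "\<Union>N. \<Union>k. D N k"
  obtain d0 where "d0 \<in> D 0 0" using net[OF schwartz_zero, of 0 0] by auto
  then have "?D \<noteq> {}" by auto
  moreover have "countable ?D" using D(1) by auto
  ultimately have r: "range (from_nat_into ?D) = ?D" by (rule range_from_nat_into)
  show ?thesis
  proof (rule that[of "from_nat_into ?D"])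
    show "from_nat_into ?D k \<in> schwartz" for k using from_nat_into[OF \<open>?D \<noteq> {}\<close>, of k] D(2) by blast
    fix \<phi> :: "real^'n \<Rightarrow> complex" and N and e :: real assume \<phi>: "\<phi> \<in> schwartz" and e: "e > 0"
    obtain k where k: "1 / real (Suc k) < e" using nat_approx_posE[OF e] by blast
    obtain d where "d \<in> D N k" "schwartz_seminorm N (\<lambda>x. d x - \<phi> x) \<le> 1 / real (Suc k)" using net[OF \<phi>] by blast
    moreover from this(1) have "d \<in> range (from_nat_into ?D)" unfolding r by blast
    then obtain i where "from_nat_into ?D i = d" by blast
    ultimately show "\<exists>k. schwartz_seminorm N (\<lambda>x. from_nat_into ?D k x - \<phi> x) \<le> e" using k by (intro exI[of _ i]) auto
  qed
qed

section \<open>Distributions whose Fourier transform is a function\<close>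

lemma seminorm_mono:
  assumes "\<phi> \<in> schwartz" "N \<le> N'"
  shows "schwartz_seminorm N \<phi> \<le> schwartz_seminorm N' \<phi>"
proof (rule seminorm_le)
  fix js :: "'a list" and x assume "length js \<le> N"
  have "(1 + norm x) ^ N * norm (iter_partial js \<phi> x) \<le> (1 + norm x) ^ N' * norm (iter_partial js \<phi> x)"
    using assms by (intro mult_right_mono power_increasing) auto
  also have "\<dots> \<le> schwartz_seminorm N' \<phi>" using assms \<open>length js \<le> N\<close> by (intro le_seminorm) auto
  finally show "(1 + norm x) ^ N * norm (iter_partial js \<phi> x) \<le> schwartz_seminorm N' \<phi>" .
qed

lemma seminorm_partial_le:
  assumes "\<phi> \<in> schwartz"
  shows "schwartz_seminorm N (partial_deriv j \<phi>) \<le> schwartz_seminorm (N + 1) \<phi>"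
proof (rule seminorm_le)
  fix js :: "'a list" and x assume "length js \<le> N"
  have "(1 + norm x) ^ N * norm (iter_partial js (partial_deriv j \<phi>) x) = (1 + norm x) ^ N * norm (iter_partial (js @ [j]) \<phi> x)"
    by (simp add: iter_partial_append)
  also have "\<dots> \<le> (1 + norm x) ^ (N + 1) * norm (iter_partial (js @ [j]) \<phi> x)"
    by (intro mult_right_mono power_increasing) auto
  also have "\<dots> \<le> schwartz_seminorm (N + 1) \<phi>" using assms \<open>length js \<le> N\<close> by (intro le_seminorm) auto
  finally show "(1 + norm x) ^ N * norm (iter_partial js (partial_deriv j \<phi>) x) \<le> schwartz_seminorm (N + 1) \<phi>" .
qed

text \<open>This makes the pairing of a function in the weighted space \<open>wL1\<close> with the inverse transform of a
  Schwartz function continuous in the latter.\<close>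

lemma inv_fourier_weighted_bound:
  obtains C N where "C > 0" "\<And>(\<phi> :: real^'n::finite \<Rightarrow> complex) \<xi>. \<phi> \<in> schwartz \<Longrightarrow>
     (1 + norm \<xi>) * norm (inv_fourier \<phi> \<xi>) \<le> C * schwartz_seminorm N \<phi>"
proof -
  let ?n = "CARD('n)"
  obtain C where C: "C > 0" "\<And>\<phi> :: real^'n \<Rightarrow> complex. \<phi> \<in> schwartz \<Longrightarrow> (LINT x|lborel. norm (\<phi> x)) \<le> C * schwartz_seminorm (?n + 1) \<phi>"
    using schwartz_L1_le_seminorm by blast
  let ?K = "fc TYPE('n) * C"
  have b: "norm (fourier \<phi> \<xi>) \<le> ?K * schwartz_seminorm (?n + 1) \<phi>" if "\<phi> \<in> schwartz" for \<phi> :: "real^'n \<Rightarrow> complex" and \<xi>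
    using order_trans[OF fourier_norm_le[OF schwartz_integrable[OF that]] mult_left_mono[OF C(2)[OF that]]] by (simp add: mult.assoc)
  show ?thesis
  proof (rule that[of "?K * (1 + real ?n)" "?n + 2"])
    show "?K * (1 + real ?n) > 0" using C by simp
    fix \<phi> :: "real^'n \<Rightarrow> complex" and \<xi> assume \<phi>: "\<phi> \<in> schwartz"
    let ?S = "?K * schwartz_seminorm (?n + 2) \<phi>"
    have 1: "norm (fourier \<phi> (-\<xi>)) \<le> ?S"
      by (rule order_trans[OF b[OF \<phi>] mult_left_mono[OF seminorm_mono[OF \<phi>]]]) (use C in auto)
    have 2: "\<bar>\<xi> $ j\<bar> * norm (fourier \<phi> (-\<xi>)) \<le> ?S" for j
    proof -
      have "\<bar>\<xi> $ j\<bar> * norm (fourier \<phi> (-\<xi>)) = norm (fourier (partial_deriv j \<phi>) (-\<xi>))"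
        by (simp add: fourier_partial[OF \<phi>] norm_mult)
      also have "\<dots> \<le> ?K * schwartz_seminorm (?n + 1) (partial_deriv j \<phi>)" by (rule b[OF schwartz_partial[OF \<phi>]])
      also have "\<dots> \<le> ?S" using seminorm_partial_le[OF \<phi>, of "?n + 1" j] C(1) by (intro mult_left_mono) auto
      finally show ?thesis .
    qed
    have "norm \<xi> * norm (fourier \<phi> (-\<xi>)) \<le> (\<Sum>j\<in>UNIV. \<bar>\<xi> $ j\<bar>) * norm (fourier \<phi> (-\<xi>))"
      by (intro mult_right_mono norm_le_l1_cart) auto
    also have "\<dots> \<le> (\<Sum>j\<in>(UNIV::'n set). ?S)" unfolding sum_distrib_right by (intro sum_mono 2)
    finally have "norm \<xi> * norm (fourier \<phi> (-\<xi>)) \<le> real ?n * ?S" by simp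
    then have "(1 + norm \<xi>) * norm (fourier \<phi> (-\<xi>)) \<le> ?S + real ?n * ?S" using 1 by (simp add: distrib_right)
    then show "(1 + norm \<xi>) * norm (inv_fourier \<phi> \<xi>) \<le> ?K * (1 + real ?n) * schwartz_seminorm (?n + 2) \<phi>"
      by (simp add: inv_fourier_eq algebra_simps)
  qed
qed

text \<open>The weight \<open>1 + norm \<xi>\<close> accommodates one derivative of an integrable spectrum, which is what the
  nonlinearity of the Navier--Stokes equations produces.\<close>

definition wL1 :: "(real^'n::finite \<Rightarrow> complex) \<Rightarrow> bool" where
  "wL1 g \<longleftrightarrow> g \<in> borel_measurable borel \<and> integrable lborel (\<lambda>\<xi>. norm (g \<xi>) / (1 + norm \<xi>))"

lemma one_plus_norm_pos [simp]: "0 < 1 + norm (x::'a::real_normed_vector)"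
  by (simp add: add_pos_nonneg)

lemma integrable_wL1:
  assumes "integrable lborel (g :: real^'n::finite \<Rightarrow> complex)" shows "wL1 g"
  unfolding wL1_def
proof
  show "integrable lborel (\<lambda>\<xi>. norm (g \<xi>) / (1 + norm \<xi>))"
  proof (rule Bochner_Integration.integrable_bound[OF assms])
    have "norm (g \<xi>) / (1 + norm \<xi>) \<le> norm (g \<xi>) / 1" for \<xi> by (intro divide_left_mono) auto
    then show "AE \<xi> in lborel. norm (norm (g \<xi>) / (1 + norm \<xi>)) \<le> norm (g \<xi>)" by simp
  qed (use assms in auto)
qed (use assms in auto)

lemma wL1_cong_AE:
  assumes "wL1 g" "h \<in> borel_measurable borel" "AE \<xi> in lborel. h \<xi> = g \<xi>"
  shows "wL1 h"
  unfolding wL1_def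
proof
  have [measurable]: "h \<in> borel_measurable borel" "g \<in> borel_measurable borel" using assms by (auto simp: wL1_def)
  show "integrable lborel (\<lambda>\<xi>. norm (h \<xi>) / (1 + norm \<xi>))"
    by (rule integrable_cong_AE_imp[of _ "\<lambda>\<xi>. norm (g \<xi>) / (1 + norm \<xi>)"]) (use assms in \<open>auto simp: wL1_def\<close>)
qed (rule assms)

lemma wL1_locally_integrable:
  assumes "wL1 g" shows "locally_integrable g"
  unfolding locally_integrable_def set_integrable_def
proof (intro allI impI)
  fix K :: "(real^'a) set" assume K: "compact K"
  have [measurable]: "g \<in> borel_measurable borel" using assms by (simp add: wL1_def)
  have [measurable]: "K \<in> sets borel" using K by (simp add: borel_compact)
  obtain B where B: "\<And>x. x \<in> K \<Longrightarrow> norm x \<le> B" using compact_imp_bounded[OF K] by (auto simp: bounded_iff)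
  have i: "integrable lborel (\<lambda>x. (1 + \<bar>B\<bar>) * (norm (g x) / (1 + norm x)))"
    using assms unfolding wL1_def by (intro integrable_mult_right) simp
  show "integrable lborel (\<lambda>x. indicat_real K x *\<^sub>R g x)"
  proof (rule Bochner_Integration.integrable_bound[OF i])
    show "AE x in lborel. norm (indicat_real K x *\<^sub>R g x) \<le> norm ((1 + \<bar>B\<bar>) * (norm (g x) / (1 + norm x)))"
    proof (rule AE_I2)
      fix x
      show "norm (indicat_real K x *\<^sub>R g x) \<le> norm ((1 + \<bar>B\<bar>) * (norm (g x) / (1 + norm x)))"
      proof (cases "x \<in> K")
        case True
        then have "1 + norm x \<le> 1 + \<bar>B\<bar>" using B by force
        then have "norm (g x) * (1 + norm x) \<le> norm (g x) * (1 + \<bar>B\<bar>)" by (intro mult_left_mono) auto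
        then show ?thesis using True by (simp add: abs_mult pos_le_divide_eq mult_ac)
      qed simp
    qed
  qed simp
qed

lemma wL1_pairing:
  fixes g \<phi> :: "real^'n::finite \<Rightarrow> complex"
  assumes g: "wL1 g" and [measurable]: "\<phi> \<in> borel_measurable borel"
    and B: "\<And>\<xi>. (1 + norm \<xi>) * norm (\<phi> \<xi>) \<le> B"
  shows "integrable lborel (\<lambda>\<xi>. g \<xi> * \<phi> \<xi>)"
    and "norm (LINT \<xi>|lborel. g \<xi> * \<phi> \<xi>) \<le> (LINT \<xi>|lborel. norm (g \<xi>) / (1 + norm \<xi>)) * B"
proof -
  have [measurable]: "g \<in> borel_measurable borel" using g by (simp add: wL1_def)
  have i: "integrable lborel (\<lambda>\<xi>. norm (g \<xi>) / (1 + norm \<xi>) * B)"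
    using g unfolding wL1_def by (intro integrable_mult_left) simp
  have b: "norm (g \<xi> * \<phi> \<xi>) \<le> norm (g \<xi>) / (1 + norm \<xi>) * B" for \<xi>
  proof -
    have "norm (g \<xi>) * norm (\<phi> \<xi>) = norm (g \<xi>) / (1 + norm \<xi>) * ((1 + norm \<xi>) * norm (\<phi> \<xi>))"
    proof -
      have "a * b = a / w * (w * b)" if "w > 0" for a b w :: real using that by simp
      from this[OF one_plus_norm_pos] show ?thesis .
    qed
    also have "\<dots> \<le> norm (g \<xi>) / (1 + norm \<xi>) * B" by (intro mult_left_mono B) (auto simp: less_imp_le)
    finally show ?thesis by (simp add: norm_mult)
  qed
  show int: "integrable lborel (\<lambda>\<xi>. g \<xi> * \<phi> \<xi>)"
    by (rule Bochner_Integration.integrable_bound[OF i])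
      (simp, rule AE_I2, unfold real_norm_def, rule order_trans[OF b abs_ge_self])
  show "norm (LINT \<xi>|lborel. g \<xi> * \<phi> \<xi>) \<le> (LINT \<xi>|lborel. norm (g \<xi>) / (1 + norm \<xi>)) * B"
    using order_trans[OF integral_norm_bound integral_mono[OF integrable_norm[OF int] i b]]
    by (simp only: integral_mult_left_zero)
qed

lemma schwartz_weight1: "\<phi> \<in> schwartz \<Longrightarrow> (1 + norm \<xi>) * norm (\<phi> \<xi>) \<le> schwartz_seminorm 1 \<phi>"
  using seminorm_decay[of \<phi> \<xi> 1] by simp

lemmas wL1_schwartz = wL1_pairing[OF _ schwartz_measurable schwartz_weight1]

lemma temperedI:
  assumes "\<And>\<phi> \<psi>. \<phi> \<in> schwartz \<Longrightarrow> \<psi> \<in> schwartz \<Longrightarrow> T (\<lambda>x. \<phi> x + \<psi> x) = T \<phi> + T \<psi>"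
    and "\<And>\<phi> c. \<phi> \<in> schwartz \<Longrightarrow> T (\<lambda>x. c * \<phi> x) = c * T \<phi>"
    and "\<And>\<phi>. \<phi> \<in> schwartz \<Longrightarrow> norm (T \<phi>) \<le> C * schwartz_seminorm N \<phi>"
  shows "T \<in> tempered"
  using assms unfolding tempered_def by blast

lemma temperedD:
  assumes "T \<in> tempered" "\<phi> \<in> schwartz"
  shows "\<psi> \<in> schwartz \<Longrightarrow> T (\<lambda>x. \<phi> x + \<psi> x) = T \<phi> + T \<psi>" "T (\<lambda>x. c * \<phi> x) = c * T \<phi>"
    "\<psi> \<in> schwartz \<Longrightarrow> T (\<lambda>x. \<phi> x - \<psi> x) = T \<phi> - T \<psi>"
proof -
  show a: "T (\<lambda>x. \<phi> x + \<psi> x) = T \<phi> + T \<psi>" if "\<psi> \<in> schwartz" for \<psi> using assms that unfolding tempered_def by blast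
  show c: "T (\<lambda>x. c * \<phi> x) = c * T \<phi>" for c using assms unfolding tempered_def by blast
  show "T (\<lambda>x. \<phi> x - \<psi> x) = T \<phi> - T \<psi>" if \<psi>: "\<psi> \<in> schwartz" for \<psi>
  proof -
    have "T (\<lambda>x. (-1) * \<psi> x) = (-1) * T \<psi>" using assms \<psi> unfolding tempered_def by blast
    then show ?thesis using a[OF schwartz_cmult[OF \<psi>, of "-1"]] by simp
  qed
qed

lemma tempered_bound:
  assumes "T \<in> tempered"
  obtains C N where "C > 0" "\<And>\<phi>. \<phi> \<in> schwartz \<Longrightarrow> norm (T \<phi>) \<le> C * schwartz_seminorm N \<phi>"
proof -
  obtain C N where C: "\<And>\<phi>. \<phi> \<in> schwartz \<Longrightarrow> norm (T \<phi>) \<le> C * schwartz_seminorm N \<phi>"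
    using assms unfolding tempered_def by blast
  show ?thesis
  proof (rule that[of "\<bar>C\<bar> + 1" N])
    fix \<phi> :: "real^'a \<Rightarrow> complex" assume \<phi>: "\<phi> \<in> schwartz"
    have "C * schwartz_seminorm N \<phi> \<le> (\<bar>C\<bar> + 1) * schwartz_seminorm N \<phi>"
      by (intro mult_right_mono seminorm_nonneg \<phi>) auto
    then show "norm (T \<phi>) \<le> (\<bar>C\<bar> + 1) * schwartz_seminorm N \<phi>" using C[OF \<phi>] by linarith
  qed simp
qed

lemma tempered_cong:
  assumes "T \<in> tempered" "\<And>\<phi>. \<phi> \<in> schwartz \<Longrightarrow> T' \<phi> = T \<phi>"
  shows "T' \<in> tempered"
proof -
  obtain C N where C: "\<And>\<phi>. \<phi> \<in> schwartz \<Longrightarrow> norm (T \<phi>) \<le> C * schwartz_seminorm N \<phi>"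
    using assms(1) unfolding tempered_def by blast
  show ?thesis by (rule temperedI) (use assms C in \<open>auto simp: schwartz_add schwartz_cmult temperedD\<close>)
qed

lemma tempered_diff:
  assumes "T \<in> tempered" "T' \<in> tempered"
  shows "T - T' \<in> tempered"
proof -
  obtain C N where C: "C > 0" "\<And>\<phi>. \<phi> \<in> schwartz \<Longrightarrow> norm (T \<phi>) \<le> C * schwartz_seminorm N \<phi>"
    using tempered_bound[OF assms(1)] by blast
  obtain C' N' where C': "C' > 0" "\<And>\<phi>. \<phi> \<in> schwartz \<Longrightarrow> norm (T' \<phi>) \<le> C' * schwartz_seminorm N' \<phi>"
    using tempered_bound[OF assms(2)] by blast
  show ?thesis
  proof (rule temperedI)
    fix \<phi> :: "real^'a \<Rightarrow> complex" assume \<phi>: "\<phi> \<in> schwartz"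
    have "norm ((T - T') \<phi>) \<le> C * schwartz_seminorm N \<phi> + C' * schwartz_seminorm N' \<phi>"
      using C(2)[OF \<phi>] C'(2)[OF \<phi>] norm_triangle_ineq4[of "T \<phi>" "T' \<phi>"] by simp
    also have "\<dots> \<le> C * schwartz_seminorm (max N N') \<phi> + C' * schwartz_seminorm (max N N') \<phi>"
      using C C' by (intro add_mono mult_left_mono seminorm_mono[OF \<phi>]) auto
    finally show "norm ((T - T') \<phi>) \<le> (C + C') * schwartz_seminorm (max N N') \<phi>" by (simp add: distrib_right)
  qed (simp_all add: temperedD[OF assms(1)] temperedD[OF assms(2)] algebra_simps)
qed

lemma wL1_tempered:
  assumes g: "wL1 g" shows "regular_dist g \<in> tempered"
  unfolding regular_dist_def
proof (rule temperedI)
  show "norm (LINT x|lborel. g x * \<phi> x) \<le> (LINT \<xi>|lborel. norm (g \<xi>) / (1 + norm \<xi>)) * schwartz_seminorm 1 \<phi>"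
    if "\<phi> \<in> schwartz" for \<phi> by (rule wL1_schwartz[OF g that that])
  show "(LINT x|lborel. g x * (\<phi> x + \<psi> x)) = (LINT x|lborel. g x * \<phi> x) + (LINT x|lborel. g x * \<psi> x)"
    if "\<phi> \<in> schwartz" "\<psi> \<in> schwartz" for \<phi> \<psi>
    using wL1_schwartz(1)[OF g that(1) that(1)] wL1_schwartz(1)[OF g that(2) that(2)] by (simp add: distrib_left)
qed (simp add: mult.left_commute)

lemma represents_wL1:
  assumes "wL1 g" "\<And>\<phi>. \<phi> \<in> schwartz \<Longrightarrow> T \<phi> = (LINT x|lborel. g x * \<phi> x)"
  shows "represents g T"
  unfolding represents_def
proof (intro conjI ballI)
  show "T \<in> tempered" by (rule tempered_cong[OF wL1_tempered[OF assms(1)]]) (simp add: assms(2) regular_dist_def)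
qed (use assms in \<open>auto simp: wL1_locally_integrable regular_dist_def test_schwartz\<close>)

lemma represents_fun_of: "represents g T \<Longrightarrow> represents (fun_of T) T"
  unfolding fun_of_def by (rule someI[of "\<lambda>g. represents g T"])

text \<open>In contrast to \<open>represents\<close>, the identity is tested on all Schwartz functions, which the integrability
  condition on \<open>g\<close> permits.\<close>

definition has_spectrum :: "'n::finite dist \<Rightarrow> (real^'n \<Rightarrow> complex) \<Rightarrow> bool" where
  "has_spectrum T g \<longleftrightarrow> wL1 g \<and> (\<forall>\<phi>\<in>schwartz. T (fourier \<phi>) = (LINT \<xi>|lborel. g \<xi> * \<phi> \<xi>))"

lemma has_spectrum_represents: "has_spectrum T g \<Longrightarrow> represents g (fourier_dist T)"
  by (rule represents_wL1) (auto simp: has_spectrum_def fourier_dist_def)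

lemma has_spectrum_has_ft: "has_spectrum T g \<Longrightarrow> T \<in> tempered \<Longrightarrow> has_ft T"
  unfolding has_ft_def using has_spectrum_represents by blast

lemma has_spectrum_cong:
  "has_spectrum T g \<Longrightarrow> (\<And>\<phi>. \<phi> \<in> schwartz \<Longrightarrow> T' \<phi> = T \<phi>) \<Longrightarrow> has_spectrum T' g"
  by (simp add: has_spectrum_def fourier_schwartz)

lemma has_spectrum_cong_AE:
  assumes "has_spectrum T g" "h \<in> borel_measurable borel" "AE \<xi> in lborel. h \<xi> = g \<xi>"
  shows "has_spectrum T h"
  unfolding has_spectrum_def
proof (intro conjI ballI)
  show h: "wL1 h" using wL1_cong_AE assms by (auto simp: has_spectrum_def)
  fix \<phi> :: "real^'a \<Rightarrow> complex" assume \<phi>: "\<phi> \<in> schwartz"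
  have [measurable]: "g \<in> borel_measurable borel" "\<phi> \<in> borel_measurable borel" "h \<in> borel_measurable borel"
    using assms \<phi> by (auto simp: has_spectrum_def wL1_def schwartz_measurable)
  have "(LINT \<xi>|lborel. h \<xi> * \<phi> \<xi>) = (LINT \<xi>|lborel. g \<xi> * \<phi> \<xi>)"
    by (rule integral_cong_AE) (use assms(3) in auto)
  then show "T (fourier \<phi>) = (LINT \<xi>|lborel. h \<xi> * \<phi> \<xi>)" using assms(1) \<phi> by (simp add: has_spectrum_def)
qed

lemma has_spectrum_value:
  assumes "has_spectrum T g" "\<phi> \<in> schwartz"
  shows "T \<phi> = (LINT \<xi>|lborel. g \<xi> * inv_fourier \<phi> \<xi>)"
  using assms inv_fourier_schwartz[OF assms(2)] fourier_inv_fourier[OF assms(2)]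
  unfolding has_spectrum_def by metis

lemma inv_fourier_add:
  assumes "integrable lborel f" "integrable lborel g"
  shows "inv_fourier (\<lambda>x. f x + g x) \<xi> = inv_fourier f \<xi> + inv_fourier g \<xi>"
  by (simp add: inv_fourier_eq fourier_add assms)

lemma inv_fourier_swap:
  fixes h k :: "real^'n::finite \<Rightarrow> complex"
  assumes h: "integrable lborel h" and k: "integrable lborel k"
  shows "(LINT x|lborel. inv_fourier h x * k x) = (LINT x|lborel. h x * inv_fourier k x)"
proof -
  have [measurable]: "h \<in> borel_measurable borel" "k \<in> borel_measurable borel" using h k by auto
  have "(LINT x|lborel. inv_fourier h x * k x) = (LINT x|lborel. (\<lambda>x. fourier h x * k (-x)) (0 + (-1) *\<^sub>R x))"
    by (simp add: inv_fourier_eq)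
  also have "\<dots> = (LINT x|lborel. fourier h x * k (-x))" by (subst LINT_affine) auto
  also have "\<dots> = (LINT x|lborel. h x * fourier (\<lambda>x. k (-x)) x)"
    using integrable_affine[OF k, of "-1" 0] by (intro fourier_swap h) simp
  finally show ?thesis by (simp add: fourier_reflect)
qed

lemma ift_exists:
  assumes g: "wL1 g"
  shows "(\<lambda>\<phi>. LINT \<xi>|lborel. g \<xi> * inv_fourier \<phi> \<xi>) \<in> tempered" (is "?T \<in> _")
    and "has_spectrum (\<lambda>\<phi>. LINT \<xi>|lborel. g \<xi> * inv_fourier \<phi> \<xi>) g"
proof -
  obtain C N where C: "C > 0" "\<And>(\<phi> :: real^'a \<Rightarrow> complex) \<xi>. \<phi> \<in> schwartz \<Longrightarrow>
     (1 + norm \<xi>) * norm (inv_fourier \<phi> \<xi>) \<le> C * schwartz_seminorm N \<phi>"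
    using inv_fourier_weighted_bound by blast
  note pair = wL1_pairing[OF g schwartz_measurable[OF inv_fourier_schwartz] C(2)]
  show "?T \<in> tempered"
  proof (rule temperedI)
    show "norm (?T \<phi>) \<le> (LINT \<xi>|lborel. norm (g \<xi>) / (1 + norm \<xi>)) * C * schwartz_seminorm N \<phi>"
      if "\<phi> \<in> schwartz" for \<phi> using pair(2)[OF that that] by (simp add: mult.assoc)
    show "?T (\<lambda>x. \<phi> x + \<psi> x) = ?T \<phi> + ?T \<psi>" if "\<phi> \<in> schwartz" "\<psi> \<in> schwartz" for \<phi> \<psi>
      using pair(1)[OF that(1) that(1)] pair(1)[OF that(2) that(2)]
      by (simp add: inv_fourier_add schwartz_integrable that distrib_left)
    show "?T (\<lambda>x. c * \<phi> x) = c * ?T \<phi>" for \<phi> c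
      by (simp add: inv_fourier_eq fourier_cmult mult.left_commute)
  qed
  show "has_spectrum ?T g" using g by (simp add: has_spectrum_def inv_fourier_fourier)
qed

context bump
begin

text \<open>Continuity with respect to the seminorms extends an identity from test functions to Schwartz
  functions.\<close>

lemma wL1_extend:
  fixes T :: "'n dist"
  assumes T: "T \<in> tempered" and g: "wL1 g"
    and eq: "\<And>\<phi>. \<phi> \<in> test_functions \<Longrightarrow> T \<phi> = (LINT x|lborel. g x * \<phi> x)" and \<phi>: "\<phi> \<in> schwartz"
  shows "T \<phi> = (LINT x|lborel. g x * \<phi> x)"
proof -
  define U where "U = T - regular_dist g"
  have "U \<in> tempered" unfolding U_def by (intro tempered_diff T wL1_tempered g)
  then obtain C N where C: "C > 0" "\<And>\<phi>. \<phi> \<in> schwartz \<Longrightarrow> norm (U \<phi>) \<le> C * schwartz_seminorm N \<phi>" using tempered_bound by blast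
  have "norm (U \<phi>) \<le> e" if e: "e > 0" for e
  proof -
    obtain \<phi>' where \<phi>': "\<phi>' \<in> test_functions" "schwartz_seminorm N (\<lambda>x. \<phi>' x - \<phi> x) \<le> e / C"
      using test_dense_schwartz[OF \<phi>, of "e / C" N] C(1) e by auto
    have "U \<phi>' = 0" using eq[OF \<phi>'(1)] by (simp add: U_def regular_dist_def)
    then have "norm (U \<phi>) = norm (U (\<lambda>x. \<phi>' x - \<phi> x))"
      using temperedD(3)[OF \<open>U \<in> tempered\<close> test_schwartz[OF \<phi>'(1)] \<phi>] by simp
    also have "\<dots> \<le> C * schwartz_seminorm N (\<lambda>x. \<phi>' x - \<phi> x)" by (intro C schwartz_diff test_schwartz \<phi>' \<phi>)
    also have "\<dots> \<le> C * (e / C)" using C(1) \<phi>'(2) by (intro mult_left_mono) auto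
    also have "\<dots> = e" using C(1) by simp
    finally show ?thesis .
  qed
  then have "norm (U \<phi>) \<le> 0" by (rule field_le_epsilon) simp
  then show ?thesis by (simp add: U_def regular_dist_def)
qed

lemma represents_unique:
  fixes T :: "'n dist"
  assumes "represents g T" "represents h T"
  shows "AE x in lborel. g x = h x"
  using assms by (intro locally_integrable_unique) (auto simp: represents_def regular_dist_def)

text \<open>The functions \<open>ft\<close>, \<open>ift\<close> and \<open>fun_of\<close> are choices. By uniqueness, what holds for one representative
  holds for them almost everywhere, and the following lemmas transfer it.\<close>

lemma ft_represents:
  assumes "has_ft (T :: 'n dist)"
  shows "represents (ft T) (fourier_dist T)" "ft T \<in> borel_measurable borel"
proof -
  show "represents (ft T) (fourier_dist T)" using assms represents_fun_of unfolding has_ft_def ft_def by blast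
  then show "ft T \<in> borel_measurable borel" by (simp add: represents_def locally_integrable_measurable)
qed

lemma has_spectrum_ft:
  assumes "has_spectrum (T :: 'n dist) g"
  shows "AE \<xi> in lborel. ft T \<xi> = g \<xi>" "ft T \<in> borel_measurable borel"
proof -
  note r = has_spectrum_represents[OF assms]
  show "AE \<xi> in lborel. ft T \<xi> = g \<xi>" unfolding ft_def by (rule represents_unique[OF represents_fun_of[OF r] r])
  show "ft T \<in> borel_measurable borel" unfolding ft_def 
    using represents_fun_of[OF r] by (simp add: represents_def locally_integrable_measurable)
qed

lemma has_ft_spectrum:
  assumes "has_ft (T :: 'n dist)" "wL1 (ft T)"
  shows "has_spectrum T (ft T)"
  unfolding has_spectrum_def
proof (intro conjI ballI)
  note r = ft_represents(1)[OF assms(1)]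
  fix \<phi> :: "real^'n \<Rightarrow> complex" assume "\<phi> \<in> schwartz"
  then have "fourier_dist T \<phi> = (LINT x|lborel. ft T x * \<phi> x)"
    by (rule wL1_extend[rotated 3]) (use r assms in \<open>auto simp: represents_def regular_dist_def\<close>)
  then show "T (fourier \<phi>) = (LINT x|lborel. ft T x * \<phi> x)" by (simp add: fourier_dist_def)
qed (rule assms)

lemma ift_spectrum:
  fixes g :: "real^'n \<Rightarrow> complex"
  assumes g: "wL1 g"
  shows "ift g \<in> tempered" "has_spectrum (ift g) g"
proof -
  have "ift g \<in> tempered \<and> represents g (fourier_dist (ift g))"
    unfolding ift_def by (rule someI[of "\<lambda>f. f \<in> tempered \<and> represents g (fourier_dist f)"])
      (use ift_exists[OF g] has_spectrum_represents in blast)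
  then have t: "ift g \<in> tempered" and r: "represents g (fourier_dist (ift g))" by auto
  show "ift g \<in> tempered" by (rule t)
  show "has_spectrum (ift g) g" unfolding has_spectrum_def
  proof (intro conjI ballI g)
    fix \<phi> :: "real^'n \<Rightarrow> complex" assume "\<phi> \<in> schwartz"
    then have "fourier_dist (ift g) \<phi> = (LINT x|lborel. g x * \<phi> x)"
      by (rule wL1_extend[rotated 3]) (use r g in \<open>auto simp: represents_def regular_dist_def\<close>)
    then show "ift g (fourier \<phi>) = (LINT x|lborel. g x * \<phi> x)" by (simp add: fourier_dist_def)
  qed
qed

lemma ift_spectrum_AE:
  fixes g :: "real^'n \<Rightarrow> complex"
  assumes g: "wL1 g" and h: "h \<in> borel_measurable borel" "AE \<xi> in lborel. h \<xi> = g \<xi>"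
  shows "ift h \<in> tempered" "has_spectrum (ift h) g"
proof -
  have "wL1 h" using wL1_cong_AE[OF g h] .
  note i = ift_spectrum[OF this]
  show "ift h \<in> tempered" by (rule i)
  show "has_spectrum (ift h) g"
    by (rule has_spectrum_cong_AE[OF i(2)]) (use g h in \<open>auto simp: wL1_def\<close>)
qed

section \<open>Fourier multipliers and the Navier--Stokes nonlinearity\<close>

text \<open>If the spectrum is integrable, the inversion integral is a bounded continuous function that represents
  \<open>T\<close>. Hence the pointwise products in \<open>div_tensor\<close> may be computed with it.\<close>

lemma spectrum_inverse:
  assumes T: "has_spectrum (T :: 'n dist) g" and g: "integrable lborel g"
  shows "AE x in lborel. fun_of T x = inv_fourier g x" "fun_of T \<in> borel_measurable borel"
proof -
  have m: "inv_fourier g \<in> borel_measurable borel" unfolding inv_fourier_eq[abs_def] using g by measurable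
  have "T \<phi> = (LINT x|lborel. inv_fourier g x * \<phi> x)" if \<phi>: "\<phi> \<in> schwartz" for \<phi>
  proof -
    show ?thesis unfolding has_spectrum_value[OF T \<phi>] by (rule inv_fourier_swap[OF g schwartz_integrable[OF \<phi>], symmetric])
  qed
  moreover have "T \<in> tempered"
    by (rule tempered_cong[OF ift_exists(1)[of g]]) (use T in \<open>auto simp: has_spectrum_def intro: has_spectrum_value[OF T]\<close>)
  moreover have "locally_integrable (inv_fourier g)"
    unfolding locally_integrable_def set_integrable_def
  proof (intro allI impI)
    fix K :: "(real^'n) set" assume K: "compact K"
    let ?B = "fc TYPE('n) * (LINT x|lborel. norm (g x))"
    have [measurable]: "K \<in> sets borel" using K by (simp add: borel_compact)
    have "integrable lborel (indicat_real K)"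
      using emeasure_bounded_finite[OF compact_imp_bounded[OF K]] by (intro integrable_real_indicator) auto
    then have i: "integrable lborel (\<lambda>x. ?B * indicat_real K x)" by (rule integrable_mult_right)
    show "integrable lborel (\<lambda>x. indicat_real K x *\<^sub>R inv_fourier g x)"
    proof (rule Bochner_Integration.integrable_bound[OF i])
      have "norm (inv_fourier g x) \<le> \<bar>?B\<bar>" for x
        unfolding inv_fourier_eq by (rule order_trans[OF fourier_norm_le[OF g] abs_ge_self])
      then show "AE x in lborel. norm (indicat_real K x *\<^sub>R inv_fourier g x) \<le> norm (?B * indicat_real K x)"
        by (auto simp: indicator_def abs_mult)
    qed (use m in measurable)
  qed
  ultimately have r: "represents (inv_fourier g) T"
    by (auto simp: represents_def regular_dist_def test_schwartz)
  show "AE x in lborel. fun_of T x = inv_fourier g x" by (rule represents_unique[OF represents_fun_of[OF r] r])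
  show "fun_of T \<in> borel_measurable borel"
    using represents_fun_of[OF r] by (simp add: represents_def locally_integrable_measurable)
qed

end

lemma regular_dist_inv_fourier:
  fixes g :: "real^'n::finite \<Rightarrow> complex"
  assumes g: "integrable lborel g"
  shows "has_spectrum (regular_dist (inv_fourier g)) g"
proof -
  have e: "regular_dist (inv_fourier g) \<phi> = (LINT \<xi>|lborel. g \<xi> * inv_fourier \<phi> \<xi>)" if \<phi>: "\<phi> \<in> schwartz" for \<phi>
    unfolding regular_dist_def by (intro inv_fourier_swap g schwartz_integrable \<phi>)
  show "has_spectrum (regular_dist (inv_fourier g)) g"
    by (rule has_spectrum_cong[OF ift_exists(2)[OF integrable_wL1[OF g]]]) (simp add: e)
qed

definition conv :: "(real^'n::finite \<Rightarrow> complex) \<Rightarrow> (real^'n \<Rightarrow> complex) \<Rightarrow> real^'n \<Rightarrow> complex" where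
  "conv f g \<xi> = (LINT \<eta>|lborel. f \<eta> * g (\<xi> - \<eta>))"

lemma conv_pair_integrable:
  fixes f g :: "real^'n::finite \<Rightarrow> complex"
  assumes f: "integrable lborel f" and g: "integrable lborel g"
  shows "integrable (lborel \<Otimes>\<^sub>M lborel) (\<lambda>(\<eta>, \<xi>). f \<eta> * g (\<xi> - \<eta>))"
proof (rule lborel_pair.Fubini_integrable)
  have [measurable]: "f \<in> borel_measurable borel" "g \<in> borel_measurable borel" using f g by auto
  show "(\<lambda>(\<eta>, \<xi>). f \<eta> * g (\<xi> - \<eta>)) \<in> borel_measurable (lborel \<Otimes>\<^sub>M lborel)" by measurable
  have s: "integrable lborel (\<lambda>\<xi>. g (\<xi> - \<eta>))" for \<eta> using integrable_affine[OF g, of 1 "-\<eta>"] by simp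
  have n: "(LINT \<xi>|lborel. norm (g (\<xi> - \<eta>))) = (LINT \<xi>|lborel. norm (g \<xi>))" for \<eta>
    using LINT_affine[of "\<lambda>\<xi>. norm (g \<xi>)" 1 "-\<eta>"] by simp
  show "integrable lborel (\<lambda>\<eta>. LINT \<xi>|lborel. norm (case (\<eta>, \<xi>) of (\<eta>, \<xi>) \<Rightarrow> f \<eta> * g (\<xi> - \<eta>)))"
    using f by (simp add: norm_mult n)
  show "AE \<eta> in lborel. integrable lborel (\<lambda>\<xi>. case (\<eta>, \<xi>) of (\<eta>, \<xi>) \<Rightarrow> f \<eta> * g (\<xi> - \<eta>))"
    using s by simp
qed

lemma conv_integrable:
  fixes f g :: "real^'n::finite \<Rightarrow> complex"
  assumes "integrable lborel f" "integrable lborel g"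
  shows "integrable lborel (conv f g)"
  using lborel_pair.integrable_snd[OF conv_pair_integrable[OF assms]] by (simp add: conv_def[abs_def])

text \<open>Fubini's theorem, after translating the inner integral.\<close>

lemma inv_fourier_product:
  fixes f g \<phi> :: "real^'n::finite \<Rightarrow> complex"
  assumes f: "integrable lborel f" and g: "integrable lborel g" and \<phi>: "\<phi> \<in> schwartz"
  shows "(LINT x|lborel. inv_fourier f x * inv_fourier g x * fourier \<phi> x) =
     complex_of_real (fc TYPE('n)) * (LINT \<xi>|lborel. conv f g \<xi> * \<phi> \<xi>)"
proof -
  let ?c = "complex_of_real (fc TYPE('n))"
  have [measurable]: "f \<in> borel_measurable borel" "g \<in> borel_measurable borel" "\<phi> \<in> borel_measurable borel"
    using f g schwartz_measurable[OF \<phi>] by auto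
  have Fi: "integrable lborel (fourier \<phi>)" by (intro schwartz_integrable fourier_schwartz \<phi>)
  have m: "inv_fourier g \<in> borel_measurable borel" unfolding inv_fourier_eq[abs_def] by measurable
  have H: "integrable lborel (\<lambda>x. inv_fourier g x * fourier \<phi> x)"
  proof (rule Bochner_Integration.integrable_bound)
    show "integrable lborel (\<lambda>x. (fc TYPE('n) * (LINT x|lborel. norm (g x))) * norm (fourier \<phi> x))"
      using Fi by simp
    show "AE x in lborel. norm (inv_fourier g x * fourier \<phi> x) \<le> norm ((fc TYPE('n) * (LINT x|lborel. norm (g x))) * norm (fourier \<phi> x))"
      using fourier_norm_le[OF g] by (auto simp: norm_mult inv_fourier_eq intro!: AE_I2 mult_right_mono order_trans[OF _ abs_ge_self])
  qed (use m in measurable)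
  have inner: "inv_fourier (\<lambda>x. inv_fourier g x * fourier \<phi> x) \<eta> = ?c * (LINT \<xi>|lborel. g (\<xi> - \<eta>) * \<phi> \<xi>)" for \<eta>
  proof -
    let ?k = "\<lambda>x. exp (\<i> * complex_of_real (\<eta> \<bullet> x)) * fourier \<phi> x"
    have k: "inv_fourier ?k \<zeta> = \<phi> (\<zeta> + \<eta>)" for \<zeta>
    proof -
      have "inv_fourier ?k \<zeta> = inv_fourier (fourier \<phi>) (\<zeta> + \<eta>)"
        by (simp add: inv_fourier_def inner_add_left exp_add distrib_left mult_ac)
      then show ?thesis by (simp add: inv_fourier_fourier \<phi>)
    qed
    have "inv_fourier (\<lambda>x. inv_fourier g x * fourier \<phi> x) \<eta> = ?c * (LINT x|lborel. inv_fourier g x * ?k x)"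
      by (simp add: inv_fourier_def mult_ac)
    also have "(LINT x|lborel. inv_fourier g x * ?k x) = (LINT \<zeta>|lborel. g \<zeta> * inv_fourier ?k \<zeta>)"
      by (intro inv_fourier_swap g integrable_char(2) Fi)
    also have "\<dots> = (LINT \<zeta>|lborel. (\<lambda>\<xi>. g (\<xi> - \<eta>) * \<phi> \<xi>) (\<eta> + 1 *\<^sub>R \<zeta>))"
      by (simp add: add.commute k)
    also have "\<dots> = (LINT \<xi>|lborel. g (\<xi> - \<eta>) * \<phi> \<xi>)" by (subst LINT_affine) auto
    finally show ?thesis .
  qed
  have "(LINT x|lborel. inv_fourier f x * inv_fourier g x * fourier \<phi> x) = (LINT x|lborel. inv_fourier f x * (inv_fourier g x * fourier \<phi> x))"
    by (simp add: mult.assoc)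
  also have "\<dots> = (LINT \<eta>|lborel. f \<eta> * inv_fourier (\<lambda>x. inv_fourier g x * fourier \<phi> x) \<eta>)"
    by (intro inv_fourier_swap f H)
  also have "\<dots> = (LINT \<eta>|lborel. ?c * (LINT \<xi>|lborel. f \<eta> * g (\<xi> - \<eta>) * \<phi> \<xi>))"
    unfolding inner
  proof (rule Bochner_Integration.integral_cong[OF refl])
    fix \<eta>
    have "f \<eta> * (LINT \<xi>|lborel. g (\<xi> - \<eta>) * \<phi> \<xi>) = (LINT \<xi>|lborel. f \<eta> * g (\<xi> - \<eta>) * \<phi> \<xi>)"
      by (simp add: mult.assoc)
    then show "f \<eta> * (?c * (LINT \<xi>|lborel. g (\<xi> - \<eta>) * \<phi> \<xi>)) = ?c * (LINT \<xi>|lborel. f \<eta> * g (\<xi> - \<eta>) * \<phi> \<xi>)"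
      by (simp only: mult.left_commute[of _ ?c])
  qed
  also have "\<dots> = ?c * (LINT \<eta>|lborel. LINT \<xi>|lborel. f \<eta> * g (\<xi> - \<eta>) * \<phi> \<xi>)" by (rule integral_mult_right_zero)
  also have "(LINT \<eta>|lborel. LINT \<xi>|lborel. f \<eta> * g (\<xi> - \<eta>) * \<phi> \<xi>) = (LINT \<xi>|lborel. LINT \<eta>|lborel. f \<eta> * g (\<xi> - \<eta>) * \<phi> \<xi>)"
  proof (rule lborel_pair.Fubini_integral[symmetric])
    have i: "integrable (lborel \<Otimes>\<^sub>M lborel) (\<lambda>x. complex_of_real (schwartz_seminorm 0 \<phi>) * (case x of (\<eta>, \<xi>) \<Rightarrow> f \<eta> * g (\<xi> - \<eta>)))"
      by (intro integrable_mult_right conv_pair_integrable f g)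
    show "integrable (lborel \<Otimes>\<^sub>M lborel) (\<lambda>(\<eta>, \<xi>). f \<eta> * g (\<xi> - \<eta>) * \<phi> \<xi>)"
      by (rule Bochner_Integration.integrable_bound[OF i])
        (use schwartz_bounded[OF \<phi>] seminorm_nonneg[OF \<phi>, of 0] in \<open>auto simp: norm_mult mult.commute split_beta intro!: AE_I2 mult_mono order_trans[OF _ abs_ge_self]\<close>)
  qed
  also have "\<dots> = (LINT \<xi>|lborel. conv f g \<xi> * \<phi> \<xi>)"
    by (simp add: conv_def)
  finally show ?thesis .
qed

lemma wL1_add: "wL1 f \<Longrightarrow> wL1 g \<Longrightarrow> wL1 (\<lambda>\<xi>. f \<xi> + g \<xi>)"
  unfolding wL1_def
proof (elim conjE, intro conjI)
  assume [measurable]: "f \<in> borel_measurable borel" "g \<in> borel_measurable borel"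
    and i: "integrable lborel (\<lambda>\<xi>. norm (f \<xi>) / (1 + norm \<xi>))" "integrable lborel (\<lambda>\<xi>. norm (g \<xi>) / (1 + norm \<xi>))"
  show "integrable lborel (\<lambda>\<xi>. norm (f \<xi> + g \<xi>) / (1 + norm \<xi>))"
  proof (rule Bochner_Integration.integrable_bound[OF Bochner_Integration.integrable_add[OF i]])
    have "norm (f \<xi> + g \<xi>) / (1 + norm \<xi>) \<le> norm (f \<xi>) / (1 + norm \<xi>) + norm (g \<xi>) / (1 + norm \<xi>)" for \<xi>
      unfolding add_divide_distrib[symmetric] by (intro divide_right_mono norm_triangle_ineq) (auto simp: less_imp_le)
    then show "AE \<xi> in lborel. norm (norm (f \<xi> + g \<xi>) / (1 + norm \<xi>)) \<le> norm (norm (f \<xi>) / (1 + norm \<xi>) + norm (g \<xi>) / (1 + norm \<xi>))"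
      by (auto intro!: AE_I2)
  qed simp
qed auto

lemma wL1_mult_bounded:
  fixes f m :: "real^'n::finite \<Rightarrow> complex"
  assumes f: "wL1 f" and [measurable]: "m \<in> borel_measurable borel" and B: "\<And>\<xi>. norm (m \<xi>) \<le> B"
  shows "wL1 (\<lambda>\<xi>. m \<xi> * f \<xi>)"
  unfolding wL1_def
proof
  have [measurable]: "f \<in> borel_measurable borel" using f by (simp add: wL1_def)
  show "(\<lambda>\<xi>. m \<xi> * f \<xi>) \<in> borel_measurable borel" by measurable
  have i: "integrable lborel (\<lambda>\<xi>. B * (norm (f \<xi>) / (1 + norm \<xi>)))"
    using f unfolding wL1_def by (intro integrable_mult_right) simp
  show "integrable lborel (\<lambda>\<xi>. norm (m \<xi> * f \<xi>) / (1 + norm \<xi>))"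
  proof (rule Bochner_Integration.integrable_bound[OF i])
    have "norm (m \<xi>) * (norm (f \<xi>) / (1 + norm \<xi>)) \<le> B * (norm (f \<xi>) / (1 + norm \<xi>))" for \<xi>
      by (intro mult_right_mono B) (auto simp: less_imp_le)
    moreover have "norm (norm (m \<xi> * f \<xi>) / (1 + norm \<xi>)) = norm (m \<xi>) * (norm (f \<xi>) / (1 + norm \<xi>))" for \<xi>
      by (simp add: norm_mult)
    ultimately show "AE \<xi> in lborel. norm (norm (m \<xi> * f \<xi>) / (1 + norm \<xi>)) \<le> norm (B * (norm (f \<xi>) / (1 + norm \<xi>)))"
      by (auto simp only: real_norm_def intro!: AE_I2 intro: order_trans[OF _ abs_ge_self])
  qed simp
qed

lemma wL1_zero: "wL1 (\<lambda>_. 0)" by (simp add: wL1_def)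

lemma wL1_sum: "(\<And>i. i \<in> I \<Longrightarrow> wL1 (f i)) \<Longrightarrow> wL1 (\<lambda>\<xi>. \<Sum>i\<in>I. f i \<xi>)"
  by (induction I rule: infinite_finite_induct) (auto intro: wL1_add wL1_zero)

lemma wL1_coord:
  fixes f :: "real^'n::finite \<Rightarrow> complex"
  assumes f: "integrable lborel f"
  shows "wL1 (\<lambda>\<xi>. complex_of_real (\<xi> $ j) * f \<xi>)"
  unfolding wL1_def
proof
  show "(\<lambda>\<xi>. complex_of_real (\<xi> $ j) * f \<xi>) \<in> borel_measurable borel" using f by measurable
  show "integrable lborel (\<lambda>\<xi>. norm (complex_of_real (\<xi> $ j) * f \<xi>) / (1 + norm \<xi>))"
  proof (rule Bochner_Integration.integrable_bound[OF f])
    have "\<bar>\<xi> $ j\<bar> * norm (f \<xi>) \<le> norm (f \<xi>) * (1 + norm \<xi>)" for \<xi>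
      using mult_right_mono[of "\<bar>\<xi> $ j\<bar>" "1 + norm \<xi>" "norm (f \<xi>)"] component_le_norm_cart[of \<xi> j] by (simp add: mult.commute)
    then show "AE \<xi> in lborel. norm (norm (complex_of_real (\<xi> $ j) * f \<xi>) / (1 + norm \<xi>)) \<le> norm (f \<xi>)"
      by (intro AE_I2) (simp add: norm_mult abs_mult pos_divide_le_eq)
  qed (use f in measurable)
qed

lemma has_spectrum_sum_pairing:
  assumes "\<And>i. i \<in> I \<Longrightarrow> wL1 (f i)" "\<phi> \<in> schwartz"
  shows "(LINT \<xi>|lborel. (\<Sum>i\<in>I. f i \<xi>) * \<phi> \<xi>) = (\<Sum>i\<in>I. LINT \<xi>|lborel. f i \<xi> * \<phi> \<xi>)"
  unfolding sum_distrib_right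
  by (intro Bochner_Integration.integral_sum wL1_schwartz(1)[OF assms(1) assms(2) assms(2)])

lemma leray_symbol_entry:
  "leray_symbol \<xi> $ l $ m = complex_of_real ((if l = m then 1 else 0) - \<xi> $ l * \<xi> $ m / (norm \<xi>)\<^sup>2)"
  by (simp add: leray_symbol_def)

lemma leray_symbol_norm: "norm (leray_symbol \<xi> $ l $ m) \<le> 2"
proof -
  have "\<bar>\<xi> $ l * \<xi> $ m / (norm \<xi>)\<^sup>2\<bar> \<le> 1"
  proof (cases "\<xi> = 0")
    case False
    have "\<bar>\<xi> $ l\<bar> * \<bar>\<xi> $ m\<bar> \<le> norm \<xi> * norm \<xi>" by (intro mult_mono component_le_norm_cart) auto
    then show ?thesis using False by (simp add: abs_mult power2_eq_square)
  qed simp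
  then show ?thesis unfolding leray_symbol_entry norm_of_real
    by (intro order_trans[OF abs_triangle_ineq4]) auto
qed

lemma leray_symbol_measurable [measurable]: "(\<lambda>\<xi>. leray_symbol \<xi> $ l $ m) \<in> borel_measurable borel"
  unfolding leray_symbol_entry[abs_def] by measurable

text \<open>The spectrum of the projected divergence of \<open>v \<otimes> v\<close> if \<open>v\<close> has spectrum \<open>g\<close>: the derivative in
  direction \<open>j\<close> is multiplication by \<open>\<i> \<xi>\<^sub>j\<close>, and the factor \<open>fc\<close> comes from the normalisation of the
  transform.\<close>

definition ns_spectrum :: "('n \<Rightarrow> real^'n::finite \<Rightarrow> complex) \<Rightarrow> 'n \<Rightarrow> real^'n \<Rightarrow> complex" where
  "ns_spectrum g l \<xi> = (\<Sum>m\<in>UNIV. leray_symbol \<xi> $ l $ m *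
     (\<Sum>j\<in>UNIV. (\<i> * complex_of_real (fc TYPE('n))) * (complex_of_real (\<xi> $ j) * conv (g j) (g m) \<xi>)))"

context bump
begin

lemma div_tensor_spectrum:
  fixes v :: "'n vdist" and g :: "'n \<Rightarrow> real^'n \<Rightarrow> complex"
  assumes v: "\<And>j. has_spectrum (v $ j) (g j)" and g: "\<And>j. integrable lborel (g j)"
  shows "has_spectrum (div_tensor v $ m) (\<lambda>\<xi>. \<Sum>j\<in>UNIV. (\<i> * complex_of_real (fc TYPE('n))) * (complex_of_real (\<xi> $ j) * conv (g j) (g m) \<xi>))"
  unfolding has_spectrum_def
proof (intro conjI ballI)
  let ?c = "complex_of_real (fc TYPE('n))"
  let ?q = "\<lambda>j \<xi>. complex_of_real (\<xi> $ j) * conv (g j) (g m) \<xi>"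
  have w: "wL1 (\<lambda>\<xi>. (\<i> * ?c) * ?q j \<xi>)" for j
    by (rule wL1_mult_bounded[where m="\<lambda>_. \<i> * ?c" and B="norm (\<i> * ?c)"]) (auto intro!: wL1_coord conv_integrable g)
  then show "wL1 (\<lambda>\<xi>. \<Sum>j\<in>UNIV. (\<i> * ?c) * ?q j \<xi>)" by (intro wL1_sum)
  fix \<phi> :: "real^'n \<Rightarrow> complex" assume \<phi>: "\<phi> \<in> schwartz"
  have "(div_tensor v $ m) (fourier \<phi>) = (\<Sum>j\<in>UNIV. - (LINT x|lborel. fun_of (v $ j) x * fun_of (v $ m) x * partial_deriv j (fourier \<phi>) x))"
    by (simp add: div_tensor_def dist_partial_def regular_dist_def)
  also have "\<dots> = (\<Sum>j\<in>UNIV. LINT \<xi>|lborel. (\<i> * ?c) * ?q j \<xi> * \<phi> \<xi>)"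
  proof (rule sum.cong[OF refl])
    fix j
    let ?\<phi> = "\<lambda>x. - \<i> * (complex_of_real (x $ j) * \<phi> x)"
    have \<phi>j: "?\<phi> \<in> schwartz" by (intro schwartz_cmult schwartz_coord_mult \<phi>)
    note [measurable] = spectrum_inverse(2)[OF v g] schwartz_measurable[OF fourier_schwartz[OF \<phi>j]]
    have [measurable]: "g j \<in> borel_measurable borel" for j using g by auto
    have "(LINT x|lborel. fun_of (v $ j) x * fun_of (v $ m) x * partial_deriv j (fourier \<phi>) x) =
      (LINT x|lborel. inv_fourier (g j) x * inv_fourier (g m) x * fourier ?\<phi> x)"
      unfolding partial_fourier[OF \<phi>]
    proof (rule integral_cong_AE)
      show "AE x in lborel. fun_of (v $ j) x * fun_of (v $ m) x * fourier ?\<phi> x = inv_fourier (g j) x * inv_fourier (g m) x * fourier ?\<phi> x"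
        using spectrum_inverse(1)[OF v g, of j] spectrum_inverse(1)[OF v g, of m] by eventually_elim simp
      show "(\<lambda>x. inv_fourier (g j) x * inv_fourier (g m) x * fourier ?\<phi> x) \<in> borel_measurable lborel"
        unfolding inv_fourier_eq by measurable
    qed measurable
    also have "\<dots> = ?c * (LINT \<xi>|lborel. conv (g j) (g m) \<xi> * ?\<phi> \<xi>)" by (rule inv_fourier_product[OF g g \<phi>j])
    also have "- \<dots> = (LINT \<xi>|lborel. (- ?c) * (conv (g j) (g m) \<xi> * ?\<phi> \<xi>))" by (simp only: integral_mult_right_zero) simp
    also have "\<dots> = (LINT \<xi>|lborel. (\<i> * ?c) * ?q j \<xi> * \<phi> \<xi>)"
      by (rule Bochner_Integration.integral_cong) (auto simp: mult_ac)
    finally show "- (LINT x|lborel. fun_of (v $ j) x * fun_of (v $ m) x * partial_deriv j (fourier \<phi>) x) = \<dots>" .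
  qed
  also have "\<dots> = (LINT \<xi>|lborel. (\<Sum>j\<in>UNIV. (\<i> * ?c) * ?q j \<xi>) * \<phi> \<xi>)"
    by (rule has_spectrum_sum_pairing[symmetric]) (use w \<phi> in auto)
  finally show "(div_tensor v $ m) (fourier \<phi>) = (LINT \<xi>|lborel. (\<Sum>j\<in>UNIV. (\<i> * ?c) * ?q j \<xi>) * \<phi> \<xi>)" .
qed

lemma leray_spectrum:
  fixes F :: "'n vdist"
  assumes F: "\<And>m. has_spectrum (F $ m) (h m)"
  shows "has_spectrum (leray F $ l) (\<lambda>\<xi>. \<Sum>m\<in>UNIV. leray_symbol \<xi> $ l $ m * h m \<xi>)"
proof -
  have h: "wL1 (h m)" for m using F by (simp add: has_spectrum_def)
  note [measurable] = has_spectrum_ft(2)[OF F]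
  have "leray F $ l = ift (\<lambda>\<xi>. (leray_symbol \<xi> *v vft F \<xi>) $ l)" by (simp add: leray_def matrix_multiplier_def)
  also have "(\<lambda>\<xi>. (leray_symbol \<xi> *v vft F \<xi>) $ l) = (\<lambda>\<xi>. \<Sum>m\<in>UNIV. leray_symbol \<xi> $ l $ m * ft (F $ m) \<xi>)"
    by (simp add: matrix_vector_mult_def vft_def)
  finally have e: "leray F $ l = ift (\<lambda>\<xi>. \<Sum>m\<in>UNIV. leray_symbol \<xi> $ l $ m * ft (F $ m) \<xi>)" .
  show ?thesis unfolding e
  proof (rule ift_spectrum_AE(2))
    show "wL1 (\<lambda>\<xi>. \<Sum>m\<in>UNIV. leray_symbol \<xi> $ l $ m * h m \<xi>)"
      by (intro wL1_sum wL1_mult_bounded[OF h, where B=2] leray_symbol_measurable leray_symbol_norm)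
    have "AE \<xi> in lborel. \<forall>m\<in>UNIV. ft (F $ m) \<xi> = h m \<xi>"
      by (subst AE_finite_all) (use has_spectrum_ft(1)[OF F] in auto)
    then show "AE \<xi> in lborel. (\<Sum>m\<in>UNIV. leray_symbol \<xi> $ l $ m * ft (F $ m) \<xi>) = (\<Sum>m\<in>UNIV. leray_symbol \<xi> $ l $ m * h m \<xi>)"
      by eventually_elim simp
  qed measurable
qed

lemma multiplier_spectrum:
  fixes F :: "'n vdist" and M :: "real^'n \<Rightarrow> real"
  assumes ft: "ft (F $ l) \<in> borel_measurable borel" "AE \<xi> in lborel. ft (F $ l) \<xi> = h \<xi>"
    and [measurable]: "M \<in> borel_measurable borel" and w: "wL1 (\<lambda>\<xi>. complex_of_real (M \<xi>) * h \<xi>)"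
  shows "multiplier M F $ l \<in> tempered" "has_spectrum (multiplier M F $ l) (\<lambda>\<xi>. complex_of_real (M \<xi>) * h \<xi>)"
proof -
  have e: "multiplier M F $ l = ift (\<lambda>\<xi>. complex_of_real (M \<xi>) * ft (F $ l) \<xi>)" by (simp add: multiplier_def)
  have m: "(\<lambda>\<xi>. complex_of_real (M \<xi>) * ft (F $ l) \<xi>) \<in> borel_measurable borel" using ft(1) by measurable
  have a: "AE \<xi> in lborel. complex_of_real (M \<xi>) * ft (F $ l) \<xi> = complex_of_real (M \<xi>) * h \<xi>"
    using ft(2) by eventually_elim simp
  show "multiplier M F $ l \<in> tempered" "has_spectrum (multiplier M F $ l) (\<lambda>\<xi>. complex_of_real (M \<xi>) * h \<xi>)"
    unfolding e using ift_spectrum_AE[OF w m a] by auto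
qed

lemma duhamel_spectrum:
  fixes u :: "real \<Rightarrow> 'n vdist" and g :: "'n \<Rightarrow> real^'n \<Rightarrow> complex"
  assumes v: "\<And>j. has_spectrum (u \<tau> $ j) (g j)" and g: "\<And>j. integrable lborel (g j)" and "\<mu> \<ge> 0" "\<tau> \<le> t"
  shows "has_spectrum (duhamel_integrand \<mu> u t \<tau> $ l)
    (\<lambda>\<xi>. complex_of_real (exp (- \<mu> * (t - \<tau>) * (norm \<xi>)\<^sup>2)) * ns_spectrum g l \<xi>)"
proof -
  have L: "has_spectrum (leray (div_tensor (u \<tau>)) $ l) (ns_spectrum g l)"
    using leray_spectrum[OF div_tensor_spectrum[OF v g]] unfolding ns_spectrum_def[abs_def] .
  show ?thesis unfolding duhamel_integrand_def heat_def
  proof (rule multiplier_spectrum(2)[OF has_spectrum_ft(2)[OF L] has_spectrum_ft(1)[OF L]])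
    show "wL1 (\<lambda>\<xi>. complex_of_real (exp (- \<mu> * (t - \<tau>) * (norm \<xi>)\<^sup>2)) * ns_spectrum g l \<xi>)"
      by (rule wL1_mult_bounded[where B=1]) (use L assms in \<open>auto simp: has_spectrum_def intro!: mult_nonneg_nonneg\<close>)
  qed measurable
qed

end

lemma integrable_gaussian:
  fixes c :: real assumes "c > 0"
  shows "integrable lborel (\<lambda>\<xi>::real^'n::finite. exp (- c * (norm \<xi>)\<^sup>2))"
proof -
  have "integrable lborel (\<lambda>\<xi>::real^'n. gauss (0 + sqrt (2 * c) *\<^sub>R \<xi>))"
    using assms by (intro integrable_affine gauss_integral) auto
  from integrable_norm[OF this] show ?thesis using assms by (simp add: gauss_def power_mult_distrib)
qed

lemma oseen_dist_spectrum:
  fixes M :: "real^'n::finite"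
  assumes "\<mu> > 0" "t > 0"
  shows "has_spectrum (oseen_dist \<mu> t M $ l) (\<lambda>\<xi>. complex_of_real (exp (- \<mu> * t * (norm \<xi>)\<^sup>2)) * (leray_symbol \<xi> *v cvec M) $ l)"
proof -
  let ?e = "\<lambda>\<xi>::real^'n. complex_of_real (exp (- \<mu> * t * (norm \<xi>)\<^sup>2))"
  let ?G = "\<lambda>\<xi>. ?e \<xi> * (leray_symbol \<xi> *v cvec M) $ l"
  have i: "integrable lborel (\<lambda>\<xi>. ?e \<xi> * leray_symbol \<xi> $ l $ m)" for m
    by (rule Bochner_Integration.integrable_bound[of _ "\<lambda>\<xi>. 2 * exp (- (\<mu> * t) * (norm \<xi>)\<^sup>2)"])
      (use assms leray_symbol_norm in \<open>auto simp: norm_mult mult.commute[of 2] intro!: AE_I2 mult_left_mono integrable_mult_right integrable_mult_left integrable_gaussian[of "\<mu> * t", simplified]\<close>)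
  have G: "?G = (\<lambda>\<xi>. \<Sum>m\<in>UNIV. cvec M $ m * (?e \<xi> * leray_symbol \<xi> $ l $ m))"
    by (auto simp: matrix_vector_mult_def sum_distrib_left mult_ac)
  have Gi: "integrable lborel ?G" unfolding G by (intro Bochner_Integration.integrable_sum integrable_mult_right i)
  have "(oseen \<mu> t x *v cvec M) $ l = inv_fourier ?G x" for x
    unfolding G inv_fourier_eq using i
    by (subst fourier_sum) (auto simp: matrix_vector_mult_def oseen_def inv_fourier_eq fourier_cmult mult.commute simp del: of_real_exp)
  then have e: "oseen_dist \<mu> t M $ l = regular_dist (inv_fourier ?G)" by (simp add: oseen_dist_def)
  show "has_spectrum (oseen_dist \<mu> t M $ l) ?G" unfolding e by (rule regular_dist_inv_fourier[OF Gi])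
qed

section \<open>Joint measurability of a time-dependent spectrum\<close>

abbreviation jointly_borel :: "('a::topological_space \<Rightarrow> 'b::topological_space \<Rightarrow> 'c::topological_space) \<Rightarrow> bool" where
  "jointly_borel f \<equiv> (\<lambda>(x, y). f x y) \<in> borel_measurable (borel \<Otimes>\<^sub>M borel)"

definition L1_spectrum :: "'n::finite dist \<Rightarrow> bool" where
  "L1_spectrum T \<longleftrightarrow> (\<exists>g. integrable lborel g \<and> has_spectrum T g)"

lemma L1_pairing_le:
  fixes g \<phi> :: "real^'n::finite \<Rightarrow> complex"
  assumes "integrable lborel g" "\<phi> \<in> borel_measurable borel" "\<And>x. norm (\<phi> x) \<le> B"
  shows "integrable lborel (\<lambda>x. g x * \<phi> x)"
    "norm (LINT x|lborel. g x * \<phi> x) \<le> (LINT x|lborel. norm (g x)) * B"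
proof -
  have [measurable]: "g \<in> borel_measurable borel" "\<phi> \<in> borel_measurable borel" using assms by auto
  have b: "norm (g x * \<phi> x) \<le> norm (g x) * B" for x unfolding norm_mult by (intro mult_left_mono assms) simp
  have i: "integrable lborel (\<lambda>x. norm (g x) * B)" using assms by simp
  show int: "integrable lborel (\<lambda>x. g x * \<phi> x)"
    by (rule Bochner_Integration.integrable_bound[OF i]) (simp, rule AE_I2, unfold real_norm_def, rule order_trans[OF b abs_ge_self])
  show "norm (LINT x|lborel. g x * \<phi> x) \<le> (LINT x|lborel. norm (g x)) * B"
    using order_trans[OF integral_norm_bound integral_mono[OF integrable_norm[OF int] i b]] by (simp only: integral_mult_left_zero)
qed

context bump
begin

text \<open>Whether the spectrum of \<open>T t\<close> is integrable can be decided, and the spectrum approximated, from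
  the countably many numbers \<open>T t (d j)\<close>, where \<open>d\<close> is dense. Hence the set of good times is measurable
  and there is a version of the spectrum that is measurable jointly in time and frequency.\<close>

lemma jointly_measurable_spectrum:
  fixes T :: "real \<Rightarrow> 'n dist"
  assumes T: "\<And>t. t > 0 \<Longrightarrow> T t \<in> tempered"
    and meas: "\<And>\<phi>. \<phi> \<in> schwartz \<Longrightarrow> (\<lambda>t. T t \<phi>) \<in> borel_measurable (restrict_space lborel {0<..})"
  shows "{t. t > 0 \<and> L1_spectrum (T t)} \<in> sets borel"
    and "\<exists>f. jointly_borel f \<and>
      (\<forall>t>0. L1_spectrum (T t) \<longrightarrow> integrable lborel (f t) \<and> has_spectrum (T t) (f t))"
proof -
  obtain d :: "nat \<Rightarrow> real^'n \<Rightarrow> complex" where d: "\<And>k. d k \<in> schwartz"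
    and dense: "\<And>\<phi> N e. \<phi> \<in> schwartz \<Longrightarrow> e > 0 \<Longrightarrow> \<exists>k. schwartz_seminorm N (\<lambda>x. d k x - \<phi> x) \<le> e"
    using schwartz_separable by blast
  obtain C1 N1 where C1: "C1 > 0" "\<And>(\<phi> :: real^'n \<Rightarrow> complex) \<xi>. \<phi> \<in> schwartz \<Longrightarrow>
     (1 + norm \<xi>) * norm (inv_fourier \<phi> \<xi>) \<le> C1 * schwartz_seminorm N1 \<phi>"
    using inv_fourier_weighted_bound by blast
  have inv_bd: "norm (inv_fourier \<phi> \<xi>) \<le> C1 * schwartz_seminorm N1 \<phi>" if "\<phi> \<in> schwartz" for \<phi> :: "real^'n \<Rightarrow> complex" and \<xi>
  proof -
    have "1 * norm (inv_fourier \<phi> \<xi>) \<le> (1 + norm \<xi>) * norm (inv_fourier \<phi> \<xi>)" by (intro mult_right_mono) auto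
    then show ?thesis using C1(2)[OF that, of \<xi>] by linarith
  qed
  define c where "c j = inv_fourier (d j)" for j
  have c: "c j \<in> schwartz" and Fc: "fourier (c j) = d j" for j
    unfolding c_def by (simp_all add: inv_fourier_schwartz fourier_inv_fourier d)
  have di: "integrable lborel (d m)" for m by (intro schwartz_integrable d)
  have [measurable]: "d m \<in> borel_measurable borel" "c m \<in> borel_measurable borel" for m
    by (intro schwartz_measurable d c)+
  define A where "A m \<phi> = (LINT x|lborel. d m x * \<phi> x)" for m \<phi>
  define T' where "T' t \<phi> = (if t > 0 then T t \<phi> else 0)" for t \<phi>
  have [measurable]: "(\<lambda>t. T' t \<phi>) \<in> borel_measurable borel" if "\<phi> \<in> schwartz" for \<phi>
  proof -
    have "(\<lambda>t. if t \<in> {0<..} then T t \<phi> else 0) \<in> borel_measurable lborel"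
      using meas[OF that] by (subst measurable_restrict_space_iff[symmetric]) auto
    then show ?thesis by (simp add: T'_def)
  qed
  \<comment> \<open>\<open>d m\<close> is close to the spectrum of \<open>T t\<close> in \<open>L\<^sup>1\<close>, as far as the countable family can tell\<close>
  define P where "P k m t \<longleftrightarrow> (\<forall>j. norm (T' t (d j) - A m (c j)) \<le> (1/2) ^ k * schwartz_seminorm 0 (c j))" for k m :: nat and t
  have [measurable]: "Measurable.pred borel (P k m)" for k m
    unfolding P_def using d by measurable
  \<comment> \<open>the inequality for the countable family extends to all Schwartz functions\<close>
  have P_extend: "norm (T t (fourier \<phi>) - A m \<phi>) \<le> (1/2) ^ k * B"
    if t: "t > 0" and P: "P k m t" and \<phi>: "\<phi> \<in> schwartz" and B: "\<And>x. norm (\<phi> x) \<le> B" for t k m \<phi> B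
  proof -
    obtain C N where C: "C > 0" "\<And>\<phi>. \<phi> \<in> schwartz \<Longrightarrow> norm (T t \<phi>) \<le> C * schwartz_seminorm N \<phi>"
      using tempered_bound[OF T[OF t]] by blast
    define D where "D = C + (1/2) ^ k * C1 + (LINT x|lborel. norm (d m x)) * C1"
    have D: "D > 0" unfolding D_def using C(1) C1(1) by (auto intro!: add_pos_nonneg)
    have F\<phi>: "fourier \<phi> \<in> schwartz" by (intro fourier_schwartz \<phi>)
    show ?thesis
    proof (rule field_le_epsilon)
      fix e :: real assume e: "e > 0"
      obtain j where j: "schwartz_seminorm (max N N1) (\<lambda>x. d j x - fourier \<phi> x) \<le> e / D"
        using dense[OF F\<phi>, of "e / D" "max N N1"] e D by auto
      let ?h = "\<lambda>x. d j x - fourier \<phi> x"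
      have h: "?h \<in> schwartz" by (intro schwartz_diff d F\<phi>)
      have hN: "schwartz_seminorm N ?h \<le> e / D" "schwartz_seminorm N1 ?h \<le> e / D"
        using seminorm_mono[OF h, of N "max N N1"] seminorm_mono[OF h, of N1 "max N N1"] j by auto
      have ch: "c j x - \<phi> x = inv_fourier ?h x" for x
      proof -
        have "c j x = inv_fourier (\<lambda>x. ?h x + fourier \<phi> x) x" by (simp add: c_def)
        also have "\<dots> = inv_fourier ?h x + inv_fourier (fourier \<phi>) x"
          by (intro inv_fourier_add schwartz_integrable h F\<phi>)
        finally show ?thesis by (simp add: inv_fourier_fourier \<phi>)
      qed
      have cb: "norm (c j x - \<phi> x) \<le> C1 * (e / D)" for x
        unfolding ch using order_trans[OF inv_bd[OF h] mult_left_mono[OF hN(2)]] C1(1) by simp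
      have 1: "norm (T t (d j) - T t (fourier \<phi>)) \<le> C * (e / D)"
        unfolding temperedD(3)[OF T[OF t] d F\<phi>, symmetric]
        using order_trans[OF C(2)[OF h] mult_left_mono[OF hN(1)]] C(1) by simp
      have 2: "norm (T t (d j) - A m (c j)) \<le> (1/2) ^ k * (B + C1 * (e / D))"
      proof -
        have "schwartz_seminorm 0 (c j) \<le> B + C1 * (e / D)"
        proof (rule seminorm_le)
          fix js :: "'n list" and x :: "real^'n" assume "length js \<le> 0"
          then show "(1 + norm x) ^ 0 * norm (iter_partial js (c j) x) \<le> B + C1 * (e / D)"
            using norm_triangle_ineq[of "\<phi> x" "c j x - \<phi> x"] B[of x] cb[of x] by simp
        qed
        then have "(1/2) ^ k * schwartz_seminorm 0 (c j) \<le> (1/2) ^ k * (B + C1 * (e / D))" by (intro mult_left_mono) auto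
        then show ?thesis using P t unfolding P_def T'_def by (auto intro: order_trans)
      qed
      have 3: "norm (A m (c j) - A m \<phi>) \<le> (LINT x|lborel. norm (d m x)) * (C1 * (e / D))"
      proof -
        have "A m (c j) - A m \<phi> = (LINT x|lborel. d m x * (c j x - \<phi> x))"
          unfolding A_def using L1_pairing_le(1)[OF di _ schwartz_bounded[OF c]] L1_pairing_le(1)[OF di _ schwartz_bounded[OF \<phi>]]
            schwartz_measurable[OF \<phi>]
          by (simp add: right_diff_distrib)
        then show ?thesis using L1_pairing_le(2)[OF di _ cb] schwartz_measurable[OF \<phi>] by simp
      qed
      have "T t (fourier \<phi>) - A m \<phi> = (T t (d j) - A m (c j)) - (T t (d j) - T t (fourier \<phi>)) + (A m (c j) - A m \<phi>)" by simp
      then have "norm (T t (fourier \<phi>) - A m \<phi>) \<le> norm (T t (d j) - A m (c j)) + norm (T t (d j) - T t (fourier \<phi>)) + norm (A m (c j) - A m \<phi>)"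
        using norm_triangle_ineq[of "(T t (d j) - A m (c j)) - (T t (d j) - T t (fourier \<phi>))" "A m (c j) - A m \<phi>"]
          norm_triangle_ineq4[of "T t (d j) - A m (c j)" "T t (d j) - T t (fourier \<phi>)"] by (simp only:)
      also have "\<dots> \<le> (1/2) ^ k * (B + C1 * (e / D)) + C * (e / D) + (LINT x|lborel. norm (d m x)) * (C1 * (e / D))"
        by (intro add_mono 1 2 3)
      also have "\<dots> = (1/2) ^ k * B + D * (e / D)" unfolding D_def by (simp only: distrib_left distrib_right mult.assoc add_ac)
      also have "\<dots> = (1/2) ^ k * B + e" using D by simp
      finally show "norm (T t (fourier \<phi>) - A m \<phi>) \<le> (1/2) ^ k * B + e" .
    qed
  qed
  have spectrum_P: "\<exists>m. P k m t" if t: "t > 0" and L: "L1_spectrum (T t)" for t k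
  proof -
    obtain g where g: "integrable lborel g" and sp: "has_spectrum (T t) g" using L by (auto simp: L1_spectrum_def)
    obtain C where C: "C > 0" "\<And>\<phi> :: real^'n \<Rightarrow> complex. \<phi> \<in> schwartz \<Longrightarrow> (LINT x|lborel. norm (\<phi> x)) \<le> C * schwartz_seminorm (CARD('n) + 1) \<phi>"
      using schwartz_L1_le_seminorm by blast
    let ?e = "(1/2) ^ k / (2::real)"
    obtain \<phi> where \<phi>: "\<phi> \<in> test_functions" "(LINT x|lborel. norm (g x - \<phi> x)) < ?e"
      using test_dense_L1[OF g, of ?e] by auto
    have \<phi>s: "\<phi> \<in> schwartz" by (rule test_schwartz[OF \<phi>(1)])
    obtain m where m: "schwartz_seminorm (CARD('n) + 1) (\<lambda>x. d m x - \<phi> x) \<le> ?e / C"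
      using dense[OF \<phi>s, of "?e / C"] C(1) by fastforce
    have i: "integrable lborel (\<lambda>x. g x - \<phi> x)" "integrable lborel (\<lambda>x. d m x - \<phi> x)" "integrable lborel (\<lambda>x. g x - d m x)"
      using g di schwartz_integrable[OF \<phi>s] by auto
    have "(LINT x|lborel. norm (d m x - \<phi> x)) \<le> C * (?e / C)"
      using order_trans[OF C(2)[OF schwartz_diff[OF d \<phi>s]] mult_left_mono[OF m]] C(1) by simp
    then have 2: "(LINT x|lborel. norm (d m x - \<phi> x)) \<le> ?e" using C(1) by simp
    have "(LINT x|lborel. norm (g x - d m x)) \<le> (LINT x|lborel. norm (g x - \<phi> x) + norm (d m x - \<phi> x))"
    proof (rule integral_mono)
      show "norm (g x - d m x) \<le> norm (g x - \<phi> x) + norm (d m x - \<phi> x)" for x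
        using norm_triangle_ineq4[of "g x - \<phi> x" "d m x - \<phi> x"] by simp
    qed (use i in auto)
    also have "\<dots> \<le> (1/2) ^ k" using i \<phi>(2) 2 by simp
    finally have b: "(LINT x|lborel. norm (g x - d m x)) \<le> (1/2) ^ k" .
    have "P k m t" unfolding P_def
    proof
      fix j
      have "T' t (d j) = (LINT x|lborel. g x * c j x)" using sp c[of j] t Fc[of j] by (metis T'_def has_spectrum_def)
      then have "T' t (d j) - A m (c j) = (LINT x|lborel. (g x - d m x) * c j x)"
        unfolding A_def using L1_pairing_le(1)[OF di _ schwartz_bounded[OF c]] L1_pairing_le(1)[OF g _ schwartz_bounded[OF c]]
        by (simp add: left_diff_distrib)
      then have "norm (T' t (d j) - A m (c j)) \<le> (LINT x|lborel. norm (g x - d m x)) * schwartz_seminorm 0 (c j)"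
        using L1_pairing_le(2)[OF i(3) _ schwartz_bounded[OF c[of j]]] by simp
      also have "\<dots> \<le> (1/2) ^ k * schwartz_seminorm 0 (c j)" by (intro mult_right_mono b seminorm_nonneg c)
      finally show "norm (T' t (d j) - A m (c j)) \<le> (1/2) ^ k * schwartz_seminorm 0 (c j)" .
    qed
    then show ?thesis by blast
  qed
  define n where "n k t = (LEAST m. P k m t)" for k t
  have [measurable]: "n k \<in> borel \<rightarrow>\<^sub>M count_space UNIV" for k unfolding n_def by measurable
  \<comment> \<open>the limit of \<open>d (n k t)\<close> as a series, which converges almost everywhere at the good times\<close>
  define f where "f t \<xi> = d (n 0 t) \<xi> + (\<Sum>k. d (n (Suc k) t) \<xi> - d (n k t) \<xi>)" for t \<xi>
  have fm: "jointly_borel f"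
  proof -
    have [measurable]: "(\<lambda>x. d (n k (fst x)) (snd x)) \<in> borel_measurable (borel \<Otimes>\<^sub>M borel)" for k
      by (rule measurable_compose_countable[where f="\<lambda>m x. d m (snd x)" and g="\<lambda>x. n k (fst x)"]) measurable
    show ?thesis unfolding f_def split_beta by measurable
  qed
  have P_spectrum: "integrable lborel (f t) \<and> has_spectrum (T t) (f t)" if t: "t > 0" and ex: "\<And>k. \<exists>m. P k m t" for t
  proof -
    let ?d = "\<lambda>k. d (n k t)" let ?D = "\<lambda>k x. d (n (Suc k) t) x - d (n k t) x"
    have P: "P k (n k t) t" for k unfolding n_def using ex[of k] by (rule LeastI_ex)
    have Di: "integrable lborel (?D k)" for k using di by simp
    have DL: "(LINT x|lborel. norm (?D k x)) \<le> 2 * (1/2) ^ k" for k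
    proof (rule L1_norm_le_by_testing[OF Di])
      fix \<phi> :: "real^'n \<Rightarrow> complex" assume \<phi>: "\<phi> \<in> test_functions" "\<And>x. norm (\<phi> x) \<le> 1"
      have \<phi>s: "\<phi> \<in> schwartz" by (rule test_schwartz[OF \<phi>(1)])
      have "(LINT x|lborel. ?D k x * \<phi> x) = (T t (fourier \<phi>) - A (n k t) \<phi>) - (T t (fourier \<phi>) - A (n (Suc k) t) \<phi>)"
        unfolding A_def using L1_pairing_le(1)[OF di _ \<phi>(2)] schwartz_measurable[OF \<phi>s] by (simp add: left_diff_distrib)
      also have "norm \<dots> \<le> (1/2) ^ k * 1 + (1/2) ^ Suc k * 1"
        by (rule order_trans[OF norm_triangle_ineq4 add_mono]) (intro P_extend t P \<phi>s \<phi>(2))+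
      also have "\<dots> \<le> 2 * (1/2) ^ k" by simp
      finally show "norm (LINT x|lborel. ?D k x * \<phi> x) \<le> 2 * (1/2) ^ k" .
    qed
    have sumD: "summable (\<lambda>k. LINT x|lborel. norm (?D k x))"
    proof (rule summable_comparison_test'[where N=0])
      show "summable (\<lambda>k. 2 * (1/2::real) ^ k)" by (intro summable_mult summable_geometric) simp
      show "norm (LINT x|lborel. norm (?D k x)) \<le> 2 * (1/2) ^ k" for k using DL[of k] by (simp add: integral_nonneg_AE)
    qed
    have AEsum: "AE x in lborel. summable (\<lambda>k. norm (?D k x))"
    proof -
      have "(\<integral>\<^sup>+x. (\<Sum>k. ennreal (norm (?D k x))) \<partial>lborel) = (\<Sum>k. \<integral>\<^sup>+x. ennreal (norm (?D k x)) \<partial>lborel)"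
        by (rule nn_integral_suminf) measurable
      also have "\<dots> = (\<Sum>k. ennreal (LINT x|lborel. norm (?D k x)))"
        using Di by (intro suminf_cong nn_integral_eq_integral) auto
      also have "\<dots> < \<infinity>" using sumD by (subst suminf_ennreal2) (auto intro: integral_nonneg_AE)
      finally have "AE x in lborel. (\<Sum>k. ennreal (norm (?D k x))) \<noteq> \<infinity>" by (intro nn_integral_noteq_infinite) auto
      then show ?thesis by eventually_elim (auto intro!: summable_suminf_not_top)
    qed
    have fi: "integrable lborel (f t)"
      unfolding f_def using di integrable_suminf[OF Di AEsum sumD] by simp
    have "T t (fourier \<phi>) = (LINT x|lborel. f t x * \<phi> x)" if \<phi>: "\<phi> \<in> schwartz" for \<phi>
    proof (rule LIMSEQ_unique)
      let ?B = "schwartz_seminorm 0 \<phi>"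
      have [measurable]: "\<phi> \<in> borel_measurable borel" by (rule schwartz_measurable[OF \<phi>])
      have "(\<lambda>k. A (n k t) \<phi> - T t (fourier \<phi>)) \<longlonglongrightarrow> 0"
      proof (rule Lim_null_comparison)
        show "\<forall>\<^sub>F k in sequentially. norm (A (n k t) \<phi> - T t (fourier \<phi>)) \<le> (1/2) ^ k * ?B"
          using P_extend[OF t P \<phi> schwartz_bounded[OF \<phi>]] by (auto simp: norm_minus_commute)
        show "(\<lambda>k. (1/2) ^ k * ?B) \<longlonglongrightarrow> 0" by (intro tendsto_mult_left_zero LIMSEQ_power_zero) simp
      qed
      then show "(\<lambda>k. A (n k t) \<phi>) \<longlonglongrightarrow> T t (fourier \<phi>)" by (simp add: LIM_zero_iff)
      show "(\<lambda>k. A (n k t) \<phi>) \<longlonglongrightarrow> (LINT x|lborel. f t x * \<phi> x)"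
        unfolding A_def
      proof (rule integral_dominated_convergence[where w="\<lambda>x. (norm (d (n 0 t) x) + (\<Sum>k. norm (?D k x))) * ?B"])
        have "integrable lborel (\<lambda>x. \<Sum>k. norm (?D k x))"
          by (rule integrable_suminf) (use Di AEsum sumD in auto)
        then show "integrable lborel (\<lambda>x. (norm (d (n 0 t) x) + (\<Sum>k. norm (?D k x))) * ?B)"
          by (intro integrable_mult_left Bochner_Integration.integrable_add integrable_norm di)
        have tele: "d (n k t) x = d (n 0 t) x + (\<Sum>i<k. ?D i x)" for k x using sum_lessThan_telescope[of "\<lambda>i. d (n i t) x" k] by simp
        show "AE x in lborel. (\<lambda>k. d (n k t) x * \<phi> x) \<longlonglongrightarrow> f t x * \<phi> x"
          using AEsum
        proof eventually_elim
          fix x assume "summable (\<lambda>k. norm (?D k x))"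
          then have "(\<lambda>k. \<Sum>i<k. ?D i x) \<longlonglongrightarrow> (\<Sum>k. ?D k x)" by (rule summable_LIMSEQ[OF summable_norm_cancel])
          then have "(\<lambda>k. (d (n 0 t) x + (\<Sum>i<k. ?D i x)) * \<phi> x) \<longlonglongrightarrow> f t x * \<phi> x"
            unfolding f_def by (intro tendsto_intros)
          moreover have "(\<lambda>k. (d (n 0 t) x + (\<Sum>i<k. ?D i x)) * \<phi> x) = (\<lambda>k. d (n k t) x * \<phi> x)"
            by (rule ext) (simp only: tele[symmetric])
          ultimately show "(\<lambda>k. d (n k t) x * \<phi> x) \<longlonglongrightarrow> f t x * \<phi> x" by (simp only:)
        qed
        show "AE x in lborel. norm (d (n k t) x * \<phi> x) \<le> (norm (d (n 0 t) x) + (\<Sum>k. norm (?D k x))) * ?B" for k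
          using AEsum
        proof eventually_elim
          fix x assume s: "summable (\<lambda>k. norm (?D k x))"
          have "norm (d (n 0 t) x + (\<Sum>i<k. ?D i x)) \<le> norm (d (n 0 t) x) + (\<Sum>i<k. norm (?D i x))"
            by (intro order_trans[OF norm_triangle_ineq] add_left_mono norm_sum)
          then have "norm (d (n k t) x) \<le> norm (d (n 0 t) x) + (\<Sum>i<k. norm (?D i x))" by (simp only: tele[symmetric])
          also have "\<dots> \<le> norm (d (n 0 t) x) + (\<Sum>k. norm (?D k x))" by (intro add_left_mono sum_le_suminf s) auto
          finally show "norm (d (n k t) x * \<phi> x) \<le> (norm (d (n 0 t) x) + (\<Sum>k. norm (?D k x))) * ?B"
            unfolding norm_mult by (intro mult_mono schwartz_bounded \<phi>) (auto intro!: add_nonneg_nonneg suminf_nonneg s)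
        qed
      qed (use fi in \<open>auto intro!: borel_measurable_times\<close>)
    qed
    then show ?thesis using fi by (auto simp: has_spectrum_def integrable_wL1)
  qed
  have "{t. t > 0 \<and> L1_spectrum (T t)} = {t. t > 0 \<and> (\<forall>k. \<exists>m. P k m t)}"
  proof (intro Collect_cong conj_cong refl iffI, goal_cases)
    case (1 t) then show ?case using spectrum_P by auto
  next
    case (2 t) then show ?case using P_spectrum[of t] unfolding L1_spectrum_def by blast
  qed
  also have "\<dots> = {t \<in> space borel. t > 0 \<and> (\<forall>k. \<exists>m. P k m t)}" by simp
  also have "\<dots> \<in> sets borel" by measurable
  finally show "{t. t > 0 \<and> L1_spectrum (T t)} \<in> sets borel" .
  show "\<exists>f. jointly_borel f \<and>
      (\<forall>t>0. L1_spectrum (T t) \<longrightarrow> integrable lborel (f t) \<and> has_spectrum (T t) (f t))"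
    using fm P_spectrum spectrum_P by blast
qed

end

section \<open>The Duhamel operator on nonnegative functions\<close>

definition nconv :: "('v::euclidean_space \<Rightarrow> ennreal) \<Rightarrow> ('v \<Rightarrow> ennreal) \<Rightarrow> 'v \<Rightarrow> ennreal" where
  "nconv f g \<xi> = (\<integral>\<^sup>+\<eta>. f \<eta> * g (\<xi> - \<eta>) \<partial>lborel)"

text \<open>Up to a bounded matrix, \<open>kern\<close> is the modulus of the symbol of the heat flow composed with the projected
  divergence.\<close>

definition kern :: "real \<Rightarrow> real \<Rightarrow> 'v::euclidean_space \<Rightarrow> ennreal" where
  "kern \<nu> \<sigma> \<xi> = ennreal (norm \<xi> * exp (- \<nu> * \<sigma> * (norm \<xi>)\<^sup>2))"

definition duh :: "real \<Rightarrow> (real \<Rightarrow> 'v::euclidean_space \<Rightarrow> ennreal) \<Rightarrow> real \<Rightarrow> 'v \<Rightarrow> ennreal" where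
  "duh \<nu> h t \<xi> = (\<integral>\<^sup>+\<tau>. indicator {0<..<t} \<tau> * kern \<nu> (t - \<tau>) \<xi> * h \<tau> \<xi> \<partial>lborel)"

abbreviation self_conv :: "(real \<Rightarrow> 'v::euclidean_space \<Rightarrow> ennreal) \<Rightarrow> real \<Rightarrow> 'v \<Rightarrow> ennreal" where
  "self_conv a \<equiv> \<lambda>\<tau>. nconv (a \<tau>) (a \<tau>)"

lemma kern_measurable [measurable (raw)]:
  assumes [measurable]: "f \<in> borel_measurable M" "g \<in> borel_measurable M"
  shows "(\<lambda>x. kern \<nu> (f x) (g x)) \<in> borel_measurable M"
  unfolding kern_def by measurable

lemma ennreal_power2_le_imp_le: "x\<^sup>2 \<le> y\<^sup>2 \<Longrightarrow> x \<le> y" for x y :: ennreal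
proof (rule ccontr)
  assume le: "x\<^sup>2 \<le> y\<^sup>2" and "\<not> x \<le> y"
  then have xy: "y < x" by simp
  then have y: "y < \<top>" by (rule less_le_trans) simp
  have "y * y < x * x"
  proof (cases x)
    case (real r)
    then obtain q where q: "y = ennreal q" "q \<ge> 0" using y by (cases y) auto
    then have "q < r" using xy real by (simp add: ennreal_less_iff)
    then show ?thesis using q real by (auto simp: ennreal_mult[symmetric] intro!: ennreal_lessI mult_strict_mono' mult_pos_pos)
  next
    case top
    then show ?thesis using y by (simp add: ennreal_mult_less_top ennreal_top_mult)
  qed
  then show False using le by (simp add: power2_eq_square)
qed

lemma ennreal_sum_square_le: "(x + y)\<^sup>2 \<le> 2 * x\<^sup>2 + 2 * y\<^sup>2" for x y :: ennreal
proof -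
  have "(x + y)\<^sup>2 = (x\<^sup>2 + y\<^sup>2) + 2 * x * y" by (simp add: power2_eq_square algebra_simps flip: mult_2)
  also have "\<dots> \<le> (x\<^sup>2 + y\<^sup>2) + (x\<^sup>2 + y\<^sup>2)" by (intro add_left_mono sum_of_squares_ge_ennreal)
  finally show ?thesis by (simp add: algebra_simps mult_2)
qed

lemma nconv_measurable [measurable (raw)]:
  fixes g :: "'a \<Rightarrow> 'v::euclidean_space"
  assumes [measurable]: "(\<lambda>(x, y). a x y) \<in> borel_measurable (M \<Otimes>\<^sub>M borel)" "(\<lambda>(x, y). b x y) \<in> borel_measurable (M \<Otimes>\<^sub>M borel)"
    "g \<in> borel_measurable M"
  shows "(\<lambda>x. nconv (a x) (b x) (g x)) \<in> borel_measurable M"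
  unfolding nconv_def by measurable

lemma nn_integral_nconv:
  assumes [measurable]: "f \<in> borel_measurable borel" "g \<in> borel_measurable borel"
  shows "(\<integral>\<^sup>+\<xi>. nconv f g \<xi> \<partial>lborel) = (\<integral>\<^sup>+\<eta>. f \<eta> \<partial>lborel) * (\<integral>\<^sup>+\<eta>. g \<eta> \<partial>lborel)"
proof -
  have "(\<integral>\<^sup>+\<xi>. nconv f g \<xi> \<partial>lborel) = (\<integral>\<^sup>+\<eta>. \<integral>\<^sup>+\<xi>. f \<eta> * g (\<xi> - \<eta>) \<partial>lborel \<partial>lborel)"
    unfolding nconv_def by (rule lborel_pair.Fubini') measurable
  also have "\<dots> = (\<integral>\<^sup>+\<eta>. f \<eta> * (\<integral>\<^sup>+\<xi>. g \<xi> \<partial>lborel) \<partial>lborel)"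
  proof (rule nn_integral_cong)
    fix \<eta>
    have "(\<integral>\<^sup>+\<xi>. g (\<xi> - \<eta>) \<partial>lborel) = (\<integral>\<^sup>+\<xi>. g \<xi> \<partial>lborel)" using nn_integral_affine[of g 1 "-\<eta>"] by simp
    then show "(\<integral>\<^sup>+\<xi>. f \<eta> * g (\<xi> - \<eta>) \<partial>lborel) = f \<eta> * (\<integral>\<^sup>+\<xi>. g \<xi> \<partial>lborel)"
      by (simp add: nn_integral_cmult)
  qed
  also have "\<dots> = (\<integral>\<^sup>+\<eta>. f \<eta> \<partial>lborel) * (\<integral>\<^sup>+\<eta>. g \<eta> \<partial>lborel)" by (rule nn_integral_multc) measurable
  finally show ?thesis .
qed

lemma AE_lborel_reflect:
  fixes \<xi> :: "'v::euclidean_space"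
  assumes "AE \<eta> in lborel. P \<eta>" shows "AE \<eta> in lborel. P (\<xi> - \<eta>)"
proof -
  have d: "distr lborel borel (\<lambda>x::'v. \<xi> + (-1) *\<^sub>R x) = lborel"
    using lborel_affine_density[of "-1" \<xi>] by (simp add: density_1)
  have "AE \<eta> in lborel. P (\<xi> + (-1) *\<^sub>R \<eta>)"
    by (rule AE_distrD[where f="\<lambda>x. \<xi> + (-1) *\<^sub>R x" and P=P and M'=borel]) (use assms in \<open>simp_all only: d, measurable\<close>)
  then show ?thesis by simp
qed

lemma kern_square: "(kern \<nu> \<sigma> \<xi>)\<^sup>2 = ennreal ((norm \<xi>)\<^sup>2 * exp (- (2 * \<nu> * \<sigma> * (norm \<xi>)\<^sup>2)))"
  by (simp add: kern_def ennreal_power power_mult_distrib exp_double[symmetric] mult_ac)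

lemma kern_square': "(kern \<nu> \<sigma> \<xi>)\<^sup>2 = ennreal ((norm \<xi>)\<^sup>2 * exp (- (2 * \<nu> * (norm \<xi>)\<^sup>2) * \<sigma>))"
proof -
  have "2 * \<nu> * \<sigma> * (norm \<xi>)\<^sup>2 = 2 * \<nu> * (norm \<xi>)\<^sup>2 * \<sigma>" by (simp only: mult_ac)
  then show ?thesis by (simp only: kern_square minus_mult_left)
qed

text \<open>The integral of the square over \<open>\<sigma> > 0\<close> is at most \<open>1 / (2 \<nu>)\<close> at every frequency: the factor \<open>|\<xi>|\<^sup>2\<close> from
  the derivative is compensated by the rate of decay. This is used with either of the two times as variable.\<close>

lemma kern_square_integral_past:
  assumes \<nu>: "\<nu> > 0"
  shows "(\<integral>\<^sup>+\<tau>. (indicator {0<..<t} \<tau> * kern \<nu> (t - \<tau>) \<xi>)\<^sup>2 \<partial>lborel) \<le> ennreal (1 / (2 * \<nu>))"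
proof (cases "0 < t")
  case True
  let ?c = "2 * \<nu> * (norm \<xi>)\<^sup>2"
  have "(\<integral>\<^sup>+\<tau>. (indicator {0<..<t} \<tau> * kern \<nu> (t - \<tau>) \<xi>)\<^sup>2 \<partial>lborel)
      \<le> (\<integral>\<^sup>+\<tau>. ennreal ((norm \<xi>)\<^sup>2 * exp (- ?c * (t - \<tau>))) * indicator {0..t} \<tau> \<partial>lborel)"
    by (rule nn_integral_mono) (simp add: power_mult_distrib kern_square' split: split_indicator del: minus_mult_left[symmetric] mult_minus_left)
  also have "\<dots> = ennreal (exp (- ?c * (t - t)) / (2 * \<nu>) - exp (- ?c * (t - 0)) / (2 * \<nu>))"
    by (rule nn_integral_FTC_Icc) (use True \<nu> in \<open>auto intro!: derivative_eq_intros simp: field_simps\<close>)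
  also have "\<dots> \<le> ennreal (1 / (2 * \<nu>))" using \<nu> by (intro ennreal_leI) simp
  finally show ?thesis .
qed simp

lemma kern_square_integral_future:
  assumes \<nu>: "\<nu> > 0"
  shows "(\<integral>\<^sup>+t. (indicator {\<tau><..} t * kern \<nu> (t - \<tau>) \<xi>)\<^sup>2 \<partial>lborel) \<le> ennreal (1 / (2 * \<nu>))"
proof (cases "\<xi> = 0")
  case False
  let ?c = "2 * \<nu> * (norm \<xi>)\<^sup>2"
  have c: "?c > 0" using \<nu> False by simp
  have "(\<integral>\<^sup>+t. (indicator {\<tau><..} t * kern \<nu> (t - \<tau>) \<xi>)\<^sup>2 \<partial>lborel)
      \<le> (\<integral>\<^sup>+t. ennreal ((norm \<xi>)\<^sup>2 * exp (- ?c * (t - \<tau>))) * indicator {\<tau>..} t \<partial>lborel)"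
    by (rule nn_integral_mono) (simp add: power_mult_distrib kern_square' split: split_indicator del: minus_mult_left[symmetric] mult_minus_left)
  also have "\<dots> = ennreal (0 - (- exp (- ?c * (\<tau> - \<tau>)) / (2 * \<nu>)))"
  proof (rule nn_integral_FTC_atLeast[where F="\<lambda>t. - exp (- ?c * (t - \<tau>)) / (2 * \<nu>)"])
    have "((\<lambda>t. - exp (- ?c * (t - \<tau>)) / (2 * \<nu>)) \<longlongrightarrow> - 0 / (2 * \<nu>)) at_top"
    proof (intro tendsto_intros)
      have "((\<lambda>t. exp (- k * (t - \<tau>))) \<longlongrightarrow> 0) at_top" if "k > 0" for k :: real using that by real_asymp
      from this[OF c] show "((\<lambda>t. exp (- ?c * (t - \<tau>))) \<longlongrightarrow> 0) at_top" .
    qed (use \<nu> in auto)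
    then show "((\<lambda>t. - exp (- ?c * (t - \<tau>)) / (2 * \<nu>)) \<longlongrightarrow> 0) at_top" by simp
  qed (use \<nu> in \<open>auto intro!: derivative_eq_intros simp: field_simps\<close>)
  also have "\<dots> = ennreal (1 / (2 * \<nu>))" by simp
  finally show ?thesis .
qed (simp add: kern_def)

text \<open>A form of Minkowski's integral inequality in \<open>L\<^sup>2\<close>: expand the square and use
  \<open>2 x y \<le> x\<^sup>2 + y\<^sup>2\<close> on the kernel.\<close>

lemma Minkowski_L2:
  fixes K :: "real \<Rightarrow> 'b::euclidean_space \<Rightarrow> ennreal"
  assumes [measurable]: "jointly_borel K" "H \<in> borel_measurable borel"
    and c: "\<And>y. (\<integral>\<^sup>+t. (K t y)\<^sup>2 \<partial>lborel) \<le> c"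
  shows "(\<integral>\<^sup>+t. (\<integral>\<^sup>+y. K t y * H y \<partial>lborel)\<^sup>2 \<partial>lborel) \<le> c * (\<integral>\<^sup>+y. H y \<partial>lborel)\<^sup>2"
proof -
  have KK: "(\<integral>\<^sup>+t. K t y * K t z \<partial>lborel) \<le> c" for y z
  proof -
    have "2 * (\<integral>\<^sup>+t. K t y * K t z \<partial>lborel) = (\<integral>\<^sup>+t. 2 * K t y * K t z \<partial>lborel)"
      by (subst nn_integral_cmult[symmetric]) (auto simp: mult.assoc)
    also have "\<dots> \<le> (\<integral>\<^sup>+t. (K t y)\<^sup>2 + (K t z)\<^sup>2 \<partial>lborel)"
      by (intro nn_integral_mono sum_of_squares_ge_ennreal)
    also have "\<dots> \<le> c + c" by (subst nn_integral_add) (auto intro: add_mono c)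
    also have "\<dots> = 2 * c" by (simp add: mult_2)
    finally show ?thesis by (subst (asm) ennreal_mult_le_mult_iff) auto
  qed
  have "(\<integral>\<^sup>+t. (\<integral>\<^sup>+y. K t y * H y \<partial>lborel)\<^sup>2 \<partial>lborel) =
      (\<integral>\<^sup>+t. \<integral>\<^sup>+y. \<integral>\<^sup>+z. (K t y * H y) * (K t z * H z) \<partial>lborel \<partial>lborel \<partial>lborel)"
    by (simp add: power2_eq_square nn_integral_cmult nn_integral_multc)
  also have "\<dots> = (\<integral>\<^sup>+y. \<integral>\<^sup>+t. \<integral>\<^sup>+z. (K t y * H y) * (K t z * H z) \<partial>lborel \<partial>lborel \<partial>lborel)"
    by (rule lborel_pair.Fubini') measurable
  also have "\<dots> = (\<integral>\<^sup>+y. \<integral>\<^sup>+z. \<integral>\<^sup>+t. (K t y * H y) * (K t z * H z) \<partial>lborel \<partial>lborel \<partial>lborel)"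
    by (intro nn_integral_cong lborel_pair.Fubini') measurable
  also have "\<dots> = (\<integral>\<^sup>+y. \<integral>\<^sup>+z. (H y * H z) * (\<integral>\<^sup>+t. K t y * K t z \<partial>lborel) \<partial>lborel \<partial>lborel)"
    by (intro nn_integral_cong, subst nn_integral_cmult[symmetric]) (auto simp: mult_ac)
  also have "\<dots> \<le> (\<integral>\<^sup>+y. \<integral>\<^sup>+z. (H y * H z) * c \<partial>lborel \<partial>lborel)"
    by (intro nn_integral_mono mult_left_mono KK) auto
  also have "\<dots> = c * (\<integral>\<^sup>+y. H y \<partial>lborel)\<^sup>2"
    by (simp add: power2_eq_square nn_integral_cmult nn_integral_multc mult_ac)
  finally show ?thesis .
qed

lemma duh_measurable [measurable (raw)]:
  assumes [measurable]: "(\<lambda>(\<tau>, \<xi>). h \<tau> \<xi>) \<in> borel_measurable (borel \<Otimes>\<^sub>M (borel :: 'v::euclidean_space measure))"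
    "f \<in> borel_measurable M" "g \<in> borel_measurable M"
  shows "(\<lambda>x. duh \<nu> h (f x) (g x)) \<in> borel_measurable M"
proof -
  have [measurable]: "Measurable.pred (M \<Otimes>\<^sub>M lborel) (\<lambda>x. snd x \<in> {0<..<f (fst x)})"
    unfolding greaterThanLessThan_iff by measurable
  show ?thesis unfolding duh_def by measurable
qed

text \<open>Minkowski's inequality, with the square integrability of the kernel in the later time.\<close>

lemma duh_L2L1:
  fixes h :: "real \<Rightarrow> 'v::euclidean_space \<Rightarrow> ennreal"
  assumes [measurable]: "jointly_borel h" and \<nu>: "\<nu> > 0"
  shows "(\<integral>\<^sup>+t. (\<integral>\<^sup>+\<xi>. duh \<nu> h t \<xi> \<partial>lborel)\<^sup>2 \<partial>lborel) \<le> ennreal (1 / (2 * \<nu>)) * (\<integral>\<^sup>+\<tau>. \<integral>\<^sup>+\<xi>. h \<tau> \<xi> \<partial>lborel \<partial>lborel)\<^sup>2"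
proof -
  let ?K = "\<lambda>t (y :: real \<times> 'v). indicator {fst y<..} t * kern \<nu> (t - fst y) (snd y)"
  let ?H = "\<lambda>y. indicator {0<..} (fst y) * h (fst y) (snd y)"
  have "(\<integral>\<^sup>+\<xi>. duh \<nu> h t \<xi> \<partial>lborel) = (\<integral>\<^sup>+y. ?K t y * ?H y \<partial>lborel)" for t
  proof -
    have [measurable]: "Measurable.pred borel (\<lambda>x. x \<in> {0<..<t})" by measurable
    have "(\<integral>\<^sup>+\<xi>. duh \<nu> h t \<xi> \<partial>lborel) = (\<integral>\<^sup>+\<tau>. \<integral>\<^sup>+\<xi>. indicator {0<..<t} \<tau> * kern \<nu> (t - \<tau>) \<xi> * h \<tau> \<xi> \<partial>lborel \<partial>lborel)"
      unfolding duh_def by (rule lborel_pair.Fubini') measurable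
    also have "\<dots> = (\<integral>\<^sup>+\<tau>. \<integral>\<^sup>+\<xi>. (\<lambda>y. ?K t y * ?H y) (\<tau>, \<xi>) \<partial>lborel \<partial>lborel)"
      by (intro nn_integral_cong) (auto simp: indicator_def)
    also have "\<dots> = (\<integral>\<^sup>+y. ?K t y * ?H y \<partial>(lborel \<Otimes>\<^sub>M lborel))"
    proof (rule lborel.nn_integral_fst)
      have "(\<lambda>y::real \<times> 'v. indicator {fst y<..} t * kern \<nu> (t - fst y) (snd y) * (indicator {0<..} (fst y) * h (fst y) (snd y))) =
        (\<lambda>y. indicator {..<t} (fst y) * kern \<nu> (t - fst y) (snd y) * (indicator {0<..} (fst y) * h (fst y) (snd y)))"
        by (auto simp: indicator_def)
      also have "\<dots> \<in> borel_measurable (lborel \<Otimes>\<^sub>M lborel)" by measurable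
      finally show "(\<lambda>y. ?K t y * ?H y) \<in> borel_measurable (lborel \<Otimes>\<^sub>M lborel)" .
    qed
    finally show ?thesis by (simp only: lborel_prod)
  qed
  then have "(\<integral>\<^sup>+t. (\<integral>\<^sup>+\<xi>. duh \<nu> h t \<xi> \<partial>lborel)\<^sup>2 \<partial>lborel) = (\<integral>\<^sup>+t. (\<integral>\<^sup>+y. ?K t y * ?H y \<partial>lborel)\<^sup>2 \<partial>lborel)" by simp
  also have "\<dots> \<le> ennreal (1 / (2 * \<nu>)) * (\<integral>\<^sup>+y. ?H y \<partial>lborel)\<^sup>2"
  proof (rule Minkowski_L2)
    have "(\<lambda>x::real \<times> (real \<times> 'v). ?K (fst x) (snd x)) = (\<lambda>x. (if fst (snd x) < fst x then 1 else 0) * kern \<nu> (fst x - fst (snd x)) (snd (snd x)))"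
      by (auto simp: indicator_def)
    also have "\<dots> \<in> borel_measurable (borel \<Otimes>\<^sub>M (borel \<Otimes>\<^sub>M borel))" by measurable
    finally show "jointly_borel ?K" by (simp add: split_beta borel_prod)
    show "?H \<in> borel_measurable borel" unfolding borel_prod[symmetric] by measurable
    show "(\<integral>\<^sup>+t. (?K t y)\<^sup>2 \<partial>lborel) \<le> ennreal (1 / (2 * \<nu>))" for y
      using kern_square_integral_future[OF \<nu>, of "fst y" "snd y"] by simp
  qed
  also have "(\<integral>\<^sup>+y. ?H y \<partial>lborel) = (\<integral>\<^sup>+\<tau>. \<integral>\<^sup>+\<xi>. ?H (\<tau>, \<xi>) \<partial>lborel \<partial>lborel)"
    unfolding lborel_prod[symmetric] by (rule lborel.nn_integral_fst[symmetric]) measurable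
  also have "\<dots> \<le> (\<integral>\<^sup>+\<tau>. \<integral>\<^sup>+\<xi>. h \<tau> \<xi> \<partial>lborel \<partial>lborel)"
    by (intro nn_integral_mono) (auto simp: indicator_def)
  finally show ?thesis by (simp add: power_mono mult_left_mono)
qed

text \<open>The Cauchy--Schwarz inequality, with the square integrability of the kernel in the earlier time.\<close>

lemma duh_sup:
  assumes [measurable]: "\<beta> \<in> borel_measurable borel" and \<nu>: "\<nu> > 0"
  shows "(duh \<nu> (\<lambda>\<tau> _. \<beta> \<tau>) t \<xi>)\<^sup>2 \<le> ennreal (1 / (2 * \<nu>)) * (\<integral>\<^sup>+\<tau>. (\<beta> \<tau>)\<^sup>2 \<partial>lborel)"
proof -
  have "(duh \<nu> (\<lambda>\<tau> _. \<beta> \<tau>) t \<xi>)\<^sup>2 \<le> (\<integral>\<^sup>+\<tau>. (indicator {0<..<t} \<tau> * kern \<nu> (t - \<tau>) \<xi>)\<^sup>2 \<partial>lborel) * (\<integral>\<^sup>+\<tau>. (\<beta> \<tau>)\<^sup>2 \<partial>lborel)"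
    unfolding duh_def by (rule Cauchy_Schwarz_nn_integral) measurable
  also have "\<dots> \<le> ennreal (1 / (2 * \<nu>)) * (\<integral>\<^sup>+\<tau>. (\<beta> \<tau>)\<^sup>2 \<partial>lborel)"
    by (intro mult_right_mono kern_square_integral_past \<nu>) auto
  finally show ?thesis .
qed

section \<open>A priori bound with exponential weight\<close>

text \<open>The square of the norm of \<open>L\<^sup>2\<close> in time with values in \<open>L\<^sup>1\<close>.\<close>

abbreviation L2L1 :: "(real \<Rightarrow> 'v::euclidean_space \<Rightarrow> ennreal) \<Rightarrow> ennreal" where
  "L2L1 a \<equiv> (\<integral>\<^sup>+t. indicator {0<..} t * (\<integral>\<^sup>+\<xi>. a t \<xi> \<partial>lborel)\<^sup>2 \<partial>lborel)"

text \<open>A continuity argument: the running integral of \<open>y\<close> starts at zero, depends continuously on the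
  endpoint, and cannot equal \<open>2 H\<close>, because \<open>H + K (2 H)\<^sup>2 < 2 H\<close>.\<close>

lemma quadratic_continuity:
  fixes y :: "real \<Rightarrow> ennreal"
  assumes [measurable]: "y \<in> borel_measurable borel" and fin: "(\<integral>\<^sup>+t. y t \<partial>lborel) < \<infinity>" and y0: "\<And>t. t \<le> 0 \<Longrightarrow> y t = 0"
    and H: "H > 0" and K: "K \<ge> 0" and HK: "4 * H * K < 1"
    and ineq: "\<And>T. (\<integral>\<^sup>+t. indicator {..T} t * y t \<partial>lborel) \<le> ennreal H + ennreal K * (\<integral>\<^sup>+t. indicator {..T} t * y t \<partial>lborel)\<^sup>2"
  shows "(\<integral>\<^sup>+t. y t \<partial>lborel) \<le> ennreal (2 * H)"
proof -
  define M where "M = density lborel y"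
  have em: "emeasure M A = (\<integral>\<^sup>+t. indicator A t * y t \<partial>lborel)" if "A \<in> sets borel" for A
    unfolding M_def using that by (subst emeasure_density) (auto simp: mult.commute)
  have "finite_measure M" by (rule finite_measureI) (use fin em[of UNIV] in \<open>simp add: M_def\<close>)
  then interpret finite_borel_measure M
    by (simp add: finite_borel_measure_def finite_borel_measure_axioms_def M_def)
  have "measure M {x} = 0" for x
  proof -
    have "AE t in lborel. indicator {x} t * y t = 0"
      using AE_lborel_singleton[of x] by eventually_elim (simp add: indicator_def)
    then have "emeasure M {x} = 0" by (subst em) (auto simp: nn_integral_0_iff_AE)
    then show ?thesis by (simp add: measure_def)
  qed
  then have cont: "isCont (cdf M) x" for x by (simp add: isCont_cdf)
  have cdf: "ennreal (cdf M T) = (\<integral>\<^sup>+t. indicator {..T} t * y t \<partial>lborel)" for T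
    unfolding cdf_def by (simp add: emeasure_eq_measure[symmetric] em)
  have cdf0: "cdf M 0 = 0"
  proof -
    have "(\<integral>\<^sup>+t. indicator {..0} t * y t \<partial>lborel) = 0" using y0 by (subst nn_integral_0_iff_AE) (auto simp: indicator_def)
    then show ?thesis using cdf[of 0] cdf_nonneg[of 0] by (simp del: ennreal_eq_0_iff add: ennreal_eq_0_iff)
  qed
  have le: "cdf M T \<le> 2 * H" for T
  proof (rule ccontr)
    assume gt: "\<not> cdf M T \<le> 2 * H"
    have "T > 0"
    proof (rule ccontr)
      assume "\<not> T > 0"
      then have "cdf M T \<le> cdf M 0" by (intro cdf_nondecreasing) auto
      then show False using gt cdf0 H by simp
    qed
    then obtain x where x: "cdf M x = 2 * H"
      using IVT'[of "cdf M" 0 "2 * H" T] gt cdf0 H cont by (auto intro: continuous_at_imp_continuous_on)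
    have "ennreal (cdf M x) \<le> ennreal H + ennreal K * (ennreal (cdf M x))\<^sup>2" using ineq[of x] by (simp only: cdf)
    then have "ennreal (2 * H) \<le> ennreal (H + K * (2 * H)\<^sup>2)"
      using H K by (simp add: x ennreal_power ennreal_mult[symmetric])
    then have "2 * H \<le> H + K * (2 * H)\<^sup>2" using H K by (subst (asm) ennreal_le_iff) auto
    also have "\<dots> = H * (1 + 4 * H * K)" by (simp add: power2_eq_square algebra_simps)
    also have "\<dots> < H * 2" using H HK by (intro mult_strict_left_mono) auto
    finally show False by simp
  qed
  have "measure M (space M) \<le> 2 * H"
    by (rule tendsto_upperbound[OF cdf_lim_at_top]) (use le in auto)
  moreover have "(\<integral>\<^sup>+t. y t \<partial>lborel) = ennreal (measure M (space M))"
    using em[of UNIV] by (simp add: emeasure_eq_measure[symmetric]) (simp add: M_def)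
  ultimately show ?thesis by (simp add: ennreal_leI)
qed

text \<open>The weight grows like \<open>exp (sqrt (\<mu> t) * norm \<xi>)\<close>. It is truncated at frequency \<open>R\<close> so that the norms
  below are finite from the start; the truncation keeps it submultiplicative.\<close>

definition wt :: "real \<Rightarrow> real \<Rightarrow> real \<Rightarrow> 'v::euclidean_space \<Rightarrow> real" where
  "wt \<mu> R t \<xi> = exp (sqrt (\<mu> * t) * min (norm \<xi>) R)"

lemma wt_measurable [measurable (raw)]:
  assumes [measurable]: "f \<in> borel_measurable M" "g \<in> borel_measurable M"
  shows "(\<lambda>x. wt \<mu> R (f x) (g x)) \<in> borel_measurable M"
  unfolding wt_def by measurable

lemma wt_submult:
  assumes "R \<ge> 0" "\<mu> \<ge> 0" "t \<ge> 0"
  shows "wt \<mu> R t \<xi> \<le> wt \<mu> R t \<eta> * wt \<mu> R t (\<xi> - \<eta>)"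
proof -
  have "norm \<xi> \<le> norm \<eta> + norm (\<xi> - \<eta>)" by (metis add.commute norm_triangle_sub)
  then have "min (norm \<xi>) R \<le> min (norm \<eta>) R + min (norm (\<xi> - \<eta>)) R" using assms(1) norm_ge_zero[of \<eta>] norm_ge_zero[of "\<xi> - \<eta>"] by linarith
  then have "sqrt (\<mu> * t) * min (norm \<xi>) R \<le> sqrt (\<mu> * t) * (min (norm \<eta>) R + min (norm (\<xi> - \<eta>)) R)"
    using assms by (intro mult_left_mono) auto
  then show ?thesis by (simp add: wt_def exp_add[symmetric] distrib_left)
qed

lemma sqrt_diff_le:
  assumes "0 \<le> \<tau>" "\<tau> \<le> t" "\<mu> \<ge> 0"
  shows "sqrt (\<mu> * t) \<le> sqrt (\<mu> * \<tau>) + sqrt (\<mu> * (t - \<tau>))"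
  using sqrt_add_le_add_sqrt[of "\<mu> * \<tau>" "\<mu> * (t - \<tau>)"] assms by (simp add: distrib_left[symmetric])

text \<open>Half of the heat kernel absorbs the growth of the weight between the times \<open>\<tau>\<close> and \<open>t\<close>.\<close>

lemma wt_heat:
  assumes "0 \<le> \<tau>" "\<tau> \<le> t" "\<mu> > 0"
  shows "wt \<mu> R t \<xi> * exp (- \<mu> * (t - \<tau>) * (norm \<xi>)\<^sup>2) \<le> exp (1/2) * (wt \<mu> R \<tau> \<xi> * exp (- (\<mu>/2) * (t - \<tau>) * (norm \<xi>)\<^sup>2))"
proof -
  let ?m = "min (norm \<xi>) R" let ?s = "sqrt (\<mu> * (t - \<tau>))"
  have "?s * ?m \<le> ?s * norm \<xi>" using assms by (intro mult_left_mono) auto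
  also have "\<dots> \<le> 1/2 + (?s * norm \<xi>)\<^sup>2 / 2" using sum_squares_bound[of "?s * norm \<xi>" 1] by simp
  also have "(?s * norm \<xi>)\<^sup>2 = \<mu> * (t - \<tau>) * (norm \<xi>)\<^sup>2" using assms by (simp add: power_mult_distrib)
  finally have 1: "?s * ?m \<le> 1/2 + \<mu> * (t - \<tau>) * (norm \<xi>)\<^sup>2 / 2" .
  have "sqrt (\<mu> * t) * ?m \<le> sqrt (\<mu> * \<tau>) * ?m + (1/2 + \<mu> * (t - \<tau>) * (norm \<xi>)\<^sup>2 / 2)"
  proof (cases "?m \<ge> 0")
    case True
    then have "sqrt (\<mu> * t) * ?m \<le> (sqrt (\<mu> * \<tau>) + ?s) * ?m" using assms by (intro mult_right_mono sqrt_diff_le) auto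
    then show ?thesis using 1 by (simp add: distrib_right)
  next
    case False
    then have "sqrt (\<mu> * t) * ?m \<le> sqrt (\<mu> * \<tau>) * ?m" using assms by (intro mult_right_mono_neg) auto
    moreover have "0 \<le> \<mu> * (t - \<tau>) * (norm \<xi>)\<^sup>2" using assms by auto
    ultimately show ?thesis by simp
  qed
  then show ?thesis by (simp add: wt_def exp_add[symmetric])
qed

text \<open>The weight at time \<open>t\<close> is first replaced by that at time \<open>\<tau>\<close>, at the expense of half of the heat kernel,
  and then distributed over the two factors of the convolution.\<close>

lemma weighted_inequality:
  fixes a :: "real \<Rightarrow> 'v::euclidean_space \<Rightarrow> ennreal" and K0 :: real
  assumes \<mu>: "\<mu> > 0" and K0: "K0 \<ge> 0" and R: "R \<ge> 0" and t: "0 < t" "t < T"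
    and I: "a t \<xi> \<le> ennreal (exp (- \<mu> * t * (norm \<xi>)\<^sup>2)) * a0 \<xi> + ennreal K0 * duh \<mu> (self_conv a) t \<xi>"
    and b: "b = (\<lambda>t \<xi>. indicator {0<..<T} t * ennreal (wt \<mu> R t \<xi>) * a t \<xi>)"
    and [measurable]: "jointly_borel a"
  shows "b t \<xi> \<le> ennreal (exp (1/2)) * (ennreal (exp (- (\<mu>/2) * t * (norm \<xi>)\<^sup>2)) * a0 \<xi> + ennreal K0 * duh (\<mu>/2) (self_conv b) t \<xi>)"
proof -
  let ?w = "\<lambda>t \<xi>. ennreal (wt \<mu> R t \<xi>)" let ?e = "ennreal (exp (1/2))"
  have 1: "?w t \<xi> * ennreal (exp (- \<mu> * t * (norm \<xi>)\<^sup>2)) \<le> ?e * ennreal (exp (- (\<mu>/2) * t * (norm \<xi>)\<^sup>2))"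
    using wt_heat[of 0 t \<mu> R \<xi>] t \<mu> by (auto simp: ennreal_mult[symmetric] wt_def intro!: ennreal_leI)
  have 2: "?w t \<xi> * duh \<mu> (self_conv a) t \<xi> \<le> ?e * duh (\<mu>/2) (self_conv b) t \<xi>"
  proof -
    have [measurable]: "jointly_borel b" unfolding b split_beta by measurable
    have "?w t \<xi> * duh \<mu> (self_conv a) t \<xi> = (\<integral>\<^sup>+\<tau>. ?w t \<xi> * (indicator {0<..<t} \<tau> * kern \<mu> (t - \<tau>) \<xi> * nconv (a \<tau>) (a \<tau>) \<xi>) \<partial>lborel)"
      unfolding duh_def by (rule nn_integral_cmult[symmetric]) measurable
    also have "\<dots> \<le> (\<integral>\<^sup>+\<tau>. ?e * (indicator {0<..<t} \<tau> * kern (\<mu>/2) (t - \<tau>) \<xi> * nconv (b \<tau>) (b \<tau>) \<xi>) \<partial>lborel)"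
    proof (rule nn_integral_mono)
      fix \<tau>
      show "?w t \<xi> * (indicator {0<..<t} \<tau> * kern \<mu> (t - \<tau>) \<xi> * nconv (a \<tau>) (a \<tau>) \<xi>)
          \<le> ?e * (indicator {0<..<t} \<tau> * kern (\<mu>/2) (t - \<tau>) \<xi> * nconv (b \<tau>) (b \<tau>) \<xi>)"
      proof (cases "0 < \<tau> \<and> \<tau> < t")
        case True
        have k: "?w t \<xi> * kern \<mu> (t - \<tau>) \<xi> \<le> ?e * kern (\<mu>/2) (t - \<tau>) \<xi> * ?w \<tau> \<xi>"
        proof -
          have "norm \<xi> * (wt \<mu> R t \<xi> * exp (- \<mu> * (t - \<tau>) * (norm \<xi>)\<^sup>2)) \<le> norm \<xi> * (exp (1/2) * (wt \<mu> R \<tau> \<xi> * exp (- (\<mu>/2) * (t - \<tau>) * (norm \<xi>)\<^sup>2)))"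
            using True \<mu> by (intro mult_left_mono wt_heat) auto
          then show ?thesis unfolding kern_def
            by (auto simp: ennreal_mult[symmetric] wt_def mult_ac intro!: ennreal_leI)
        qed
        have c: "?w \<tau> \<xi> * nconv (a \<tau>) (a \<tau>) \<xi> \<le> nconv (b \<tau>) (b \<tau>) \<xi>"
        proof -
          have "?w \<tau> \<xi> * nconv (a \<tau>) (a \<tau>) \<xi> = (\<integral>\<^sup>+\<eta>. ?w \<tau> \<xi> * (a \<tau> \<eta> * a \<tau> (\<xi> - \<eta>)) \<partial>lborel)"
            unfolding nconv_def by (rule nn_integral_cmult[symmetric]) measurable
          also have "\<dots> \<le> (\<integral>\<^sup>+\<eta>. b \<tau> \<eta> * b \<tau> (\<xi> - \<eta>) \<partial>lborel)"
          proof (rule nn_integral_mono)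
            fix \<eta>
            have "?w \<tau> \<xi> \<le> ?w \<tau> \<eta> * ?w \<tau> (\<xi> - \<eta>)"
              using wt_submult[of R \<mu> \<tau> \<xi> \<eta>] R \<mu> True by (auto simp: ennreal_mult[symmetric] wt_def intro!: ennreal_leI)
            then have "?w \<tau> \<xi> * (a \<tau> \<eta> * a \<tau> (\<xi> - \<eta>)) \<le> (?w \<tau> \<eta> * ?w \<tau> (\<xi> - \<eta>)) * (a \<tau> \<eta> * a \<tau> (\<xi> - \<eta>))"
              by (intro mult_right_mono) auto
            then show "?w \<tau> \<xi> * (a \<tau> \<eta> * a \<tau> (\<xi> - \<eta>)) \<le> b \<tau> \<eta> * b \<tau> (\<xi> - \<eta>)"
              using True t by (simp add: b mult_ac)
          qed
          finally show ?thesis by (simp add: nconv_def)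
        qed
        have "?w t \<xi> * (kern \<mu> (t - \<tau>) \<xi> * nconv (a \<tau>) (a \<tau>) \<xi>) \<le> (?e * kern (\<mu>/2) (t - \<tau>) \<xi> * ?w \<tau> \<xi>) * nconv (a \<tau>) (a \<tau>) \<xi>"
          using mult_right_mono[OF k, of "nconv (a \<tau>) (a \<tau>) \<xi>"] by (simp add: mult.assoc)
        also have "\<dots> \<le> (?e * kern (\<mu>/2) (t - \<tau>) \<xi>) * nconv (b \<tau>) (b \<tau>) \<xi>"
          unfolding mult.assoc[of _ "?w \<tau> \<xi>"] by (intro mult_left_mono c) auto
        finally show ?thesis using True by (simp add: mult_ac)
      qed (auto simp: indicator_def)
    qed
    also have "\<dots> = ?e * duh (\<mu>/2) (self_conv b) t \<xi>"
      unfolding duh_def by (rule nn_integral_cmult) measurable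
    finally show ?thesis .
  qed
  have "b t \<xi> = ?w t \<xi> * a t \<xi>" using t by (simp add: b)
  also have "\<dots> \<le> ?w t \<xi> * (ennreal (exp (- \<mu> * t * (norm \<xi>)\<^sup>2)) * a0 \<xi> + ennreal K0 * duh \<mu> (self_conv a) t \<xi>)"
    by (intro mult_left_mono I) auto
  also have "\<dots> = (?w t \<xi> * ennreal (exp (- \<mu> * t * (norm \<xi>)\<^sup>2))) * a0 \<xi> + ennreal K0 * (?w t \<xi> * duh \<mu> (self_conv a) t \<xi>)"
    by (simp add: distrib_left mult_ac)
  also have "\<dots> \<le> (?e * ennreal (exp (- (\<mu>/2) * t * (norm \<xi>)\<^sup>2))) * a0 \<xi> + ennreal K0 * (?e * duh (\<mu>/2) (self_conv b) t \<xi>)"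
    by (intro add_mono mult_right_mono mult_left_mono 1 2) auto
  finally show ?thesis by (simp add: distrib_left mult_ac)
qed

lemma ennreal_absorb:
  fixes x :: ennreal
  assumes "x \<le> ennreal q * x" "q < 1" "x < \<infinity>" shows "x = 0"
proof (cases x)
  case (real r)
  have "r \<le> \<bar>q\<bar> * r \<or> q < 0"
  proof (cases "q < 0")
    case False
    then have "ennreal r \<le> ennreal (q * r)" using assms(1) real by (simp add: ennreal_mult)
    then show ?thesis using False real by (auto simp: ennreal_le_iff)
  qed simp
  then show ?thesis
  proof
    assume "r \<le> \<bar>q\<bar> * r"
    show ?thesis
    proof (cases "q < 0")
      case True then show ?thesis using assms(1) by (simp add: ennreal_neg)
    next
      case False
      then have "0 \<le> (q - 1) * r" using \<open>r \<le> \<bar>q\<bar> * r\<close> by (simp add: left_diff_distrib)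
      then have "r \<le> 0" using assms(2) by (simp add: zero_le_mult_iff)
      then show ?thesis using real by simp
    qed
  qed (use assms(1) in \<open>simp add: ennreal_neg\<close>)
qed (use assms in simp)

text \<open>The a priori bound on a bounded time interval, for the truncated weight. The linear inequality
  satisfied by the excess over the bound is contractive in \<open>L\<^sup>2(L\<^sup>1)\<close>, where the excess is known to be
  finite; so the excess vanishes.\<close>

lemma weighted_bound:
  fixes a :: "real \<Rightarrow> 'v::euclidean_space \<Rightarrow> ennreal" and A K0 H0 \<mu> :: real
  assumes a [measurable]: "jointly_borel a"
    and a0 [measurable]: "a0 \<in> borel_measurable borel"
    and \<mu>: "\<mu> > 0" and K0: "K0 \<ge> 0" and H0: "H0 > 0" and A: "A \<ge> 0" and R: "R \<ge> 0"
    and a0A: "AE \<xi> in lborel. a0 \<xi> \<le> ennreal A"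
    and fin: "L2L1 a < \<infinity>"
    and lin: "L2L1 (\<lambda>t \<xi>. ennreal (exp (- (\<mu>/2) * t * (norm \<xi>)\<^sup>2)) * a0 \<xi>) \<le> ennreal H0"
    and small: "16 * exp 2 * K0\<^sup>2 * H0 < \<mu>"
    and I: "AE t in lborel. t > 0 \<longrightarrow> (AE \<xi> in lborel. a t \<xi> \<le>
       ennreal (exp (- \<mu> * t * (norm \<xi>)\<^sup>2)) * a0 \<xi> + ennreal K0 * duh \<mu> (self_conv a) t \<xi>)"
  shows "AE t in lborel. AE \<xi> in lborel. indicator {0<..<T} t * ennreal (wt \<mu> R t \<xi>) * a t \<xi> \<le> ennreal (2 * exp (1/2) * A)"
proof -
  define b where "b = (\<lambda>t \<xi>. indicator {0<..<T} t * ennreal (wt \<mu> R t \<xi>) * a t \<xi>)"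
  have [measurable]: "jointly_borel b"
    unfolding b_def split_beta by measurable
  let ?e = "exp (1/2) :: real" let ?\<nu> = "\<mu> / 2"
  have e2: "?e * ?e = exp 1" "?e\<^sup>2 = exp 1" by (simp_all add: exp_add[symmetric] power2_eq_square)
  have \<nu>: "?\<nu> > 0" "1 / (2 * ?\<nu>) = 1 / \<mu>" using \<mu> by auto
  define hl where "hl t \<xi> = ennreal (exp (- ?\<nu> * t * (norm \<xi>)\<^sup>2)) * a0 \<xi>" for t and \<xi> :: 'v
  have [measurable]: "jointly_borel hl"
    unfolding hl_def split_beta by measurable
  define nb where "nb t = (\<integral>\<^sup>+\<xi>. b t \<xi> \<partial>lborel)" for t
  let ?B = "(\<integral>\<^sup>+t. (nb t)\<^sup>2 \<partial>lborel)"
  have [measurable]: "nb \<in> borel_measurable borel" unfolding nb_def by measurable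
  define bb where "bb = (self_conv b)"
  have [measurable]: "jointly_borel bb"
    unfolding bb_def split_beta by measurable
  have W: "AE t in lborel. 0 < t \<and> t < T \<longrightarrow> (AE \<xi> in lborel. b t \<xi> \<le> ennreal ?e * (hl t \<xi> + ennreal K0 * duh ?\<nu> bb t \<xi>))"
    using I
  proof eventually_elim
    case (elim t)
    show ?case
    proof
      assume t: "0 < t \<and> t < T"
      with elim have "AE \<xi> in lborel. a t \<xi> \<le> ennreal (exp (- \<mu> * t * (norm \<xi>)\<^sup>2)) * a0 \<xi> + ennreal K0 * duh \<mu> (self_conv a) t \<xi>" by simp
      then show "AE \<xi> in lborel. b t \<xi> \<le> ennreal ?e * (hl t \<xi> + ennreal K0 * duh ?\<nu> bb t \<xi>)"
      proof eventually_elim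
        case (elim \<xi>)
        show ?case unfolding hl_def bb_def
          by (rule weighted_inequality[where a=a and b=b and T=T and R=R]) (use t elim \<mu> K0 R b_def a in auto)
      qed
    qed
  qed
  have b0: "b t \<xi> = 0" if "\<not> (0 < t \<and> t < T)" for t \<xi> using that by (auto simp: b_def)
  have nb0: "nb t = 0" if "\<not> (0 < t \<and> t < T)" for t using b0[OF that] by (simp add: nb_def)
  have yfin: "?B < \<infinity>"
  proof -
    let ?w = "exp (sqrt (\<mu> * T) * R)"
    have "(nb t)\<^sup>2 \<le> ennreal (?w\<^sup>2) * (indicator {0<..} t * (\<integral>\<^sup>+\<xi>. a t \<xi> \<partial>lborel)\<^sup>2)" for t
    proof (cases "0 < t \<and> t < T")
      case True
      have "wt \<mu> R t \<xi> \<le> ?w" for \<xi> :: 'v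
      proof -
        have "sqrt (\<mu> * t) * min (norm \<xi>) R \<le> sqrt (\<mu> * T) * R"
          using True \<mu> R by (intro mult_mono) auto
        then show ?thesis by (simp add: wt_def)
      qed
      then have "nb t \<le> (\<integral>\<^sup>+\<xi>. ennreal ?w * a t \<xi> \<partial>lborel)" unfolding nb_def b_def using True
        by (intro nn_integral_mono) (auto intro!: mult_right_mono ennreal_leI)
      also have "\<dots> = ennreal ?w * (\<integral>\<^sup>+\<xi>. a t \<xi> \<partial>lborel)" by (rule nn_integral_cmult) measurable
      finally have "(nb t)\<^sup>2 \<le> (ennreal ?w * (\<integral>\<^sup>+\<xi>. a t \<xi> \<partial>lborel))\<^sup>2" by (rule power_mono) simp
      then show ?thesis using True by (simp add: power_mult_distrib ennreal_power)
    qed (simp add: nb0)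
    then have "?B \<le> (\<integral>\<^sup>+t. ennreal (?w\<^sup>2) * (indicator {0<..} t * (\<integral>\<^sup>+\<xi>. a t \<xi> \<partial>lborel)\<^sup>2) \<partial>lborel)"
      by (rule nn_integral_mono)
    also have "\<dots> = ennreal (?w\<^sup>2) * L2L1 a"
      by (rule nn_integral_cmult) measurable
    also have "\<dots> < \<infinity>" using fin by (simp add: ennreal_mult_less_top)
    finally show ?thesis .
  qed
  define Y where "Y = 4 * exp 1 * H0"
  have Y: "?B \<le> ennreal Y"
  proof -
    have "?B \<le> ennreal (2 * (2 * exp 1 * H0))"
    proof (rule quadratic_continuity[where K="2 * exp 1 * K0\<^sup>2 / \<mu>"])
      show "4 * (2 * exp 1 * H0) * (2 * exp 1 * K0\<^sup>2 / \<mu>) < 1"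
      proof -
        have "exp 1 * exp 1 = (exp 2 :: real)" by (simp add: exp_add[symmetric])
        moreover have "4 * (2 * exp 1 * H0) * (2 * exp 1 * K0\<^sup>2 / \<mu>) = 16 * (exp 1 * exp 1) * K0\<^sup>2 * H0 / \<mu>" by simp
        ultimately have "4 * (2 * exp 1 * H0) * (2 * exp 1 * K0\<^sup>2 / \<mu>) = 16 * exp 2 * K0\<^sup>2 * H0 / \<mu>" by (simp only:)
        moreover have "16 * exp 2 * K0\<^sup>2 * H0 / \<mu> < 1" using small \<mu> by (simp only: pos_divide_less_eq mult_1_left)
        ultimately show ?thesis by (simp only:)
      qed
      fix T'
      let ?B' = "(\<integral>\<^sup>+t. indicator {..T'} t * (nb t)\<^sup>2 \<partial>lborel)"
      define h where "h = (\<lambda>\<tau> \<xi>. indicator {..T'} \<tau> * bb \<tau> \<xi>)"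
      have [measurable]: "jointly_borel h"
        unfolding h_def split_beta by measurable
      let ?L = "\<lambda>t. indicator {0<..} t * (\<integral>\<^sup>+\<xi>. hl t \<xi> \<partial>lborel)"
      let ?D = "\<lambda>t. \<integral>\<^sup>+\<xi>. duh ?\<nu> h t \<xi> \<partial>lborel"
      have pt: "AE t in lborel. indicator {..T'} t * (nb t)\<^sup>2 \<le> ennreal (2 * exp 1) * (?L t)\<^sup>2 + ennreal (2 * exp 1 * K0\<^sup>2) * (?D t)\<^sup>2"
        using W
      proof eventually_elim
        case (elim t)
        show ?case
        proof (cases "0 < t \<and> t < T \<and> t \<le> T'")
          case True
          have dh: "duh ?\<nu> bb t \<xi> = duh ?\<nu> h t \<xi>" for \<xi>
            unfolding duh_def h_def using True by (intro nn_integral_cong) (auto simp: indicator_def)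
          have "nb t \<le> (\<integral>\<^sup>+\<xi>. ennreal ?e * (hl t \<xi> + ennreal K0 * duh ?\<nu> h t \<xi>) \<partial>lborel)"
            unfolding nb_def using elim True by (intro nn_integral_mono_AE) (simp add: dh)
          also have "\<dots> = ennreal ?e * (?L t + ennreal K0 * ?D t)"
            using True by (simp add: nn_integral_cmult nn_integral_add)
          finally have "(nb t)\<^sup>2 \<le> (ennreal ?e * (?L t + ennreal K0 * ?D t))\<^sup>2" by (rule power_mono) simp
          also have "\<dots> = ennreal (exp 1) * (?L t + ennreal K0 * ?D t)\<^sup>2"
            by (simp only: power_mult_distrib) (simp add: ennreal_power e2)
          also have "\<dots> \<le> ennreal (exp 1) * (2 * (?L t)\<^sup>2 + 2 * (ennreal K0 * ?D t)\<^sup>2)"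
            by (intro mult_left_mono ennreal_sum_square_le) simp
          also have "\<dots> = ennreal (2 * exp 1) * (?L t)\<^sup>2 + ennreal (2 * exp 1 * K0\<^sup>2) * (?D t)\<^sup>2"
            using K0 by (simp add: distrib_left power_mult_distrib ennreal_mult ennreal_power mult_ac)
          finally show ?thesis using True by simp
        qed (use nb0[of t] in \<open>auto simp: indicator_def\<close>)
      qed
      have "?B' \<le> (\<integral>\<^sup>+t. ennreal (2 * exp 1) * (?L t)\<^sup>2 + ennreal (2 * exp 1 * K0\<^sup>2) * (?D t)\<^sup>2 \<partial>lborel)"
        by (rule nn_integral_mono_AE[OF pt])
      also have "\<dots> = ennreal (2 * exp 1) * (\<integral>\<^sup>+t. (?L t)\<^sup>2 \<partial>lborel) + ennreal (2 * exp 1 * K0\<^sup>2) * (\<integral>\<^sup>+t. (?D t)\<^sup>2 \<partial>lborel)"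
        by (subst nn_integral_add) (auto simp: nn_integral_cmult)
      also have "\<dots> \<le> ennreal (2 * exp 1) * ennreal H0 + ennreal (2 * exp 1 * K0\<^sup>2) * (ennreal (1 / \<mu>) * ?B'\<^sup>2)"
      proof (intro add_mono mult_left_mono)
        have "(\<integral>\<^sup>+t. (?L t)\<^sup>2 \<partial>lborel) = L2L1 hl"
          by (intro nn_integral_cong) (auto simp: indicator_def)
        then show "(\<integral>\<^sup>+t. (?L t)\<^sup>2 \<partial>lborel) \<le> ennreal H0" using lin by (simp add: hl_def)
        have "(\<integral>\<^sup>+\<xi>. h \<tau> \<xi> \<partial>lborel) = indicator {..T'} \<tau> * (nb \<tau>)\<^sup>2" for \<tau>
          unfolding h_def bb_def by (simp add: nn_integral_cmult nn_integral_nconv nb_def power2_eq_square)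
        then show "(\<integral>\<^sup>+t. (?D t)\<^sup>2 \<partial>lborel) \<le> ennreal (1 / \<mu>) * ?B'\<^sup>2"
          using duh_L2L1[of h ?\<nu>] \<nu> by simp
      qed auto
      also have "\<dots> = ennreal (2 * exp 1 * H0) + ennreal (2 * exp 1 * K0\<^sup>2 / \<mu>) * ?B'\<^sup>2"
        using H0 \<mu> by (simp add: ennreal_mult[symmetric] mult.assoc[symmetric] del: times_divide_eq_right) (simp add: ennreal_mult[symmetric] mult.assoc[symmetric])
      finally show "?B' \<le> ennreal (2 * exp 1 * H0) + ennreal (2 * exp 1 * K0\<^sup>2 / \<mu>) * ?B'\<^sup>2" .
    qed (use yfin nb0 H0 \<mu> in auto)
    then show ?thesis by (simp add: Y_def mult.assoc)
  qed
  have Ypos: "Y > 0" using H0 by (simp add: Y_def)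
  define Q where "Q = sqrt (Y / \<mu>)"
  have Q: "Q \<ge> 0" "Q\<^sup>2 = Y / \<mu>" using Ypos \<mu> by (auto simp: Q_def)
  have eKQ: "(?e * K0)\<^sup>2 * (Y / \<mu>) \<le> 1/4"
  proof -
    have "exp 1 * exp 1 = (exp 2 :: real)" by (simp add: exp_add[symmetric])
    then have "(?e * K0)\<^sup>2 * (Y / \<mu>) = 4 * exp 2 * K0\<^sup>2 * H0 / \<mu>" by (simp add: power_mult_distrib e2 Y_def mult_ac)
    also have "\<dots> \<le> 1/4" using small \<mu> by simp
    finally show ?thesis .
  qed
  have eKQ': "?e * K0 * Q \<le> 1/2"
  proof (rule power2_le_imp_le)
    show "(?e * K0 * Q)\<^sup>2 \<le> (1/2)\<^sup>2" unfolding power_mult_distrib[of _ Q] Q(2) using eKQ by (simp add: power2_eq_square[of "1/2::real"])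
  qed simp
  define D where "D = 2 * ?e * A"
  have D: "D \<ge> 0" using A by (simp add: D_def)
  \<comment> \<open>the excess over the bound, truncated at zero\<close>
  define d where "d = (\<lambda>t \<xi>. b t \<xi> - ennreal D)"
  have [measurable]: "jointly_borel d"
    unfolding d_def split_beta by measurable
  have bd: "b t \<xi> \<le> d t \<xi> + ennreal D" for t \<xi> unfolding d_def
    using ennreal_minus_le_iff[of "b t \<xi>" "ennreal D" "b t \<xi> - ennreal D"] by (simp add: add.commute)
  define ne where "ne t = (\<integral>\<^sup>+\<xi>. d t \<xi> \<partial>lborel)" for t
  let ?E = "(\<integral>\<^sup>+t. (ne t)\<^sup>2 \<partial>lborel)"
  have [measurable]: "ne \<in> borel_measurable borel" unfolding ne_def by measurable
  define f where "f = (\<lambda>\<tau>. nconv (b \<tau>) (d \<tau>))"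
  let ?F = "\<lambda>t. \<integral>\<^sup>+\<xi>. duh ?\<nu> f t \<xi> \<partial>lborel"
  have [measurable]: "jointly_borel f"
    unfolding f_def split_beta by measurable
  have conv_le: "bb \<tau> \<xi> \<le> f \<tau> \<xi> + ennreal D * nb \<tau>" for \<tau> \<xi>
  proof -
    have "bb \<tau> \<xi> \<le> (\<integral>\<^sup>+\<eta>. b \<tau> \<eta> * (d \<tau> (\<xi> - \<eta>) + ennreal D) \<partial>lborel)"
      unfolding bb_def nconv_def by (intro nn_integral_mono mult_left_mono bd) auto
    also have "\<dots> = f \<tau> \<xi> + nb \<tau> * ennreal D"
      unfolding f_def nconv_def nb_def distrib_left by (subst nn_integral_add) (auto simp: nn_integral_multc)
    finally show ?thesis by (simp only: mult.commute)
  qed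
  have duh_le: "duh ?\<nu> bb t \<xi> \<le> duh ?\<nu> f t \<xi> + ennreal (D * Q)" for t \<xi>
  proof -
    have "duh ?\<nu> bb t \<xi> \<le> (\<integral>\<^sup>+\<tau>. indicator {0<..<t} \<tau> * kern ?\<nu> (t - \<tau>) \<xi> * (f \<tau> \<xi> + ennreal D * nb \<tau>) \<partial>lborel)"
      unfolding duh_def by (intro nn_integral_mono mult_left_mono conv_le) auto
    also have "\<dots> = (\<integral>\<^sup>+\<tau>. indicator {0<..<t} \<tau> * kern ?\<nu> (t - \<tau>) \<xi> * f \<tau> \<xi> + ennreal D * (indicator {0<..<t} \<tau> * kern ?\<nu> (t - \<tau>) \<xi> * nb \<tau>) \<partial>lborel)"
      by (intro nn_integral_cong) (simp only: distrib_left mult.assoc mult.left_commute[of "ennreal D"])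
    also have "\<dots> = duh ?\<nu> f t \<xi> + ennreal D * duh ?\<nu> (\<lambda>\<tau> _. nb \<tau>) t \<xi>"
      unfolding duh_def by (subst nn_integral_add) (auto simp: nn_integral_cmult)
    also have "\<dots> \<le> duh ?\<nu> f t \<xi> + ennreal D * ennreal Q"
    proof (intro add_left_mono mult_left_mono)
      have "(duh ?\<nu> (\<lambda>\<tau> _. nb \<tau>) t \<xi>)\<^sup>2 \<le> ennreal (1 / \<mu>) * ?B" using duh_sup[of nb ?\<nu> t \<xi>] \<nu> by simp
      also have "\<dots> \<le> ennreal (1 / \<mu>) * ennreal Y" by (intro mult_left_mono Y) auto
      also have "\<dots> = (ennreal Q)\<^sup>2" using Q \<mu> Ypos by (simp add: ennreal_power ennreal_mult[symmetric])
      finally show "duh ?\<nu> (\<lambda>\<tau> _. nb \<tau>) t \<xi> \<le> ennreal Q" by (rule ennreal_power2_le_imp_le)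
    qed auto
    finally show ?thesis using D Q by (simp add: ennreal_mult)
  qed
  have dW: "AE t in lborel. AE \<xi> in lborel. d t \<xi> \<le> ennreal (?e * K0) * duh ?\<nu> f t \<xi>"
    using W
  proof eventually_elim
    case (elim t)
    show ?case
    proof (cases "0 < t \<and> t < T")
      case True
      with elim have "AE \<xi> in lborel. b t \<xi> \<le> ennreal ?e * (hl t \<xi> + ennreal K0 * duh ?\<nu> bb t \<xi>)" by simp
      then show ?thesis using a0A
      proof eventually_elim
        case (elim \<xi>)
        have "exp (- ?\<nu> * t * (norm \<xi>)\<^sup>2) \<le> 1" using True \<mu> by simp
        then have "hl t \<xi> \<le> 1 * ennreal A" unfolding hl_def using elim(2)
          by (intro mult_mono) (auto simp: ennreal_le_1)
        then have "b t \<xi> \<le> ennreal ?e * (ennreal A + ennreal K0 * (duh ?\<nu> f t \<xi> + ennreal (D * Q)))"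
          by (intro order_trans[OF elim(1)] mult_left_mono add_mono duh_le) auto
        also have "\<dots> = ennreal (?e * A + ?e * K0 * Q * D) + ennreal (?e * K0) * duh ?\<nu> f t \<xi>"
          using A K0 D Q by (simp add: distrib_left ennreal_mult ennreal_plus add_ac mult_ac)
        also have "ennreal (?e * A + ?e * K0 * Q * D) \<le> ennreal D"
        proof (rule ennreal_leI)
          have "?e * K0 * Q * D \<le> 1/2 * D" by (intro mult_right_mono eKQ' D)
          then show "?e * A + ?e * K0 * Q * D \<le> D" by (simp add: D_def)
        qed
        finally have "b t \<xi> \<le> ennreal D + ennreal (?e * K0) * duh ?\<nu> f t \<xi>" by (simp add: add_right_mono)
        then show ?case unfolding d_def by (simp add: ennreal_minus_le_iff add.commute)
      qed
    next
      case False
      then show ?thesis by (simp add: d_def b0)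
    qed
  qed
  have "?E = 0"
  proof (rule ennreal_absorb[where q="1/4"])
    have "ne t \<le> nb t" for t unfolding ne_def nb_def d_def by (intro nn_integral_mono) (simp add: diff_le_self_ennreal)
    then have "?E \<le> ?B" by (intro nn_integral_mono power_mono) auto
    then show "?E < \<infinity>" using yfin by (rule le_less_trans)
    have "AE t in lborel. (ne t)\<^sup>2 \<le> ennreal ((?e * K0)\<^sup>2) * (?F t)\<^sup>2"
      using dW
    proof eventually_elim
      case (elim t)
      have "ne t \<le> (\<integral>\<^sup>+\<xi>. ennreal (?e * K0) * duh ?\<nu> f t \<xi> \<partial>lborel)" unfolding ne_def by (rule nn_integral_mono_AE[OF elim])
      also have "\<dots> = ennreal (?e * K0) * ?F t" by (rule nn_integral_cmult) measurable
      finally have "(ne t)\<^sup>2 \<le> (ennreal (?e * K0) * ?F t)\<^sup>2" by (rule power_mono) simp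
      then show ?case using K0 by (simp only: power_mult_distrib[of "ennreal _"] ennreal_power mult_nonneg_nonneg exp_ge_zero)
    qed
    then have "?E \<le> (\<integral>\<^sup>+t. ennreal ((?e * K0)\<^sup>2) * (?F t)\<^sup>2 \<partial>lborel)"
      by (rule nn_integral_mono_AE)
    also have "\<dots> = ennreal ((?e * K0)\<^sup>2) * (\<integral>\<^sup>+t. (?F t)\<^sup>2 \<partial>lborel)"
      by (rule nn_integral_cmult) measurable
    also have "\<dots> \<le> ennreal ((?e * K0)\<^sup>2) * (ennreal (1 / \<mu>) * (\<integral>\<^sup>+\<tau>. nb \<tau> * ne \<tau> \<partial>lborel)\<^sup>2)"
    proof (intro mult_left_mono)
      have "(\<integral>\<^sup>+\<xi>. f \<tau> \<xi> \<partial>lborel) = nb \<tau> * ne \<tau>" for \<tau>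
        unfolding f_def nb_def ne_def by (rule nn_integral_nconv) measurable
      then show "(\<integral>\<^sup>+t. (?F t)\<^sup>2 \<partial>lborel) \<le> ennreal (1 / \<mu>) * (\<integral>\<^sup>+\<tau>. nb \<tau> * ne \<tau> \<partial>lborel)\<^sup>2"
        using duh_L2L1[of f ?\<nu>] \<nu> by simp
    qed simp
    also have "\<dots> \<le> ennreal ((?e * K0)\<^sup>2) * (ennreal (1 / \<mu>) * (?B * ?E))"
      by (intro mult_left_mono Cauchy_Schwarz_nn_integral) auto
    also have "\<dots> \<le> ennreal ((?e * K0)\<^sup>2) * (ennreal (1 / \<mu>) * (ennreal Y * ?E))"
      by (intro mult_left_mono mult_right_mono Y) auto
    also have "\<dots> = ennreal ((?e * K0)\<^sup>2 * (Y / \<mu>)) * ?E"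
      using \<mu> Ypos by (simp add: mult.assoc[symmetric] ennreal_mult[symmetric])
    also have "\<dots> \<le> ennreal (1/4) * ?E"
      by (intro mult_right_mono ennreal_leI eKQ) auto
    finally show "?E \<le> ennreal (1/4) * ?E" .
  qed simp
  then have "AE t in lborel. (ne t)\<^sup>2 = 0" by (subst (asm) nn_integral_0_iff_AE) auto
  then have "AE t in lborel. AE \<xi> in lborel. b t \<xi> \<le> ennreal D"
  proof eventually_elim
    case (elim t)
    then have "(\<integral>\<^sup>+\<xi>. d t \<xi> \<partial>lborel) = 0" by (simp add: ne_def)
    then have "AE \<xi> in lborel. d t \<xi> = 0" by (subst (asm) nn_integral_0_iff_AE) auto
    then show ?case
    proof eventually_elim
      case (elim \<xi>)
      then show ?case using bd[of t \<xi>] by simp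
    qed
  qed
  then show ?thesis by (simp add: b_def D_def)
qed

text \<open>The previous bound does not depend on the truncation parameters, which may tend to infinity.\<close>

theorem exponential_bound:
  fixes a :: "real \<Rightarrow> 'v::euclidean_space \<Rightarrow> ennreal" and A K0 H0 \<mu> :: real
  assumes a: "jointly_borel a"
    and a0: "a0 \<in> borel_measurable borel"
    and \<mu>: "\<mu> > 0" and K0: "K0 \<ge> 0" and H0: "H0 > 0" and A: "A \<ge> 0"
    and a0A: "AE \<xi> in lborel. a0 \<xi> \<le> ennreal A"
    and fin: "L2L1 a < \<infinity>"
    and lin: "L2L1 (\<lambda>t \<xi>. ennreal (exp (- (\<mu>/2) * t * (norm \<xi>)\<^sup>2)) * a0 \<xi>) \<le> ennreal H0"
    and small: "16 * exp 2 * K0\<^sup>2 * H0 < \<mu>"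
    and I: "AE t in lborel. t > 0 \<longrightarrow> (AE \<xi> in lborel. a t \<xi> \<le>
       ennreal (exp (- \<mu> * t * (norm \<xi>)\<^sup>2)) * a0 \<xi> + ennreal K0 * duh \<mu> (self_conv a) t \<xi>)"
  shows "AE t in lborel. t > 0 \<longrightarrow> (AE \<xi> in lborel. a t \<xi> \<le> ennreal (2 * exp (1/2) * A * exp (- sqrt (\<mu> * t) * norm \<xi>)))"
proof -
  let ?D = "2 * exp (1/2) * A"
  have "AE t in lborel. \<forall>T R::nat. AE \<xi> in lborel. indicator {0<..<real T} t * ennreal (wt \<mu> (real R) t \<xi>) * a t \<xi> \<le> ennreal ?D"
    unfolding AE_all_countable by (intro allI weighted_bound[OF a a0 \<mu> K0 H0 A _ a0A fin lin small I]) simp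
  then show ?thesis
  proof eventually_elim
    case (elim t)
    show ?case
    proof
      assume t: "t > 0"
      obtain T :: nat where T: "t < real T" using reals_Archimedean2 by blast
      have "AE \<xi> in lborel. \<forall>R::nat. indicator {0<..<real T} t * ennreal (wt \<mu> (real R) t \<xi>) * a t \<xi> \<le> ennreal ?D"
        unfolding AE_all_countable using elim by blast
      then show "AE \<xi> in lborel. a t \<xi> \<le> ennreal (?D * exp (- sqrt (\<mu> * t) * norm \<xi>))"
      proof eventually_elim
        case (elim \<xi>)
        obtain R :: nat where R: "norm \<xi> \<le> real R" using real_arch_simple by blast
        let ?E = "sqrt (\<mu> * t) * norm \<xi>"
        have "ennreal (exp ?E) * a t \<xi> \<le> ennreal ?D" using elim[rule_format, of R] t T R by (simp add: wt_def)
        then have "ennreal (exp (- ?E)) * (ennreal (exp ?E) * a t \<xi>) \<le> ennreal (exp (- ?E)) * ennreal ?D"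
          by (intro mult_left_mono) auto
        moreover have "ennreal (exp (- ?E)) * (ennreal (exp ?E) * a t \<xi>) = a t \<xi>"
        proof -
          have "ennreal (exp (- ?E)) * ennreal (exp ?E) = 1" by (simp add: ennreal_mult[symmetric] exp_add[symmetric])
          then show ?thesis by (simp only: mult.assoc[symmetric] mult_1_left)
        qed
        moreover have "ennreal (exp (- ?E)) * ennreal ?D = ennreal (?D * exp (- sqrt (\<mu> * t) * norm \<xi>))"
          using A by (subst ennreal_mult[symmetric]) (auto simp: mult.commute)
        ultimately show ?case by (simp only:)
      qed
    qed
  qed
qed


section \<open>Decay of the Duhamel term\<close>

lemma sqrt_young:
  assumes "s \<ge> 0" "\<mu> \<ge> 0"
  shows "sqrt (\<mu> * s) * r \<le> 1/2 + \<mu> * s * r\<^sup>2 / 2"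
proof -
  have "sqrt (\<mu> * s) * r \<le> 1/2 + (sqrt (\<mu> * s) * r)\<^sup>2 / 2" using sum_squares_bound[of "sqrt (\<mu> * s) * r" 1] by simp
  also have "(sqrt (\<mu> * s) * r)\<^sup>2 = \<mu> * s * r\<^sup>2" using assms by (simp add: power_mult_distrib)
  finally show ?thesis .
qed

lemma nn_integral_exp_norm:
  obtains C where "C \<ge> 0" "\<And>\<kappa>. \<kappa> > 0 \<Longrightarrow>
     (\<integral>\<^sup>+x. ennreal (exp (- \<kappa> * norm (x::real^'n::finite))) \<partial>lborel) = ennreal (C * \<kappa> powr (- real CARD('n)))"
proof -
  obtain C where C: "C \<ge> 0" "\<And>\<kappa>. \<kappa> > 0 \<Longrightarrow>
     (\<integral>\<^sup>+x. ennreal (norm (x::real^'n) powr 0 * exp (- \<kappa> * norm x)) \<partial>lborel) = ennreal (C * \<kappa> powr (- 0 - real CARD('n)))"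
    using nn_integral_powr_exp[where 'n='n and \<beta>=0] by auto
  have "(\<integral>\<^sup>+x. ennreal (exp (- \<kappa> * norm (x::real^'n))) \<partial>lborel) = (\<integral>\<^sup>+x. ennreal (norm (x::real^'n) powr 0 * exp (- \<kappa> * norm x)) \<partial>lborel)" for \<kappa>
    by (rule nn_integral_cong_AE, rule AE_mp[OF AE_lborel_singleton[of 0]]) simp
  then show ?thesis using that[of C] C by simp
qed

text \<open>The time integral of the heat decay rate is bounded in dimension at least three and grows
  logarithmically in dimension two; this is the source of the logarithm in the main result.\<close>

definition growth :: "'n::finite itself \<Rightarrow> real \<Rightarrow> real" where
  "growth _ t = (if CARD('n) \<ge> 3 then 1 else ln (1 + t))"

lemma growth_ge:
  assumes "t \<ge> 1" shows "1 \<le> 2 * growth TYPE('n::finite) t"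
proof -
  have "exp (1/2) \<le> (2::real)"
  proof (rule power2_le_imp_le)
    have "(exp (1/2 :: real))\<^sup>2 = exp 1" by (simp add: power2_eq_square exp_add[symmetric])
    then show "(exp (1/2))\<^sup>2 \<le> (2::real)\<^sup>2" using exp_le by simp
  qed simp
  then have "exp (1/2) \<le> 1 + t" using assms by linarith
  then have "1/2 \<le> ln (1 + t)" using assms by (subst ln_ge_iff) auto
  then show ?thesis by (simp add: growth_def)
qed

lemma half_power_bound:
  fixes c x y :: real
  assumes "0 \<le> c" "0 \<le> x" "2 * y \<le> 4"
  shows "c * (- 2) * x - c * (- 2) * y \<le> 4 * c"
proof -
  have "c * (2 * y - 2 * x) \<le> c * 4" using assms by (intro mult_left_mono) auto
  then show ?thesis by (simp add: algebra_simps)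
qed

lemma decay_time_integral:
  assumes "CARD('n::finite) \<ge> 2"
  obtains C where "C \<ge> 0" "\<And>t. t \<ge> 1 \<Longrightarrow>
    (\<integral>\<^sup>+\<tau>. ennreal (\<tau> powr (- real CARD('n) / 2)) * indicator {1/2..t} \<tau> \<partial>lborel) \<le> ennreal (C * growth TYPE('n) t)"
proof (cases "CARD('n) \<ge> 3")
  case True
  let ?n = "real CARD('n)"
  let ?c = "2 powr ((?n - 3) / 2) :: real"
  show ?thesis
  proof (rule that[of "4 * ?c"])
    fix t :: real assume t: "t \<ge> 1"
    have "(\<integral>\<^sup>+\<tau>. ennreal (\<tau> powr (- ?n / 2)) * indicator {1/2..t} \<tau> \<partial>lborel) \<le>
      (\<integral>\<^sup>+\<tau>. ennreal (?c * \<tau> powr (- 3 / 2)) * indicator {1/2..t} \<tau> \<partial>lborel)"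
    proof (rule nn_integral_mono)
      fix \<tau> :: real
      show "ennreal (\<tau> powr (- ?n / 2)) * indicator {1/2..t} \<tau> \<le> ennreal (?c * \<tau> powr (- 3 / 2)) * indicator {1/2..t} \<tau>"
      proof (cases "1/2 \<le> \<tau>")
        case True
        have "\<tau> powr (- ?n / 2) = \<tau> powr (- ((?n - 3) / 2)) * \<tau> powr (- 3 / 2)"
          by (simp add: powr_add[symmetric] field_simps)
        moreover have "\<tau> powr (- ((?n - 3) / 2)) \<le> (1/2) powr (- ((?n - 3) / 2))"
          using True \<open>CARD('n) \<ge> 3\<close> by (intro powr_mono2') auto
        moreover have "(1/2) powr (- ((?n - 3) / 2)) = ?c" by (simp add: powr_minus powr_divide)
        ultimately show ?thesis by (auto simp: indicator_def intro!: ennreal_leI mult_right_mono)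
      qed simp
    qed
    also have "\<dots> = ennreal (?c * (- 2) * t powr (- 1/2) - ?c * (- 2) * (1/2) powr (- 1/2))"
    proof (rule nn_integral_FTC_Icc[where F="\<lambda>\<tau>. ?c * (- 2) * \<tau> powr (- 1/2)"])
      show "((\<lambda>\<tau>. ?c * (- 2) * \<tau> powr (- 1/2)) has_real_derivative ?c * \<tau> powr (- 3 / 2)) (at \<tau>)" if "\<tau> \<in> {1/2..t}" for \<tau>
        using that by (auto intro!: derivative_eq_intros)
    qed (use t in auto)
    also have "\<dots> \<le> ennreal (4 * ?c * growth TYPE('n) t)"
    proof (rule ennreal_leI)
      have "(1/2::real) powr (- 1/2) = sqrt 2" by (simp add: powr_minus powr_divide powr_half_sqrt)
      also have "\<dots> \<le> 2" by (rule real_le_lsqrt) auto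
      finally have "2 * (1/2::real) powr (- 1/2) \<le> 4" by simp
      then have "?c * (- 2) * t powr (- 1/2) - ?c * (- 2) * (1/2) powr (- 1/2) \<le> 4 * ?c"
        by (intro half_power_bound) auto
      then show "?c * (- 2) * t powr (- 1/2) - ?c * (- 2) * (1/2) powr (- 1/2) \<le> 4 * ?c * growth TYPE('n) t"
        using True by (simp only: growth_def if_True mult_1_right)
    qed
    finally show "(\<integral>\<^sup>+\<tau>. ennreal (\<tau> powr (- ?n / 2)) * indicator {1/2..t} \<tau> \<partial>lborel) \<le> ennreal (4 * ?c * growth TYPE('n) t)" .
  qed simp
next
  case False
  then have n: "CARD('n) = 2" using assms by simp
  show ?thesis
  proof (rule that[of 2])
    fix t :: real assume t: "t \<ge> 1"
    have "(\<integral>\<^sup>+\<tau>. ennreal (\<tau> powr (- real CARD('n) / 2)) * indicator {1/2..t} \<tau> \<partial>lborel) = (\<integral>\<^sup>+\<tau>. ennreal (1 / \<tau>) * indicator {1/2..t} \<tau> \<partial>lborel)"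
    proof (rule nn_integral_cong)
      fix \<tau> :: real
      have "- real CARD('n) / 2 = -1" using n by simp
      then have "\<tau> powr (- real CARD('n) / 2) = 1 / \<tau>" if "1/2 \<le> \<tau>"
        using powr_neg_one[of \<tau>] that by auto
      then show "ennreal (\<tau> powr (- real CARD('n) / 2)) * indicator {1/2..t} \<tau> = ennreal (1 / \<tau>) * indicator {1/2..t} \<tau>"
        by (simp split: split_indicator)
    qed
    also have "\<dots> = ennreal (ln t - ln (1/2))"
      by (rule nn_integral_FTC_Icc) (use t in \<open>auto intro!: derivative_eq_intros\<close>)
    also have "\<dots> \<le> ennreal (2 * growth TYPE('n) t)"
    proof (rule ennreal_leI)
      have "ln t - ln (1/2) = ln (2 * t)" using t by (simp add: ln_mult ln_div)
      also have "\<dots> \<le> ln ((1 + t)\<^sup>2)" 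
        by (rule ln_mono) (use t in \<open>auto simp: power2_eq_square algebra_simps add_increasing\<close>)
      also have "\<dots> = 2 * ln (1 + t)" using t by (simp add: ln_realpow)
      finally show "ln t - ln (1/2) \<le> 2 * growth TYPE('n) t" using n by (simp add: growth_def)
    qed
    finally show "(\<integral>\<^sup>+\<tau>. ennreal (\<tau> powr (- real CARD('n) / 2)) * indicator {1/2..t} \<tau> \<partial>lborel) \<le> ennreal (2 * growth TYPE('n) t)" .
  qed simp
qed

text \<open>For \<open>\<tau> < 1/2\<close> the heat kernel still decays at time \<open>t - \<tau> \<ge> t / 2\<close> and boundedness of \<open>a\<close> suffices;
  afterwards the exponential bound on both factors yields the decay of the convolution.\<close>

theorem duhamel_decay:
  fixes a :: "real \<Rightarrow> real^'n::finite \<Rightarrow> ennreal" and D \<mu> :: real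
  assumes dim: "CARD('n) \<ge> 2" and \<mu>: "\<mu> > 0" and D: "D \<ge> 0"
    and [measurable]: "jointly_borel a"
    and fin: "L2L1 a < \<infinity>"
    and bnd: "AE t in lborel. t > 0 \<longrightarrow> (AE \<xi> in lborel. a t \<xi> \<le> ennreal (D * exp (- sqrt (\<mu> * t) * norm \<xi>)))"
  obtains C where "C \<ge> 0" "\<And>t \<xi>. t \<ge> 1 \<Longrightarrow> duh \<mu> (self_conv a) t \<xi> \<le>
     ennreal (C * growth TYPE('n) t * (norm \<xi> * exp (- (sqrt (\<mu> * t) / 2) * norm \<xi>)))"
proof -
  let ?n = "real CARD('n)"
  obtain W where W: "W \<ge> 0" "L2L1 a = ennreal W"
    using fin by (cases "\<integral>\<^sup>+t. indicator {0<..} t * (\<integral>\<^sup>+\<xi>. a t \<xi> \<partial>lborel)\<^sup>2 \<partial>lborel") auto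
  obtain E where E: "E \<ge> 0" "\<And>\<kappa>. \<kappa> > 0 \<Longrightarrow>
     (\<integral>\<^sup>+x. ennreal (exp (- \<kappa> * norm (x::real^'n))) \<partial>lborel) = ennreal (E * \<kappa> powr (- ?n))"
    using nn_integral_exp_norm by blast
  obtain G where G: "G \<ge> 0" "\<And>t. t \<ge> 1 \<Longrightarrow>
    (\<integral>\<^sup>+\<tau>. ennreal (\<tau> powr (- ?n / 2)) * indicator {1/2..t} \<tau> \<partial>lborel) \<le> ennreal (G * growth TYPE('n) t)"
    using decay_time_integral[OF dim] by blast
  define w where "w \<tau> = (\<integral>\<^sup>+\<xi>. a \<tau> \<xi> \<partial>lborel)" for \<tau>
  have [measurable]: "w \<in> borel_measurable borel" unfolding w_def by measurable
  define C1 where "C1 = D\<^sup>2 * (E * (sqrt \<mu> / 2) powr (- ?n))"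
  have C1: "C1 \<ge> 0" using E by (simp add: C1_def)
  have c1: "nconv (a \<tau>) (a \<tau>) \<xi> \<le> ennreal D * w \<tau>"
    if \<tau>: "\<tau> > 0" and b: "AE \<xi> in lborel. a \<tau> \<xi> \<le> ennreal (D * exp (- sqrt (\<mu> * \<tau>) * norm \<xi>))" for \<tau> \<xi>
  proof -
    have "nconv (a \<tau>) (a \<tau>) \<xi> \<le> (\<integral>\<^sup>+\<eta>. a \<tau> \<eta> * ennreal D \<partial>lborel)"
      unfolding nconv_def
    proof (rule nn_integral_mono_AE)
      show "AE \<eta> in lborel. a \<tau> \<eta> * a \<tau> (\<xi> - \<eta>) \<le> a \<tau> \<eta> * ennreal D"
        using AE_lborel_reflect[OF b, of \<xi>]
      proof eventually_elim
        case (elim \<eta>)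
        have "D * exp (- sqrt (\<mu> * \<tau>) * norm (\<xi> - \<eta>)) \<le> D * 1" using D \<mu> \<tau> by (intro mult_left_mono) auto
        then have "a \<tau> (\<xi> - \<eta>) \<le> ennreal D" using elim by (elim order_trans) (auto intro: ennreal_leI)
        then show ?case by (rule mult_left_mono) simp
      qed
    qed
    also have "\<dots> = w \<tau> * ennreal D" unfolding w_def by (rule nn_integral_multc) measurable
    finally show ?thesis by (simp only: mult.commute)
  qed
  have c2: "nconv (a \<tau>) (a \<tau>) \<xi> \<le> ennreal (C1 * \<tau> powr (- ?n / 2) * exp (- (sqrt (\<mu> * \<tau>) / 2) * norm \<xi>))"
    if \<tau>: "\<tau> > 0" and b: "AE \<xi> in lborel. a \<tau> \<xi> \<le> ennreal (D * exp (- sqrt (\<mu> * \<tau>) * norm \<xi>))" for \<tau> \<xi>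
  proof -
    let ?s = "sqrt (\<mu> * \<tau>)"
    have s: "?s > 0" using \<mu> \<tau> by simp
    have "nconv (a \<tau>) (a \<tau>) \<xi> \<le> (\<integral>\<^sup>+\<eta>. ennreal (D\<^sup>2 * exp (- (?s/2) * norm \<xi>)) * ennreal (exp (- (?s/2) * norm (\<eta>::real^'n))) \<partial>lborel)"
      unfolding nconv_def
    proof (rule nn_integral_mono_AE)
      show "AE \<eta> in lborel. a \<tau> \<eta> * a \<tau> (\<xi> - \<eta>) \<le> ennreal (D\<^sup>2 * exp (- (?s/2) * norm \<xi>)) * ennreal (exp (- (?s/2) * norm \<eta>))"
        using b AE_lborel_reflect[OF b, of \<xi>]
      proof eventually_elim
        case (elim \<eta>)
        have "norm \<xi> \<le> norm \<eta> + norm (\<xi> - \<eta>)" by (metis add.commute norm_triangle_sub)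
        then have "norm \<xi> / 2 + norm \<eta> / 2 \<le> norm \<eta> + norm (\<xi> - \<eta>)" using norm_ge_zero[of "\<xi> - \<eta>"] by linarith
        then have "?s * (norm \<xi> / 2 + norm \<eta> / 2) \<le> ?s * (norm \<eta> + norm (\<xi> - \<eta>))" using s by (intro mult_left_mono) auto
        then have "exp (- ?s * norm \<eta>) * exp (- ?s * norm (\<xi> - \<eta>)) \<le> exp (- (?s/2) * norm \<xi>) * exp (- (?s/2) * norm \<eta>)"
          by (simp add: exp_add[symmetric] distrib_left)
        then have "D\<^sup>2 * (exp (- ?s * norm \<eta>) * exp (- ?s * norm (\<xi> - \<eta>))) \<le> D\<^sup>2 * (exp (- (?s/2) * norm \<xi>) * exp (- (?s/2) * norm \<eta>))"
          by (intro mult_left_mono) auto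
        then have "ennreal (D * exp (- ?s * norm \<eta>)) * ennreal (D * exp (- ?s * norm (\<xi> - \<eta>))) \<le> ennreal (D\<^sup>2 * exp (- (?s/2) * norm \<xi>)) * ennreal (exp (- (?s/2) * norm \<eta>))"
          using D by (simp add: ennreal_mult[symmetric] power2_eq_square mult_ac ennreal_leI)
        moreover have "a \<tau> \<eta> * a \<tau> (\<xi> - \<eta>) \<le> ennreal (D * exp (- ?s * norm \<eta>)) * ennreal (D * exp (- ?s * norm (\<xi> - \<eta>)))"
          by (intro mult_mono elim) auto
        ultimately show ?case by (rule order_trans[rotated])
      qed
    qed
    also have "\<dots> = ennreal (D\<^sup>2 * exp (- (?s/2) * norm \<xi>)) * ennreal (E * (?s/2) powr (- ?n))"
      using E(2)[of "?s/2"] s by (subst nn_integral_cmult) auto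
    also have "\<dots> = ennreal (C1 * \<tau> powr (- ?n / 2) * exp (- (?s / 2) * norm \<xi>))"
    proof -
      have "?s / 2 = (sqrt \<mu> / 2) * \<tau> powr (1/2)" using \<mu> \<tau> by (simp add: real_sqrt_mult powr_half_sqrt)
      then have "(?s/2) powr (- ?n) = (sqrt \<mu> / 2) powr (- ?n) * \<tau> powr (- ?n / 2)"
        by (simp only:) (use \<mu> \<tau> in \<open>subst powr_mult; simp add: powr_powr\<close>)
      then show ?thesis using E by (simp add: C1_def ennreal_mult[symmetric] mult_ac)
    qed
    finally show ?thesis .
  qed
  define C where "C = 2 * (exp (1/2) * D * (1/2 + W)) + C1 * exp (1/2) * G"
  show ?thesis
  proof (rule that[of C])
    show "C \<ge> 0" using D W C1 G by (simp add: C_def)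
    fix t :: real and \<xi> :: "real^'n" assume t: "t \<ge> 1"
    let ?r = "norm \<xi>"
    define X where "X = ?r * exp (- (sqrt (\<mu> * t) / 2) * ?r)"
    have X: "X \<ge> 0" by (simp add: X_def)
    let ?g1 = "\<lambda>\<tau>. ennreal (exp (1/2) * D * X) * (indicator {0..1/2} \<tau> + indicator {0<..} \<tau> * (w \<tau>)\<^sup>2)"
    let ?g2 = "\<lambda>\<tau>. ennreal (C1 * exp (1/2) * X) * (ennreal (\<tau> powr (- ?n / 2)) * indicator {1/2..t} \<tau>)"
    have "duh \<mu> (self_conv a) t \<xi> \<le> (\<integral>\<^sup>+\<tau>. ?g1 \<tau> + ?g2 \<tau> \<partial>lborel)"
      unfolding duh_def
    proof (rule nn_integral_mono_AE)
      show "AE \<tau> in lborel. indicator {0<..<t} \<tau> * kern \<mu> (t - \<tau>) \<xi> * nconv (a \<tau>) (a \<tau>) \<xi> \<le> ?g1 \<tau> + ?g2 \<tau>"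
        using bnd
      proof eventually_elim
        case (elim \<tau>)
        show ?case
        proof (cases "0 < \<tau> \<and> \<tau> < t")
          case True
          then have b: "AE \<xi> in lborel. a \<tau> \<xi> \<le> ennreal (D * exp (- sqrt (\<mu> * \<tau>) * norm \<xi>))" using elim by simp
          show ?thesis
          proof (cases "\<tau> \<le> 1/2")
            case small: True
            have "- \<mu> * (t - \<tau>) * ?r\<^sup>2 \<le> 1/2 - sqrt (\<mu> * t) / 2 * ?r"
            proof -
              have "sqrt (\<mu> * t) * ?r \<le> 1/2 + \<mu> * t * ?r\<^sup>2 / 2" using sqrt_young[of t \<mu> ?r] t \<mu> by simp
              moreover have "\<mu> * t * ?r\<^sup>2 / 2 \<le> \<mu> * (t - \<tau>) * ?r\<^sup>2"
              proof -
                have "\<mu> * ?r\<^sup>2 * (t / 2) \<le> \<mu> * ?r\<^sup>2 * (t - \<tau>)" using small t \<mu> by (intro mult_left_mono) auto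
                then show ?thesis by (simp add: mult_ac)
              qed
              moreover have "sqrt (\<mu> * t) / 2 * ?r \<le> sqrt (\<mu> * t) * ?r" using \<mu> t by (intro mult_right_mono) auto
              ultimately show ?thesis by linarith
            qed
            then have "exp (- \<mu> * (t - \<tau>) * ?r\<^sup>2) \<le> exp (1/2) * exp (- (sqrt (\<mu> * t) / 2) * ?r)"
              by (simp add: exp_add[symmetric])
            then have "?r * exp (- \<mu> * (t - \<tau>) * ?r\<^sup>2) \<le> ?r * (exp (1/2) * exp (- (sqrt (\<mu> * t) / 2) * ?r))" by (intro mult_left_mono) auto
            then have k: "kern \<mu> (t - \<tau>) \<xi> \<le> ennreal (exp (1/2) * X)" unfolding kern_def X_def by (intro ennreal_leI) (simp add: mult_ac)
            have "w \<tau> \<le> 1 + (w \<tau>)\<^sup>2"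
            proof (cases "w \<tau> \<le> 1")
              case True then show ?thesis by (rule order_trans) simp
            next
              case False
              then have "w \<tau> * 1 \<le> w \<tau> * w \<tau>" by (intro mult_left_mono) auto
              then have "w \<tau> \<le> (w \<tau>)\<^sup>2" by (simp add: power2_eq_square)
              then show ?thesis by (rule order_trans) simp
            qed
            then have "kern \<mu> (t - \<tau>) \<xi> * nconv (a \<tau>) (a \<tau>) \<xi> \<le> ennreal (exp (1/2) * X) * (ennreal D * (1 + (w \<tau>)\<^sup>2))"
              using True by (intro mult_mono k order_trans[OF c1[OF _ b]] mult_left_mono) auto
            also have "\<dots> = ?g1 \<tau>" using True small X D by (simp add: ennreal_mult mult_ac)
            finally show ?thesis using True by (simp add: add_increasing2)
          next
            case large: False
            have "- \<mu> * (t - \<tau>) * ?r\<^sup>2 - sqrt (\<mu> * \<tau>) / 2 * ?r \<le> 1/2 - sqrt (\<mu> * t) / 2 * ?r"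
            proof -
              have "sqrt (\<mu> * (t - \<tau>)) * ?r \<le> 1/2 + \<mu> * (t - \<tau>) * ?r\<^sup>2 / 2" using sqrt_young[of "t - \<tau>" \<mu> ?r] True \<mu> by simp
              moreover have "sqrt (\<mu> * t) * ?r \<le> sqrt (\<mu> * \<tau>) * ?r + sqrt (\<mu> * (t - \<tau>)) * ?r"
                unfolding distrib_right[symmetric] using True \<mu> by (intro mult_right_mono sqrt_diff_le) auto
              moreover have "0 \<le> \<mu> * (t - \<tau>) * ?r\<^sup>2" using True \<mu> by simp
              ultimately show ?thesis by (simp add: field_simps)
            qed
            then have "exp (- \<mu> * (t - \<tau>) * ?r\<^sup>2) * exp (- (sqrt (\<mu> * \<tau>) / 2) * ?r) \<le> exp (1/2) * exp (- (sqrt (\<mu> * t) / 2) * ?r)"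
              by (simp add: exp_add[symmetric])
            then have "?r * (exp (- \<mu> * (t - \<tau>) * ?r\<^sup>2) * exp (- (sqrt (\<mu> * \<tau>) / 2) * ?r)) \<le> ?r * (exp (1/2) * exp (- (sqrt (\<mu> * t) / 2) * ?r))" by (intro mult_left_mono) auto
            then have le: "(C1 * \<tau> powr (- ?n / 2)) * (?r * (exp (- \<mu> * (t - \<tau>) * ?r\<^sup>2) * exp (- (sqrt (\<mu> * \<tau>) / 2) * ?r))) \<le> (C1 * \<tau> powr (- ?n / 2)) * (exp (1/2) * X)"
              unfolding X_def using C1 by (intro mult_left_mono) (auto simp: mult_ac)
            have "kern \<mu> (t - \<tau>) \<xi> * nconv (a \<tau>) (a \<tau>) \<xi> \<le> kern \<mu> (t - \<tau>) \<xi> * ennreal (C1 * \<tau> powr (- ?n / 2) * exp (- (sqrt (\<mu> * \<tau>) / 2) * ?r))"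
              using True by (intro mult_left_mono c2[OF _ b]) auto
            also have "\<dots> = ennreal ((C1 * \<tau> powr (- ?n / 2)) * (?r * (exp (- \<mu> * (t - \<tau>) * ?r\<^sup>2) * exp (- (sqrt (\<mu> * \<tau>) / 2) * ?r))))"
              unfolding kern_def using C1 by (simp add: ennreal_mult[symmetric] mult_ac)
            also have "\<dots> \<le> ennreal ((C1 * \<tau> powr (- ?n / 2)) * (exp (1/2) * X))" by (rule ennreal_leI[OF le])
            also have "\<dots> = ?g2 \<tau>" using True large X C1 by (simp add: ennreal_mult[symmetric] mult_ac)
            finally show ?thesis using True by (simp add: add_increasing)
          qed
        qed simp
      qed
    qed
    also have "\<dots> = ennreal (exp (1/2) * D * X) * (ennreal (1/2) + ennreal W) + ennreal (C1 * exp (1/2) * X) * (\<integral>\<^sup>+\<tau>. ennreal (\<tau> powr (- ?n / 2)) * indicator {1/2..t} \<tau> \<partial>lborel)"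
      using W(2) by (simp add: nn_integral_add nn_integral_cmult w_def)
    also have "\<dots> \<le> ennreal (exp (1/2) * D * X) * (ennreal (1/2) + ennreal W) + ennreal (C1 * exp (1/2) * X) * ennreal (G * growth TYPE('n) t)"
      by (intro add_left_mono mult_left_mono G t) auto
    also have "\<dots> = ennreal (exp (1/2) * D * (1/2 + W) * X + C1 * exp (1/2) * G * growth TYPE('n) t * X)"
    proof -
      have "0 \<le> growth TYPE('n) t" using growth_ge[OF t, where 'n='n] by simp
      note nn = this D W(1) X C1 G(1)
      have "ennreal (1/2) + ennreal W = ennreal (1/2 + W)" using W(1) by (subst ennreal_plus) auto
      moreover have "ennreal (exp (1/2) * D * X) * ennreal (1/2 + W) = ennreal (exp (1/2) * D * (1/2 + W) * X)"
        using nn by (subst ennreal_mult[symmetric]) (auto simp: mult_ac)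
      moreover have "ennreal (C1 * exp (1/2) * X) * ennreal (G * growth TYPE('n) t) = ennreal (C1 * exp (1/2) * G * growth TYPE('n) t * X)"
        using nn by (subst ennreal_mult[symmetric]) (auto simp: mult_ac)
      ultimately show ?thesis using nn by (simp only:) (subst ennreal_plus, auto)
    qed
    also have "\<dots> \<le> ennreal (C * growth TYPE('n) t * X)"
    proof (rule ennreal_leI)
      have "exp (1/2) * D * (1/2 + W) * X * 1 \<le> exp (1/2) * D * (1/2 + W) * X * (2 * growth TYPE('n) t)"
        using growth_ge[OF t, where 'n='n] D W X by (intro mult_left_mono) auto
      then show "exp (1/2) * D * (1/2 + W) * X + C1 * exp (1/2) * G * growth TYPE('n) t * X \<le> C * growth TYPE('n) t * X"
        by (simp add: C_def algebra_simps)
    qed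
    finally show "duh \<mu> (self_conv a) t \<xi> \<le> ennreal (C * growth TYPE('n) t * (norm \<xi> * exp (- (sqrt (\<mu> * t) / 2) * norm \<xi>)))"
      by (simp add: X_def)
  qed
qed

section \<open>Norms of distributions in terms of their spectrum\<close>

lemma epowr_1 [simp]: "epowr a 1 = a"
  by (cases a) (auto simp: epowr_def)

lemma epowr_2 [simp]: "epowr a 2 = a\<^sup>2"
  by (cases a) (auto simp: epowr_def ennreal_power power2_eq_square[of "\<top>"] ennreal_top_mult)

lemma conj_exp_simps [simp]: "conj_exp \<infinity> = 1" "conj_exp 1 = \<infinity>" "conj_exp \<top> = 1"
  by (simp_all add: conj_exp_def)

lemma Lp_norm_1 [simp]: "Lp_norm M 1 f = (\<integral>\<^sup>+x. f x \<partial>M)"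
  by (simp add: Lp_norm_def)

lemma Lp_norm_2: "Lp_norm M 2 f = epowr (\<integral>\<^sup>+x. (f x)\<^sup>2 \<partial>M) (1/2)"
  by (simp add: Lp_norm_def)

lemma Lp_norm_cong_AE:
  assumes [measurable]: "f \<in> borel_measurable M" "g \<in> borel_measurable M" and eq: "AE x in M. f x = g x"
  shows "Lp_norm M p f = Lp_norm M p g"
proof (cases "p = \<infinity>")
  case True
  have "(AE x in M. f x \<le> z) \<longleftrightarrow> (AE x in M. g x \<le> z)" for z
    using eq by (auto elim: eventually_elim2)
  then show ?thesis using True by (simp add: Lp_norm_def esssup_eq_AE)
next
  case False
  have "(\<integral>\<^sup>+x. epowr (f x) (enn2real p) \<partial>M) = (\<integral>\<^sup>+x. epowr (g x) (enn2real p) \<partial>M)"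
    by (rule nn_integral_cong_AE) (use eq in eventually_elim, simp)
  then show ?thesis using False by (simp add: Lp_norm_def)
qed

lemma vec_measurable:
  fixes g :: "'n::finite \<Rightarrow> 'a \<Rightarrow> complex"
  assumes "\<And>l. g l \<in> borel_measurable M"
  shows "(\<lambda>x. (\<chi> l. g l x)) \<in> borel_measurable M"
proof -
  have "(\<lambda>x. \<Sum>l\<in>UNIV. axis l (g l x)) \<in> borel_measurable M"
  proof (intro borel_measurable_sum)
    fix l
    have "(\<lambda>z. axis l z :: complex^'n) \<in> borel_measurable borel"
    proof (intro borel_measurable_continuous_onI linear_continuous_on)
      have "linear (\<lambda>z. axis l z :: complex^'n)" by (rule linearI) (auto simp: vec_eq_iff axis_def)
      then show "bounded_linear (\<lambda>z. axis l z :: complex^'n)" by (simp add: linear_conv_bounded_linear)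
    qed
    then show "(\<lambda>x. axis l (g l x) :: complex^'n) \<in> borel_measurable M"
      using measurable_compose[OF assms] by blast
  qed
  moreover have "(\<Sum>l\<in>UNIV. axis l (g l x)) = (\<chi> l. g l x)" for x
    by (simp add: vec_eq_iff axis_def if_distrib cong: if_cong)
  ultimately show ?thesis by simp
qed

lemma norm_vec_le_sum: "norm (v :: complex^'n::finite) \<le> (\<Sum>l\<in>UNIV. norm (v $ l))"
  unfolding norm_vec_def by (rule L2_set_le_sum) simp

context bump
begin

lemma Lhat_norm_spectrum:
  fixes F :: "'n vdist"
  assumes t: "\<And>l. F $ l \<in> tempered" and s: "\<And>l. has_spectrum (F $ l) (g l)"
  shows "Lhat_norm p F = Lp_norm lborel (conj_exp p) (\<lambda>\<xi>. ennreal (norm (\<chi> l. g l \<xi>)))"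
proof -
  have "\<forall>l. has_ft (F $ l)" using has_spectrum_has_ft[OF s t] by blast
  then have "Lhat_norm p F = Lp_norm lborel (conj_exp p) (\<lambda>\<xi>. ennreal (norm (vft F \<xi>)))" by (simp add: Lhat_norm_def)
  also have "\<dots> = Lp_norm lborel (conj_exp p) (\<lambda>\<xi>. ennreal (norm (\<chi> l. g l \<xi>)))"
  proof (rule Lp_norm_cong_AE)
    have m: "g l \<in> borel_measurable lborel" "ft (F $ l) \<in> borel_measurable lborel" for l
      using s[of l] has_spectrum_ft(2)[OF s[of l]] by (auto simp: has_spectrum_def wL1_def)
    show "(\<lambda>\<xi>. ennreal (norm (vft F \<xi>))) \<in> borel_measurable lborel" "(\<lambda>\<xi>. ennreal (norm (\<chi> l. g l \<xi>))) \<in> borel_measurable lborel"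
      using vec_measurable[OF m(1)] vec_measurable[OF m(2)] unfolding vft_def by measurable
    have "AE \<xi> in lborel. \<forall>l\<in>UNIV. ft (F $ l) \<xi> = g l \<xi>"
      by (subst AE_finite_all) (use has_spectrum_ft(1)[OF s] in auto)
    then show "AE \<xi> in lborel. ennreal (norm (vft F \<xi>)) = ennreal (norm (\<chi> l. g l \<xi>))"
      by eventually_elim (simp add: vft_def)
  qed
  finally show ?thesis .
qed

end

section \<open>Fourier--Herz norms\<close>

abbreviation dyadic_scale :: "(real^'n::finite \<Rightarrow> real) \<Rightarrow> int \<Rightarrow> real^'n \<Rightarrow> real" where
  "dyadic_scale \<psi> j \<xi> \<equiv> \<psi> ((2 powr - real_of_int j) *\<^sub>R \<xi>)"

text \<open>The pieces \<open>j\<close> with \<open>2\<^sup>j\<close> outside \<open>{|\<xi>|/2..2|\<xi>|}\<close> vanish at \<open>\<xi>\<close>.\<close>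

lemma dyadic_three_terms:
  fixes \<psi> :: "real^'n::finite \<Rightarrow> real"
  assumes "dyadic_cutoff \<psi>" "\<xi> \<noteq> 0"
  obtains k :: int where "(\<Sum>j\<in>{k - 1, k, k + 1}. dyadic_scale \<psi> j \<xi>) = 1"
proof -
  define k where "k = \<lfloor>log 2 (norm \<xi>)\<rfloor>"
  have supp: "\<And>x. \<psi> x \<noteq> 0 \<Longrightarrow> 1/2 \<le> norm x \<and> norm x \<le> 2"
    and tot: "((\<lambda>j::int. dyadic_scale \<psi> j \<xi>) has_sum 1) UNIV"
    using assms unfolding dyadic_cutoff_def by blast+
  have n: "norm \<xi> > 0" using assms by simp
  have "((\<lambda>j::int. dyadic_scale \<psi> j \<xi>) has_sum 1) {k - 1, k, k + 1}"
  proof (rule has_sum_cong_neutral[THEN iffD1, OF _ _ _ tot])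
    fix j assume j: "j \<in> UNIV - {k - 1, k, k + 1}"
    show "dyadic_scale \<psi> j \<xi> = 0"
    proof (rule ccontr)
      assume "dyadic_scale \<psi> j \<xi> \<noteq> 0"
      from supp[OF this] have *: "1/2 \<le> 2 powr - real_of_int j * norm \<xi>" "2 powr - real_of_int j * norm \<xi> \<le> 2" by auto
      have p: "2 powr - real_of_int j * norm \<xi> = 2 powr (log 2 (norm \<xi>) - real_of_int j)"
        using n by (simp add: powr_diff powr_minus field_simps)
      have "log 2 (1/2) \<le> log 2 (2 powr - real_of_int j * norm \<xi>)" using * by (intro log_mono) auto
      then have a: "- 1 \<le> log 2 (norm \<xi>) - real_of_int j" unfolding p by (simp add: log_divide)
      have "log 2 (2 powr - real_of_int j * norm \<xi>) \<le> log 2 2" using * n by (intro log_mono) auto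
      then have b: "log 2 (norm \<xi>) - real_of_int j \<le> 1" unfolding p by simp
      have "k \<le> j + 1" "k \<ge> j - 1" using a b unfolding k_def by linarith+
      then show False using j by auto
    qed
  qed auto
  from has_sum_unique[OF has_sum_finite this] show ?thesis using that by blast
qed

lemma sum_le_nn_integral_count:
  fixes f :: "int \<Rightarrow> ennreal"
  assumes "finite J" shows "(\<Sum>j\<in>J. f j) \<le> (\<integral>\<^sup>+j. f j \<partial>count_space UNIV)"
proof -
  have "(\<Sum>j\<in>J. f j) = (\<integral>\<^sup>+j. f j * indicator J j \<partial>count_space UNIV)"
    using assms by (simp add: nn_integral_count_space_finite flip: nn_integral_count_space_indicator)
  also have "\<dots> \<le> (\<integral>\<^sup>+j. f j \<partial>count_space UNIV)" by (intro nn_integral_mono) (auto simp: indicator_def)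
  finally show ?thesis .
qed

lemma int_geometric:
  "(\<integral>\<^sup>+k. ennreal ((1/2) ^ nat \<bar>j - k\<bar>) \<partial>count_space (UNIV :: int set)) \<le> 4"
proof -
  let ?f = "\<lambda>k. ennreal ((1/2) ^ nat \<bar>j - k\<bar>)"
  have g: "(\<integral>\<^sup>+n. ennreal ((1/2) ^ n) \<partial>count_space (UNIV :: nat set)) = 2"
    using suminf_geometric[of "1/2::real"] summable_geometric[of "1/2::real"]
    by (subst nn_integral_count_space_nat) (simp add: suminf_ennreal2)
  have "(\<integral>\<^sup>+k. ?f k \<partial>count_space UNIV) \<le> (\<integral>\<^sup>+k. ?f k * indicator {j..} k + ?f k * indicator {..j} k \<partial>count_space UNIV)"
    by (intro nn_integral_mono) (auto simp: indicator_def)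
  also have "\<dots> = (\<integral>\<^sup>+k. ?f k \<partial>count_space {j..}) + (\<integral>\<^sup>+k. ?f k \<partial>count_space {..j})"
    by (subst nn_integral_add) (auto simp: nn_integral_count_space_indicator)
  also have "(\<integral>\<^sup>+k. ?f k \<partial>count_space {j..}) = (\<integral>\<^sup>+n. ?f (j + int n) \<partial>count_space UNIV)"
    by (rule nn_integral_bij_count_space[symmetric])
      (auto simp: bij_betw_def inj_on_def image_iff intro!: exI[of _ "nat (_ - j)"])
  also have "\<dots> = 2" using g by simp
  also have "(\<integral>\<^sup>+k. ?f k \<partial>count_space {..j}) = (\<integral>\<^sup>+n. ?f (j - int n) \<partial>count_space UNIV)"
    by (rule nn_integral_bij_count_space[symmetric])
      (auto simp: bij_betw_def inj_on_def image_iff intro!: exI[of _ "nat (j - _)"])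
  also have "\<dots> = 2" using g by simp
  finally show ?thesis by simp
qed

lemma dyadic_weight_le:
  fixes j k :: int
  shows "2 powr real_of_int j * 2 powr real_of_int k / (4 powr real_of_int j + 4 powr real_of_int k) \<le> (1/2) ^ nat \<bar>j - k\<bar>"
proof -
  have le: "2 powr real_of_int j * 2 powr real_of_int k / (4 powr real_of_int j + 4 powr real_of_int k) \<le> (1/2) ^ nat \<bar>j - k\<bar>"
    if "j \<le> k" for j k :: int
  proof -
    have four: "4 powr real_of_int k = 2 powr real_of_int k * 2 powr real_of_int k" for k
      using powr_mult[of 2 2 "real_of_int k"] by simp
    have "2 powr real_of_int j * 2 powr real_of_int k / (4 powr real_of_int j + 4 powr real_of_int k)
      \<le> 2 powr real_of_int j * 2 powr real_of_int k / (4 powr real_of_int k)"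
      by (intro divide_left_mono mult_pos_pos add_pos_pos) auto
    also have "\<dots> = 2 powr (real_of_int j - real_of_int k)" unfolding four by (simp add: powr_diff)
    also have "\<dots> = (1/2) ^ nat \<bar>j - k\<bar>"
    proof -
      have "real_of_int j - real_of_int k = - real (nat \<bar>j - k\<bar>)" using that by simp
      then show ?thesis by (simp only: powr_minus powr_realpow) (simp add: power_one_over inverse_eq_divide)
    qed
    finally show ?thesis .
  qed
  show ?thesis
  proof (cases "j \<le> k")
    case False
    then show ?thesis using le[of k j] by (simp add: mult.commute add.commute abs_minus_commute)
  qed (rule le)
qed

text \<open>The heat flow of a function in the Fourier--Herz space of index \<open>(-1, \<infinity>, 2)\<close> is in \<open>L\<^sup>2\<close> in time with
  values in \<open>L\<^sup>1\<close>. On the \<open>j\<close>-th dyadic annulus the heat factor is at most \<open>exp (- \<mu> t 4\<^sup>j / 8)\<close>; the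
  square of the sum over \<open>j\<close> is integrated in time, and the resulting kernel decays geometrically
  in \<open>\<bar>j - k\<bar>\<close>.\<close>

lemma herz_heat_flow:
  fixes \<psi> :: "real^'n::finite \<Rightarrow> real" and v :: "real^'n \<Rightarrow> ennreal"
  assumes \<psi>: "dyadic_cutoff \<psi>" and [measurable]: "v \<in> borel_measurable borel" and \<mu>: "\<mu> > 0"
  defines "\<beta> \<equiv> \<lambda>j::int. ennreal (2 powr - real_of_int j) * (\<integral>\<^sup>+\<xi>. ennreal (dyadic_scale \<psi> j \<xi>) * v \<xi> \<partial>lborel)"
  shows "L2L1 (\<lambda>t \<xi>. ennreal (exp (- (\<mu>/2) * t * (norm \<xi>)\<^sup>2)) * v \<xi>)
     \<le> ennreal (64 / \<mu>) * (\<integral>\<^sup>+j. (\<beta> j)\<^sup>2 \<partial>count_space UNIV)"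
proof -
  let ?C = "count_space (UNIV :: int set)"
  interpret C: sigma_finite_measure ?C by (rule sigma_finite_measure_count_space)
  interpret LC: pair_sigma_finite "lborel :: (real^'n) measure" ?C ..
  interpret RC: pair_sigma_finite "lborel :: real measure" ?C ..
  define p where "p j \<xi> = ennreal (dyadic_scale \<psi> j \<xi>)" for j :: int and \<xi>
  have [measurable]: "\<psi> \<in> borel_measurable borel" using \<psi> by (simp add: dyadic_cutoff_def smooth_measurable)
  have [measurable]: "p j \<in> borel_measurable borel" for j unfolding p_def by measurable
  have pm [measurable]: "(\<lambda>x. p (snd x) (fst x)) \<in> borel_measurable (borel \<Otimes>\<^sub>M ?C)"
    by (rule measurable_compose_countable[where f="\<lambda>j x. p j (fst x)" and g=snd]) measurable
  have supp: "\<And>x. \<psi> x \<noteq> 0 \<Longrightarrow> 1/2 \<le> norm x \<and> norm x \<le> 2" and nn: "\<And>x. 0 \<le> \<psi> x"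
    using \<psi> unfolding dyadic_cutoff_def by blast+
  define b where "b j = (\<integral>\<^sup>+\<xi>. p j \<xi> * v \<xi> \<partial>lborel)" for j
  define q where "q j = \<mu> / 8 * 4 powr real_of_int j" for j :: int
  have q: "q j > 0" for j using \<mu> by (simp add: q_def)
  have \<beta>: "b j = ennreal (2 powr real_of_int j) * \<beta> j" for j
    unfolding \<beta>_def b_def p_def by (simp add: mult.assoc[symmetric] ennreal_mult[symmetric] powr_add[symmetric])
  have one: "1 \<le> (\<integral>\<^sup>+j. p j \<xi> \<partial>?C)" if \<xi>0: "\<xi> \<noteq> 0" for \<xi>
  proof -
    obtain k :: int where "(\<Sum>j\<in>{k - 1, k, k + 1}. dyadic_scale \<psi> j \<xi>) = 1"
      using dyadic_three_terms[OF \<psi> \<xi>0] by blast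
    then have "(\<Sum>j\<in>{k - 1, k, k + 1}. p j \<xi>) = 1" unfolding p_def by (subst sum_ennreal) (auto simp: nn)
    then show ?thesis using sum_le_nn_integral_count[of "{k - 1, k, k + 1}" "\<lambda>j. p j \<xi>"] by simp
  qed
  have inner: "(\<integral>\<^sup>+\<xi>. ennreal (exp (- (\<mu>/2) * t * (norm \<xi>)\<^sup>2)) * v \<xi> \<partial>lborel) \<le> (\<integral>\<^sup>+j. ennreal (exp (- q j * t)) * b j \<partial>?C)" if t: "t > 0" for t
  proof -
    let ?h = "\<lambda>\<xi>::real^'n. ennreal (exp (- (\<mu>/2) * t * (norm \<xi>)\<^sup>2))"
    have "(\<integral>\<^sup>+\<xi>. ?h \<xi> * v \<xi> \<partial>lborel) \<le> (\<integral>\<^sup>+\<xi>. \<integral>\<^sup>+j. ?h \<xi> * (p j \<xi> * v \<xi>) \<partial>?C \<partial>lborel)"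
    proof (rule nn_integral_mono_AE, rule AE_mp[OF AE_lborel_singleton[of 0]], rule AE_I2, rule impI)
      fix \<xi> :: "real^'n" assume "\<xi> \<noteq> 0"
      have "?h \<xi> * v \<xi> * 1 \<le> ?h \<xi> * v \<xi> * (\<integral>\<^sup>+j. p j \<xi> \<partial>?C)" by (intro mult_left_mono one \<open>\<xi> \<noteq> 0\<close>) auto
      also have "\<dots> = (\<integral>\<^sup>+j. ?h \<xi> * (p j \<xi> * v \<xi>) \<partial>?C)"
        by (subst nn_integral_cmult[symmetric]) (auto simp: mult_ac)
      finally show "?h \<xi> * v \<xi> \<le> (\<integral>\<^sup>+j. ?h \<xi> * (p j \<xi> * v \<xi>) \<partial>?C)" by simp
    qed
    also have "\<dots> = (\<integral>\<^sup>+j. \<integral>\<^sup>+\<xi>. ?h \<xi> * (p j \<xi> * v \<xi>) \<partial>lborel \<partial>?C)"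
      by (rule LC.Fubini'[symmetric]) (simp add: split_beta, measurable)
    also have "\<dots> \<le> (\<integral>\<^sup>+j. \<integral>\<^sup>+\<xi>. ennreal (exp (- q j * t)) * (p j \<xi> * v \<xi>) \<partial>lborel \<partial>?C)"
    proof (intro nn_integral_mono)
      fix j :: int and \<xi> :: "real^'n"
      show "?h \<xi> * (p j \<xi> * v \<xi>) \<le> ennreal (exp (- q j * t)) * (p j \<xi> * v \<xi>)"
      proof (cases "dyadic_scale \<psi> j \<xi> = 0")
        case False
        from supp[OF False] have "1/2 \<le> 2 powr - real_of_int j * norm \<xi>" by simp
        then have n: "2 powr real_of_int j / 2 \<le> norm \<xi>" by (simp add: powr_minus field_simps)
        have "(2 powr real_of_int j / 2)\<^sup>2 \<le> (norm \<xi>)\<^sup>2" by (rule power_mono[OF n]) simp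
        moreover have "(2 powr real_of_int j / 2)\<^sup>2 = 4 powr real_of_int j / 4"
          using powr_mult[of 2 2 "real_of_int j"] by (simp add: power2_eq_square)
        ultimately have "(\<mu>/2) * t * (4 powr real_of_int j / 4) \<le> (\<mu>/2) * t * (norm \<xi>)\<^sup>2"
          using \<mu> t by (intro mult_left_mono) auto
        then have "exp (- (\<mu>/2) * t * (norm \<xi>)\<^sup>2) \<le> exp (- q j * t)" by (simp add: q_def mult_ac)
        then show ?thesis by (intro mult_right_mono ennreal_leI) auto
      qed (simp add: p_def)
    qed
    also have "\<dots> = (\<integral>\<^sup>+j. ennreal (exp (- q j * t)) * b j \<partial>?C)"
      unfolding b_def by (intro nn_integral_cong nn_integral_cmult) measurable
    finally show ?thesis .
  qed
  have time: "(\<integral>\<^sup>+t. indicator {0<..} t * (ennreal (exp (- q j * t)) * ennreal (exp (- q k * t))) \<partial>lborel) \<le> ennreal (1 / (q j + q k))" for j k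
  proof -
    let ?s = "q j + q k"
    have s: "?s > 0" using q[of j] q[of k] by simp
    have "(\<integral>\<^sup>+t. indicator {0<..} t * (ennreal (exp (- q j * t)) * ennreal (exp (- q k * t))) \<partial>lborel) \<le> (\<integral>\<^sup>+t. ennreal (exp (- ?s * t)) * indicator {0..} t \<partial>lborel)"
      by (intro nn_integral_mono) (auto simp: indicator_def ennreal_mult[symmetric] exp_add[symmetric] algebra_simps)
    also have "\<dots> = ennreal (0 - (- exp (- ?s * 0) / ?s))"
    proof (rule nn_integral_FTC_atLeast[where F="\<lambda>t. - exp (- ?s * t) / ?s"])
      have "((\<lambda>t. - exp (- c * t) / c) \<longlongrightarrow> 0) at_top" if "c > 0" for c :: real using that by real_asymp
      from this[OF s] show "((\<lambda>t. - exp (- ?s * t) / ?s) \<longlongrightarrow> 0) at_top" .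
      have "((\<lambda>t. - exp (- c * t) / c) has_real_derivative exp (- c * x)) (at x)" if "c > 0" for c x :: real
        using that by (auto intro!: derivative_eq_intros)
      from this[OF s] show "((\<lambda>t. - exp (- ?s * t) / ?s) has_real_derivative exp (- ?s * x)) (at x)" for x .
    qed auto
    also have "\<dots> = ennreal (1 / ?s)" by simp
    finally show ?thesis .
  qed
  let ?E = "\<lambda>j t. ennreal (exp (- q j * t))"
  let ?g = "\<lambda>j k::int. (1/2) ^ nat \<bar>j - k\<bar> :: real"
  let ?I = "\<lambda>t. \<integral>\<^sup>+\<xi>. ennreal (exp (- (\<mu>/2) * t * (norm \<xi>)\<^sup>2)) * v \<xi> \<partial>lborel"
  have [measurable]: "(\<lambda>x. q (f x)) \<in> borel_measurable M" if "f \<in> M \<rightarrow>\<^sub>M ?C" for f and M :: "'x measure"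
    using measurable_compose[OF that, of q borel] by simp
  have [measurable]: "(\<lambda>x. b (f x)) \<in> borel_measurable M" if "f \<in> M \<rightarrow>\<^sub>M ?C" for f and M :: "'x measure"
    using measurable_compose[OF that, of b borel] by simp
  have "L2L1 (\<lambda>t \<xi>. ennreal (exp (- (\<mu>/2) * t * (norm \<xi>)\<^sup>2)) * v \<xi>)
      \<le> (\<integral>\<^sup>+t. \<integral>\<^sup>+j. \<integral>\<^sup>+k. indicator {0<..} t * ((?E j t * b j) * (?E k t * b k)) \<partial>?C \<partial>?C \<partial>lborel)"
  proof (rule nn_integral_mono)
    fix t :: real
    show "indicator {0<..} t * (?I t)\<^sup>2
      \<le> (\<integral>\<^sup>+j. \<integral>\<^sup>+k. indicator {0<..} t * ((?E j t * b j) * (?E k t * b k)) \<partial>?C \<partial>?C)"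
    proof (cases "t > 0")
      case True
      have "(?I t)\<^sup>2 \<le> (\<integral>\<^sup>+j. ?E j t * b j \<partial>?C)\<^sup>2"
        by (rule power_mono[OF inner[OF True]]) simp
      also have "\<dots> = (\<integral>\<^sup>+j. \<integral>\<^sup>+k. (?E j t * b j) * (?E k t * b k) \<partial>?C \<partial>?C)"
        by (simp add: power2_eq_square nn_integral_cmult nn_integral_multc)
      finally show ?thesis using True by simp
    qed simp
  qed
  also have "\<dots> = (\<integral>\<^sup>+j. \<integral>\<^sup>+t. \<integral>\<^sup>+k. indicator {0<..} t * ((?E j t * b j) * (?E k t * b k)) \<partial>?C \<partial>lborel \<partial>?C)"
    by (rule RC.Fubini'[symmetric]) (simp add: split_beta, measurable)
  also have "\<dots> = (\<integral>\<^sup>+j. \<integral>\<^sup>+k. \<integral>\<^sup>+t. indicator {0<..} t * ((?E j t * b j) * (?E k t * b k)) \<partial>lborel \<partial>?C \<partial>?C)"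
    by (intro nn_integral_cong RC.Fubini'[symmetric]) (simp add: split_beta, measurable)
  also have "\<dots> = (\<integral>\<^sup>+j. \<integral>\<^sup>+k. (b j * b k) * (\<integral>\<^sup>+t. indicator {0<..} t * (?E j t * ?E k t) \<partial>lborel) \<partial>?C \<partial>?C)"
    by (intro nn_integral_cong, subst nn_integral_cmult[symmetric]) (auto simp: mult_ac)
  also have "\<dots> \<le> (\<integral>\<^sup>+j. \<integral>\<^sup>+k. ennreal (8 / \<mu>) * (((\<beta> j)\<^sup>2 + (\<beta> k)\<^sup>2) * ennreal (?g j k)) \<partial>?C \<partial>?C)"
  proof (intro nn_integral_mono)
    fix j k :: int
    have bb: "\<beta> j * \<beta> k \<le> (\<beta> j)\<^sup>2 + (\<beta> k)\<^sup>2"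
    proof -
      have "\<beta> j * \<beta> k \<le> 2 * \<beta> j * \<beta> k" unfolding mult_2 distrib_right by (rule add_increasing) simp_all
      then show ?thesis using sum_of_squares_ge_ennreal[of "\<beta> j" "\<beta> k"] by (rule order_trans)
    qed
    have "(b j * b k) * (\<integral>\<^sup>+t. indicator {0<..} t * (?E j t * ?E k t) \<partial>lborel) \<le> (b j * b k) * ennreal (1 / (q j + q k))"
      by (intro mult_left_mono time) auto
    also have "\<dots> = (\<beta> j * \<beta> k) * (ennreal (2 powr real_of_int j) * ennreal (2 powr real_of_int k) * ennreal (1 / (q j + q k)))"
      unfolding \<beta> by (simp only: mult_ac)
    also have "ennreal (2 powr real_of_int j) * ennreal (2 powr real_of_int k) * ennreal (1 / (q j + q k)) =
      ennreal (2 powr real_of_int j * 2 powr real_of_int k * (1 / (q j + q k)))"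
      using q[of j] q[of k] by (simp add: ennreal_mult[symmetric] less_imp_le)
    also have "2 powr real_of_int j * 2 powr real_of_int k * (1 / (q j + q k)) = 8 / \<mu> * (2 powr real_of_int j * 2 powr real_of_int k / (4 powr real_of_int j + 4 powr real_of_int k))"
    proof -
      have "q j + q k = \<mu> / 8 * (4 powr real_of_int j + 4 powr real_of_int k)" by (simp add: q_def distrib_left)
      then show ?thesis by (simp only: times_divide_eq_right times_divide_eq_left divide_divide_eq_right mult_1_left mult_1_right divide_divide_eq_left mult.commute)
    qed
    also have "(\<beta> j * \<beta> k) * ennreal (8 / \<mu> * (2 powr real_of_int j * 2 powr real_of_int k / (4 powr real_of_int j + 4 powr real_of_int k)))
       \<le> ((\<beta> j)\<^sup>2 + (\<beta> k)\<^sup>2) * ennreal (8 / \<mu> * (1/2) ^ nat \<bar>j - k\<bar>)"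
      using \<mu> by (intro mult_mono bb ennreal_leI mult_left_mono dyadic_weight_le) auto
    also have "\<dots> = ennreal (8 / \<mu>) * (((\<beta> j)\<^sup>2 + (\<beta> k)\<^sup>2) * ennreal (?g j k))"
      using \<mu> by (subst ennreal_mult) (auto simp: mult_ac)
    finally show "(b j * b k) * (\<integral>\<^sup>+t. indicator {0<..} t * (?E j t * ?E k t) \<partial>lborel) \<le> ennreal (8 / \<mu>) * (((\<beta> j)\<^sup>2 + (\<beta> k)\<^sup>2) * ennreal (?g j k))" .
  qed
  also have "\<dots> = ennreal (8 / \<mu>) * ((\<integral>\<^sup>+j. \<integral>\<^sup>+k. (\<beta> j)\<^sup>2 * ennreal (?g j k) \<partial>?C \<partial>?C) + (\<integral>\<^sup>+j. \<integral>\<^sup>+k. (\<beta> k)\<^sup>2 * ennreal (?g j k) \<partial>?C \<partial>?C))"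
    by (simp add: nn_integral_cmult nn_integral_add distrib_right)
  also have "(\<integral>\<^sup>+j. \<integral>\<^sup>+k. (\<beta> k)\<^sup>2 * ennreal (?g j k) \<partial>?C \<partial>?C) = (\<integral>\<^sup>+k. \<integral>\<^sup>+j. (\<beta> k)\<^sup>2 * ennreal (?g j k) \<partial>?C \<partial>?C)"
  proof -
    interpret CC: pair_sigma_finite ?C ?C ..
    show ?thesis by (rule CC.Fubini') (simp add: pair_measure_countable)
  qed
  also have "\<dots> = (\<integral>\<^sup>+j. \<integral>\<^sup>+k. (\<beta> j)\<^sup>2 * ennreal (?g j k) \<partial>?C \<partial>?C)"
    by (simp add: abs_minus_commute)
  also have "(\<integral>\<^sup>+j. \<integral>\<^sup>+k. (\<beta> j)\<^sup>2 * ennreal (?g j k) \<partial>?C \<partial>?C) + (\<integral>\<^sup>+j. \<integral>\<^sup>+k. (\<beta> j)\<^sup>2 * ennreal (?g j k) \<partial>?C \<partial>?C)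
     \<le> (\<integral>\<^sup>+j. (\<beta> j)\<^sup>2 * 4 \<partial>?C) + (\<integral>\<^sup>+j. (\<beta> j)\<^sup>2 * 4 \<partial>?C)"
    by (intro add_mono nn_integral_mono; subst nn_integral_cmult; simp add: mult_left_mono int_geometric)
  also have "\<dots> = 8 * (\<integral>\<^sup>+j. (\<beta> j)\<^sup>2 \<partial>?C)"
  proof -
    have "(\<integral>\<^sup>+j. (\<beta> j)\<^sup>2 * 4 \<partial>?C) = 4 * (\<integral>\<^sup>+j. (\<beta> j)\<^sup>2 \<partial>?C)"
      by (subst nn_integral_multc) (simp_all add: mult.commute)
    moreover have "4 * x + 4 * x = 8 * x" for x :: ennreal by (simp flip: distrib_right)
    ultimately show ?thesis by simp
  qed
  also have "ennreal (8 / \<mu>) * (8 * (\<integral>\<^sup>+j. (\<beta> j)\<^sup>2 \<partial>?C)) = ennreal (64 / \<mu>) * (\<integral>\<^sup>+j. (\<beta> j)\<^sup>2 \<partial>?C)"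
  proof -
    have "ennreal (8 / \<mu>) * 8 = ennreal (64 / \<mu>)" using \<mu> ennreal_mult[of "8/\<mu>" 8] by simp
    then show ?thesis by (simp only: mult.assoc[symmetric])
  qed
  finally show ?thesis by (simp add: mult_left_mono)
qed

section \<open>The initial velocity\<close>

lemma dyadic_cutoff_le_one:
  fixes \<psi> :: "real^'n::finite \<Rightarrow> real"
  assumes "dyadic_cutoff \<psi>" shows "0 \<le> \<psi> x" "\<psi> x \<le> 1"
proof -
  have nn: "\<And>x. 0 \<le> \<psi> x" and supp: "\<And>x. \<psi> x \<noteq> 0 \<Longrightarrow> 1/2 \<le> norm x \<and> norm x \<le> 2"
    and tot: "\<And>x. x \<noteq> 0 \<Longrightarrow> ((\<lambda>j::int. dyadic_scale \<psi> j x) has_sum 1) UNIV"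
    using assms unfolding dyadic_cutoff_def by blast+
  show "0 \<le> \<psi> x" by (rule nn)
  show "\<psi> x \<le> 1"
  proof (cases "x = 0")
    case True
    then show ?thesis using supp[of 0] by force
  next
    case False
    have "(\<Sum>j\<in>{0::int}. dyadic_scale \<psi> j x) \<le> 1"
      by (rule has_sum_mono2[OF has_sum_finite tot[OF False]]) (auto simp: nn)
    then show ?thesis by simp
  qed
qed

lemma norm_vec_scale:
  fixes x :: "'n::finite \<Rightarrow> complex"
  shows "norm (\<chi> l. complex_of_real r * x l) = \<bar>r\<bar> * norm (\<chi> l. x l)"
proof -
  have "(\<chi> l. complex_of_real r * x l) = r *\<^sub>R (\<chi> l. x l)" unfolding scaleR_vec_def by (simp add: scaleR_conv_of_real)
  then show ?thesis by simp
qed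

lemma (in bump) dyadic_block_norm:
  fixes \<psi> :: "real^'n \<Rightarrow> real" and u\<^sub>0 :: "'n vdist"
  assumes \<psi>: "dyadic_cutoff \<psi>" and u0: "\<And>l. has_ft (u\<^sub>0 $ l)"
  shows "Lhat_norm p (dyadic_block \<psi> j u\<^sub>0) = Lp_norm lborel (conj_exp p) (\<lambda>\<xi>. ennreal (dyadic_scale \<psi> j \<xi>) * ennreal (norm (vft u\<^sub>0 \<xi>)))"
proof -
  let ?m = "\<lambda>\<xi>. dyadic_scale \<psi> j \<xi>"
  have [measurable]: "\<psi> \<in> borel_measurable borel" using \<psi> by (simp add: dyadic_cutoff_def smooth_measurable)
  have [measurable]: "ft (u\<^sub>0 $ l) \<in> borel_measurable borel" for l by (rule ft_represents(2)[OF u0])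
  have w: "wL1 (\<lambda>\<xi>. complex_of_real (?m \<xi>) * ft (u\<^sub>0 $ l) \<xi>)" for l
  proof (rule integrable_wL1)
    let ?R = "2 * 2 powr real_of_int j"
    have "locally_integrable (ft (u\<^sub>0 $ l))" using ft_represents(1)[OF u0] by (simp add: represents_def)
    then have i: "integrable lborel (\<lambda>\<xi>. indicat_real (cball 0 ?R) \<xi> *\<^sub>R ft (u\<^sub>0 $ l) \<xi>)"
      unfolding locally_integrable_def set_integrable_def using compact_cball by blast
    show "integrable lborel (\<lambda>\<xi>. complex_of_real (?m \<xi>) * ft (u\<^sub>0 $ l) \<xi>)"
    proof (rule Bochner_Integration.integrable_bound[OF i])
      show "AE \<xi> in lborel. norm (complex_of_real (?m \<xi>) * ft (u\<^sub>0 $ l) \<xi>) \<le> norm (indicat_real (cball 0 ?R) \<xi> *\<^sub>R ft (u\<^sub>0 $ l) \<xi>)"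
      proof (rule AE_I2)
        fix \<xi> :: "real^'n"
        show "norm (complex_of_real (?m \<xi>) * ft (u\<^sub>0 $ l) \<xi>) \<le> norm (indicat_real (cball 0 ?R) \<xi> *\<^sub>R ft (u\<^sub>0 $ l) \<xi>)"
        proof (cases "?m \<xi> = 0")
          case False
          then have "norm ((2 powr - real_of_int j) *\<^sub>R \<xi>) \<le> 2" using \<psi> unfolding dyadic_cutoff_def by blast
          then have "norm \<xi> \<le> ?R" by (simp add: powr_minus field_simps)
          moreover have "\<bar>?m \<xi>\<bar> * norm (ft (u\<^sub>0 $ l) \<xi>) \<le> 1 * norm (ft (u\<^sub>0 $ l) \<xi>)"
            using dyadic_cutoff_le_one[OF \<psi>] by (intro mult_right_mono) auto
          ultimately show ?thesis by (simp add: norm_mult indicator_def)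
        qed simp
      qed
    qed measurable
  qed
  have s: "dyadic_block \<psi> j u\<^sub>0 $ l \<in> tempered" "has_spectrum (dyadic_block \<psi> j u\<^sub>0 $ l) (\<lambda>\<xi>. complex_of_real (?m \<xi>) * ft (u\<^sub>0 $ l) \<xi>)" for l
    unfolding dyadic_block_def using multiplier_spectrum[OF ft_represents(2)[OF u0] AE_I2[OF refl] _ w] by simp_all
  show ?thesis
    unfolding Lhat_norm_spectrum[OF s] norm_vec_scale
    using dyadic_cutoff_le_one(1)[OF \<psi>] by (simp add: ennreal_mult vft_def)
qed

text \<open>Each dyadic piece is bounded, and at every frequency three consecutive ones sum to \<open>1\<close>.\<close>

lemma (in bump) bounded_initial_spectrum:
  fixes \<psi> :: "real^'n \<Rightarrow> real" and u\<^sub>0 :: "'n vdist"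
  assumes \<psi>: "dyadic_cutoff \<psi>" and u0: "u\<^sub>0 \<in> herz_space \<psi> 0 1 \<infinity>"
  obtains A where "A \<ge> 0" "AE \<xi> in lborel. norm (vft u\<^sub>0 \<xi>) \<le> A"
proof -
  have ft: "\<And>l. has_ft (u\<^sub>0 $ l)" and fin: "herz_norm \<psi> 0 1 \<infinity> u\<^sub>0 < \<infinity>" using u0 by (auto simp: herz_space_def)
  let ?m = "\<lambda>j \<xi>. dyadic_scale \<psi> j \<xi>"
  obtain A where A: "A \<ge> 0" "herz_norm \<psi> 0 1 \<infinity> u\<^sub>0 = ennreal A" using fin by (cases "herz_norm \<psi> 0 1 \<infinity> u\<^sub>0") auto
  have "AE \<xi> in lborel. ?m j \<xi> * norm (vft u\<^sub>0 \<xi>) \<le> A" for j :: int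
  proof -
    have "AE j in count_space UNIV. ennreal (2 powr (0 * real_of_int j)) * Lhat_norm 1 (dyadic_block \<psi> j u\<^sub>0) \<le> herz_norm \<psi> 0 1 \<infinity> u\<^sub>0"
      unfolding herz_norm_def Lp_norm_def by (simp add: esssup_AE)
    then have "Lhat_norm 1 (dyadic_block \<psi> j u\<^sub>0) \<le> ennreal A" using A by (simp add: AE_count_space)
    then have "esssup lborel (\<lambda>\<xi>. ennreal (?m j \<xi>) * ennreal (norm (vft u\<^sub>0 \<xi>))) \<le> ennreal A"
      unfolding dyadic_block_norm[OF \<psi> ft] by (simp add: Lp_norm_def)
    moreover have "AE \<xi> in lborel. ennreal (?m j \<xi>) * ennreal (norm (vft u\<^sub>0 \<xi>)) \<le> esssup lborel (\<lambda>\<xi>. ennreal (?m j \<xi>) * ennreal (norm (vft u\<^sub>0 \<xi>)))"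
      by (rule esssup_AE)
    ultimately have "AE \<xi> in lborel. ennreal (?m j \<xi>) * ennreal (norm (vft u\<^sub>0 \<xi>)) \<le> ennreal A" by auto
    then show ?thesis
      by eventually_elim (use A dyadic_cutoff_le_one[OF \<psi>] in \<open>simp add: ennreal_mult[symmetric]\<close>)
  qed
  then have "AE \<xi> in lborel. \<forall>j::int. ?m j \<xi> * norm (vft u\<^sub>0 \<xi>) \<le> A" by (subst AE_all_countable) blast
  moreover have "AE \<xi> in lborel. \<xi> \<noteq> (0::real^'n)" by (rule AE_lborel_singleton)
  ultimately have "AE \<xi> in lborel. norm (vft u\<^sub>0 \<xi>) \<le> 3 * A"
  proof eventually_elim
    case (elim \<xi>)
    obtain k :: int where k: "(\<Sum>j\<in>{k - 1, k, k + 1}. ?m j \<xi>) = 1" using dyadic_three_terms[OF \<psi> elim(2)] by blast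
    have "norm (vft u\<^sub>0 \<xi>) = (\<Sum>j\<in>{k - 1, k, k + 1}. ?m j \<xi> * norm (vft u\<^sub>0 \<xi>))" unfolding sum_distrib_right[symmetric] k by simp
    also have "\<dots> \<le> (\<Sum>j\<in>{k - 1, k, k + 1}. A)" by (intro sum_mono) (use elim(1) in blast)
    finally show ?case by simp
  qed
  then show ?thesis using that[of "3 * A"] A by simp
qed

text \<open>The form in which the smallness of the initial velocity enters the a priori bound.\<close>

lemma (in bump) small_heat_flow:
  fixes \<psi> :: "real^'n \<Rightarrow> real" and u\<^sub>0 :: "'n vdist"
  assumes \<psi>: "dyadic_cutoff \<psi>" and ft: "\<And>l. has_ft (u\<^sub>0 $ l)" and \<mu>: "\<mu> > 0" and \<epsilon>: "\<epsilon> > 0"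
    and small: "herz_norm \<psi> (-1) \<infinity> 2 u\<^sub>0 < ennreal \<epsilon>"
  shows "L2L1 (\<lambda>t \<xi>. ennreal (exp (- (\<mu>/2) * t * (norm \<xi>)\<^sup>2)) * ennreal (norm (vft u\<^sub>0 \<xi>)))
     \<le> ennreal (64 / \<mu> * \<epsilon>\<^sup>2)"
proof -
  let ?m = "\<lambda>j \<xi>. dyadic_scale \<psi> j \<xi>"
  let ?\<beta> = "\<lambda>j::int. ennreal (2 powr - real_of_int j) * (\<integral>\<^sup>+\<xi>. ennreal (?m j \<xi>) * ennreal (norm (vft u\<^sub>0 \<xi>)) \<partial>lborel)"
  let ?S = "\<integral>\<^sup>+j. (?\<beta> j)\<^sup>2 \<partial>count_space UNIV"
  have "herz_norm \<psi> (-1) \<infinity> 2 u\<^sub>0 = epowr ?S (1/2)"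
    unfolding herz_norm_def Lp_norm_2 dyadic_block_norm[OF \<psi> ft] by simp
  with small have S: "epowr ?S (1/2) < ennreal \<epsilon>" by simp
  have "?S \<le> ennreal (\<epsilon>\<^sup>2)"
  proof (cases "?S")
    case (real r)
    then have "ennreal (r powr (1/2)) < ennreal \<epsilon>" using S by (simp add: epowr_def)
    then have "sqrt r < \<epsilon>" using real \<epsilon> by (simp add: powr_half_sqrt ennreal_less_iff)
    then have "r \<le> \<epsilon>\<^sup>2" using real by (metis less_imp_le real_sqrt_ge_zero real_sqrt_pow2 power_mono)
    then show ?thesis using real by (simp add: ennreal_leI)
  next
    case top
    then show ?thesis using S by (simp add: epowr_def)
  qed
  moreover have "(\<lambda>\<xi>. ennreal (norm (vft u\<^sub>0 \<xi>))) \<in> borel_measurable borel"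
    using vec_measurable[OF ft_represents(2)[OF ft]] unfolding vft_def by measurable
  from herz_heat_flow[OF \<psi> this \<mu>]
  have "L2L1 (\<lambda>t \<xi>. ennreal (exp (- (\<mu>/2) * t * (norm \<xi>)\<^sup>2)) * ennreal (norm (vft u\<^sub>0 \<xi>)))
     \<le> ennreal (64 / \<mu>) * ?S" .
  ultimately have "L2L1 (\<lambda>t \<xi>. ennreal (exp (- (\<mu>/2) * t * (norm \<xi>)\<^sup>2)) * ennreal (norm (vft u\<^sub>0 \<xi>)))
     \<le> ennreal (64 / \<mu>) * ennreal (\<epsilon>\<^sup>2)"
    by (meson mult_left_mono order_trans zero_le)
  moreover have "ennreal (64 / \<mu>) * ennreal (\<epsilon>\<^sup>2) = ennreal (64 / \<mu> * \<epsilon>\<^sup>2)" using \<mu> by (intro ennreal_mult[symmetric]) auto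
  ultimately show ?thesis by simp
qed

section \<open>The spectrum of a mild solution\<close>

definition amplitude :: "('n \<Rightarrow> real \<Rightarrow> real^'n::finite \<Rightarrow> complex) \<Rightarrow> real \<Rightarrow> real^'n \<Rightarrow> ennreal" where
  "amplitude f t \<xi> = ennreal (norm (\<chi> l. f l t \<xi>))"

lemma amplitude_measurable:
  fixes f :: "'n::finite \<Rightarrow> real \<Rightarrow> real^'n \<Rightarrow> complex"
  assumes f: "\<And>l. jointly_borel (f l)"
  shows "jointly_borel (amplitude f)"
proof -
  have "(\<lambda>x. (\<chi> l. f l (fst x) (snd x))) \<in> borel_measurable (borel \<Otimes>\<^sub>M borel)"
    by (rule vec_measurable) (use f in \<open>simp add: split_beta\<close>)
  then show ?thesis unfolding amplitude_def split_beta by measurable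
qed

text \<open>A solution that is square integrable in time has an integrable spectrum at almost every time. The jointly
  measurable choice makes Fubini's theorem applicable to the Duhamel integral.\<close>

lemma (in bump) solution_spectrum:
  fixes u :: "real \<Rightarrow> 'n vdist"
  assumes u: "L2_time_Lhat_inf u"
  obtains f :: "'n \<Rightarrow> real \<Rightarrow> real^'n \<Rightarrow> complex" where
    "\<And>l. jointly_borel (f l)"
    "AE t in lborel. t > 0 \<longrightarrow> (\<forall>l. integrable lborel (f l t) \<and> has_spectrum (u t $ l) (f l t))"
    "L2L1 (amplitude f) < \<infinity>"
proof -
  have T: "\<And>t l. t > 0 \<Longrightarrow> u t $ l \<in> tempered"
    and M: "\<And>l \<phi>. \<phi> \<in> schwartz \<Longrightarrow> (\<lambda>t. (u t $ l) \<phi>) \<in> borel_measurable (restrict_space lborel {0<..})"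
    and L: "Lp_norm (restrict_space lborel {0<..}) 2 (\<lambda>t. Lhat_norm \<infinity> (u t)) < \<infinity>"
    using u unfolding L2_time_Lhat_inf_def by auto
  define G where "G l = {t. t > 0 \<and> L1_spectrum (u t $ l)}" for l
  have [measurable]: "G l \<in> sets borel" for l
    unfolding G_def by (rule jointly_measurable_spectrum(1)[of "\<lambda>t. u t $ l"]) (use T M in auto)
  have "\<exists>f. jointly_borel f \<and>
      (\<forall>t>0. L1_spectrum (u t $ l) \<longrightarrow> integrable lborel (f t) \<and> has_spectrum (u t $ l) (f t))" for l
    by (rule jointly_measurable_spectrum(2)[of "\<lambda>t. u t $ l"]) (use T M in auto)
  then obtain f where f: "\<And>l. jointly_borel (f l)"
    and sp: "\<And>l t. t \<in> G l \<Longrightarrow> integrable lborel (f l t) \<and> has_spectrum (u t $ l) (f l t)"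
    unfolding G_def by (simp only: mem_Collect_eq) metis
  note [measurable] = amplitude_measurable[OF f]
  define N where "N t = (if \<forall>l. t \<in> G l then (\<integral>\<^sup>+\<xi>. amplitude f t \<xi> \<partial>lborel) else \<infinity>)" for t
  have [measurable]: "N \<in> borel_measurable borel" unfolding N_def by measurable
  have eq: "Lhat_norm \<infinity> (u t) = N t" if t: "t > 0" for t
  proof (cases "\<forall>l. t \<in> G l")
    case True
    then have "Lhat_norm \<infinity> (u t) = Lp_norm lborel (conj_exp \<infinity>) (amplitude f t)"
      using sp unfolding amplitude_def by (intro Lhat_norm_spectrum T t) blast
    then show ?thesis using True by (simp add: N_def)
  next
    case False
    then obtain l where l: "\<not> L1_spectrum (u t $ l)" using t by (auto simp: G_def)
    have "Lhat_norm \<infinity> (u t) = \<infinity>"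
    proof (rule ccontr)
      assume fin: "Lhat_norm \<infinity> (u t) \<noteq> \<infinity>"
      then have ft: "\<forall>l. has_ft (u t $ l)" by (auto simp: Lhat_norm_def split: if_splits)
      then have I: "(\<integral>\<^sup>+\<xi>. ennreal (norm (vft (u t) \<xi>)) \<partial>lborel) < \<infinity>" using fin by (simp add: Lhat_norm_def less_top)
      have [measurable]: "ft (u t $ l) \<in> borel_measurable borel" using ft_represents(2) ft by blast
      have "integrable lborel (ft (u t $ l))"
      proof (rule integrableI_bounded)
        have "(\<integral>\<^sup>+\<xi>. ennreal (norm (ft (u t $ l) \<xi>)) \<partial>lborel) \<le> (\<integral>\<^sup>+\<xi>. ennreal (norm (vft (u t) \<xi>)) \<partial>lborel)"
        proof (intro nn_integral_mono ennreal_leI)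
          show "norm (ft (u t $ l) \<xi>) \<le> norm (vft (u t) \<xi>)" for \<xi>
            using Finite_Cartesian_Product.norm_nth_le[of "vft (u t) \<xi>" l] by (simp add: vft_def)
        qed
        then show "(\<integral>\<^sup>+\<xi>. ennreal (norm (ft (u t $ l) \<xi>)) \<partial>lborel) < \<infinity>" using I by (rule le_less_trans)
      qed simp
      then show False using l has_ft_spectrum[of "u t $ l"] ft integrable_wL1 unfolding L1_spectrum_def by blast
    qed
    moreover have "N t = \<infinity>" using False by (auto simp: N_def)
    ultimately show ?thesis by simp
  qed
  have "(\<integral>\<^sup>+t. (N t)\<^sup>2 \<partial>restrict_space lborel {0<..}) < \<infinity>"
  proof -
    have "(\<integral>\<^sup>+t. (Lhat_norm \<infinity> (u t))\<^sup>2 \<partial>restrict_space lborel {0<..}) = (\<integral>\<^sup>+t. (N t)\<^sup>2 \<partial>restrict_space lborel {0<..})"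
      by (rule nn_integral_cong) (simp add: space_restrict_space eq[unfolded infinity_ennreal_def])
    moreover have "(\<integral>\<^sup>+t. (Lhat_norm \<infinity> (u t))\<^sup>2 \<partial>restrict_space lborel {0<..}) < \<infinity>"
      using L by (auto simp: Lp_norm_2 epowr_def less_top split: if_splits)
    ultimately show ?thesis by simp
  qed
  then have fin: "(\<integral>\<^sup>+t. indicator {0<..} t * (N t)\<^sup>2 \<partial>lborel) < \<infinity>"
    by (subst (asm) nn_integral_restrict_space) (auto simp: mult.commute)
  then have "AE t in lborel. indicator {0<..} t * (N t)\<^sup>2 \<noteq> \<infinity>" by (intro nn_integral_noteq_infinite) auto
  then have good: "AE t in lborel. t > 0 \<longrightarrow> (\<forall>l. t \<in> G l)"
  proof eventually_elim
    case (elim t)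
    then show ?case by (auto simp: N_def power2_eq_square ennreal_top_mult split: if_splits)
  qed
  show ?thesis
  proof (rule that[OF f])
    show "AE t in lborel. t > 0 \<longrightarrow> (\<forall>l. integrable lborel (f l t) \<and> has_spectrum (u t $ l) (f l t))"
      using good by eventually_elim (use sp in blast)
    have "L2L1 (amplitude f) \<le> (\<integral>\<^sup>+t. indicator {0<..} t * (N t)\<^sup>2 \<partial>lborel)"
      by (intro nn_integral_mono mult_left_mono power_mono) (auto simp: N_def)
    then show "L2L1 (amplitude f) < \<infinity>"
      using fin by (rule le_less_trans)
  qed
qed

text \<open>Every entry of the projection is at most \<open>2\<close>, and there are \<open>n\<^sup>2\<close> products of components.\<close>

definition ns_const :: "'n::finite itself \<Rightarrow> real" where
  "ns_const _ = 2 * real CARD('n) ^ 2 * fc TYPE('n)"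

lemma norm_conv_le:
  fixes f :: "'n::finite \<Rightarrow> real^'n \<Rightarrow> complex"
  assumes [measurable]: "\<And>l. f l \<in> borel_measurable borel"
  shows "ennreal (norm (conv (f j) (f m) \<xi>)) \<le> nconv (\<lambda>\<eta>. ennreal (norm (\<chi> l. f l \<eta>))) (\<lambda>\<eta>. ennreal (norm (\<chi> l. f l \<eta>))) \<xi>"
proof (cases "integrable lborel (\<lambda>\<eta>. f j \<eta> * f m (\<xi> - \<eta>))")
  case True
  have "ennreal (norm (conv (f j) (f m) \<xi>)) \<le> (\<integral>\<^sup>+\<eta>. ennreal (norm (f j \<eta> * f m (\<xi> - \<eta>))) \<partial>lborel)"
    unfolding conv_def by (rule integral_norm_bound_ennreal[OF True])
  also have "\<dots> \<le> nconv (\<lambda>\<eta>. ennreal (norm (\<chi> l. f l \<eta>))) (\<lambda>\<eta>. ennreal (norm (\<chi> l. f l \<eta>))) \<xi>"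
    unfolding nconv_def
  proof (rule nn_integral_mono)
    fix \<eta>
    have c: "norm (f i x) \<le> norm (\<chi> l. f l x)" for i x
      using Finite_Cartesian_Product.norm_nth_le[of "\<chi> l. f l x" i] by simp
    show "ennreal (norm (f j \<eta> * f m (\<xi> - \<eta>))) \<le> ennreal (norm (\<chi> l. f l \<eta>)) * ennreal (norm (\<chi> l. f l (\<xi> - \<eta>)))"
      unfolding norm_mult by (subst ennreal_mult) (auto intro!: mult_mono ennreal_leI c)
  qed
  finally show ?thesis .
next
  case False
  then show ?thesis by (simp add: conv_def not_integrable_integral_eq)
qed

lemma ns_spectrum_bound:
  fixes f :: "'n::finite \<Rightarrow> real^'n \<Rightarrow> complex"
  assumes [measurable]: "\<And>l. f l \<in> borel_measurable borel"
  shows "ennreal (norm (ns_spectrum f l \<xi>)) \<le> ennreal (ns_const TYPE('n)) *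
    (ennreal (norm \<xi>) * nconv (\<lambda>\<eta>. ennreal (norm (\<chi> l. f l \<eta>))) (\<lambda>\<eta>. ennreal (norm (\<chi> l. f l \<eta>))) \<xi>)"
proof -
  let ?X = "nconv (\<lambda>\<eta>. ennreal (norm (\<chi> l. f l \<eta>))) (\<lambda>\<eta>. ennreal (norm (\<chi> l. f l \<eta>))) \<xi>"
  let ?c = "fc TYPE('n)"
  have "norm (ns_spectrum f l \<xi>) \<le> (\<Sum>m\<in>UNIV. \<Sum>j\<in>UNIV. 2 * ?c * (norm \<xi> * norm (conv (f j) (f m) \<xi>)))"
    unfolding ns_spectrum_def
  proof (intro sum_norm_le)
    fix m
    have "norm (leray_symbol \<xi> $ l $ m * (\<Sum>j\<in>UNIV. (\<i> * complex_of_real ?c) * (complex_of_real (\<xi> $ j) * conv (f j) (f m) \<xi>)))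
      \<le> 2 * (\<Sum>j\<in>UNIV. ?c * (norm \<xi> * norm (conv (f j) (f m) \<xi>)))"
      unfolding norm_mult
    proof (intro mult_mono leray_symbol_norm sum_norm_le)
      fix j
      show "norm ((\<i> * complex_of_real ?c) * (complex_of_real (\<xi> $ j) * conv (f j) (f m) \<xi>)) \<le> ?c * (norm \<xi> * norm (conv (f j) (f m) \<xi>))"
        using component_le_norm_cart[of \<xi> j] by (auto simp: norm_mult intro!: mult_left_mono mult_right_mono)
    qed (auto intro: sum_nonneg)
    then show "norm (leray_symbol \<xi> $ l $ m * (\<Sum>j\<in>UNIV. (\<i> * complex_of_real ?c) * (complex_of_real (\<xi> $ j) * conv (f j) (f m) \<xi>)))
      \<le> (\<Sum>j\<in>UNIV. 2 * ?c * (norm \<xi> * norm (conv (f j) (f m) \<xi>)))"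
      by (simp add: sum_distrib_left mult.assoc)
  qed
  then have "ennreal (norm (ns_spectrum f l \<xi>)) \<le> ennreal (\<Sum>m\<in>UNIV. \<Sum>j\<in>UNIV. 2 * ?c * (norm \<xi> * norm (conv (f j) (f m) \<xi>)))"
    by (rule ennreal_leI)
  also have "\<dots> = (\<Sum>m\<in>UNIV. \<Sum>j\<in>UNIV. ennreal (2 * ?c) * (ennreal (norm \<xi>) * ennreal (norm (conv (f j) (f m) \<xi>))))"
    by (simp add: sum_ennreal[symmetric] sum_nonneg ennreal_mult)
  also have "\<dots> \<le> (\<Sum>m\<in>(UNIV::'n set). \<Sum>j\<in>(UNIV::'n set). ennreal (2 * ?c) * (ennreal (norm \<xi>) * ?X))"
    by (intro sum_mono mult_left_mono norm_conv_le) auto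
  also have "\<dots> = ennreal (ns_const TYPE('n)) * (ennreal (norm \<xi>) * ?X)"
  proof -
    have "ennreal (ns_const TYPE('n)) = of_nat CARD('n) * (of_nat CARD('n) * ennreal (2 * ?c))"
      by (simp add: ns_const_def ennreal_of_nat_eq_real_of_nat ennreal_mult[symmetric] power2_eq_square mult_ac)
    then show ?thesis by (simp add: mult.assoc)
  qed
  finally show ?thesis .
qed

lemma ns_spectrum_measurable [measurable]:
  fixes f :: "'n::finite \<Rightarrow> real \<Rightarrow> real^'n \<Rightarrow> complex"
  assumes f [measurable]: "\<And>l. jointly_borel (f l)"
  shows "(\<lambda>x. ns_spectrum (\<lambda>l. f l (fst x)) l (snd x)) \<in> borel_measurable (borel \<Otimes>\<^sub>M borel)"
proof -
  have C: "(\<lambda>x. conv (f j (fst x)) (f m (fst x)) (snd x)) \<in> borel_measurable (borel \<Otimes>\<^sub>M (borel :: (real^'n) measure))" for j m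
  proof -
    have c: "(\<lambda>z. f i (fst (fst z)) (h z)) \<in> borel_measurable ((borel \<Otimes>\<^sub>M borel) \<Otimes>\<^sub>M lborel)"
      if h: "h \<in> (((borel :: real measure) \<Otimes>\<^sub>M (borel :: (real^'n) measure)) \<Otimes>\<^sub>M lborel) \<rightarrow>\<^sub>M borel" for i and h :: "(real \<times> (real^'n)) \<times> (real^'n) \<Rightarrow> real^'n"
    proof -
      have "(\<lambda>z. (fst (fst z), h z)) \<in> ((borel \<Otimes>\<^sub>M borel) \<Otimes>\<^sub>M lborel) \<rightarrow>\<^sub>M (borel \<Otimes>\<^sub>M borel)"
        by (rule measurable_Pair[OF measurable_compose[OF measurable_fst measurable_fst] h])
      from measurable_compose[OF this f[of i]] show ?thesis by simp
    qed
    show ?thesis unfolding conv_def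
    proof (rule lborel.borel_measurable_lebesgue_integral, unfold split_beta, rule borel_measurable_times)
      show "(\<lambda>z. f j (fst (fst z)) (snd z)) \<in> borel_measurable ((borel \<Otimes>\<^sub>M (borel :: (real^'n) measure)) \<Otimes>\<^sub>M (lborel :: (real^'n) measure))"
        by (rule c) measurable
      show "(\<lambda>z. f m (fst (fst z)) (snd (fst z) - snd z)) \<in> borel_measurable ((borel \<Otimes>\<^sub>M borel) \<Otimes>\<^sub>M (lborel :: (real^'n) measure))"
        by (rule c) measurable
    qed
  qed
  have L: "(\<lambda>x. leray_symbol (snd x) $ l $ m) \<in> borel_measurable (borel \<Otimes>\<^sub>M (borel :: (real^'n) measure))" for m
    by (rule measurable_compose[OF measurable_snd leray_symbol_measurable])
  have c: "(\<lambda>x. complex_of_real (snd x $ j)) \<in> borel_measurable (borel \<Otimes>\<^sub>M (borel :: (real^'n) measure))" for j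
    by (rule measurable_compose[OF measurable_snd]) (intro borel_measurable_continuous_onI continuous_intros)
  show ?thesis unfolding ns_spectrum_def
    by (intro borel_measurable_sum borel_measurable_times borel_measurable_const L C c)
qed

lemma has_spectrum_diff:
  assumes "has_spectrum T f" "has_spectrum T' g"
  shows "has_spectrum (T - T') (\<lambda>\<xi>. f \<xi> - g \<xi>)"
proof -
  have f: "wL1 f" and g: "wL1 g" using assms by (auto simp: has_spectrum_def)
  have "wL1 (\<lambda>\<xi>. f \<xi> + (- 1) * g \<xi>)" by (rule wL1_add[OF f wL1_mult_bounded[OF g, where B=1]]) auto
  then have "wL1 (\<lambda>\<xi>. f \<xi> - g \<xi>)" by simp
  moreover have "(T - T') (fourier \<phi>) = (LINT \<xi>|lborel. (f \<xi> - g \<xi>) * \<phi> \<xi>)" if \<phi>: "\<phi> \<in> schwartz" for \<phi>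
    using assms \<phi> wL1_schwartz(1)[OF f \<phi>] wL1_schwartz(1)[OF g \<phi>] by (simp add: has_spectrum_def left_diff_distrib)
  ultimately show ?thesis by (simp add: has_spectrum_def)
qed

definition duhamel_density :: "real \<Rightarrow> ('n \<Rightarrow> real \<Rightarrow> real^'n::finite \<Rightarrow> complex) \<Rightarrow> real \<Rightarrow> 'n \<Rightarrow> real \<Rightarrow> real^'n \<Rightarrow> complex" where
  "duhamel_density \<mu> f t l \<tau> \<xi> = indicator {0<..<t} \<tau> *\<^sub>R
     (complex_of_real (exp (- \<mu> * (t - \<tau>) * (norm \<xi>)\<^sup>2)) * ns_spectrum (\<lambda>j. f j \<tau>) l \<xi>)"

definition duhamel_function :: "real \<Rightarrow> ('n \<Rightarrow> real \<Rightarrow> real^'n::finite \<Rightarrow> complex) \<Rightarrow> real \<Rightarrow> 'n \<Rightarrow> real^'n \<Rightarrow> complex" where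
  "duhamel_function \<mu> f t l \<xi> = (LINT \<tau>|lborel. duhamel_density \<mu> f t l \<tau> \<xi>)"

lemma duhamel_density_measurable:
  fixes f :: "'n::finite \<Rightarrow> real \<Rightarrow> real^'n \<Rightarrow> complex"
  assumes f: "\<And>l. jointly_borel (f l)"
  shows "(\<lambda>x. duhamel_density \<mu> f t l (fst x) (snd x)) \<in> borel_measurable (borel \<Otimes>\<^sub>M borel)"
proof -
  note [measurable] = ns_spectrum_measurable[OF f]
  have [measurable]: "(\<lambda>x. exp (- \<mu> * (t - fst x) * (norm (snd x))\<^sup>2)) \<in> borel_measurable (borel \<Otimes>\<^sub>M (borel :: (real^'n) measure))"
    by measurable
  have [measurable]: "(\<lambda>x. indicat_real {0<..<t} (fst x)) \<in> borel_measurable (borel \<Otimes>\<^sub>M (borel :: (real^'n) measure))"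
    by measurable
  show ?thesis unfolding duhamel_density_def by measurable
qed

lemma duhamel_density_bound:
  fixes f :: "'n::finite \<Rightarrow> real \<Rightarrow> real^'n \<Rightarrow> complex"
  assumes f: "\<And>l. jointly_borel (f l)"
  shows "ennreal (norm (duhamel_density \<mu> f t l \<tau> \<xi>)) \<le>
    ennreal (ns_const TYPE('n)) * (indicator {0<..<t} \<tau> * kern \<mu> (t - \<tau>) \<xi> * nconv (amplitude f \<tau>) (amplitude f \<tau>) \<xi>)"
proof (cases "\<tau> \<in> {0<..<t}")
  case True
  have m: "f l \<tau> \<in> borel_measurable borel" for l using measurable_Pair2[OF f[of l], of \<tau>] by simp
  let ?e = "exp (- \<mu> * (t - \<tau>) * (norm \<xi>)\<^sup>2)"
  have "ennreal (norm (duhamel_density \<mu> f t l \<tau> \<xi>)) = ennreal ?e * ennreal (norm (ns_spectrum (\<lambda>j. f j \<tau>) l \<xi>))"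
    using True by (simp add: duhamel_density_def norm_mult ennreal_mult)
  also have "\<dots> \<le> ennreal ?e * (ennreal (ns_const TYPE('n)) * (ennreal (norm \<xi>) * nconv (amplitude f \<tau>) (amplitude f \<tau>) \<xi>))"
    unfolding amplitude_def[abs_def] by (intro mult_left_mono ns_spectrum_bound m) auto
  also have "\<dots> = ennreal (ns_const TYPE('n)) * ((ennreal (norm \<xi>) * ennreal ?e) * nconv (amplitude f \<tau>) (amplitude f \<tau>) \<xi>)"
    by (simp only: mult_ac)
  also have "ennreal (norm \<xi>) * ennreal ?e = kern \<mu> (t - \<tau>) \<xi>" by (simp add: kern_def ennreal_mult)
  finally show ?thesis using True by simp
qed (simp add: duhamel_density_def)

lemma duhamel_function_bound:
  fixes f :: "'n::finite \<Rightarrow> real \<Rightarrow> real^'n \<Rightarrow> complex"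
  assumes f: "\<And>l. jointly_borel (f l)"
  shows "ennreal (norm (\<chi> l. duhamel_function \<mu> f t l \<xi>)) \<le>
    ennreal (real CARD('n) * ns_const TYPE('n)) * duh \<mu> (self_conv (amplitude f)) t \<xi>"
proof -
  note [measurable] = amplitude_measurable[OF f]
  let ?N = "ennreal (ns_const TYPE('n))"
  let ?D = "duh \<mu> (self_conv (amplitude f)) t \<xi>"
  have "ennreal (norm (duhamel_function \<mu> f t l \<xi>)) \<le> ?N * ?D" for l
  proof (cases "integrable lborel (\<lambda>\<tau>. duhamel_density \<mu> f t l \<tau> \<xi>)")
    case True
    have "ennreal (norm (duhamel_function \<mu> f t l \<xi>)) \<le> (\<integral>\<^sup>+\<tau>. ennreal (norm (duhamel_density \<mu> f t l \<tau> \<xi>)) \<partial>lborel)"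
      unfolding duhamel_function_def by (rule integral_norm_bound_ennreal[OF True])
    also have "\<dots> \<le> (\<integral>\<^sup>+\<tau>. ?N * (indicator {0<..<t} \<tau> * kern \<mu> (t - \<tau>) \<xi> * nconv (amplitude f \<tau>) (amplitude f \<tau>) \<xi>) \<partial>lborel)"
      by (intro nn_integral_mono duhamel_density_bound f)
    also have "\<dots> = ?N * ?D" unfolding duh_def by (rule nn_integral_cmult) measurable
    finally show ?thesis .
  qed (simp add: duhamel_function_def not_integrable_integral_eq)
  then have s: "(\<Sum>l\<in>UNIV. ennreal (norm (duhamel_function \<mu> f t l \<xi>))) \<le> (\<Sum>l\<in>(UNIV::'n set). ?N * ?D)" by (intro sum_mono)
  have "ennreal (norm (\<chi> l. duhamel_function \<mu> f t l \<xi>)) \<le> ennreal (\<Sum>l\<in>UNIV. norm (duhamel_function \<mu> f t l \<xi>))"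
    using norm_vec_le_sum[of "\<chi> l. duhamel_function \<mu> f t l \<xi>"] by (intro ennreal_leI) simp
  also have "\<dots> \<le> (\<Sum>l\<in>(UNIV::'n set). ?N * ?D)" using s by (simp add: sum_ennreal)
  also have "\<dots> = ennreal (real CARD('n) * ns_const TYPE('n)) * ?D"
  proof -
    have "0 \<le> ns_const TYPE('n)" by (simp add: ns_const_def)
    then have "ennreal (real CARD('n) * ns_const TYPE('n)) = of_nat CARD('n) * ?N"
      by (simp add: ennreal_mult ennreal_of_nat_eq_real_of_nat)
    then show ?thesis by (simp add: mult.assoc)
  qed
  finally show ?thesis .
qed

text \<open>The weight absorbs the factor \<open>|\<xi>|\<close>, the heat factor is at most \<open>1\<close>, and the integral of the
  convolution of \<open>amplitude f \<tau>\<close> with itself is the square of the integral of \<open>amplitude f \<tau>\<close>.\<close>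

lemma duhamel_density_weighted_integral:
  fixes f :: "'n::finite \<Rightarrow> real \<Rightarrow> real^'n \<Rightarrow> complex" and h :: "real^'n \<Rightarrow> real"
  assumes f: "\<And>l. jointly_borel (f l)"
    and fin: "L2L1 (amplitude f) < \<infinity>"
    and \<mu>: "\<mu> \<ge> 0" and [measurable]: "h \<in> borel_measurable borel" and h: "\<And>\<xi>. 0 \<le> h \<xi>" "\<And>\<xi>. norm \<xi> * h \<xi> \<le> B"
  shows "(\<integral>\<^sup>+\<tau>. \<integral>\<^sup>+\<xi>. ennreal (norm (duhamel_density \<mu> f t l \<tau> \<xi>) * h \<xi>) \<partial>lborel \<partial>lborel) < \<infinity>"
proof -
  note [measurable] = amplitude_measurable[OF f]
  let ?N = "ennreal (ns_const TYPE('n) * B)"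
  have B: "0 \<le> B" using h(2)[of 0] by simp
  have p: "ennreal (norm (duhamel_density \<mu> f t l \<tau> \<xi>) * h \<xi>) \<le> indicator {0<..} \<tau> * (?N * nconv (amplitude f \<tau>) (amplitude f \<tau>) \<xi>)" for \<tau> \<xi>
  proof (cases "\<tau> \<in> {0<..<t}")
    case True
    let ?X = "nconv (amplitude f \<tau>) (amplitude f \<tau>) \<xi>"
    have "ennreal (norm (duhamel_density \<mu> f t l \<tau> \<xi>) * h \<xi>) = ennreal (norm (duhamel_density \<mu> f t l \<tau> \<xi>)) * ennreal (h \<xi>)"
      by (rule ennreal_mult) (use h in auto)
    also have "\<dots> \<le> (ennreal (ns_const TYPE('n)) * (indicator {0<..<t} \<tau> * kern \<mu> (t - \<tau>) \<xi> * ?X)) * ennreal (h \<xi>)"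
      by (intro mult_right_mono duhamel_density_bound f) simp
    also have "\<dots> = ennreal (ns_const TYPE('n)) * (kern \<mu> (t - \<tau>) \<xi> * ennreal (h \<xi>)) * ?X" using True by (simp add: mult_ac)
    also have "kern \<mu> (t - \<tau>) \<xi> * ennreal (h \<xi>) \<le> ennreal B"
    proof -
      have "exp (- \<mu> * (t - \<tau>) * (norm \<xi>)\<^sup>2) \<le> 1" using True \<mu> by (auto intro!: mult_nonneg_nonneg)
      then have "norm \<xi> * h \<xi> * exp (- \<mu> * (t - \<tau>) * (norm \<xi>)\<^sup>2) \<le> B * 1" using h B by (intro mult_mono) auto
      then have "norm \<xi> * exp (- \<mu> * (t - \<tau>) * (norm \<xi>)\<^sup>2) * h \<xi> \<le> B" by (simp only: mult_ac mult_1_right mult_1_left)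
      then show ?thesis unfolding kern_def using h by (subst ennreal_mult[symmetric]) (auto intro: ennreal_leI)
    qed
    finally show ?thesis using True B by (simp add: ennreal_mult ns_const_def mult_left_mono mult_right_mono)
  qed (simp add: duhamel_density_def)
  have "(\<integral>\<^sup>+\<tau>. \<integral>\<^sup>+\<xi>. ennreal (norm (duhamel_density \<mu> f t l \<tau> \<xi>) * h \<xi>) \<partial>lborel \<partial>lborel)
    \<le> (\<integral>\<^sup>+\<tau>. \<integral>\<^sup>+\<xi>. indicator {0<..} \<tau> * (?N * nconv (amplitude f \<tau>) (amplitude f \<tau>) \<xi>) \<partial>lborel \<partial>lborel)"
    by (intro nn_integral_mono p)
  also have "\<dots> = (\<integral>\<^sup>+\<tau>. ?N * (indicator {0<..} \<tau> * (\<integral>\<^sup>+\<xi>. amplitude f \<tau> \<xi> \<partial>lborel)\<^sup>2) \<partial>lborel)"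
    by (intro nn_integral_cong) (simp add: nn_integral_cmult nn_integral_nconv power2_eq_square mult_ac)
  also have "\<dots> = ?N * (\<integral>\<^sup>+\<tau>. indicator {0<..} \<tau> * (\<integral>\<^sup>+\<xi>. amplitude f \<tau> \<xi> \<partial>lborel)\<^sup>2 \<partial>lborel)"
    by (rule nn_integral_cmult) measurable
  also have "\<dots> < \<infinity>" using fin by (simp add: ennreal_mult_less_top)
  finally show ?thesis .
qed

lemma duhamel_density_integrable:
  fixes f :: "'n::finite \<Rightarrow> real \<Rightarrow> real^'n \<Rightarrow> complex" and \<phi> :: "real^'n \<Rightarrow> complex"
  assumes f: "\<And>l. jointly_borel (f l)"
    and fin: "L2L1 (amplitude f) < \<infinity>"
    and \<mu>: "\<mu> \<ge> 0" and [measurable]: "\<phi> \<in> borel_measurable borel" and \<phi>: "\<And>\<xi>. norm \<xi> * norm (\<phi> \<xi>) \<le> B"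
  shows "integrable (lborel \<Otimes>\<^sub>M lborel) (\<lambda>(\<tau>, \<xi>). duhamel_density \<mu> f t l \<tau> \<xi> * \<phi> \<xi>)"
  unfolding split_beta
proof (rule integrableI_bounded)
  have [measurable]: "(\<lambda>x. duhamel_density \<mu> f t l (fst x) (snd x)) \<in> borel_measurable (lborel \<Otimes>\<^sub>M lborel)"
    using duhamel_density_measurable[OF f] by (simp cong: measurable_cong_sets)
  show "(\<lambda>x. duhamel_density \<mu> f t l (fst x) (snd x) * \<phi> (snd x)) \<in> borel_measurable (lborel \<Otimes>\<^sub>M lborel)"
    by measurable
  have "(\<integral>\<^sup>+x. ennreal (norm (duhamel_density \<mu> f t l (fst x) (snd x) * \<phi> (snd x))) \<partial>(lborel \<Otimes>\<^sub>M lborel))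
    = (\<integral>\<^sup>+\<tau>. \<integral>\<^sup>+\<xi>. ennreal (norm (duhamel_density \<mu> f t l \<tau> \<xi>) * norm (\<phi> \<xi>)) \<partial>lborel \<partial>lborel)"
    by (subst lborel.nn_integral_fst[symmetric]) (auto simp: norm_mult)
  also have "\<dots> < \<infinity>" by (rule duhamel_density_weighted_integral[OF f fin \<mu> _ _ \<phi>]) auto
  finally show "(\<integral>\<^sup>+x. ennreal (norm (duhamel_density \<mu> f t l (fst x) (snd x) * \<phi> (snd x))) \<partial>(lborel \<Otimes>\<^sub>M lborel)) < \<infinity>" .
qed

lemma duhamel_function_measurable:
  fixes f :: "'n::finite \<Rightarrow> real \<Rightarrow> real^'n \<Rightarrow> complex"
  assumes f: "\<And>l. jointly_borel (f l)"
  shows "duhamel_function \<mu> f t l \<in> borel_measurable borel"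
proof -
  have "(\<lambda>x. duhamel_density \<mu> f t l (snd x) (fst x)) \<in> borel_measurable (borel \<Otimes>\<^sub>M lborel)"
    using measurable_compose[OF measurable_Pair[OF measurable_snd measurable_fst] duhamel_density_measurable[OF f]]
    by (simp cong: measurable_cong_sets)
  then show ?thesis unfolding duhamel_function_def[abs_def]
    by (intro lborel.borel_measurable_lebesgue_integral) (simp add: split_beta)
qed

lemma wL1_duhamel_function:
  fixes f :: "'n::finite \<Rightarrow> real \<Rightarrow> real^'n \<Rightarrow> complex"
  assumes f: "\<And>l. jointly_borel (f l)"
    and fin: "L2L1 (amplitude f) < \<infinity>"
    and \<mu>: "\<mu> \<ge> 0"
  shows "wL1 (duhamel_function \<mu> f t l)"
  unfolding wL1_def
proof (rule conjI[OF duhamel_function_measurable[OF f]])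
  have "integrable (lborel \<Otimes>\<^sub>M lborel) (\<lambda>(\<tau>, \<xi>). duhamel_density \<mu> f t l \<tau> \<xi> * complex_of_real (1 / (1 + norm \<xi>)))"
    by (rule duhamel_density_integrable[OF f fin \<mu>, where B=1]) (auto simp: norm_divide divide_simps add_pos_nonneg simp del: of_real_add)
  from lborel_pair.integrable_snd[OF this]
  have "integrable lborel (\<lambda>\<xi>. LINT \<tau>|lborel. duhamel_density \<mu> f t l \<tau> \<xi> * complex_of_real (1 / (1 + norm \<xi>)))" .
  from integrable_norm[OF this]
  show "integrable lborel (\<lambda>\<xi>. norm (duhamel_function \<mu> f t l \<xi>) / (1 + norm \<xi>))"
    by (simp add: duhamel_function_def norm_divide norm_mult del: of_real_add)
qed

text \<open>The mild equation is tested on the Fourier transform of a Schwartz function. At almost every \<open>\<tau>\<close> the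
  integrand is the pairing with \<open>duhamel_density\<close>, and Fubini's theorem exchanges the pairing and the time
  integral.\<close>

lemma (in bump) mild_spectrum:
  fixes u :: "real \<Rightarrow> 'n vdist" and u\<^sub>0 :: "'n vdist"
  assumes mild: "global_mild_solution \<mu> u\<^sub>0 u" and \<mu>: "\<mu> > 0" and t: "t > 0"
    and u0: "\<And>l. has_ft (u\<^sub>0 $ l)" and A: "AE \<xi> in lborel. norm (vft u\<^sub>0 \<xi>) \<le> A"
    and f: "\<And>l. jointly_borel (f l)"
    and sp: "AE t in lborel. t > 0 \<longrightarrow> (\<forall>l. integrable lborel (f l t) \<and> has_spectrum (u t $ l) (f l t))"
    and fin: "L2L1 (amplitude f) < \<infinity>"
  shows "has_spectrum (u t $ l) (\<lambda>\<xi>. complex_of_real (exp (- \<mu> * t * (norm \<xi>)\<^sup>2)) * ft (u\<^sub>0 $ l) \<xi> - duhamel_function \<mu> f t l \<xi>)"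
proof -
  have [measurable]: "ft (u\<^sub>0 $ l) \<in> borel_measurable borel" by (rule ft_represents(2)[OF u0])
  have "integrable lborel (\<lambda>\<xi>. complex_of_real (exp (- \<mu> * t * (norm \<xi>)\<^sup>2)) * ft (u\<^sub>0 $ l) \<xi>)"
  proof (rule Bochner_Integration.integrable_bound)
    show "integrable lborel (\<lambda>\<xi>::real^'n. A * exp (- (\<mu> * t) * (norm \<xi>)\<^sup>2))"
      using \<mu> t by (intro integrable_mult_right integrable_gaussian) auto
    show "AE \<xi> in lborel. norm (complex_of_real (exp (- \<mu> * t * (norm \<xi>)\<^sup>2)) * ft (u\<^sub>0 $ l) \<xi>) \<le> norm (A * exp (- (\<mu> * t) * (norm \<xi>)\<^sup>2))"
      using A
    proof eventually_elim
      case (elim \<xi>)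
      have "norm (ft (u\<^sub>0 $ l) \<xi>) \<le> norm (vft u\<^sub>0 \<xi>)"
        using Finite_Cartesian_Product.norm_nth_le[of "vft u\<^sub>0 \<xi>" l] by (simp add: vft_def)
      then have "norm (ft (u\<^sub>0 $ l) \<xi>) \<le> \<bar>A\<bar>" using elim by linarith
      then show ?case by (simp add: norm_mult abs_mult mult.commute mult_left_mono)
    qed
  qed measurable
  then have "has_spectrum (heat \<mu> t u\<^sub>0 $ l) (\<lambda>\<xi>. complex_of_real (exp (- \<mu> * t * (norm \<xi>)\<^sup>2)) * ft (u\<^sub>0 $ l) \<xi>)"
    unfolding heat_def by (intro multiplier_spectrum(2) integrable_wL1) auto
  moreover define U where "U = (\<lambda>\<phi>. LINT \<tau>:{0<..<t}|lborel. (duhamel_integrand \<mu> u t \<tau> $ l) \<phi>)"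
  have "has_spectrum U (duhamel_function \<mu> f t l)"
    unfolding has_spectrum_def
  proof (intro conjI ballI)
    show "wL1 (duhamel_function \<mu> f t l)" by (rule wL1_duhamel_function[OF f fin]) (use \<mu> in simp)
    fix \<phi> :: "real^'n \<Rightarrow> complex" assume \<phi>: "\<phi> \<in> schwartz"
    have [measurable]: "\<phi> \<in> borel_measurable borel" by (rule schwartz_measurable[OF \<phi>])
    have "norm \<xi> * norm (\<phi> \<xi>) \<le> schwartz_seminorm 1 \<phi>" for \<xi>
    proof -
      have "norm \<xi> * norm (\<phi> \<xi>) \<le> (1 + norm \<xi>) ^ 1 * norm (\<phi> \<xi>)" by (intro mult_right_mono) auto
      also have "\<dots> \<le> schwartz_seminorm 1 \<phi>" by (rule seminorm_decay[OF \<phi>])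
      finally show ?thesis .
    qed
    then have I: "integrable (lborel \<Otimes>\<^sub>M lborel) (\<lambda>(\<tau>, \<xi>). duhamel_density \<mu> f t l \<tau> \<xi> * \<phi> \<xi>)"
      using \<mu> by (intro duhamel_density_integrable[OF f fin]) auto
    have "U (fourier \<phi>) = (LINT \<tau>|lborel. indicator {0<..<t} \<tau> *\<^sub>R (duhamel_integrand \<mu> u t \<tau> $ l) (fourier \<phi>))"
      by (simp add: U_def set_lebesgue_integral_def)
    also have "\<dots> = (LINT \<tau>|lborel. (LINT \<xi>|lborel. duhamel_density \<mu> f t l \<tau> \<xi> * \<phi> \<xi>))"
    proof (rule integral_cong_AE)
      show ae: "AE \<tau> in lborel. indicator {0<..<t} \<tau> *\<^sub>R (duhamel_integrand \<mu> u t \<tau> $ l) (fourier \<phi>) = (LINT \<xi>|lborel. duhamel_density \<mu> f t l \<tau> \<xi> * \<phi> \<xi>)"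
        using sp
      proof eventually_elim
        case (elim \<tau>)
        show ?case
        proof (cases "\<tau> \<in> {0<..<t}")
          case True
          have "has_spectrum (duhamel_integrand \<mu> u t \<tau> $ l)
            (\<lambda>\<xi>. complex_of_real (exp (- \<mu> * (t - \<tau>) * (norm \<xi>)\<^sup>2)) * ns_spectrum (\<lambda>j. f j \<tau>) l \<xi>)"
            by (rule duhamel_spectrum) (use elim True \<mu> in auto)
          then show ?thesis using True \<phi> by (simp add: has_spectrum_def duhamel_density_def)
        qed (simp add: duhamel_density_def)
      qed
      show m: "(\<lambda>\<tau>. LINT \<xi>|lborel. duhamel_density \<mu> f t l \<tau> \<xi> * \<phi> \<xi>) \<in> borel_measurable lborel"
        using lborel_pair.integrable_fst[OF I] by (rule borel_measurable_integrable)
      have "set_integrable lborel {0<..<t} (\<lambda>\<tau>. (duhamel_integrand \<mu> u t \<tau> $ l) (fourier \<phi>))"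
        using mild t fourier_schwartz[OF \<phi>] unfolding global_mild_solution_def by blast
      then show "(\<lambda>\<tau>. indicator {0<..<t} \<tau> *\<^sub>R (duhamel_integrand \<mu> u t \<tau> $ l) (fourier \<phi>)) \<in> borel_measurable lborel"
        unfolding set_integrable_def by (rule borel_measurable_integrable)
    qed
    also have "\<dots> = (LINT \<xi>|lborel. (LINT \<tau>|lborel. duhamel_density \<mu> f t l \<tau> \<xi> * \<phi> \<xi>))"
      by (rule lborel_pair.Fubini_integral[OF I, symmetric])
    also have "\<dots> = (LINT \<xi>|lborel. duhamel_function \<mu> f t l \<xi> * \<phi> \<xi>)"
      by (simp add: duhamel_function_def)
    finally show "U (fourier \<phi>) = (LINT \<xi>|lborel. duhamel_function \<mu> f t l \<xi> * \<phi> \<xi>)" .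
  qed
  ultimately have "has_spectrum (heat \<mu> t u\<^sub>0 $ l - U) (\<lambda>\<xi>. complex_of_real (exp (- \<mu> * t * (norm \<xi>)\<^sup>2)) * ft (u\<^sub>0 $ l) \<xi> - duhamel_function \<mu> f t l \<xi>)"
    by (rule has_spectrum_diff)
  then show ?thesis
  proof (rule has_spectrum_cong)
    fix \<phi> :: "real^'n \<Rightarrow> complex" assume "\<phi> \<in> schwartz"
    then show "(u t $ l) \<phi> = (heat \<mu> t u\<^sub>0 $ l - U) \<phi>"
      using mild t unfolding global_mild_solution_def U_def by simp
  qed
qed

text \<open>At almost every time the jointly measurable spectrum and the one given by the mild equation agree almost
  everywhere; take moduli in the latter.\<close>

lemma (in bump) mild_amplitude_inequality:
  fixes u :: "real \<Rightarrow> 'n vdist" and u\<^sub>0 :: "'n vdist"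
  assumes mild: "global_mild_solution \<mu> u\<^sub>0 u" and \<mu>: "\<mu> > 0"
    and u0: "\<And>l. has_ft (u\<^sub>0 $ l)" and A: "AE \<xi> in lborel. norm (vft u\<^sub>0 \<xi>) \<le> A"
    and f: "\<And>l. jointly_borel (f l)"
    and sp: "AE t in lborel. t > 0 \<longrightarrow> (\<forall>l. integrable lborel (f l t) \<and> has_spectrum (u t $ l) (f l t))"
    and fin: "L2L1 (amplitude f) < \<infinity>"
  shows "AE t in lborel. t > 0 \<longrightarrow> (AE \<xi> in lborel. amplitude f t \<xi> \<le> ennreal (exp (- \<mu> * t * (norm \<xi>)\<^sup>2)) * ennreal (norm (vft u\<^sub>0 \<xi>)) +
      ennreal (real CARD('n) * ns_const TYPE('n)) * duh \<mu> (self_conv (amplitude f)) t \<xi>)"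
  using sp
proof eventually_elim
  case (elim t)
  show ?case
  proof
    assume t: "t > 0"
    let ?e = "\<lambda>\<xi>::real^'n. exp (- \<mu> * t * (norm \<xi>)\<^sup>2)"
    let ?R = "\<lambda>l \<xi>. complex_of_real (?e \<xi>) * ft (u\<^sub>0 $ l) \<xi> - duhamel_function \<mu> f t l \<xi>"
    have "AE \<xi> in lborel. f l t \<xi> = ?R l \<xi>" for l
    proof -
      have h: "has_spectrum (u t $ l) (f l t)" using elim t by blast
      show ?thesis using has_spectrum_ft(1)[OF h] has_spectrum_ft(1)[OF mild_spectrum[OF mild \<mu> t u0 A f sp fin, of l]]
        by eventually_elim simp
    qed
    then have "AE \<xi> in lborel. \<forall>l. f l t \<xi> = ?R l \<xi>" by (simp add: AE_all_countable)
    then show "AE \<xi> in lborel. amplitude f t \<xi> \<le> ennreal (?e \<xi>) * ennreal (norm (vft u\<^sub>0 \<xi>)) +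
      ennreal (real CARD('n) * ns_const TYPE('n)) * duh \<mu> (self_conv (amplitude f)) t \<xi>"
    proof eventually_elim
      case (elim \<xi>)
      have "(\<chi> l. f l t \<xi>) = (\<chi> l. complex_of_real (?e \<xi>) * ft (u\<^sub>0 $ l) \<xi>) - (\<chi> l. duhamel_function \<mu> f t l \<xi>)"
        using elim by (simp add: vec_eq_iff)
      then have "norm (\<chi> l. f l t \<xi>) \<le> ?e \<xi> * norm (vft u\<^sub>0 \<xi>) + norm (\<chi> l. duhamel_function \<mu> f t l \<xi>)"
        using norm_triangle_ineq4[of "\<chi> l. complex_of_real (?e \<xi>) * ft (u\<^sub>0 $ l) \<xi>" "\<chi> l. duhamel_function \<mu> f t l \<xi>"]
        by (simp add: norm_vec_scale vft_def)
      then have "amplitude f t \<xi> \<le> ennreal (?e \<xi> * norm (vft u\<^sub>0 \<xi>) + norm (\<chi> l. duhamel_function \<mu> f t l \<xi>))"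
        unfolding amplitude_def by (rule ennreal_leI)
      also have "\<dots> = ennreal (?e \<xi>) * ennreal (norm (vft u\<^sub>0 \<xi>)) + ennreal (norm (\<chi> l. duhamel_function \<mu> f t l \<xi>))"
        by (simp add: ennreal_mult)
      also have "\<dots> \<le> ennreal (?e \<xi>) * ennreal (norm (vft u\<^sub>0 \<xi>)) +
        ennreal (real CARD('n) * ns_const TYPE('n)) * duh \<mu> (self_conv (amplitude f)) t \<xi>"
        by (intro add_left_mono duhamel_function_bound f)
      finally show ?case .
    qed
  qed
qed

section \<open>Pointwise decay of the difference\<close>

text \<open>The exponential bound on the amplitude, inserted into the Duhamel term.\<close>

lemma (in bump) mild_solution_profile:
  fixes u :: "real \<Rightarrow> 'n vdist" and u\<^sub>0 :: "'n vdist" and \<psi> :: "real^'n \<Rightarrow> real"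
  assumes dim: "CARD('n) \<ge> 2" and \<mu>: "\<mu> > 0" and \<psi>: "dyadic_cutoff \<psi>"
    and u0: "u\<^sub>0 \<in> herz_space \<psi> 0 1 \<infinity>" and \<epsilon>: "\<epsilon> > 0"
    and small: "herz_norm \<psi> (-1) \<infinity> 2 u\<^sub>0 < ennreal \<epsilon>"
      "16 * exp 2 * (real CARD('n) * ns_const TYPE('n))\<^sup>2 * (64 / \<mu> * \<epsilon>\<^sup>2) < \<mu>"
    and mild: "global_mild_solution \<mu> u\<^sub>0 u"
  obtains A C B where "A \<ge> 0" "C \<ge> 0" "AE \<xi> in lborel. norm (vft u\<^sub>0 \<xi>) \<le> A"
    "\<And>t l. t > 0 \<Longrightarrow> has_spectrum (u t $ l) (\<lambda>\<xi>. complex_of_real (exp (- \<mu> * t * (norm \<xi>)\<^sup>2)) * ft (u\<^sub>0 $ l) \<xi> - B t l \<xi>)"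
    "\<And>t \<xi>. t \<ge> 1 \<Longrightarrow> norm (\<chi> l. B t l \<xi>) \<le> C * growth TYPE('n) t * (norm \<xi> * exp (- (sqrt (\<mu> * t) / 2) * norm \<xi>))"
proof -
  let ?K = "real CARD('n) * ns_const TYPE('n)"
  have K: "0 \<le> ?K" by (simp add: ns_const_def)
  have ft: "\<And>l. has_ft (u\<^sub>0 $ l)" using u0 by (simp add: herz_space_def)
  obtain A where A: "A \<ge> 0" "AE \<xi> in lborel. norm (vft u\<^sub>0 \<xi>) \<le> A" using bounded_initial_spectrum[OF \<psi> u0] by blast
  have L2: "L2_time_Lhat_inf u" using mild by (simp add: global_mild_solution_def)
  obtain f :: "'n \<Rightarrow> real \<Rightarrow> real^'n \<Rightarrow> complex" where
    f: "\<And>l. jointly_borel (f l)"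
    and sp: "AE t in lborel. t > 0 \<longrightarrow> (\<forall>l. integrable lborel (f l t) \<and> has_spectrum (u t $ l) (f l t))"
    and fin: "L2L1 (amplitude f) < \<infinity>"
    using solution_spectrum[OF L2] by blast
  note a = amplitude_measurable[OF f]
  have a0: "(\<lambda>\<xi>. ennreal (norm (vft u\<^sub>0 \<xi>))) \<in> borel_measurable borel"
    using vec_measurable[OF ft_represents(2)[OF ft]] unfolding vft_def by measurable
  have a0A: "AE \<xi> in lborel. ennreal (norm (vft u\<^sub>0 \<xi>)) \<le> ennreal A" using A(2) by eventually_elim (rule ennreal_leI)
  have H: "64 / \<mu> * \<epsilon>\<^sup>2 > 0" using \<mu> \<epsilon> by simp
  have "AE t in lborel. t > 0 \<longrightarrow> (AE \<xi> in lborel. amplitude f t \<xi> \<le> ennreal (2 * exp (1/2) * A * exp (- sqrt (\<mu> * t) * norm \<xi>)))"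
    by (rule exponential_bound[OF a a0 \<mu> K H A(1) a0A fin small_heat_flow[OF \<psi> ft \<mu> \<epsilon> small(1)] small(2)
        mild_amplitude_inequality[OF mild \<mu> ft A(2) f sp fin]])
  moreover have "2 * exp (1/2) * A \<ge> 0" using A by simp
  ultimately obtain C where C: "C \<ge> 0" and dec: "\<And>t \<xi>. t \<ge> 1 \<Longrightarrow> duh \<mu> (self_conv (amplitude f)) t \<xi> \<le>
     ennreal (C * growth TYPE('n) t * (norm \<xi> * exp (- (sqrt (\<mu> * t) / 2) * norm \<xi>)))"
    using duhamel_decay[OF dim \<mu> _ a fin] by blast
  show ?thesis
  proof (rule that[OF A(1) _ A(2)])
    show "?K * C \<ge> 0" using K C by simp
    show "has_spectrum (u t $ l) (\<lambda>\<xi>. complex_of_real (exp (- \<mu> * t * (norm \<xi>)\<^sup>2)) * ft (u\<^sub>0 $ l) \<xi> - duhamel_function \<mu> f t l \<xi>)"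
      if "t > 0" for t l by (rule mild_spectrum[OF mild \<mu> that ft A(2) f sp fin])
    fix t :: real and \<xi> :: "real^'n" assume t: "t \<ge> 1"
    let ?y = "C * growth TYPE('n) t * (norm \<xi> * exp (- (sqrt (\<mu> * t) / 2) * norm \<xi>))"
    have y: "0 \<le> ?y" using C growth_ge[OF t, where 'n='n] by simp
    have "ennreal (norm (\<chi> l. duhamel_function \<mu> f t l \<xi>)) \<le> ennreal ?K * duh \<mu> (self_conv (amplitude f)) t \<xi>"
      by (rule duhamel_function_bound[OF f])
    also have "\<dots> \<le> ennreal ?K * ennreal ?y" by (intro mult_left_mono dec t) simp
    also have "\<dots> = ennreal (?K * ?y)" using K y by (simp only: ennreal_mult)
    finally have "norm (\<chi> l. duhamel_function \<mu> f t l \<xi>) \<le> ?K * ?y"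
      using K y by (subst (asm) ennreal_le_iff) auto
    then show "norm (\<chi> l. duhamel_function \<mu> f t l \<xi>) \<le> ?K * C * growth TYPE('n) t * (norm \<xi> * exp (- (sqrt (\<mu> * t) / 2) * norm \<xi>))"
      by (simp only: mult.assoc)
  qed
qed

lemma leray_symbol_vec_bounded:
  obtains c where "\<And>\<xi>. norm (leray_symbol \<xi> *v (v :: complex^'n::finite)) \<le> c"
proof
  fix \<xi>
  have "norm (leray_symbol \<xi> *v v) \<le> (\<Sum>l\<in>UNIV. norm ((leray_symbol \<xi> *v v) $ l))" by (rule norm_vec_le_sum)
  also have "\<dots> \<le> (\<Sum>l\<in>(UNIV::'n set). \<Sum>m\<in>UNIV. 2 * norm (v $ m))"
    unfolding matrix_vector_mult_def vec_lambda_beta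
    by (intro sum_mono sum_norm_le) (simp add: norm_mult mult_right_mono leray_symbol_norm)
  finally show "norm (leray_symbol \<xi> *v v) \<le> (\<Sum>l\<in>(UNIV::'n set). \<Sum>m\<in>UNIV. 2 * norm (v $ m))" .
qed

text \<open>Away from the origin the bound by a power is weaker than boundedness.\<close>

lemma global_bound_from_origin:
  fixes g :: "real^'n::finite \<Rightarrow> real"
  assumes K: "AE \<xi> in lborel. 0 < norm \<xi> \<and> norm \<xi> < r \<longrightarrow> g \<xi> \<le> K * norm \<xi> powr \<alpha>"
    and r: "r > 0" and \<alpha>: "\<alpha> > 0" and A: "AE \<xi> in lborel. g \<xi> \<le> A"
  obtains K' where "K' \<ge> 0" "AE \<xi> in lborel. g \<xi> \<le> K' * norm \<xi> powr \<alpha>"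
proof
  let ?K = "\<bar>K\<bar> + \<bar>A\<bar> / r powr \<alpha>"
  show "?K \<ge> 0" by simp
  show "AE \<xi> in lborel. g \<xi> \<le> ?K * norm \<xi> powr \<alpha>"
    using K A AE_lborel_singleton[of 0]
  proof eventually_elim
    case (elim \<xi>)
    show ?case
    proof (cases "norm \<xi> < r")
      case True
      then have "g \<xi> \<le> K * norm \<xi> powr \<alpha>" using elim by simp
      also have "\<dots> \<le> ?K * norm \<xi> powr \<alpha>" by (intro mult_right_mono) (auto intro: add_increasing2)
      finally show ?thesis .
    next
      case False
      have "g \<xi> \<le> \<bar>A\<bar>" using elim by linarith
      also have "\<bar>A\<bar> = \<bar>A\<bar> / r powr \<alpha> * r powr \<alpha>" using r by simp
      also have "\<dots> \<le> ?K * norm \<xi> powr \<alpha>" using False r \<alpha> by (intro mult_mono powr_mono2) auto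
      finally show ?thesis .
    qed
  qed
qed

lemma heat_le_exp:
  assumes "\<mu> > 0" "t > 0"
  shows "exp (- \<mu> * t * x\<^sup>2) \<le> exp (1/2) * exp (- (sqrt (\<mu> * t) / 2) * \<bar>x\<bar>)"
proof -
  have "sqrt (\<mu> * t) * \<bar>x\<bar> \<le> 1/2 + \<mu> * t * x\<^sup>2 / 2" using sqrt_young[of t \<mu> "\<bar>x\<bar>"] assms by simp
  moreover have "0 \<le> \<mu> * t * x\<^sup>2" "0 \<le> sqrt (\<mu> * t) * \<bar>x\<bar>" using assms by auto
  ultimately have "- (\<mu> * t * x\<^sup>2) \<le> 1/2 - sqrt (\<mu> * t) * \<bar>x\<bar> / 2" by linarith
  then show ?thesis by (simp add: exp_add[symmetric])
qed

text \<open>The first term stems from the behaviour of the initial velocity at the origin. The second one stems from the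
  nonlinearity, whose divergence form is responsible for the factor \<open>|\<xi>|\<close>.\<close>

lemma (in bump) difference_pointwise:
  fixes u :: "real \<Rightarrow> 'n vdist" and u\<^sub>0 :: "'n vdist" and \<psi> :: "real^'n \<Rightarrow> real"
  assumes dim: "CARD('n) \<ge> 2" and \<mu>: "\<mu> > 0" and \<psi>: "dyadic_cutoff \<psi>"
    and u0: "u\<^sub>0 \<in> herz_space \<psi> 0 1 \<infinity>" and \<epsilon>: "\<epsilon> > 0"
    and small: "herz_norm \<psi> (-1) \<infinity> 2 u\<^sub>0 < ennreal \<epsilon>"
      "16 * exp 2 * (real CARD('n) * ns_const TYPE('n))\<^sup>2 * (64 / \<mu> * \<epsilon>\<^sup>2) < \<mu>"
    and mild: "global_mild_solution \<mu> u\<^sub>0 u"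
    and \<alpha>: "\<alpha> > 0" and r: "r > 0"
    and near: "AE \<xi> in lborel. 0 < norm \<xi> \<and> norm \<xi> < r \<longrightarrow> norm (vft u\<^sub>0 \<xi> - leray_symbol \<xi> *v cvec M\<^sub>0) \<le> K * norm \<xi> powr \<alpha>"
  obtains C D where "C \<ge> 0"
    "\<forall>t>0. \<forall>l. has_spectrum ((u t - oseen_dist \<mu> t M\<^sub>0) $ l) (D t l)"
    "\<forall>t\<ge>1. AE \<xi> in lborel. norm (\<chi> l. D t l \<xi>) \<le>
       C * ((norm \<xi> powr \<alpha> + growth TYPE('n) t * norm \<xi>) * exp (- (sqrt (\<mu> * t) / 2) * norm \<xi>))"
proof -
  obtain A C B where A1: "A \<ge> 0" and C: "C \<ge> 0" and A: "AE \<xi> in lborel. norm (vft u\<^sub>0 \<xi>) \<le> A"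
    and sp: "\<And>t l. t > 0 \<Longrightarrow> has_spectrum (u t $ l) (\<lambda>\<xi>. complex_of_real (exp (- \<mu> * t * (norm \<xi>)\<^sup>2)) * ft (u\<^sub>0 $ l) \<xi> - B t l \<xi>)"
    and B: "\<And>t \<xi>. t \<ge> 1 \<Longrightarrow> norm (\<chi> l. B t l \<xi>) \<le> C * growth TYPE('n) t * (norm \<xi> * exp (- (sqrt (\<mu> * t) / 2) * norm \<xi>))"
    by (rule mild_solution_profile[OF dim \<mu> \<psi> u0 \<epsilon> small mild], rule that)
  let ?E = "\<lambda>\<xi>. vft u\<^sub>0 \<xi> - leray_symbol \<xi> *v cvec M\<^sub>0"
  obtain c where c: "\<And>\<xi>. norm (leray_symbol \<xi> *v cvec M\<^sub>0) \<le> c" using leray_symbol_vec_bounded[of "cvec M\<^sub>0"] by blast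
  have "AE \<xi> in lborel. norm (?E \<xi>) \<le> A + c"
    using A by eventually_elim (rule order_trans[OF norm_triangle_ineq4 add_mono[OF _ c]])
  then obtain K' where K': "K' \<ge> 0" "AE \<xi> in lborel. norm (?E \<xi>) \<le> K' * norm \<xi> powr \<alpha>"
    using global_bound_from_origin[OF near r \<alpha>] by blast
  let ?e = "\<lambda>t \<xi>. complex_of_real (exp (- \<mu> * t * (norm \<xi>)\<^sup>2))"
  let ?D = "\<lambda>t l \<xi>. (?e t \<xi> * ft (u\<^sub>0 $ l) \<xi> - B t l \<xi>) - ?e t \<xi> * (leray_symbol \<xi> *v cvec M\<^sub>0) $ l"
  show ?thesis
  proof (rule that[of "K' * exp (1/2) + C" ?D]; (intro allI impI)?)
    show "0 \<le> K' * exp (1/2) + C" using K' C by simp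
    show "has_spectrum ((u t - oseen_dist \<mu> t M\<^sub>0) $ l) (?D t l)" if t: "t > 0" for t l
      unfolding vector_minus_component by (rule has_spectrum_diff[OF sp[OF t] oseen_dist_spectrum[OF \<mu> t]])
    fix t :: real assume t: "t \<ge> 1"
    let ?x = "\<lambda>\<xi>::real^'n. exp (- (sqrt (\<mu> * t) / 2) * norm \<xi>)"
    have g: "0 \<le> growth TYPE('n) t" using growth_ge[OF t, where 'n='n] by simp
    show "AE \<xi> in lborel. norm (\<chi> l. ?D t l \<xi>) \<le> (K' * exp (1/2) + C) * ((norm \<xi> powr \<alpha> + growth TYPE('n) t * norm \<xi>) * ?x \<xi>)"
      using K'(2)
    proof eventually_elim
      case (elim \<xi>)
      have "(\<chi> l. ?D t l \<xi>) = (\<chi> l. ?e t \<xi> * ?E \<xi> $ l) - (\<chi> l. B t l \<xi>)"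
        unfolding vec_eq_iff vector_minus_component vec_lambda_beta vft_def right_diff_distrib by (simp add: algebra_simps)
      then have "norm (\<chi> l. ?D t l \<xi>) \<le> norm (\<chi> l. ?e t \<xi> * ?E \<xi> $ l) + norm (\<chi> l. B t l \<xi>)"
        by (simp only: norm_triangle_ineq4)
      also have "\<dots> \<le> K' * exp (1/2) * (norm \<xi> powr \<alpha> * ?x \<xi>) + C * (growth TYPE('n) t * norm \<xi> * ?x \<xi>)"
      proof (rule add_mono)
        have "norm (\<chi> l. ?e t \<xi> * ?E \<xi> $ l) = exp (- \<mu> * t * (norm \<xi>)\<^sup>2) * norm (?E \<xi>)"
          using norm_vec_scale[of "exp (- \<mu> * t * (norm \<xi>)\<^sup>2)" "\<lambda>l. ?E \<xi> $ l"] by (simp add: vec_nth_inverse del: vector_minus_component)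
        also have "\<dots> \<le> (exp (1/2) * ?x \<xi>) * (K' * norm \<xi> powr \<alpha>)"
          using heat_le_exp[OF \<mu>, of t "norm \<xi>"] t elim by (intro mult_mono) auto
        finally show "norm (\<chi> l. ?e t \<xi> * ?E \<xi> $ l) \<le> K' * exp (1/2) * (norm \<xi> powr \<alpha> * ?x \<xi>)" by (simp only: mult_ac)
        show "norm (\<chi> l. B t l \<xi>) \<le> C * (growth TYPE('n) t * norm \<xi> * ?x \<xi>)" using B[OF t] by (simp only: mult.assoc)
      qed
      also have "\<dots> \<le> (K' * exp (1/2) + C) * (norm \<xi> powr \<alpha> * ?x \<xi>) + (K' * exp (1/2) + C) * (growth TYPE('n) t * norm \<xi> * ?x \<xi>)"
        using K' C g by (intro add_mono mult_right_mono) auto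
      finally show ?case by (simp only: distrib_left distrib_right)
    qed
  qed
qed

section \<open>Lebesgue norms of the majorant\<close>

lemma powr_exp_bounded:
  fixes a b :: real
  assumes "a \<ge> 0" "b > 0"
  obtains c where "c > 0" "\<And>x. x \<ge> 0 \<Longrightarrow> x powr a * exp (- b * x) \<le> c"
proof (cases "a = 0")
  case True
  show ?thesis by (rule that[of 1]) (use assms True in \<open>auto simp: powr_def\<close>)
next
  case False
  with assms have a: "a > 0" by simp
  show ?thesis
  proof (rule that[of "exp (- a - a * ln (b / a))"])
    fix x :: real assume "x \<ge> 0"
    show "x powr a * exp (- b * x) \<le> exp (- a - a * ln (b / a))"
    proof (cases "x = 0")
      case False
      with \<open>x \<ge> 0\<close> have x: "x > 0" by simp
      have "ln (x * (b / a)) \<le> x * (b / a) - 1" using x a assms by (intro ln_le_minus_one) auto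
      moreover have "ln (x * (b / a)) = ln x + ln (b / a)" using x a assms by (intro ln_mult_pos) auto
      ultimately have "a * (ln x + ln (b / a)) \<le> a * (x * (b / a) - 1)" using a by (intro mult_left_mono) auto
      also have "\<dots> = b * x - a" using a by (simp add: field_simps)
      finally have "a * ln x - b * x \<le> - a - a * ln (b / a)" by (simp add: algebra_simps)
      then show ?thesis using x by (simp add: powr_def exp_add[symmetric])
    qed (use a in simp)
  qed simp
qed

lemma epowr_mono: "a \<le> b \<Longrightarrow> r \<ge> 0 \<Longrightarrow> epowr a r \<le> epowr b r"
  by (cases a; cases b) (auto simp: epowr_def ennreal_le_iff top_unique intro!: ennreal_leI powr_mono2)

text \<open>The dependence on \<open>\<kappa>\<close> is dictated by scaling, and the condition on \<open>\<beta>\<close> is integrability (boundedness,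
  if \<open>q = \<infinity>\<close>) at the origin.\<close>

lemma Lp_norm_powr_exp:
  fixes \<beta> :: real and q :: ennreal
  assumes q: "1 \<le> q" and sup: "q = \<infinity> \<Longrightarrow> \<beta> \<ge> 0" and int: "q < \<infinity> \<Longrightarrow> enn2real q * \<beta> > - real CARD('n::finite)"
  obtains C where "C \<ge> 0" "\<And>\<kappa> c F. \<kappa> > 0 \<Longrightarrow> c \<ge> 0 \<Longrightarrow> F \<in> borel_measurable borel \<Longrightarrow>
     (AE \<xi> in lborel. F \<xi> \<le> ennreal (c * (norm (\<xi>::real^'n) powr \<beta> * exp (- \<kappa> * norm \<xi>)))) \<Longrightarrow>
     Lp_norm lborel q F \<le> ennreal (C * (c * \<kappa> powr (- \<beta> - real CARD('n) * recip q)))"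
proof (cases q)
  case top
  then have \<beta>: "\<beta> \<ge> 0" using sup by simp
  obtain C where C: "C > 0" "\<And>x. x \<ge> 0 \<Longrightarrow> x powr \<beta> * exp (- 1 * x) \<le> C" using powr_exp_bounded[OF \<beta>, of 1] by auto
  show ?thesis
  proof (rule that[of C])
    fix \<kappa> c :: real and F :: "real^'n \<Rightarrow> ennreal"
    assume \<kappa>: "\<kappa> > 0" and c: "c \<ge> 0" and F: "F \<in> borel_measurable borel"
      and le: "AE \<xi> in lborel. F \<xi> \<le> ennreal (c * (norm \<xi> powr \<beta> * exp (- \<kappa> * norm \<xi>)))"
    have b: "c * (x powr \<beta> * exp (- \<kappa> * x)) \<le> C * (c * \<kappa> powr - \<beta>)" if x: "x \<ge> 0" for x
    proof -
      have "x powr \<beta> * exp (- \<kappa> * x) = \<kappa> powr - \<beta> * ((\<kappa> * x) powr \<beta> * exp (- 1 * (\<kappa> * x)))"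
        using \<kappa> x by (simp add: powr_mult powr_minus)
      also have "\<dots> \<le> \<kappa> powr - \<beta> * C" using \<kappa> x by (intro mult_left_mono C(2)) auto
      finally have "c * (x powr \<beta> * exp (- \<kappa> * x)) \<le> c * (\<kappa> powr - \<beta> * C)" using c by (rule mult_left_mono)
      then show ?thesis by (simp only: mult_ac)
    qed
    have "AE \<xi> in lborel. F \<xi> \<le> ennreal (C * (c * \<kappa> powr - \<beta>))"
      using le by eventually_elim (rule order_trans[OF _ ennreal_leI[OF b]], auto)
    then have "esssup lborel F \<le> ennreal (C * (c * \<kappa> powr - \<beta>))" by (intro esssup_I) (use F in auto)
    then show "Lp_norm lborel q F \<le> ennreal (C * (c * \<kappa> powr (- \<beta> - real CARD('n) * recip q)))"
      using top by (simp add: Lp_norm_def recip_def)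
  qed (use C in simp)
next
  case (real Q)
  have Q: "Q \<ge> 1" using q real by (simp flip: ennreal_1)
  have rq: "recip q = 1 / Q" using real Q by (simp add: recip_def inverse_ennreal field_simps)
  have "\<beta> * Q > - real CARD('n)" using int real by (simp add: mult.commute)
  from nn_integral_powr_exp[OF this] obtain C where C: "C \<ge> 0" and
    I: "\<And>\<kappa>. \<kappa> > 0 \<Longrightarrow> (\<integral>\<^sup>+x. ennreal (norm (x::real^'n) powr (\<beta> * Q) * exp (- \<kappa> * norm x)) \<partial>lborel) = ennreal (C * \<kappa> powr (- (\<beta> * Q) - real CARD('n)))"
    by blast
  show ?thesis
  proof (rule that[of "(C * Q powr (- (\<beta> * Q) - real CARD('n))) powr (1/Q)"])
    fix \<kappa> c :: real and F :: "real^'n \<Rightarrow> ennreal"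
    assume \<kappa>: "\<kappa> > 0" and c: "c \<ge> 0" and F: "F \<in> borel_measurable borel"
      and le: "AE \<xi> in lborel. F \<xi> \<le> ennreal (c * (norm \<xi> powr \<beta> * exp (- \<kappa> * norm \<xi>)))"
    let ?y = "- (\<beta> * Q) - real CARD('n)"
    have "AE \<xi> in lborel. epowr (F \<xi>) Q \<le> ennreal (c powr Q) * ennreal (norm \<xi> powr (\<beta> * Q) * exp (- (Q * \<kappa>) * norm \<xi>))"
      using le
    proof eventually_elim
      case (elim \<xi>)
      have "epowr (F \<xi>) Q \<le> epowr (ennreal (c * (norm \<xi> powr \<beta> * exp (- \<kappa> * norm \<xi>)))) Q" using elim Q by (intro epowr_mono) auto
      also have "\<dots> = ennreal (c powr Q) * ennreal (norm \<xi> powr (\<beta> * Q) * exp (- (Q * \<kappa>) * norm \<xi>))"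
      proof -
        have "(c * (norm \<xi> powr \<beta> * exp (- \<kappa> * norm \<xi>))) powr Q = c powr Q * (norm \<xi> powr (\<beta> * Q) * exp (- (Q * \<kappa>) * norm \<xi>))"
          using c by (simp add: powr_mult powr_powr exp_powr_real mult_ac)
        moreover have "epowr (ennreal (c * (norm \<xi> powr \<beta> * exp (- \<kappa> * norm \<xi>)))) Q = ennreal ((c * (norm \<xi> powr \<beta> * exp (- \<kappa> * norm \<xi>))) powr Q)"
          unfolding epowr_def using c by (subst enn2real_ennreal) (simp_all del: ennreal_mult ennreal_mult')
        ultimately show ?thesis by (simp only: ennreal_mult[OF powr_ge_zero mult_nonneg_nonneg[OF powr_ge_zero exp_ge_zero]])
      qed
      finally show ?case .
    qed
    then have "(\<integral>\<^sup>+\<xi>. epowr (F \<xi>) Q \<partial>lborel) \<le> (\<integral>\<^sup>+\<xi>. ennreal (c powr Q) * ennreal (norm (\<xi>::real^'n) powr (\<beta> * Q) * exp (- (Q * \<kappa>) * norm \<xi>)) \<partial>lborel)"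
      by (rule nn_integral_mono_AE)
    also have "\<dots> = ennreal (c powr Q) * ennreal (C * (Q * \<kappa>) powr ?y)"
      using I[of "Q * \<kappa>"] \<kappa> Q by (subst nn_integral_cmult) auto
    also have "\<dots> = ennreal (c powr Q * (C * (Q * \<kappa>) powr ?y))" using C by (simp add: ennreal_mult)
    finally have "Lp_norm lborel q F \<le> epowr (ennreal (c powr Q * (C * (Q * \<kappa>) powr ?y))) (1/Q)"
      using real Q by (simp add: Lp_norm_def epowr_mono)
    also have "\<dots> = ennreal ((c powr Q * (C * (Q * \<kappa>) powr ?y)) powr (1/Q))" using C by (simp add: epowr_def)
    also have "(c powr Q * (C * (Q * \<kappa>) powr ?y)) powr (1/Q) = (C * Q powr ?y) powr (1/Q) * (c * \<kappa> powr (- \<beta> - real CARD('n) * recip q))"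
    proof -
      have "(c powr Q * (C * (Q * \<kappa>) powr ?y)) powr (1/Q) = (c powr Q) powr (1/Q) * ((C * Q powr ?y) powr (1/Q) * (\<kappa> powr ?y) powr (1/Q))"
        using C c Q \<kappa> by (simp add: powr_mult)
      also have "(c powr Q) powr (1/Q) = c" using c Q by (simp add: powr_powr)
      also have "(\<kappa> powr ?y) powr (1/Q) = \<kappa> powr (- \<beta> - real CARD('n) * recip q)"
        unfolding powr_powr rq using Q by (simp add: field_simps)
      finally show ?thesis by (simp only: mult_ac)
    qed
    finally show "Lp_norm lborel q F \<le> ennreal ((C * Q powr ?y) powr (1/Q) * (c * \<kappa> powr (- \<beta> - real CARD('n) * recip q)))" .
  qed simp
qed

lemma conj_exp_properties:
  assumes p: "1 \<le> p"
  shows "1 \<le> conj_exp p" "recip (conj_exp p) = 1 - recip p" "conj_exp p = \<infinity> \<longleftrightarrow> p = 1"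
    "conj_exp p < \<infinity> \<Longrightarrow> recip (conj_exp p) = 1 / enn2real (conj_exp p)" "p = \<infinity> \<Longrightarrow> enn2real (conj_exp p) = 1"
proof -
  have "1 \<le> conj_exp p \<and> recip (conj_exp p) = 1 - recip p \<and> (conj_exp p = \<infinity> \<longleftrightarrow> p = 1) \<and>
    (conj_exp p < \<infinity> \<longrightarrow> recip (conj_exp p) = 1 / enn2real (conj_exp p)) \<and> (p = \<infinity> \<longrightarrow> enn2real (conj_exp p) = 1)"
  proof (cases p)
    case top
    then show ?thesis by (simp add: recip_def)
  next
    case (real P)
    have P: "P \<ge> 1" using p real by (simp flip: ennreal_1)
    show ?thesis
    proof (cases "P = 1")
      case True
      then have "p = 1" using real by simp
      then show ?thesis by (simp add: recip_def)
    next
      case False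
      with P have P1: "P > 1" by simp
      have i: "inverse p = ennreal (1/P)" using real P1 by (simp add: inverse_ennreal divide_inverse)
      have "1 - inverse p = ennreal (1 - 1/P)" unfolding i using P1 by (simp add: ennreal_minus flip: ennreal_1)
      moreover have "1 - 1/P > 0" using P1 by simp
      ultimately have q: "conj_exp p = ennreal (inverse (1 - 1/P))" unfolding conj_exp_def by (simp add: inverse_ennreal)
      have "1 \<le> inverse (1 - 1/P)" using P1 by (intro one_le_inverse) auto
      then have "1 \<le> conj_exp p" unfolding q by simp
      moreover have "recip (conj_exp p) = 1 - 1/P" unfolding q recip_def using \<open>1 - 1/P > 0\<close> by (simp add: inverse_ennreal)
      moreover have "recip p = 1/P" unfolding recip_def i using P1 by simp
      moreover have "p \<noteq> 1" using real P1 by (simp flip: ennreal_1)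
      ultimately show ?thesis using q real \<open>1 - 1/P > 0\<close> by (simp add: divide_inverse)
    qed
  qed
  then show "1 \<le> conj_exp p" "recip (conj_exp p) = 1 - recip p" "conj_exp p = \<infinity> \<longleftrightarrow> p = 1"
    "conj_exp p < \<infinity> \<Longrightarrow> recip (conj_exp p) = 1 / enn2real (conj_exp p)" "p = \<infinity> \<Longrightarrow> enn2real (conj_exp p) = 1" by blast+
qed

section \<open>Decay rates\<close>

text \<open>In terms of the scale-invariant variable \<open>z = sqrt t * r\<close>, the excess \<open>z powr (a - m)\<close> is absorbed by half of
  the exponential, and the remaining powers are converted into powers of \<open>t\<close>.\<close>

lemma powr_exp_rescale:
  fixes a m k t r :: real
  assumes c: "\<And>x. x \<ge> 0 \<Longrightarrow> x powr (a - m) * exp (- k * x) \<le> c" and t: "t > 0" and r: "r > 0"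
  shows "r powr a * exp (- (2 * k * sqrt t) * r) \<le> c * t powr (- a / 2) * (t powr (m / 2) * (r powr m * exp (- (k * sqrt t) * r)))"
proof -
  let ?z = "sqrt t * r"
  have z: "?z > 0" using t r by simp
  have h: "?z powr b = t powr (b / 2) * r powr b" for b
    using t r by (simp add: powr_mult powr_half_sqrt[symmetric] powr_powr)
  have "r powr a = t powr (- a / 2) * ?z powr a" using t by (simp add: h mult.assoc[symmetric] powr_add[symmetric])
  also have "?z powr a = ?z powr m * ?z powr (a - m)" by (simp add: powr_add[symmetric])
  finally have "r powr a * exp (- (2 * k * sqrt t) * r) =
    t powr (- a / 2) * (?z powr m * exp (- (k * sqrt t) * r)) * (?z powr (a - m) * exp (- k * ?z))"
    by (simp add: exp_add[symmetric] mult_ac exp_double[symmetric] power2_eq_square)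
  also have "\<dots> \<le> t powr (- a / 2) * (?z powr m * exp (- (k * sqrt t) * r)) * c"
    using z by (intro mult_left_mono c) auto
  also have "\<dots> = c * t powr (- a / 2) * (t powr (m / 2) * (r powr m * exp (- (k * sqrt t) * r)))"
    unfolding h by (simp only: mult_ac)
  finally show ?thesis .
qed

text \<open>Both terms of the pointwise bound are reduced to the power \<open>m = min \<alpha> 1\<close>. Since \<open>m > 0\<close>, the
  hypotheses on \<open>s\<close> make the norm of \<open>|\<xi>|\<close> to the power \<open>s + m\<close> finite near the origin in all three cases.\<close>

lemma (in bump) decay_of_difference:
  fixes u :: "real \<Rightarrow> 'n vdist" and u\<^sub>0 :: "'n vdist" and \<psi> :: "real^'n \<Rightarrow> real" and p :: ennreal
  assumes dim: "CARD('n) \<ge> 2" and \<mu>: "\<mu> > 0" and \<psi>: "dyadic_cutoff \<psi>" and p: "1 \<le> p"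
    and s1: "p = 1 \<Longrightarrow> s \<ge> 0" and s2: "1 < p \<Longrightarrow> p < \<infinity> \<Longrightarrow> s > - (real CARD('n) * recip (conj_exp p))"
    and s3: "p = \<infinity> \<Longrightarrow> s \<ge> -1"
    and u0: "u\<^sub>0 \<in> herz_space \<psi> 0 1 \<infinity>" and \<epsilon>: "\<epsilon> > 0"
    and small: "herz_norm \<psi> (-1) \<infinity> 2 u\<^sub>0 < ennreal \<epsilon>"
      "16 * exp 2 * (real CARD('n) * ns_const TYPE('n))\<^sup>2 * (64 / \<mu> * \<epsilon>\<^sup>2) < \<mu>"
    and mild: "global_mild_solution \<mu> u\<^sub>0 u"
    and \<alpha>: "\<alpha> > 0" and r: "r > 0"
    and near: "AE \<xi> in lborel. 0 < norm \<xi> \<and> norm \<xi> < r \<longrightarrow> norm (vft u\<^sub>0 \<xi> - leray_symbol \<xi> *v cvec M\<^sub>0) \<le> K * norm \<xi> powr \<alpha>"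
  obtains C where "C > 0" "\<And>t. t \<ge> 1 \<Longrightarrow> Lhat_norm p (riesz s (u t - oseen_dist \<mu> t M\<^sub>0)) \<le>
    ennreal (C * ((t powr (- \<alpha> / 2) + growth TYPE('n) t * t powr (- 1 / 2)) * t powr (- (real CARD('n) / 2) * (1 - recip p) - s / 2)))"
proof -
  obtain C D where C: "C \<ge> 0"
    and sp': "\<forall>t>0. \<forall>l. has_spectrum ((u t - oseen_dist \<mu> t M\<^sub>0) $ l) (D t l)"
    and D': "\<forall>t\<ge>1. AE \<xi> in lborel. norm (\<chi> l. D t l \<xi>) \<le>
       C * ((norm \<xi> powr \<alpha> + growth TYPE('n) t * norm \<xi>) * exp (- (sqrt (\<mu> * t) / 2) * norm \<xi>))"
    by (rule difference_pointwise[OF dim \<mu> \<psi> u0 \<epsilon> small mild \<alpha> r near])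
  note sp = sp'[rule_format] and D = D'[rule_format]
  let ?n = "real CARD('n)"
  let ?q = "conj_exp p"
  define m where "m = min \<alpha> 1"
  have m: "m > 0" "m \<le> \<alpha>" "m \<le> 1" using \<alpha> by (auto simp: m_def)
  \<comment> \<open>half of the rate in the pointwise bound\<close>
  define k where "k = sqrt \<mu> / 4"
  have k: "k > 0" using \<mu> by (simp add: k_def)
  have n: "?n \<ge> 2" using dim by simp
  have q1: "1 \<le> ?q" by (rule conj_exp_properties(1)[OF p])
  have sup: "?q = \<infinity> \<Longrightarrow> s + m \<ge> 0" using conj_exp_properties(3)[OF p] s1 m by force
  have int: "enn2real ?q * (s + m) > - ?n" if "?q < \<infinity>"
  proof (cases "p = \<infinity>")
    case True
    then show ?thesis using conj_exp_properties(5)[OF p True] s3 m n by simp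
  next
    case False
    have "p \<noteq> 1" using that conj_exp_properties(3)[OF p] by auto
    then have "1 < p" using p by (simp only: order_less_le not_sym simp_thms)
    moreover have "p < \<infinity>" using False by (simp only: less_top infinity_ennreal_def simp_thms)
    ultimately have "s > - (?n * recip ?q)" by (rule s2)
    then have "s > - (?n * (1 / enn2real ?q))" unfolding conj_exp_properties(4)[OF p that] .
    moreover have "enn2real ?q > 0"
      using order_less_le_trans[OF zero_less_one q1] that by (simp only: enn2real_positive_iff infinity_ennreal_def simp_thms)
    ultimately have "enn2real ?q * s > - ?n" by (simp add: field_simps)
    moreover have "enn2real ?q * m > 0" using m \<open>enn2real ?q > 0\<close> by simp
    ultimately show ?thesis unfolding distrib_left by linarith
  qed
  have low: "s + m > - ?n"
  proof (cases "p = 1")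
    case True
    then show ?thesis using s1 m n by simp
  next
    case False
    show ?thesis
    proof (cases "p = \<infinity>")
      case False
      have "recip ?q \<le> 1" unfolding conj_exp_properties(2)[OF p] by (simp add: recip_def)
      then have "?n * recip ?q \<le> ?n * 1" by (intro mult_left_mono) auto
      moreover have "s > - (?n * recip ?q)"
      proof (rule s2)
        show "1 < p" using p \<open>p \<noteq> 1\<close> by (simp only: order_less_le not_sym simp_thms)
        show "p < \<infinity>" using False by (simp only: less_top infinity_ennreal_def simp_thms)
      qed
      ultimately show ?thesis using m by linarith
    qed (use s3 m n in simp)
  qed
  obtain c1 where c1: "c1 > 0" "\<And>x. x \<ge> 0 \<Longrightarrow> x powr (\<alpha> - m) * exp (- k * x) \<le> c1"
    using powr_exp_bounded[of "\<alpha> - m" k] m k by auto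
  obtain c2 where c2: "c2 > 0" "\<And>x. x \<ge> 0 \<Longrightarrow> x powr (1 - m) * exp (- k * x) \<le> c2"
    using powr_exp_bounded[of "1 - m" k] m k by auto
  define c where "c = C * (c1 + c2)"
  have c: "c \<ge> 0" using C c1 c2 by (simp add: c_def)
  define L where "L t = t powr (- \<alpha> / 2) + growth TYPE('n) t * t powr (- 1 / 2)" for t
  have g: "growth TYPE('n) t \<ge> 0" if "t \<ge> 1" for t using growth_ge[OF that, where 'n='n] by simp
  have L: "L t \<ge> 0" if "t \<ge> 1" for t using g[OF that] by (simp add: L_def)
  have bound: "AE \<xi> in lborel. norm \<xi> powr s * norm (\<chi> l. D t l \<xi>) \<le> (c * L t * t powr (m / 2)) * (norm \<xi> powr (s + m) * exp (- (k * sqrt t) * norm \<xi>))"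
    if t: "t \<ge> 1" for t
    using D[OF t] AE_lborel_singleton[of 0]
  proof eventually_elim
    case (elim \<xi>)
    define r where "r = norm \<xi>"
    have r: "r > 0" using elim by (simp add: r_def)
    let ?g = "growth TYPE('n) t" and ?y = "t powr (m / 2) * (r powr m * exp (- (k * sqrt t) * r))"
    have y: "?y \<ge> 0" by simp
    have e: "sqrt (\<mu> * t) / 2 = 2 * k * sqrt t" by (simp add: k_def real_sqrt_mult)
    have "(r powr \<alpha> + ?g * r) * exp (- (2 * k * sqrt t) * r) = r powr \<alpha> * exp (- (2 * k * sqrt t) * r) + ?g * (r powr 1 * exp (- (2 * k * sqrt t) * r))"
      using r by (simp add: distrib_right mult.assoc)
    also have "\<dots> \<le> c1 * t powr (- \<alpha> / 2) * ?y + ?g * (c2 * t powr (- 1 / 2) * ?y)"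
      using t r g[OF t] by (intro add_mono mult_left_mono powr_exp_rescale c1(2) c2(2)) auto
    also have "\<dots> \<le> (c1 + c2) * t powr (- \<alpha> / 2) * ?y + ?g * ((c1 + c2) * t powr (- 1 / 2) * ?y)"
      using c1 c2 y g[OF t] by (intro add_mono mult_left_mono mult_right_mono) auto
    also have "\<dots> = (c1 + c2) * L t * ?y" by (simp only: L_def distrib_left distrib_right mult_ac)
    finally have "C * ((r powr \<alpha> + ?g * r) * exp (- (2 * k * sqrt t) * r)) \<le> C * ((c1 + c2) * L t * ?y)"
      using C by (rule mult_left_mono)
    with elim(1) have "norm (\<chi> l. D t l \<xi>) \<le> C * ((c1 + c2) * L t * ?y)" unfolding e r_def by (rule order_trans)
    then have "r powr s * norm (\<chi> l. D t l \<xi>) \<le> r powr s * (C * ((c1 + c2) * L t * ?y))" by (rule mult_left_mono) simp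
    also have "\<dots> = (c * L t * t powr (m / 2)) * (r powr (s + m) * exp (- (k * sqrt t) * r))"
      by (simp only: c_def powr_add mult_ac)
    finally show ?case by (simp only: r_def)
  qed
  obtain C0 where C0: "\<And>\<kappa>. \<kappa> > 0 \<Longrightarrow> (\<integral>\<^sup>+x. ennreal (norm (x::real^'n) powr (s + m) * exp (- \<kappa> * norm x)) \<partial>lborel) = ennreal (C0 * \<kappa> powr (- (s + m) - ?n))"
    using nn_integral_powr_exp[OF low] by blast
  obtain C' where C': "C' \<ge> 0" and norm: "\<And>\<kappa> c F. \<kappa> > 0 \<Longrightarrow> c \<ge> 0 \<Longrightarrow> F \<in> borel_measurable borel \<Longrightarrow>
     (AE \<xi> in lborel. F \<xi> \<le> ennreal (c * (norm (\<xi>::real^'n) powr (s + m) * exp (- \<kappa> * norm \<xi>)))) \<Longrightarrow>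
     Lp_norm lborel ?q F \<le> ennreal (C' * (c * \<kappa> powr (- (s + m) - ?n * recip ?q)))"
    by (rule Lp_norm_powr_exp[OF q1 sup int], assumption, assumption, rule that)
  define E where "E = - (?n / 2) * (1 - recip p) - s / 2"
  define y where "y = - (s + m) - ?n * recip ?q"
  show ?thesis
  proof (rule that[of "C' * c * k powr y + 1"])
    show "C' * c * k powr y + 1 > 0" using C' c by (simp add: add_nonneg_pos)
    fix t :: real assume t: "t \<ge> 1"
    then have t0: "t > 0" by simp
    have [measurable]: "D t l \<in> borel_measurable borel" for l using sp[OF t0, of l] by (simp add: has_spectrum_def wL1_def)
    have [measurable]: "(\<lambda>\<xi>. (\<chi> l. D t l \<xi>)) \<in> borel_measurable borel" by (rule vec_measurable) measurable
    let ?c = "c * L t * t powr (m / 2)" and ?\<kappa> = "k * sqrt t"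
    have \<kappa>: "?\<kappa> > 0" using k t0 by simp
    have c': "?c \<ge> 0" using c L[OF t] by simp
    have w: "wL1 (\<lambda>\<xi>. complex_of_real (norm \<xi> powr s) * D t l \<xi>)" for l
    proof (intro integrable_wL1 integrableI_bounded)
      have "(\<integral>\<^sup>+\<xi>. ennreal (norm (complex_of_real (norm \<xi> powr s) * D t l \<xi>)) \<partial>lborel)
         \<le> (\<integral>\<^sup>+\<xi>. ennreal ?c * ennreal (norm (\<xi>::real^'n) powr (s + m) * exp (- ?\<kappa> * norm \<xi>)) \<partial>lborel)"
      proof (rule nn_integral_mono_AE)
        show "AE \<xi> in lborel. ennreal (norm (complex_of_real (norm \<xi> powr s) * D t l \<xi>)) \<le> ennreal ?c * ennreal (norm \<xi> powr (s + m) * exp (- ?\<kappa> * norm \<xi>))"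
          using bound[OF t]
        proof eventually_elim
          case (elim \<xi>)
          have "norm (D t l \<xi>) \<le> norm (\<chi> l. D t l \<xi>)" using Finite_Cartesian_Product.norm_nth_le[of "\<chi> l. D t l \<xi>" l] by simp
          then have "norm (complex_of_real (norm \<xi> powr s) * D t l \<xi>) \<le> norm \<xi> powr s * norm (\<chi> l. D t l \<xi>)"
            by (simp add: norm_mult mult_left_mono)
          then have "norm (complex_of_real (norm \<xi> powr s) * D t l \<xi>) \<le> ?c * (norm \<xi> powr (s + m) * exp (- ?\<kappa> * norm \<xi>))"
            using elim by (rule order_trans)
          then show ?case using c' by (subst ennreal_mult[symmetric]) (auto intro: ennreal_leI)
        qed
      qed
      also have "\<dots> = ennreal ?c * ennreal (C0 * ?\<kappa> powr (- (s + m) - ?n))"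
        unfolding C0[OF \<kappa>, symmetric] by (rule nn_integral_cmult) measurable
      also have "\<dots> < \<infinity>" by (simp add: ennreal_mult_less_top)
      finally show "(\<integral>\<^sup>+\<xi>. ennreal (norm (complex_of_real (norm \<xi> powr s) * D t l \<xi>)) \<partial>lborel) < \<infinity>" .
    qed measurable
    let ?F = "u t - oseen_dist \<mu> t M\<^sub>0"
    have R: "riesz s ?F $ l \<in> tempered" "has_spectrum (riesz s ?F $ l) (\<lambda>\<xi>. complex_of_real (norm \<xi> powr s) * D t l \<xi>)" for l
      unfolding riesz_def using multiplier_spectrum[OF has_spectrum_ft(2)[OF sp[OF t0]] has_spectrum_ft(1)[OF sp[OF t0]] _ w] by auto
    have "Lhat_norm p (riesz s ?F) = Lp_norm lborel ?q (\<lambda>\<xi>. ennreal (norm \<xi> powr s * norm (\<chi> l. D t l \<xi>)))"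
      unfolding Lhat_norm_spectrum[OF R] norm_vec_scale by simp
    also have "\<dots> \<le> ennreal (C' * (?c * ?\<kappa> powr y))"
      unfolding y_def
    proof (rule norm[OF \<kappa> c'])
      show "AE \<xi> in lborel. ennreal (norm \<xi> powr s * norm (\<chi> l. D t l \<xi>)) \<le> ennreal (?c * (norm \<xi> powr (s + m) * exp (- ?\<kappa> * norm \<xi>)))"
        using bound[OF t] by eventually_elim (rule ennreal_leI)
    qed measurable
    also have "C' * (?c * ?\<kappa> powr y) = C' * c * k powr y * (L t * t powr E)"
    proof -
      have "?\<kappa> powr y = k powr y * t powr (y / 2)" using k t0 by (simp add: powr_mult powr_half_sqrt[symmetric] powr_powr)
      moreover have "t powr (m / 2) * t powr (y / 2) = t powr E"
        unfolding powr_add[symmetric] y_def E_def conj_exp_properties(2)[OF p] by (rule arg_cong[where f="\<lambda>x. t powr x"]) (simp add: field_simps)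
      ultimately show ?thesis by (simp only: mult_ac flip: \<open>t powr (m / 2) * t powr (y / 2) = t powr E\<close>)
    qed
    also have "ennreal (C' * c * k powr y * (L t * t powr E)) \<le> ennreal ((C' * c * k powr y + 1) * (L t * t powr E))"
      using L[OF t] by (intro ennreal_leI mult_right_mono) auto
    finally show "Lhat_norm p (riesz s ?F) \<le> ennreal ((C' * c * k powr y + 1) * ((t powr (- \<alpha> / 2) + growth TYPE('n) t * t powr (- 1 / 2)) * t powr (- (?n / 2) * (1 - recip p) - s / 2)))"
      unfolding L_def E_def .
  qed
qed

theorem theorem2p2:
  fixes \<psi> :: "real^'n::finite \<Rightarrow> real" and \<mu> s :: real and p :: ennreal
  assumes "CARD('n) \<ge> 2" and "\<mu> > 0" and "dyadic_cutoff \<psi>" and "1 \<le> p"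
    and "p = 1 \<Longrightarrow> s \<ge> 0"
    and "1 < p \<Longrightarrow> p < \<infinity> \<Longrightarrow>
           s > - min (real CARD('n) * recip (conj_exp p)) (1 + real CARD('n) * recip p)"
    and "p = \<infinity> \<Longrightarrow> s \<ge> -1"
  shows "\<exists>\<epsilon>>0. \<forall>(u\<^sub>0 :: 'n vdist) (M\<^sub>0 :: real^'n) (\<alpha> :: real) (u :: real \<Rightarrow> 'n vdist).
    u\<^sub>0 \<in> herz_space \<psi> (-1) \<infinity> 2 \<inter> herz_space \<psi> 0 1 \<infinity> \<longrightarrow>
    (\<forall>l. real_dist (u\<^sub>0 $ l)) \<longrightarrow>
    div_free u\<^sub>0 \<longrightarrow>
    herz_norm \<psi> (-1) \<infinity> 2 u\<^sub>0 < ennreal \<epsilon> \<longrightarrow>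
    M\<^sub>0 \<noteq> 0 \<longrightarrow> \<alpha> > 0 \<longrightarrow>
    (\<exists>K. \<exists>r>0. AE \<xi> in lborel. 0 < norm \<xi> \<and> norm \<xi> < r \<longrightarrow>
        norm (vft u\<^sub>0 \<xi> - leray_symbol \<xi> *v cvec M\<^sub>0) \<le> K * norm \<xi> powr \<alpha>) \<longrightarrow>
    global_mild_solution \<mu> u\<^sub>0 u \<longrightarrow>
    (\<exists>C>0. \<forall>t\<ge>1.
       Lhat_norm p (riesz s (u t - oseen_dist \<mu> t M\<^sub>0)) \<le>
         ennreal (C *
           (if CARD('n) \<ge> 3
            then t powr (- (real CARD('n) / 2) * (1 - recip p) - s / 2 - min \<alpha> 1 / 2)
            else t powr (- (real CARD('n) / 2) * (1 - recip p) - s / 2) *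
                 (t powr (- \<alpha> / 2) + t powr (- 1 / 2) * ln (1 + t)))))"
proof -
  interpret bump "\<lambda>x::real^'n. if norm x < 3 then 1 - \<psi> ((1/2) *\<^sub>R x) - \<psi> ((1/4) *\<^sub>R x) else 0"
    by (rule dyadic_cutoff_bump[OF assms(3)])
  let ?K = "real CARD('n) * ns_const TYPE('n)"
  let ?c = "1024 * exp 2 * ?K\<^sup>2"
  \<comment> \<open>any \<open>\<epsilon>\<close> with \<open>?c * \<epsilon>\<^sup>2 < \<mu>\<^sup>2\<close> meets the smallness condition of \<open>exponential_bound\<close>\<close>
  define \<epsilon> where "\<epsilon> = \<mu> / sqrt (?c + 1)"
  have c: "?c \<ge> 0" by simp
  then have c1: "?c + 1 > 0" by linarith
  have \<epsilon>: "\<epsilon> > 0" unfolding \<epsilon>_def using c1 assms(2) by simp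
  have small: "16 * exp 2 * ?K\<^sup>2 * (64 / \<mu> * \<epsilon>\<^sup>2) < \<mu>"
  proof -
    have "\<epsilon>\<^sup>2 = \<mu>\<^sup>2 / (?c + 1)" unfolding \<epsilon>_def power_divide using c1 by simp
    then have "16 * exp 2 * ?K\<^sup>2 * (64 / \<mu> * \<epsilon>\<^sup>2) = \<mu> * (?c / (?c + 1))"
      using assms(2) by (simp add: power2_eq_square)
    also have "\<dots> < \<mu> * 1" using assms(2) c1 by (intro mult_strict_left_mono) auto
    finally show ?thesis by simp
  qed
  have s2: "s > - (real CARD('n) * recip (conj_exp p))" if "1 < p" "p < \<infinity>"
    using assms(6)[OF that] by linarith
  show ?thesis
  proof (rule exI[of _ \<epsilon>], intro conjI \<epsilon> allI impI)
    fix u\<^sub>0 :: "'n vdist" and M\<^sub>0 :: "real^'n" and \<alpha> :: real and u :: "real \<Rightarrow> 'n vdist"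
    assume u0: "u\<^sub>0 \<in> herz_space \<psi> (-1) \<infinity> 2 \<inter> herz_space \<psi> 0 1 \<infinity>"
      and norm: "herz_norm \<psi> (-1) \<infinity> 2 u\<^sub>0 < ennreal \<epsilon>" and \<alpha>: "\<alpha> > 0"
      and near: "\<exists>K. \<exists>r>0. AE \<xi> in lborel. 0 < norm \<xi> \<and> norm \<xi> < r \<longrightarrow>
        norm (vft u\<^sub>0 \<xi> - leray_symbol \<xi> *v cvec M\<^sub>0) \<le> K * norm \<xi> powr \<alpha>"
      and mild: "global_mild_solution \<mu> u\<^sub>0 u"
    let ?E = "- (real CARD('n) / 2) * (1 - recip p) - s / 2"
    obtain K r where r: "r > 0" and Kr: "AE \<xi> in lborel. 0 < norm \<xi> \<and> norm \<xi> < r \<longrightarrow>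
        norm (vft u\<^sub>0 \<xi> - leray_symbol \<xi> *v cvec M\<^sub>0) \<le> K * norm \<xi> powr \<alpha>" using near by blast
    obtain C where C: "C > 0" "\<And>t. t \<ge> 1 \<Longrightarrow> Lhat_norm p (riesz s (u t - oseen_dist \<mu> t M\<^sub>0)) \<le>
      ennreal (C * ((t powr (- \<alpha> / 2) + growth TYPE('n) t * t powr (- 1 / 2)) * t powr ?E))"
      using decay_of_difference[OF assms(1-5) s2 assms(7) IntD2[OF u0] \<epsilon> norm small mild \<alpha> r Kr] by blast
    show "\<exists>C>0. \<forall>t\<ge>1. Lhat_norm p (riesz s (u t - oseen_dist \<mu> t M\<^sub>0)) \<le> ennreal (C *
      (if CARD('n) \<ge> 3 then t powr (?E - min \<alpha> 1 / 2)
       else t powr ?E * (t powr (- \<alpha> / 2) + t powr (- 1 / 2) * ln (1 + t))))"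
    proof (intro exI[of _ "2 * C"] conjI allI impI)
      show "2 * C > 0" using C by simp
      fix t :: real assume t: "t \<ge> 1"
      have "C * ((t powr (- \<alpha> / 2) + growth TYPE('n) t * t powr (- 1 / 2)) * t powr ?E) \<le> 2 * C *
        (if CARD('n) \<ge> 3 then t powr (?E - min \<alpha> 1 / 2)
         else t powr ?E * (t powr (- \<alpha> / 2) + t powr (- 1 / 2) * ln (1 + t)))"
      proof (cases "CARD('n) \<ge> 3")
        case True
        have "t powr (- \<alpha> / 2) + t powr (- 1 / 2) \<le> t powr (- (min \<alpha> 1 / 2)) + t powr (- (min \<alpha> 1 / 2))"
          using t by (intro add_mono powr_mono) auto
        then have "C * ((t powr (- \<alpha> / 2) + t powr (- 1 / 2)) * t powr ?E) \<le> C * ((2 * t powr (- (min \<alpha> 1 / 2))) * t powr ?E)"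
          using C by (intro mult_left_mono mult_right_mono) auto
        also have "\<dots> = 2 * C * (t powr ?E * t powr (- (min \<alpha> 1 / 2)))" by (simp only: mult_ac)
        also have "t powr ?E * t powr (- (min \<alpha> 1 / 2)) = t powr (?E - min \<alpha> 1 / 2)" by (simp only: powr_add[symmetric] add_uminus_conv_diff)
        finally show ?thesis using True by (simp add: growth_def)
      next
        case False
        have "0 \<le> t powr ?E * (t powr (- \<alpha> / 2) + t powr (- 1 / 2) * ln (1 + t))" using t by simp
        then have "C * (t powr ?E * (t powr (- \<alpha> / 2) + t powr (- 1 / 2) * ln (1 + t))) \<le> 2 * C * (t powr ?E * (t powr (- \<alpha> / 2) + t powr (- 1 / 2) * ln (1 + t)))"
          using C by (intro mult_right_mono) auto
        then show ?thesis using False by (simp add: growth_def mult_ac)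
      qed
      then show "Lhat_norm p (riesz s (u t - oseen_dist \<mu> t M\<^sub>0)) \<le> ennreal (2 * C *
        (if CARD('n) \<ge> 3 then t powr (?E - min \<alpha> 1 / 2)
         else t powr ?E * (t powr (- \<alpha> / 2) + t powr (- 1 / 2) * ln (1 + t))))"
        using C(2)[OF t] by (meson ennreal_leI order_trans)
    qed
  qed
qed

end
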